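(* Let $\theta$ be a non-constant inner function in $\mathbb{D}$, let $K_\theta$ be the corresponding model space, let $\zeta\in\mathbb{T}$, and let $\sigma$ be some Clark measure for $K_\theta$ (i.e. $\sigma=\sigma_\alpha$ for some $\alpha\in\mathbb{T}$). Assume that, for some $\varepsilon>0$, $$\int_{\mathbb{T}}\exp\Big(\frac{\varepsilon}{|\eta-\zeta|}\Big)\,d\sigma(\eta)<\infty.$$ Then $\zeta$ is a strong localization point for $K_\theta$, i.e., $K_\theta|_{[0,\zeta]}$ is a class of quasi-analyticity.
   Context: $\mathbb{D}$ is the open unit disc, $\mathbb{T}$ the unit circle, $H^2=H^2(\mathbb{D})$ the Hardy space. For an inner function $\theta$ in $\mathbb{D}$, the model space is $K_\theta=H^2\ominus\theta H^2$. Let $z_j$ be the zeros of $\theta$ (counting multiplicities) and $\nu$ the positive singular measure on $\mathbb{T}$ generating the singular inner factor of $\theta$. For an integer $n\ge0$, $AC_n(\theta)$ is the set of $\zeta\in\mathbb{T}$ such that $\sum_j\frac{1-|z_j|^2}{|\zeta-z_j|^{2n+2}}+\int_{\mathbb{T}}\frac{d\nu(z)}{|\zeta-z|^{2n+2}}<\infty$. For $\alpha\in\mathbb{T}$ the Clark measure $\sigma_\alpha$ is the (unique, finite, positive, singular) Borel measure on $\mathbb{T}$ such that $\operatorname{Re}\frac{\alpha+\theta(z)}{\alpha-\theta(z)}=\int_{\mathbb{T}}\operatorname{Re}\frac{1+\overline{\xi}z}{1-\overline{\xi}z}\,d\sigma_\alpha(\xi)$ for $z\in\mathbb{D}$. In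 the exponential integral the integrand is taken to be $+\infty$ at $\eta=\zeta$ (so finiteness forces $\sigma(\{\zeta\})=0$). Strong localization: let $\zeta\in\bigcap_{n\ge0}AC_n(\theta)$. $K_\theta$ has strong localization at $\zeta$ (i.e. $\zeta$ is a strong localization point for $K_\theta$) if the system $\{(z-\zeta)^{-k}\}_{k\ge1}$ is complete in $L^2(\sigma_\alpha)$ for some (any) $\alpha\in\mathbb{T}$ such that $\sigma_\alpha(\{\zeta\})=0$. In particular, being a strong localization point includes the requirement $\zeta\in\bigcap_{n\ge0}AC_n(\theta)$. Quasi-analyticity: $K_\theta|_{[0,\zeta]}$ (restrictions to the radius $[0,\zeta]$) is a class of quasi-analyticity if for every $f\in K_\theta$ all the derivatives $f^{(n)}$, $n\ge0$, have finite radial limits $f^{(n)}(\zeta)=\lim_{r\to1^-}f^{(n)}(r\zeta)$, and the only $f\in K_\theta$ with $f^{(n)}(\zeta)=0$ for all $n\ge0$ is $f=0$. *)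

theory Defs
  imports "HOL-Complex_Analysis.Complex_Analysis"
begin

abbreviation unit_disc :: "complex set" where
  "unit_disc \<equiv> ball 0 1"

abbreviation unit_circle :: "complex set" where
  "unit_circle \<equiv> sphere 0 1"

definition circle_borel :: "complex measure" where
  "circle_borel = restrict_space borel unit_circle"

definition circle_lebesgue :: "complex measure" where
  "circle_lebesgue = distr (uniform_measure lborel {0..2 * pi}) circle_borel cis"

definition singular_circle_measure :: "complex measure \<Rightarrow> bool" where
  "singular_circle_measure \<mu> \<longleftrightarrow>
     sets \<mu> = sets circle_borel \<and> finite_measure \<mu> \<and>
     (\<exists>N\<in>sets circle_borel. emeasure circle_lebesgue N = 0 \<and> emeasure \<mu> (unit_circle - N) = 0)"


subsection \<open>Hardy space, inner functions, model spaces\<close>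

text \<open>Functions on the disc are represented by total functions on the complex plane; only their
  values on the disc matter.\<close>

definition hardy2 :: "(complex \<Rightarrow> complex) set" where
  "hardy2 = {f. f holomorphic_on unit_disc \<and>
     bdd_above ((\<lambda>r. LINT \<xi>|circle_lebesgue. (cmod (f (of_real r * \<xi>)))\<^sup>2) ` {0..<1})}"

text \<open>The integral means increase with the radius, so the squared norm, their supremum, is their
  limit; this is the inner product that induces it, and the limit exists on the Hardy space.\<close>

definition hardy_inner :: "(complex \<Rightarrow> complex) \<Rightarrow> (complex \<Rightarrow> complex) \<Rightarrow> complex" where
  "hardy_inner f g =
     Lim (at_left 1) (\<lambda>r::real. LINT \<xi>|circle_lebesgue. f (of_real r * \<xi>) * cnj (g (of_real r * \<xi>)))"

definition inner_function :: "(complex \<Rightarrow> complex) \<Rightarrow> bool" where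
  "inner_function \<theta> \<longleftrightarrow>
     \<theta> holomorphic_on unit_disc \<and> (\<forall>z\<in>unit_disc. cmod (\<theta> z) \<le> 1) \<and>
     (AE \<xi> in circle_lebesgue.
        \<exists>l. cmod l = 1 \<and> ((\<lambda>r::real. \<theta> (of_real r * \<xi>)) \<longlongrightarrow> l) (at_left 1))"

definition model_space :: "(complex \<Rightarrow> complex) \<Rightarrow> (complex \<Rightarrow> complex) set" where
  "model_space \<theta> = {f \<in> hardy2. \<forall>g\<in>hardy2. hardy_inner f (\<lambda>z. \<theta> z * g z) = 0}"


subsection \<open>Canonical factorisation\<close>

text \<open>A zero \<open>w\<close> of multiplicity \<open>m\<close> is listed as the pairs \<open>(w, 0), \<dots>, (w, m - 1)\<close>.\<close>

definition disc_zeros :: "(complex \<Rightarrow> complex) \<Rightarrow> (complex \<times> nat) set" where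
  "disc_zeros \<theta> = (SIGMA w:{w \<in> unit_disc. \<theta> w = 0}. {..<nat (zorder \<theta> w)})"

definition blaschke_factor :: "complex \<Rightarrow> complex \<Rightarrow> complex" where
  "blaschke_factor w z =
     (if w = 0 then z else (of_real (cmod w) / w) * ((w - z) / (1 - cnj w * z)))"

text \<open>The product over the zeros, as the limit of the net of its finite subproducts.\<close>

definition blaschke_product :: "(complex \<Rightarrow> complex) \<Rightarrow> complex \<Rightarrow> complex" where
  "blaschke_product \<theta> z =
     Lim (finite_subsets_at_top (disc_zeros \<theta>)) (\<lambda>F. \<Prod>(w, k)\<in>F. blaschke_factor w z)"

definition singular_inner :: "complex measure \<Rightarrow> complex \<Rightarrow> complex" where
  "singular_inner \<nu> z = exp (- (LINT \<xi>|\<nu>. (\<xi> + z) / (\<xi> - z)))"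

definition generates_singular_factor :: "complex measure \<Rightarrow> (complex \<Rightarrow> complex) \<Rightarrow> bool" where
  "generates_singular_factor \<nu> \<theta> \<longleftrightarrow>
     singular_circle_measure \<nu> \<and>
     (\<exists>c. cmod c = 1 \<and>
        (\<forall>z\<in>unit_disc. \<theta> z = c * blaschke_product \<theta> z * singular_inner \<nu> z))"

text \<open>The measure \<open>\<nu>\<close> is uniquely determined by \<open>\<theta>\<close>. In \<^typ>\<open>ennreal\<close>, \<open>1 / 0 = \<infinity>\<close>, so the
  second integrand is infinite at \<open>\<zeta>\<close>.\<close>

definition AC :: "nat \<Rightarrow> (complex \<Rightarrow> complex) \<Rightarrow> complex set" where
  "AC n \<theta> = {\<zeta> \<in> unit_circle. \<exists>\<nu>. generates_singular_factor \<nu> \<theta> \<and>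
     (\<Sum>\<^sub>\<infinity>(w, k)\<in>disc_zeros \<theta>. ennreal ((1 - (cmod w)\<^sup>2) / cmod (\<zeta> - w) ^ (2 * n + 2)))
     + (\<integral>\<^sup>+z. 1 / ennreal (cmod (\<zeta> - z) ^ (2 * n + 2)) \<partial>\<nu>) < \<infinity>}"


subsection \<open>Clark measures and strong localization\<close>

definition clark_measure :: "(complex \<Rightarrow> complex) \<Rightarrow> complex \<Rightarrow> complex measure \<Rightarrow> bool" where
  "clark_measure \<theta> \<alpha> \<sigma> \<longleftrightarrow>
     singular_circle_measure \<sigma> \<and>
     (\<forall>z\<in>unit_disc. Re ((\<alpha> + \<theta> z) / (\<alpha> - \<theta> z)) =
        (LINT \<xi>|\<sigma>. Re ((1 + cnj \<xi> * z) / (1 - cnj \<xi> * z))))"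

definition square_integrable :: "'a measure \<Rightarrow> ('a \<Rightarrow> complex) set" where
  "square_integrable M = {g \<in> borel_measurable M. integrable M (\<lambda>x. (cmod (g x))\<^sup>2)}"

definition complete_system :: "'a measure \<Rightarrow> 'i set \<Rightarrow> ('i \<Rightarrow> 'a \<Rightarrow> complex) \<Rightarrow> bool" where
  "complete_system M I e \<longleftrightarrow>
     (\<forall>i\<in>I. e i \<in> square_integrable M) \<and>
     (\<forall>g\<in>square_integrable M. \<forall>\<epsilon>>0. \<exists>F c. finite F \<and> F \<subseteq> I \<and>
        (LINT x|M. (cmod (g x - (\<Sum>i\<in>F. c i * e i x)))\<^sup>2) < \<epsilon>)"

text \<open>The Clark measure for a given \<open>\<alpha>\<close> is unique, and the choice of \<open>\<alpha>\<close> is known to be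
  immaterial. Since \<open>\<sigma>\<close> has no atom at \<open>\<zeta>\<close>, the value there of the powers does not matter.\<close>

definition strong_localization_point :: "(complex \<Rightarrow> complex) \<Rightarrow> complex \<Rightarrow> bool" where
  "strong_localization_point \<theta> \<zeta> \<longleftrightarrow>
     \<zeta> \<in> (\<Inter>n. AC n \<theta>) \<and>
     (\<exists>\<alpha>\<in>unit_circle. \<exists>\<sigma>. clark_measure \<theta> \<alpha> \<sigma> \<and> emeasure \<sigma> {\<zeta>} = 0 \<and>
        complete_system \<sigma> {1::nat..} (\<lambda>k z. inverse ((z - \<zeta>) ^ k)))"

definition radial_quasianalytic :: "(complex \<Rightarrow> complex) \<Rightarrow> complex \<Rightarrow> bool" where
  "radial_quasianalytic \<theta> \<zeta> \<longleftrightarrow>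
     (\<forall>f\<in>model_space \<theta>. \<forall>n. \<exists>l. ((\<lambda>r::real. (deriv ^^ n) f (of_real r * \<zeta>)) \<longlongrightarrow> l) (at_left 1)) \<and>
     (\<forall>f\<in>model_space \<theta>.
        (\<forall>n. ((\<lambda>r::real. (deriv ^^ n) f (of_real r * \<zeta>)) \<longlongrightarrow> 0) (at_left 1)) \<longrightarrow>
        (\<forall>z\<in>unit_disc. f z = 0))"

end

theory Submission
  imports Defs "HOL-Probability.Probability"
begin

text \<open>
  The hypothesis says that \<open>E(\<eta>) = exp (\<epsilon> / |\<eta> - \<zeta>|)\<close> is integrable for the Clark measure \<open>\<sigma>\<close>. All
  powers of \<open>1 / |\<eta> - \<zeta>|\<close> are therefore integrable as well, but the three parts of the claim use
  the exponential in different ways.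

  \<^emph>\<open>The moment conditions.\<close> The Poisson integral of \<open>\<sigma>\<close> at \<open>z\<close> is
  \<open>(1 - |\<theta>(z)|\<^sup>2) / |\<alpha> - \<theta>(z)|\<^sup>2\<close>. Since \<open>\<sigma>\<close> is exponentially thin at \<open>\<zeta>\<close>, it is at most
  \<open>C (1 - |z|)\<close> for all \<open>z\<close> whose distance from the circle is not smaller than a fixed power of
  \<open>|z - \<zeta>| / 2\<close> (\<open>poisson_integral_small\<close>). Hence \<open>- ln |\<theta>(z)|\<^sup>2 \<le> C' (1 - |z|)\<close> for these \<open>z\<close> close to
  the circle. Every zero and every piece of the singular measure \<open>\<nu>\<close> contributes to the left side,
  which bounds \<open>\<Sum> (1 - |w|\<^sup>2) / |1 - cnj w z|\<^sup>2 + \<integral> |\<xi> - z|\<^sup>-\<^sup>2 d\<nu>\<close> uniformly in \<open>z\<close>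
  (\<open>zeros_and_singular_mass_bounded\<close>). This bound is integrated along a curve that touches the circle
  at \<open>\<zeta>\<close> to the order \<open>N\<close>. The zeros near \<open>\<zeta>\<close> are that close to the circle too, because \<open>\<theta>\<close> does not
  vanish elsewhere near \<open>\<zeta>\<close>. So a zero or a point of the circle \<open>x\<close> near \<open>\<zeta>\<close> is at a distance of the
  order \<open>d = |x - \<zeta>|\<^sup>N\<close> from an arc of the curve of length of the order \<open>d\<close>, so that the integral of its kernel along the curve
  is at least a multiple of \<open>d / d\<^sup>2 = |x - \<zeta>|\<^sup>-\<^sup>N\<close>. The result is the finiteness of the moments of
  order \<open>N\<close> (\<open>zeros_moment\<close>, \<open>singular_moment\<close>). The measure \<open>\<nu>\<close> itself is obtained by dividing \<open>\<theta>\<close> by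
  its Blaschke product and by representing the logarithm of the quotient by the Herglotz theorem
  (\<open>inner_function_factorization\<close>).

  \<^emph>\<open>Completeness.\<close> On the circle, \<open>u = 1 / (1 - cnj \<zeta> \<xi>)\<close> has real part \<open>1 / 2\<close>, so
  \<open>v = u - 1 / 2\<close> is imaginary and \<open>exp (t v)\<close> has modulus one for real \<open>t\<close>. The products \<open>v\<^sup>k u\<^sup>j\<close> with
  \<open>j \<ge> 1\<close> are combinations of negative powers of \<open>\<xi> - \<zeta>\<close>. For \<open>|\<tau>| \<le> \<epsilon> / 4\<close> the partial sums of the
  series of \<open>exp (\<tau> v) v\<^sup>k u\<^sup>j\<close> are dominated by a power of \<open>1 / |\<xi> - \<zeta>|\<close> times
  \<open>exp (\<epsilon> / (4 |\<xi> - \<zeta>|))\<close>, which is square-integrable. Finitely many steps of this length reach every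
  real \<open>t\<close>: multiplication by \<open>exp (t v)\<close> preserves the closed span of the negative powers. Geometric
  series and \<open>t \<rightarrow> 0\<close> turn these bounded multipliers into the resolvents \<open>1 / (1/2 \<plusminus> v)\<close>, which are
  \<open>1 - cnj \<zeta> \<xi>\<close> and its conjugate. So the coordinates are multipliers, and by the Stone-Weierstrass
  theorem all continuous functions are. Because \<open>(\<xi> - \<zeta>) (\<xi> - \<zeta>)\<^sup>-\<^sup>1 = 1\<close>, the closed span contains all
  continuous functions, and these are dense.

  \<^emph>\<open>Quasi-analyticity.\<close> Put \<open>p = \<alpha> / (\<alpha> - \<theta>)\<close>. The reproducing kernel of the model space, multiplied by
  \<open>p(w) cnj (p(y))\<close>, is the inner product of the Cauchy kernels at \<open>w\<close> and \<open>y\<close> in \<open>L\<^sup>2(\<sigma>)\<close>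
  (\<open>clark_kernel_identity\<close>). For \<open>f\<close> in the model space, \<open>h = f p\<close> is therefore the image of the Cauchy
  kernels under a bounded functional on their closed span. Derivatives of \<open>h\<close> are the values at the
  derivatives of the kernels, and those converge in \<open>L\<^sup>2(\<sigma>)\<close> along the radius, again by domination by
  powers of \<open>1 / |\<xi> - \<zeta>|\<close>. Thus all derivatives of \<open>h\<close> have radial limits. The same holds for \<open>p\<close>,
  which is a Cauchy transform of \<open>\<sigma>\<close> up to a constant, and \<open>Re p \<ge> 1 / 2\<close> allows one to divide by \<open>p\<close>.
  If all limits for \<open>f\<close> vanish, so do those for \<open>h\<close>, and the functional vanishes at \<open>\<xi> (\<xi> - \<zeta>)\<^sup>-\<^sup>k\<close>
  for all \<open>k \<ge> 1\<close>. By completeness it vanishes at every Cauchy kernel, so \<open>h = 0\<close> (\<open>vanishes_if_flat\<close>).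
\<close>

section \<open>Measures on the circle\<close>

locale circle_measure = finite_measure \<mu> for \<mu> :: "complex measure" +
  assumes sets_circle [simp, measurable_cong]: "sets \<mu> = sets circle_borel"
begin

lemma space_circle [simp]: "space \<mu> = unit_circle"
  using sets_eq_imp_space_eq[OF sets_circle]
  by (simp add: circle_borel_def space_restrict_space)

lemma measurable_circle:
  assumes "f \<in> borel_measurable borel"
  shows "f \<in> borel_measurable \<mu>"
proof -
  have "f \<in> borel_measurable circle_borel"
    unfolding circle_borel_def using assms by (rule measurable_restrict_space1)
  then show ?thesis
    by (simp add: measurable_cong_sets[OF sets_circle refl])
qed

lemma measurable_continuous_on_circle:
  fixes f :: "complex \<Rightarrow> 'a::topological_space"
  assumes "continuous_on unit_circle f"
  shows "f \<in> borel_measurable \<mu>"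
proof -
  have "f \<in> borel_measurable circle_borel"
    unfolding circle_borel_def using assms by (rule borel_measurable_continuous_on_restrict)
  then show ?thesis
    by (simp add: measurable_cong_sets[OF sets_circle refl])
qed

lemma integrable_continuous_on_circle:
  fixes f :: "complex \<Rightarrow> 'a::{banach, second_countable_topology}"
  assumes "continuous_on unit_circle f"
  shows "integrable \<mu> f"
proof -
  obtain B where B: "\<And>x. x \<in> unit_circle \<Longrightarrow> norm (f x) \<le> B"
    using compact_imp_bounded[OF compact_continuous_image[OF assms compact_sphere]]
    unfolding bounded_iff by blast
  show ?thesis
    by (rule integrable_const_bound[of _ B])
      (auto intro!: AE_I2 B measurable_continuous_on_circle assms)
qed

end

lemma circle_measureI:
  assumes "finite_measure \<mu>" "sets \<mu> = sets circle_borel"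
  shows "circle_measure \<mu>"
  using assms by (simp add: circle_measure_def circle_measure_axioms_def)

lemma cis_measurable [measurable]: "cis \<in> measurable borel circle_borel"
  unfolding circle_borel_def
  by (rule measurable_restrict_space2) (auto intro!: borel_measurable_continuous_onI continuous_intros)

lemma prob_space_uniform_period: "prob_space (uniform_measure lborel {0..2 * pi})"
  by (rule prob_space_uniform_measure) auto

interpretation lebesgue: circle_measure circle_lebesgue
proof -
  interpret U: prob_space "uniform_measure lborel {0..2 * pi}"
    by (rule prob_space_uniform_period)
  interpret D: prob_space circle_lebesgue
    unfolding circle_lebesgue_def by (rule U.prob_space_distr) simp
  interpret circle_measure circle_lebesgue
    by unfold_locales (simp add: circle_lebesgue_def)
  show "circle_measure circle_lebesgue" ..
qed

interpretation lebesgue: prob_space circle_lebesgue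
  unfolding circle_lebesgue_def
  by (rule prob_space.prob_space_distr[OF prob_space_uniform_period]) simp

lemma circle_lebesgue_total [simp]: "measure circle_lebesgue unit_circle = 1"
  using lebesgue.prob_space by simp

lemma integral_uniform_period:
  fixes f :: "real \<Rightarrow> 'a::{banach, second_countable_topology}"
  assumes "f \<in> borel_measurable borel"
  shows "(LINT t|uniform_measure lborel {0..2 * pi}. f t) =
    (1 / (2 * pi)) *\<^sub>R (LINT t:{0..2 * pi}|lborel. f t)"
proof -
  have *: "uniform_measure lborel {0..2 * pi} =
      density lborel (\<lambda>t. ennreal (indicator {0..2 * pi} t / (2 * pi)))"
    unfolding uniform_measure_def
    by (rule density_cong) (use divide_ennreal[of 1 "2 * pi"] in \<open>auto simp: indicator_def\<close>)
  have "(LINT t|uniform_measure lborel {0..2 * pi}. f t) =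
      (LINT t|lborel. (indicator {0..2 * pi} t / (2 * pi)) *\<^sub>R f t)"
    unfolding * by (rule integral_density) (use assms in auto)
  also have "\<dots> = (LINT t|lborel. (1 / (2 * pi)) *\<^sub>R (indicator {0..2 * pi} t *\<^sub>R f t))"
    by (intro Bochner_Integration.integral_cong) auto
  finally show ?thesis
    unfolding set_lebesgue_integral_def integral_scaleR_right .
qed

lemma integral_circle_lebesgue:
  fixes f :: "complex \<Rightarrow> 'a::{banach, second_countable_topology}"
  assumes "f \<in> borel_measurable circle_lebesgue"
  shows "(LINT \<xi>|circle_lebesgue. f \<xi>) = (1 / (2 * pi)) *\<^sub>R (LINT t:{0..2 * pi}|lborel. f (cis t))"
proof -
  have f: "f \<in> borel_measurable circle_borel"
    using assms by (simp add: circle_lebesgue_def)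
  have "(LINT \<xi>|circle_lebesgue. f \<xi>) = (LINT t|uniform_measure lborel {0..2 * pi}. f (cis t))"
    unfolding circle_lebesgue_def using f by (intro integral_distr) auto
  also have "\<dots> = (1 / (2 * pi)) *\<^sub>R (LINT t:{0..2 * pi}|lborel. f (cis t))"
    by (rule integral_uniform_period) (rule measurable_compose[OF cis_measurable f])
  finally show ?thesis .
qed

lemma integral_circle_power:
  assumes "n > 0"
  shows "(LINT \<xi>|circle_lebesgue. \<xi> ^ n) = 0"
proof -
  have "((\<lambda>t. cis (real n * t)) has_integral
      (cis (real n * (2 * pi)) / (\<i> * n) - cis (real n * 0) / (\<i> * n))) {0..2 * pi}"
  proof (rule fundamental_theorem_of_calculus)
    fix t assume "t \<in> {0..2 * pi}"
    have "((\<lambda>t. exp (t *\<^sub>R (\<i> * n)) / (\<i> * n)) has_vector_derivative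
        (exp (t *\<^sub>R (\<i> * n)) * (\<i> * n)) / (\<i> * n)) (at t within {0..2 * pi})"
      by (intro has_vector_derivative_divide exp_scaleR_has_vector_derivative_right)
    then show "((\<lambda>t. cis (real n * t) / (\<i> * n)) has_vector_derivative cis (real n * t)) (at t within {0..2 * pi})"
      using assms by (simp add: cis_conv_exp scaleR_conv_of_real mult_ac)
  qed auto
  moreover have "cis (real n * (2 * pi)) = 1"
    by (metis cis_multiple_2pi Ints_of_nat mult.commute mult.left_commute)
  ultimately have "((\<lambda>t. cis t ^ n) has_integral 0) {0..2 * pi}"
    unfolding Complex.DeMoivre by simp
  moreover have "set_integrable lborel {0..2 * pi} (\<lambda>t. cis t ^ n)"
    by (rule borel_integrable_atLeastAtMost') (auto intro!: continuous_intros)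
  ultimately have "(LINT t:{0..2 * pi}|lborel. cis t ^ n) = 0"
    by (metis set_borel_integral_eq_integral(2) integral_unique)
  then show ?thesis
    by (subst integral_circle_lebesgue)
      (auto intro!: lebesgue.measurable_continuous_on_circle continuous_intros)
qed

lemma circle_power_cnj:
  assumes "cmod \<xi> = 1"
  shows "\<xi> ^ n * cnj \<xi> ^ k = (if n < k then cnj (\<xi> ^ (k - n)) else \<xi> ^ (n - k))"
proof -
  have *: "\<xi> * cnj \<xi> = 1"
    using assms by (simp add: complex_norm_square[symmetric])
  show ?thesis
  proof (cases "n < k")
    case True
    then have "cnj \<xi> ^ k = cnj \<xi> ^ n * cnj \<xi> ^ (k - n)"
      by (simp flip: power_add)
    with True * show ?thesis
      by (simp add: mult.assoc[symmetric] flip: power_mult_distrib)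
  next
    case False
    then have "\<xi> ^ n = \<xi> ^ (n - k) * \<xi> ^ k"
      by (simp flip: power_add)
    with False * show ?thesis
      by (simp add: mult.assoc flip: power_mult_distrib)
  qed
qed

lemma integral_circle_monomials:
  "(LINT \<xi>|circle_lebesgue. \<xi> ^ n * cnj \<xi> ^ k) = (if n = k then 1 else 0)"
proof -
  have "(LINT \<xi>|circle_lebesgue. \<xi> ^ n * cnj \<xi> ^ k) =
      (LINT \<xi>|circle_lebesgue. (if n < k then cnj (\<xi> ^ (k - n)) else \<xi> ^ (n - k)))"
    by (intro Bochner_Integration.integral_cong) (auto simp: circle_power_cnj)
  also have "\<dots> = (if n = k then 1 else 0)"
  proof (cases "n < k")
    case True
    then show ?thesis
      using integral_circle_power[of "k - n"] by (simp del: complex_cnj_power)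
  next
    case False
    then show ?thesis
      using integral_circle_power[of "n - k"] by (cases "n = k") auto
  qed
  finally show ?thesis .
qed


subsection \<open>Taylor coefficients and circular means\<close>

lemma eventually_radius_less_1: "\<forall>\<^sub>F r in at_left (1::real). 0 < r \<and> r < 1"
  using eventually_at_left_real[of 0 "1::real"] by (simp add: greaterThanLessThan_iff)

definition taylor_coeff :: "(complex \<Rightarrow> complex) \<Rightarrow> nat \<Rightarrow> complex" where
  "taylor_coeff f n = (deriv ^^ n) f 0 / fact n"

lemma taylor_sums:
  assumes "f holomorphic_on unit_disc" "cmod z < 1"
  shows "(\<lambda>n. taylor_coeff f n * z ^ n) sums f z"
  using holomorphic_power_series[OF assms(1), of z] assms(2) by (simp add: taylor_coeff_def)

lemma taylor_abs_summable:
  assumes "f holomorphic_on unit_disc" "0 \<le> r" "r < 1"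
  shows "summable (\<lambda>n. cmod (taylor_coeff f n) * r ^ n)"
proof -
  have "summable (\<lambda>n. taylor_coeff f n * of_real ((r + 1) / 2) ^ n)"
    using taylor_sums[OF assms(1), of "of_real ((r + 1) / 2)"] assms
    by (auto simp: sums_iff simp del: of_real_divide of_real_add)
  from powser_insidea[OF this, of "of_real r"] assms show ?thesis
    by (simp add: norm_mult norm_power del: of_real_divide of_real_add)
qed

lemma (in circle_measure) integral_absolutely_convergent_series:
  fixes c :: "nat \<Rightarrow> complex" and e :: "nat \<Rightarrow> complex \<Rightarrow> complex"
  assumes "summable (\<lambda>n. cmod (c n))"
    and "\<And>n. continuous_on unit_circle (e n)" and "\<And>n x. x \<in> unit_circle \<Longrightarrow> cmod (e n x) \<le> B"
    and "\<And>x. x \<in> unit_circle \<Longrightarrow> (\<lambda>n. c n * e n x) sums g x"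
  shows "(\<lambda>n. c n * (LINT x|\<mu>. e n x)) sums (LINT x|\<mu>. g x)"
proof -
  have int: "integrable \<mu> (\<lambda>x. c n * e n x)" for n
    by (intro integrable_continuous_on_circle continuous_intros assms)
  have bd: "cmod (c n * e n x) \<le> cmod (c n) * B" if "x \<in> unit_circle" for n x
    using assms(3)[OF that, of n] by (simp add: norm_mult mult_left_mono)
  have sB: "summable (\<lambda>n. cmod (c n) * B)"
    using assms(1) by (rule summable_mult2)
  have "(\<lambda>n. LINT x|\<mu>. c n * e n x) sums (LINT x|\<mu>. (\<Sum>n. c n * e n x))"
  proof (rule sums_integral[OF int])
    show "AE x in \<mu>. summable (\<lambda>n. cmod (c n * e n x))"
    proof (rule AE_I2)
      fix x assume "x \<in> space \<mu>"
      then have "norm (cmod (c n * e n x)) \<le> cmod (c n) * B" for n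
        using bd[of x n] by simp
      then show "summable (\<lambda>n. cmod (c n * e n x))"
        by (rule summable_comparison_test'[OF sB])
    qed
    have "(LINT x|\<mu>. cmod (c n * e n x)) \<le> (LINT x|\<mu>. cmod (c n) * B)" for n
    proof (rule integral_mono)
      show "integrable \<mu> (\<lambda>x. cmod (c n * e n x))"
        by (rule integrable_norm[OF int])
    qed (use bd in auto)
    then have le: "(LINT x|\<mu>. cmod (c n * e n x)) \<le> measure \<mu> unit_circle * (cmod (c n) * B)" for n
      by (simp add: mult_ac)
    have "norm (LINT x|\<mu>. cmod (c n * e n x)) \<le> measure \<mu> unit_circle * (cmod (c n) * B)" for n
      using le[of n] by (simp add: integral_nonneg_AE)
    then show "summable (\<lambda>n. LINT x|\<mu>. cmod (c n * e n x))"
      by (rule summable_comparison_test'[OF summable_mult[OF sB, of "measure \<mu> unit_circle"], of 0])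
  qed
  also have "(LINT x|\<mu>. (\<Sum>n. c n * e n x)) = (LINT x|\<mu>. g x)"
    by (intro Bochner_Integration.integral_cong) (use assms(4) in \<open>auto simp: sums_iff\<close>)
  finally show ?thesis
    by simp
qed

lemma dilate_holomorphic_continuous_on_circle:
  assumes "f holomorphic_on unit_disc" "0 \<le> r" "r < 1"
  shows "continuous_on unit_circle (\<lambda>\<xi>. f (of_real r * \<xi>))"
proof (rule continuous_on_compose2[OF holomorphic_on_imp_continuous_on[OF assms(1)]])
  show "(\<lambda>\<xi>. of_real r * \<xi>) ` unit_circle \<subseteq> unit_disc"
    using assms by (auto simp: norm_mult)
qed (intro continuous_intros)

lemma taylor_circle_integral:
  assumes f: "f holomorphic_on unit_disc" and r: "0 \<le> r" "r < 1"
    and \<phi>: "continuous_on unit_circle \<phi>"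
  shows "(\<lambda>n. taylor_coeff f n * of_real r ^ n * (LINT \<xi>|circle_lebesgue. \<xi> ^ n * \<phi> \<xi>)) sums
    (LINT \<xi>|circle_lebesgue. f (of_real r * \<xi>) * \<phi> \<xi>)"
proof -
  obtain B where B: "\<And>x. x \<in> unit_circle \<Longrightarrow> norm (\<phi> x) \<le> B"
    using compact_imp_bounded[OF compact_continuous_image[OF \<phi> compact_sphere]]
    unfolding bounded_iff by blast
  show ?thesis
  proof (rule lebesgue.integral_absolutely_convergent_series)
    show "summable (\<lambda>n. cmod (taylor_coeff f n * of_real r ^ n))"
      using taylor_abs_summable[OF f r] r by (simp add: norm_mult norm_power)
    show "continuous_on unit_circle (\<lambda>\<xi>. \<xi> ^ n * \<phi> \<xi>)" for n
      by (intro continuous_intros \<phi>)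
    show "cmod (x ^ n * \<phi> x) \<le> B" if "x \<in> unit_circle" for n x
      using B[OF that] that by (simp add: norm_mult norm_power)
    show "(\<lambda>n. taylor_coeff f n * of_real r ^ n * (x ^ n * \<phi> x)) sums (f (of_real r * x) * \<phi> x)"
      if "x \<in> unit_circle" for x
    proof -
      have "cmod (of_real r * x) < 1"
        using that r by (simp add: norm_mult)
      from sums_mult2[OF taylor_sums[OF f this], of "\<phi> x"] show ?thesis
        by (simp add: power_mult_distrib mult.assoc)
    qed
  qed
qed

lemma circle_moment_cnj_power:
  assumes f: "f holomorphic_on unit_disc" and r: "0 \<le> r" "r < 1"
  shows "(LINT \<xi>|circle_lebesgue. f (of_real r * \<xi>) * cnj \<xi> ^ k) = taylor_coeff f k * of_real r ^ k"
proof -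
  have "(\<lambda>n. taylor_coeff f n * of_real r ^ n * (if n = k then 1 else 0)) sums
      (LINT \<xi>|circle_lebesgue. f (of_real r * \<xi>) * cnj \<xi> ^ k)"
    using taylor_circle_integral[OF f r, of "\<lambda>\<xi>. cnj \<xi> ^ k"]
    by (simp add: integral_circle_monomials continuous_intros)
  moreover have "(\<lambda>n. taylor_coeff f n * of_real r ^ n * (if n = k then 1 else 0)) sums
      (taylor_coeff f k * of_real r ^ k)"
    using sums_single[of k "\<lambda>n. taylor_coeff f n * of_real r ^ n"] by (simp add: if_distrib cong: if_cong)
  ultimately show ?thesis
    by (rule sums_unique2)
qed

lemma circle_moment_power:
  assumes f: "f holomorphic_on unit_disc" and r: "0 \<le> r" "r < 1"
  shows "(LINT \<xi>|circle_lebesgue. f (of_real r * \<xi>) * \<xi> ^ k) = (if k = 0 then taylor_coeff f 0 else 0)"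
proof (cases "k = 0")
  case True
  then show ?thesis
    using circle_moment_cnj_power[OF f r, of 0] by simp
next
  case False
  then have "(LINT \<xi>|circle_lebesgue. \<xi> ^ n * \<xi> ^ k) = 0" for n
    using integral_circle_power[of "n + k"] by (simp add: power_add)
  then have "(\<lambda>n. 0) sums (LINT \<xi>|circle_lebesgue. f (of_real r * \<xi>) * \<xi> ^ k)"
    using taylor_circle_integral[OF f r, of "\<lambda>\<xi>. \<xi> ^ k"] by (simp add: continuous_intros)
  then have "(LINT \<xi>|circle_lebesgue. f (of_real r * \<xi>) * \<xi> ^ k) = 0"
    using sums_zero by (rule sums_unique2)
  with False show ?thesis
    by simp
qed

text \<open>The real part is half the sum of \<open>f\<close> and its conjugate, and the conjugate has no Fourier
  coefficients of positive order. So \<open>Re f\<close> determines the Taylor coefficients of \<open>f\<close> except for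
  \<open>Im (f 0)\<close>.\<close>

lemma circle_moment_Re:
  assumes f: "f holomorphic_on unit_disc" and r: "0 \<le> r" "r < 1"
  shows "(LINT \<xi>|circle_lebesgue. of_real (Re (f (of_real r * \<xi>))) * cnj \<xi> ^ k) =
    (if k = 0 then of_real (Re (f 0)) else taylor_coeff f k * of_real r ^ k / 2)"
proof -
  note cont = dilate_holomorphic_continuous_on_circle[OF f r]
  have "(LINT \<xi>|circle_lebesgue. cnj (f (of_real r * \<xi>)) * cnj \<xi> ^ k) =
      (LINT \<xi>|circle_lebesgue. cnj (f (of_real r * \<xi>) * \<xi> ^ k))"
    unfolding complex_cnj_mult complex_cnj_power ..
  also have "\<dots> = (if k = 0 then cnj (taylor_coeff f 0) else 0)"
    using Bochner_Integration.integral_cnj[of circle_lebesgue "\<lambda>\<xi>. f (of_real r * \<xi>) * \<xi> ^ k"]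
    unfolding circle_moment_power[OF f r] by (simp split: if_splits)
  finally have *: "(LINT \<xi>|circle_lebesgue. cnj (f (of_real r * \<xi>)) * cnj \<xi> ^ k) =
      (if k = 0 then cnj (taylor_coeff f 0) else 0)" .
  have "(LINT \<xi>|circle_lebesgue. of_real (Re (f (of_real r * \<xi>))) * cnj \<xi> ^ k) =
      (LINT \<xi>|circle_lebesgue. (f (of_real r * \<xi>) * cnj \<xi> ^ k + cnj (f (of_real r * \<xi>)) * cnj \<xi> ^ k) / 2)"
    by (intro Bochner_Integration.integral_cong) (auto simp: complex_eq_iff algebra_simps)
  also have "\<dots> = ((LINT \<xi>|circle_lebesgue. f (of_real r * \<xi>) * cnj \<xi> ^ k) +
      (LINT \<xi>|circle_lebesgue. cnj (f (of_real r * \<xi>)) * cnj \<xi> ^ k)) / 2"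
    by (subst Bochner_Integration.integral_divide_zero, subst Bochner_Integration.integral_add)
      (auto intro!: lebesgue.integrable_continuous_on_circle continuous_intros cont)
  also have "\<dots> = (if k = 0 then of_real (Re (f 0)) else taylor_coeff f k * of_real r ^ k / 2)"
    unfolding * circle_moment_cnj_power[OF f r]
    by (cases "k = 0") (simp_all add: taylor_coeff_def complex_add_cnj)
  finally show ?thesis .
qed

lemma circle_parseval:
  assumes f: "f holomorphic_on unit_disc" and g: "g holomorphic_on unit_disc" and r: "0 \<le> r" "r < 1"
  shows "(\<lambda>n. taylor_coeff f n * cnj (taylor_coeff g n) * of_real r ^ (2 * n)) sums
    (LINT \<xi>|circle_lebesgue. f (of_real r * \<xi>) * cnj (g (of_real r * \<xi>)))"
proof -
  have "(LINT \<xi>|circle_lebesgue. \<xi> ^ n * cnj (g (of_real r * \<xi>))) =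
      cnj (LINT \<xi>|circle_lebesgue. g (of_real r * \<xi>) * cnj \<xi> ^ n)" for n
    using Bochner_Integration.integral_cnj[of circle_lebesgue "\<lambda>\<xi>. g (of_real r * \<xi>) * cnj \<xi> ^ n"] by (simp add: mult.commute)
  then have "(LINT \<xi>|circle_lebesgue. \<xi> ^ n * cnj (g (of_real r * \<xi>))) = cnj (taylor_coeff g n) * of_real r ^ n" for n
    by (simp add: circle_moment_cnj_power[OF g r])
  then show ?thesis
    using taylor_circle_integral[OF f r continuous_on_cnj[OF dilate_holomorphic_continuous_on_circle[OF g r]]]
    by (simp add: mult_ac power_mult power2_eq_square power_mult_distrib)
qed


subsection \<open>Cauchy transforms and the Herglotz representation\<close>

lemma circle_denominator_nonzero:
  assumes "cmod \<xi> = 1" "cmod z < 1"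
  shows "1 - cnj \<xi> * z \<noteq> 0" "\<xi> - z \<noteq> 0"
proof -
  have "cmod (cnj \<xi> * z) < 1"
    using assms by (simp add: norm_mult)
  then show "1 - cnj \<xi> * z \<noteq> 0" "\<xi> - z \<noteq> 0"
    using assms by auto
qed

lemma herglotz_kernel_eq:
  assumes "cmod \<xi> = 1" "cmod z < 1"
  shows "(\<xi> + z) / (\<xi> - z) = 2 * (1 / (1 - cnj \<xi> * z)) - 1"
    "(1 + cnj \<xi> * z) / (1 - cnj \<xi> * z) = (\<xi> + z) / (\<xi> - z)"
proof -
  have \<xi>: "\<xi> * cnj \<xi> = 1"
    using assms by (simp add: complex_norm_square[symmetric])
  show *: "(1 + cnj \<xi> * z) / (1 - cnj \<xi> * z) = (\<xi> + z) / (\<xi> - z)"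
    using circle_denominator_nonzero[OF assms] \<xi> by (simp add: field_simps)
  show "(\<xi> + z) / (\<xi> - z) = 2 * (1 / (1 - cnj \<xi> * z)) - 1"
    unfolding *[symmetric] using circle_denominator_nonzero[OF assms] by (simp add: field_simps)
qed

lemma continuous_on_cauchy_kernel:
  assumes "cmod z < 1"
  shows "continuous_on unit_circle (\<lambda>\<xi>. 1 / (1 - cnj \<xi> * z))"
  using circle_denominator_nonzero[OF _ assms] by (intro continuous_intros) auto

lemma (in circle_measure) cauchy_transform_sums:
  assumes "cmod z < 1"
  shows "(\<lambda>n. z ^ n * (LINT \<xi>|\<mu>. cnj \<xi> ^ n)) sums (LINT \<xi>|\<mu>. 1 / (1 - cnj \<xi> * z))"
proof (rule integral_absolutely_convergent_series)
  show "summable (\<lambda>n. cmod (z ^ n))"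
    using assms by (simp add: norm_power summable_geometric)
  show "(\<lambda>n. z ^ n * cnj x ^ n) sums (1 / (1 - cnj x * z))" if "x \<in> unit_circle" for x
    using geometric_sums[of "cnj x * z"] assms that by (simp add: power_mult_distrib norm_mult mult.commute)
  show "cmod (cnj x ^ n) \<le> 1" if "x \<in> unit_circle" for n x
    using that by (simp add: norm_power)
qed (intro continuous_intros)

lemma (in circle_measure) cauchy_transform_holomorphic:
  "(\<lambda>z. LINT \<xi>|\<mu>. 1 / (1 - cnj \<xi> * z)) holomorphic_on unit_disc"
  by (rule power_series_holomorphic[where a = "\<lambda>n. LINT \<xi>|\<mu>. cnj \<xi> ^ n"])
    (use cauchy_transform_sums in \<open>simp add: mult.commute\<close>)

lemma (in circle_measure) herglotz_integral_eq:
  assumes "cmod z < 1"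
  shows "(LINT \<xi>|\<mu>. (\<xi> + z) / (\<xi> - z)) =
    2 * (LINT \<xi>|\<mu>. 1 / (1 - cnj \<xi> * z)) - of_real (measure \<mu> unit_circle)"
proof -
  have "(LINT \<xi>|\<mu>. (\<xi> + z) / (\<xi> - z)) = (LINT \<xi>|\<mu>. 2 * (1 / (1 - cnj \<xi> * z)) - 1)"
    by (intro Bochner_Integration.integral_cong) (use assms in \<open>auto simp: herglotz_kernel_eq\<close>)
  also have "\<dots> = (LINT \<xi>|\<mu>. 2 * (1 / (1 - cnj \<xi> * z))) - (LINT \<xi>|\<mu>. 1)"
    by (intro Bochner_Integration.integral_diff integrable_continuous_on_circle continuous_on_mult
        continuous_on_const continuous_on_cauchy_kernel assms)
  finally show ?thesis
    unfolding integral_mult_right_zero by (simp add: scaleR_conv_of_real)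
qed

text \<open>The Taylor coefficients of a Herglotz integral are twice the moments of the measure. Moments are
  continuous under weak limits, which makes this the form in which the representing measure can be
  recognized.\<close>

lemma circle_measure_of_moments:
  fixes G :: "complex \<Rightarrow> complex"
  assumes "circle_measure \<nu>" and G: "G holomorphic_on unit_disc"
    and moments: "\<And>k. (LINT \<xi>|\<nu>. cnj \<xi> ^ k) = (if k = 0 then of_real (Re (G 0)) else taylor_coeff G k / 2)"
    and z: "cmod z < 1"
  shows "G z = (LINT \<xi>|\<nu>. (\<xi> + z) / (\<xi> - z)) + \<i> * of_real (Im (G 0))"
proof -
  interpret circle_measure \<nu> by fact
  let ?I = "LINT \<xi>|\<nu>. 1 / (1 - cnj \<xi> * z)"
  have "(\<lambda>n. 2 * (z ^ n * (LINT \<xi>|\<nu>. cnj \<xi> ^ n)) - taylor_coeff G n * z ^ n) sums (2 * ?I - G z)"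
    by (intro sums_diff sums_mult cauchy_transform_sums taylor_sums G z)
  moreover have "(\<lambda>n. 2 * (z ^ n * (LINT \<xi>|\<nu>. cnj \<xi> ^ n)) - taylor_coeff G n * z ^ n) =
      (\<lambda>n. if n = 0 then 2 * of_real (Re (G 0)) - G 0 else 0)"
    by (auto simp: moments taylor_coeff_def)
  ultimately have "2 * ?I - G z = 2 * of_real (Re (G 0)) - G 0"
    using sums_single[of 0 "\<lambda>n. 2 * of_real (Re (G 0)) - G 0"] by (metis (no_types, lifting) sums_unique2)
  moreover have "of_real (measure \<nu> unit_circle) = complex_of_real (Re (G 0))"
    using moments[of 0] by (simp add: scaleR_conv_of_real)
  ultimately show ?thesis
    unfolding herglotz_integral_eq[OF z] by (simp add: algebra_simps complex_eq_iff)
qed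

lemma integral_uniform_period_cis:
  fixes f :: "complex \<Rightarrow> 'a::{banach, second_countable_topology}"
  assumes "continuous_on unit_circle f"
  shows "(LINT t|uniform_measure lborel {0..2 * pi}. f (cis t)) = (LINT \<xi>|circle_lebesgue. f \<xi>)"
proof -
  have "f \<in> borel_measurable circle_borel"
    using lebesgue.measurable_continuous_on_circle[OF assms] by (simp add: circle_lebesgue_def)
  then show ?thesis
    unfolding circle_lebesgue_def by (intro integral_distr[symmetric]) auto
qed

text \<open>The measures with the densities \<open>Re (G (r \<xi>))\<close> have the total mass \<open>Re (G 0)\<close>, and their moments tend to
  those required of the representing measure as \<open>r \<rightarrow> 1\<close>. Such measures have a weakly convergent
  subsequence. Selection is applied on the real line, to the normalized densities on \<open>[0, 2 \<pi>]\<close>, and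
  the limit is transported to the circle by \<^const>\<open>cis\<close>.\<close>

theorem herglotz_representation:
  fixes G :: "complex \<Rightarrow> complex"
  assumes G: "G holomorphic_on unit_disc" and pos: "\<And>z. cmod z < 1 \<Longrightarrow> 0 \<le> Re (G z)"
  shows "\<exists>\<nu>. circle_measure \<nu> \<and>
    (\<forall>z. cmod z < 1 \<longrightarrow> G z = (LINT \<xi>|\<nu>. (\<xi> + z) / (\<xi> - z)) + \<i> * of_real (Im (G 0)))"
proof (cases "Re (G 0) = 0")
  case True
  \<comment> \<open>A harmonic function that is nonnegative and vanishes at the centre has mean zero on every
    circle, so its Fourier coefficients vanish too.\<close>
  have "taylor_coeff G k = 0" if "k > 0" for k
  proof -
    let ?h = "\<lambda>\<xi>. of_real (Re (G (of_real (1 / 2) * \<xi>))) :: complex"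
    have half: "cmod (of_real (1 / 2) * \<xi>) < 1" if "cmod \<xi> = 1" for \<xi>
      using that by (simp add: norm_mult)
    have "cmod (LINT \<xi>|circle_lebesgue. ?h \<xi> * cnj \<xi> ^ k) \<le> (LINT \<xi>|circle_lebesgue. cmod (?h \<xi> * cnj \<xi> ^ k))"
      by (rule integral_norm_bound)
    also have "\<dots> = (LINT \<xi>|circle_lebesgue. Re (?h \<xi>))"
      by (intro Bochner_Integration.integral_cong)
        (use pos half in \<open>auto simp: norm_mult norm_power simp del: of_real_divide\<close>)
    also have "\<dots> = Re (LINT \<xi>|circle_lebesgue. ?h \<xi> * cnj \<xi> ^ 0)"
      by (subst integral_Re)
        (auto intro!: lebesgue.integrable_continuous_on_circle continuous_intros
          dilate_holomorphic_continuous_on_circle[OF G] simp del: of_real_divide)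
    also have "\<dots> = 0"
      by (subst circle_moment_Re[OF G]) (auto simp: True)
    finally show ?thesis
      using circle_moment_Re[OF G, of "1/2" k] that by simp
  qed
  then have tc: "(LINT \<xi>|null_measure circle_borel. cnj \<xi> ^ k) =
      (if k = 0 then of_real (Re (G 0)) else taylor_coeff G k / 2)" for k
    using True by (simp add: integral_null_measure)
  have "circle_measure (null_measure circle_borel)"
    by (rule circle_measureI) (auto intro: finite_measureI)
  with circle_measure_of_moments[OF this G tc] show ?thesis
    by blast
next
  case False
  define c where "c = Re (G 0)"
  have c: "c > 0"
    using False pos[of 0] unfolding c_def by simp
  define r where "r n = 1 - inverse (real (Suc n))" for n
  have r: "0 \<le> r n" "r n < 1" for n
    by (auto simp: r_def field_simps)
  have r_lim: "r \<longlonglongrightarrow> 1"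
    unfolding r_def using tendsto_diff[OF tendsto_const LIMSEQ_inverse_real_of_nat] by simp
  let ?U = "uniform_measure lborel {0..2 * pi}"
  interpret U: prob_space ?U
    by (rule prob_space_uniform_period)
  define p where "p n \<xi> = Re (G (of_real (r n) * \<xi>)) / c" for n \<xi>
  have p_cont: "continuous_on unit_circle (p n)" for n
    unfolding p_def using c
    by (intro continuous_intros dilate_holomorphic_continuous_on_circle[OF G r]) auto
  have p_nonneg: "0 \<le> p n (cis t)" for n t
    unfolding p_def using pos[of "of_real (r n) * cis t"] r[of n] c by (auto simp: norm_mult)
  have pcis: "continuous_on UNIV (\<lambda>t. p n (cis t))" for n
    by (rule continuous_on_compose2[OF p_cont]) (auto intro!: continuous_intros)
  have p_meas [measurable]: "(\<lambda>t. p n (cis t)) \<in> borel_measurable borel" for n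
    by (rule borel_measurable_continuous_onI[OF pcis])
  define D where "D n = density ?U (\<lambda>t. ennreal (p n (cis t)))" for n
  have D_int: "(LINT t|D n. \<phi> (cis t)) = (LINT \<xi>|circle_lebesgue. p n \<xi> *\<^sub>R \<phi> \<xi>)"
    if "continuous_on unit_circle \<phi>" for n and \<phi> :: "complex \<Rightarrow> complex"
  proof -
    have [measurable]: "(\<lambda>t. \<phi> (cis t)) \<in> borel_measurable borel"
      by (intro borel_measurable_continuous_onI continuous_on_compose2[OF that]) (auto intro!: continuous_intros)
    have "(LINT t|D n. \<phi> (cis t)) = (LINT t|?U. p n (cis t) *\<^sub>R \<phi> (cis t))"
      unfolding D_def by (rule integral_density) (use p_nonneg in auto)
    also have "\<dots> = (LINT \<xi>|circle_lebesgue. p n \<xi> *\<^sub>R \<phi> \<xi>)"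
      by (rule integral_uniform_period_cis) (intro continuous_intros p_cont that)
    finally show ?thesis .
  qed
  have D_moment: "(LINT t|D n. cnj (cis t) ^ k) =
      (if k = 0 then 1 else taylor_coeff G k * of_real (r n) ^ k / (2 * of_real c))" for n k
  proof -
    have "(LINT t|D n. cnj (cis t) ^ k) = (LINT \<xi>|circle_lebesgue. p n \<xi> *\<^sub>R cnj \<xi> ^ k)"
      by (rule D_int) (intro continuous_intros)
    also have "\<dots> = (LINT \<xi>|circle_lebesgue. of_real (Re (G (of_real (r n) * \<xi>))) * cnj \<xi> ^ k / of_real c)"
      by (intro Bochner_Integration.integral_cong) (auto simp: p_def scaleR_conv_of_real)
    also have "\<dots> = (LINT \<xi>|circle_lebesgue. of_real (Re (G (of_real (r n) * \<xi>))) * cnj \<xi> ^ k) / of_real c"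
      by simp
    finally show ?thesis
      unfolding circle_moment_Re[OF G r] using c by (auto simp: c_def)
  qed
  have D_total: "(\<integral>\<^sup>+t. ennreal (p n (cis t)) \<partial>?U) = 1" for n
  proof -
    have "(LINT t|?U. p n (cis t)) = (LINT \<xi>|circle_lebesgue. p n \<xi>)"
      by (rule integral_uniform_period_cis[OF p_cont])
    also have "\<dots> = (LINT \<xi>|circle_lebesgue. Re (of_real (Re (G (of_real (r n) * \<xi>))) * cnj \<xi> ^ 0)) / c"
      by (simp add: p_def)
    also have "(LINT \<xi>|circle_lebesgue. Re (of_real (Re (G (of_real (r n) * \<xi>))) * cnj \<xi> ^ 0)) =
        Re (LINT \<xi>|circle_lebesgue. of_real (Re (G (of_real (r n) * \<xi>))) * cnj \<xi> ^ 0)"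
      by (intro integral_Re lebesgue.integrable_continuous_on_circle continuous_intros
          dilate_holomorphic_continuous_on_circle[OF G r])
    also have "\<dots> = c"
      unfolding circle_moment_Re[OF G r] by (simp add: c_def)
    finally have "(LINT t|?U. p n (cis t)) = 1"
      using c by simp
    moreover have "integrable ?U (\<lambda>t. p n (cis t))"
    proof -
      obtain B where "\<And>x. x \<in> unit_circle \<Longrightarrow> norm (p n x) \<le> B"
        using compact_imp_bounded[OF compact_continuous_image[OF p_cont compact_sphere]]
        unfolding bounded_iff by blast
      then show ?thesis
        by (intro U.integrable_const_bound[of _ B]) auto
    qed
    ultimately show ?thesis
      using p_nonneg by (subst nn_integral_eq_integral) auto
  qed
  have D_dist: "real_distribution (D n)" for n
  proof -
    have "prob_space (D n)"
      by (rule prob_spaceI) (simp add: D_def emeasure_density D_total)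
    then interpret prob_space "D n" .
    show ?thesis
      by unfold_locales (simp add: D_def)
  qed
  \<comment> \<open>Tightness speaks of half-open intervals, and the interval must contain the point \<open>0\<close>.\<close>
  have D_supp: "measure (D n) {-1<..2 * pi} = 1" for n
  proof -
    have "emeasure (D n) {-1<..2 * pi} = (\<integral>\<^sup>+t. ennreal (p n (cis t)) * indicator {-1<..2 * pi} t \<partial>?U)"
      unfolding D_def by (subst emeasure_density) auto
    also have "\<dots> = (\<integral>\<^sup>+t. ennreal (p n (cis t)) \<partial>?U)"
      by (intro nn_integral_cong_AE AE_uniform_measureI) auto
    finally show ?thesis
      by (simp add: D_total measure_def)
  qed
  have "tight D"
    unfolding tight_def
  proof (intro conjI allI impI)
    fix e :: real assume "e > 0"
    moreover have "-1 < 2 * pi"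
      using pi_gt_zero by linarith
    ultimately show "\<exists>a b. a < b \<and> (\<forall>n. 1 - e < measure (D n) {a<..b})"
      using D_supp by (intro exI[of _ "-1"] exI[of _ "2 * pi"]) simp
  qed (rule D_dist)
  from tight_imp_convergent_subsubsequence[OF this, of id]
  obtain s M where s: "strict_mono s" and M: "real_distribution M" and conv: "weak_conv_m (D \<circ> s) M"
    by (auto simp: strict_mono_id)
  interpret M: real_distribution M by fact
  have M_moment: "(LINT t|M. cnj (cis t) ^ k) = (if k = 0 then 1 else taylor_coeff G k / (2 * of_real c))" for k
  proof -
    have "(\<lambda>n. LINT t|(D \<circ> s) n. cnj (cis t) ^ k) \<longlonglongrightarrow> (LINT t|M. cnj (cis t) ^ k)"
    proof (rule weak_conv_imp_integral_bdd_continuous_conv[where B = 1])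
      have "continuous_on UNIV (\<lambda>t. cnj (cis t) ^ k)"
        by (intro continuous_intros)
      then show "isCont (\<lambda>t. cnj (cis t) ^ k) x" for x
        by (simp add: continuous_on_eq_continuous_at)
    qed (use D_dist M conv in \<open>auto simp: norm_power o_def\<close>)
    moreover have "(\<lambda>n. LINT t|(D \<circ> s) n. cnj (cis t) ^ k) \<longlonglongrightarrow>
        (if k = 0 then 1 else taylor_coeff G k * of_real 1 ^ k / (2 * of_real c))"
    proof (cases "k = 0")
      case False
      have "(\<lambda>n. r (s n)) \<longlonglongrightarrow> 1"
        using LIMSEQ_subseq_LIMSEQ[OF r_lim s] by (simp add: o_def)
      then have "(\<lambda>n. taylor_coeff G k * of_real (r (s n)) ^ k / (2 * of_real c)) \<longlonglongrightarrow>
          taylor_coeff G k * of_real 1 ^ k / (2 * of_real c)"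
        using c by (intro tendsto_intros) auto
      then show ?thesis
        using False by (simp add: D_moment)
    qed (simp only: o_def D_moment simp_thms if_True tendsto_const)
    ultimately show ?thesis
      using LIMSEQ_unique by fastforce
  qed
  define \<nu> where "\<nu> = density (distr M circle_borel cis) (\<lambda>_. ennreal c)"
  interpret N: prob_space "distr M circle_borel cis"
    by (rule M.prob_space_distr) simp
  have "circle_measure \<nu>"
  proof (rule circle_measureI)
    show "finite_measure \<nu>"
      using N.emeasure_space_1 by (intro finite_measureI) (simp add: \<nu>_def emeasure_density_const)
  qed (simp add: \<nu>_def)
  then interpret \<nu>: circle_measure \<nu> .
  have "(LINT \<xi>|\<nu>. cnj \<xi> ^ k) = (if k = 0 then of_real (Re (G 0)) else taylor_coeff G k / 2)" for k
  proof -
    have m: "(\<lambda>\<xi>. cnj \<xi> ^ k) \<in> borel_measurable circle_borel"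
      using lebesgue.measurable_continuous_on_circle[of "\<lambda>\<xi>. cnj \<xi> ^ k"]
      by (simp add: circle_lebesgue_def continuous_intros)
    have "(LINT \<xi>|\<nu>. cnj \<xi> ^ k) = (LINT \<xi>|distr M circle_borel cis. c *\<^sub>R cnj \<xi> ^ k)"
      unfolding \<nu>_def by (rule integral_density) (use c m in auto)
    also have "\<dots> = c *\<^sub>R (LINT \<xi>|distr M circle_borel cis. cnj \<xi> ^ k)"
      by (rule integral_scaleR_right)
    also have "(LINT \<xi>|distr M circle_borel cis. cnj \<xi> ^ k) = (LINT t|M. cnj (cis t) ^ k)"
      by (rule integral_distr) (use m in auto)
    finally show ?thesis
      using c by (auto simp: M_moment scaleR_conv_of_real c_def)
  qed
  with circle_measure_of_moments[OF \<open>circle_measure \<nu>\<close> G] \<open>circle_measure \<nu>\<close> show ?thesis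
    by blast
qed

section \<open>Canonical factorization\<close>

subsection \<open>Division by Blaschke factors\<close>

lemma cmod_diff_power2: "(cmod (a - b))\<^sup>2 = (cmod a)\<^sup>2 + (cmod b)\<^sup>2 - 2 * Re (a * cnj b)"
  unfolding cmod_power2 by (simp add: power2_eq_square algebra_simps)

lemma pseudohyperbolic_identity:
  "(cmod (1 - cnj w * z))\<^sup>2 - (cmod (w - z))\<^sup>2 = (1 - (cmod w)\<^sup>2) * (1 - (cmod z)\<^sup>2)"
  unfolding cmod_power2 by (simp add: power2_eq_square algebra_simps)

lemma disc_denominator_nonzero:
  assumes "cmod w < 1" "cmod z \<le> 1"
  shows "1 - cnj w * z \<noteq> 0"
proof -
  have "cmod (cnj w * z) < 1"
    using mult_mono[OF order_refl assms(2), of "cmod w"] assms(1) by (simp add: norm_mult)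
  then show ?thesis
    by auto
qed

lemma disc_denominator_lower:
  assumes "cmod w \<le> 1"
  shows "1 - cmod z \<le> cmod (1 - cnj w * z)"
proof -
  have "1 - cmod z \<le> 1 - cmod (cnj w * z)"
    using mult_right_mono[OF assms, of "cmod z"] by (simp add: norm_mult)
  also have "\<dots> \<le> cmod (1 - cnj w * z)"
    using norm_triangle_ineq2[of 1 "cnj w * z"] by simp
  finally show ?thesis .
qed

text \<open>What is left of a Blaschke factor when its zero is split off: a function without zeros on the
  closed disc.\<close>

definition blaschke_unit :: "complex \<Rightarrow> complex \<Rightarrow> complex" where
  "blaschke_unit w z = (if w = 0 then 1 else - (of_real (cmod w) / w) / (1 - cnj w * z))"

lemma blaschke_factor_eq: "blaschke_factor w z = (z - w) * blaschke_unit w z"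
  by (simp add: blaschke_factor_def blaschke_unit_def divide_simps) (simp add: algebra_simps)

lemma blaschke_unit_nonzero:
  assumes "cmod w < 1" "cmod z \<le> 1"
  shows "blaschke_unit w z \<noteq> 0"
  using disc_denominator_nonzero[OF assms] by (simp add: blaschke_unit_def)

lemma blaschke_unit_holomorphic:
  assumes "cmod w < 1"
  shows "blaschke_unit w holomorphic_on cball 0 1"
  unfolding blaschke_unit_def using disc_denominator_nonzero[OF assms]
  by (cases "w = 0") (auto intro!: holomorphic_intros)

lemma blaschke_factor_holomorphic:
  assumes "cmod w < 1"
  shows "blaschke_factor w holomorphic_on cball 0 1"
  unfolding blaschke_factor_eq[abs_def]
  by (intro holomorphic_intros blaschke_unit_holomorphic assms)

lemma blaschke_factor_eq_0_iff:
  assumes "cmod w < 1" "cmod z \<le> 1"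
  shows "blaschke_factor w z = 0 \<longleftrightarrow> z = w"
  using blaschke_unit_nonzero[OF assms] by (simp add: blaschke_factor_eq)

lemma one_minus_blaschke_factor_norm:
  assumes "cmod w < 1" "cmod z \<le> 1"
  shows "1 - (cmod (blaschke_factor w z))\<^sup>2 = (1 - (cmod w)\<^sup>2) * (1 - (cmod z)\<^sup>2) / (cmod (1 - cnj w * z))\<^sup>2"
proof (cases "w = 0")
  case False
  have "(cmod (blaschke_factor w z))\<^sup>2 = (cmod (w - z))\<^sup>2 / (cmod (1 - cnj w * z))\<^sup>2"
    using False by (simp add: blaschke_factor_def norm_mult norm_divide power_divide)
  then show ?thesis
    using disc_denominator_nonzero[OF assms]
    by (simp add: pseudohyperbolic_identity[symmetric] diff_divide_distrib)
qed (simp add: blaschke_factor_def)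

lemma blaschke_factor_le_1:
  assumes "cmod w < 1" "cmod z \<le> 1"
  shows "cmod (blaschke_factor w z) \<le> 1"
proof -
  have "0 \<le> 1 - (cmod (blaschke_factor w z))\<^sup>2"
    unfolding one_minus_blaschke_factor_norm[OF assms]
    using assms by (intro divide_nonneg_nonneg mult_nonneg_nonneg) (auto simp: power_le_one)
  then show ?thesis
    by (simp add: power2_le_imp_le[of _ 1])
qed

text \<open>Together with the Blaschke condition, this makes the product over the zeros converge.\<close>

lemma blaschke_factor_near_1:
  assumes "cmod w < 1" "cmod z < 1"
  shows "cmod (1 - blaschke_factor w z) \<le> (1 - cmod w) * (2 / (1 - cmod z))"
proof (cases "w = 0")
  case True
  have "cmod (1 - z) \<le> 1 + cmod z"
    using norm_triangle_ineq4[of 1 z] by simp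
  also have "\<dots> \<le> 2 / (1 - cmod z)"
    using assms by (simp add: field_simps)
  finally show ?thesis
    using True by (simp add: blaschke_factor_def)
next
  case False
  have nz: "1 - cnj w * z \<noteq> 0"
    using disc_denominator_nonzero[of w z] assms by simp
  have ww: "w * cnj w = of_real (cmod w) * of_real (cmod w)"
    using complex_norm_square[of w] by (simp add: power2_eq_square)
  have "1 - blaschke_factor w z = (w * (1 - cnj w * z) - of_real (cmod w) * (w - z)) / (w * (1 - cnj w * z))"
    using False nz by (simp add: blaschke_factor_def field_simps)
  also have "w * (1 - cnj w * z) - of_real (cmod w) * (w - z) = of_real (1 - cmod w) * (w + of_real (cmod w) * z)"
    using ww by (simp add: algebra_simps)
  finally have "cmod (1 - blaschke_factor w z) = (1 - cmod w) * (cmod (w + of_real (cmod w) * z) / cmod w) / cmod (1 - cnj w * z)"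
    using assms by (simp add: norm_mult norm_divide del: of_real_diff)
  also have "\<dots> \<le> (1 - cmod w) * 2 / (1 - cmod z)"
  proof (intro frac_le mult_left_mono)
    have "cmod (w + of_real (cmod w) * z) \<le> cmod w + cmod w * cmod z"
      using norm_triangle_ineq[of w "of_real (cmod w) * z"] by (simp add: norm_mult)
    also have "\<dots> \<le> 2 * cmod w"
      using mult_left_mono[of "cmod z" 1 "cmod w"] assms by simp
    finally show "cmod (w + of_real (cmod w) * z) / cmod w \<le> 2"
      using False by (simp add: field_simps)
    show "1 - cmod z \<le> cmod (1 - cnj w * z)"
      using disc_denominator_lower[of w z] assms by simp
  qed (use assms in auto)
  finally show ?thesis
    by simp
qed

lemma eventually_nonzero_at:
  assumes "g holomorphic_on unit_disc" "\<exists>u\<in>unit_disc. g u \<noteq> 0" "v \<in> unit_disc"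
  shows "\<forall>\<^sub>F z in at v. g z \<noteq> 0"
proof -
  obtain r where r: "r > 0" "\<And>w. w \<in> cball v r \<Longrightarrow> g w = zor_poly g v w * (w - v) ^ nat (zorder g v) \<and> zor_poly g v w \<noteq> 0"
    using conjunct2[OF zorder_exist_zero[OF assms(1) open_ball connected_ball assms(3) assms(2)]] by blast
  have "\<forall>\<^sub>F z in at v. z \<in> ball v r"
    using r(1) by (intro eventually_at_in_open') auto
  moreover have "\<forall>\<^sub>F z in at v. z \<noteq> v"
    by (simp add: eventually_at_filter)
  ultimately show ?thesis
  proof eventually_elim
    case (elim z)
    then have "z \<in> cball v r" "z - v \<noteq> 0"
      by auto
    with r(2)[of z] show ?case
      by (metis mult_eq_0_iff power_eq_0_iff)
  qed
qed

lemma zorder_on_disc: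
  assumes "g holomorphic_on unit_disc" "\<exists>u\<in>unit_disc. g u \<noteq> 0" "v \<in> unit_disc"
  shows "if g v = 0 then zorder g v > 0 else zorder g v = 0"
  using zorder_exist_zero[OF assms(1) open_ball _ assms(3,2)] by (simp add: convex_connected)

text \<open>As in the Schwarz lemma, dividing out a zero does not increase the bound: on the circle of radius
  \<open>r\<close> the Blaschke factor is at least \<open>1 - C (1 - r\<^sup>2)\<close> in squared modulus, and the maximum principle
  transports the resulting bound for the quotient inwards before \<open>r \<rightarrow> 1\<close>. The clause on orders allows
  the division to be repeated at the same zero.\<close>

lemma divide_by_blaschke_factor:
  assumes g: "g holomorphic_on unit_disc" and g1: "\<And>z. cmod z < 1 \<Longrightarrow> cmod (g z) \<le> 1"
    and nz: "\<exists>u\<in>unit_disc. g u \<noteq> 0" and w: "cmod w < 1" "g w = 0"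
  shows "\<exists>q. q holomorphic_on unit_disc \<and> (\<forall>z\<in>unit_disc. cmod (q z) \<le> 1 \<and> g z = blaschke_factor w z * q z) \<and>
    (\<forall>v\<in>unit_disc. zorder g v = zorder q v + (if v = w then 1 else 0))"
proof -
  define p where "p z = (if z = w then deriv g w else (g z - g w) / (z - w))" for z
  define q where "q z = p z / blaschke_unit w z" for z
  have "p holomorphic_on unit_disc"
    unfolding p_def by (rule pole_lemma_open[OF g open_ball])
  then have q: "q holomorphic_on unit_disc"
    unfolding q_def using blaschke_unit_nonzero[OF w(1)]
    by (intro holomorphic_intros holomorphic_on_subset[OF blaschke_unit_holomorphic[OF w(1)]]) auto
  have gq: "g z = blaschke_factor w z * q z" if "cmod z < 1" for z
    using blaschke_unit_nonzero[OF w(1), of z] that w(2)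
    by (auto simp: blaschke_factor_eq q_def p_def)
  have q1: "cmod (q z) \<le> 1" if z: "cmod z < 1" for z
  proof -
    have wl: "1 - cmod w \<le> cmod (1 - cnj w * v)" if "cmod v \<le> 1" for v :: complex
      using disc_denominator_lower[of v w] that by (metis complex_cnj_mult complex_cnj_cnj complex_cnj_diff complex_cnj_one complex_mod_cnj mult.commute)
    define C where "C = 1 / (1 - cmod w)\<^sup>2"
    have bound: "1 - C * (1 - r\<^sup>2) \<le> (cmod (blaschke_factor w v))\<^sup>2" if "cmod v = r" "r < 1" for v :: complex and r
    proof -
      have "(1 - cmod w)\<^sup>2 \<le> (cmod (1 - cnj w * v))\<^sup>2"
        using wl[of v] that w(1) by (intro power_mono) auto
      then have "(1 - (cmod w)\<^sup>2) * (1 - (cmod v)\<^sup>2) / (cmod (1 - cnj w * v))\<^sup>2 \<le> 1 * (1 - (cmod v)\<^sup>2) / (1 - cmod w)\<^sup>2"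
        using that w(1) by (intro frac_le mult_mono) (auto simp: power_le_one)
      then have "1 - (cmod (blaschke_factor w v))\<^sup>2 \<le> 1 * (1 - (cmod v)\<^sup>2) / (1 - cmod w)\<^sup>2"
        using one_minus_blaschke_factor_norm[of w v] that w(1) by simp
      then show ?thesis
        using that by (simp add: C_def)
    qed
    have le: "(cmod (q z))\<^sup>2 * (1 - C * (1 - r\<^sup>2)) \<le> 1" if r: "cmod z < r" "r < 1" "1 - C * (1 - r\<^sup>2) > 0" for r
    proof -
      let ?m = "1 - C * (1 - r\<^sup>2)"
      have r0: "0 < r"
        using r(1) norm_ge_zero[of z] by linarith
      have "cmod (q z) \<le> sqrt (1 / ?m)"
      proof (rule maximum_modulus_frontier[of q "ball 0 r"])
        show "q holomorphic_on interior (ball 0 r)"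
          using r by (intro holomorphic_on_subset[OF q]) auto
        show "continuous_on (closure (ball 0 r)) q"
          using r r0 by (intro continuous_on_subset[OF holomorphic_on_imp_continuous_on[OF q]]) auto
        fix v :: complex assume "v \<in> frontier (ball 0 r)"
        then have v: "cmod v = r"
          using r0 by simp
        have "?m * (cmod (q v))\<^sup>2 \<le> (cmod (blaschke_factor w v))\<^sup>2 * (cmod (q v))\<^sup>2"
          by (intro mult_right_mono bound v r) auto
        also have "\<dots> = (cmod (g v))\<^sup>2"
          using gq[of v] v r by (simp add: norm_mult power_mult_distrib)
        also have "\<dots> \<le> 1"
          using g1[of v] v r by (simp add: power_le_one)
        finally have "(cmod (q v))\<^sup>2 \<le> 1 / ?m"
          using r(3) by (simp add: field_simps)
        then show "cmod (q v) \<le> sqrt (1 / ?m)"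
          by (rule real_le_rsqrt)
      qed (use r in auto)
      then have "(cmod (q z))\<^sup>2 \<le> (sqrt (1 / ?m))\<^sup>2"
        by (intro power_mono) auto
      also have "\<dots> = 1 / ?m"
        using r(3) by simp
      finally show ?thesis
        using r(3) by (simp add: field_simps)
    qed
    have lim: "((\<lambda>r. 1 - C * (1 - r\<^sup>2)) \<longlongrightarrow> 1 - C * (1 - 1\<^sup>2)) (at_left 1)"
      by (intro tendsto_intros)
    then have "\<forall>\<^sub>F r in at_left 1. 1 - C * (1 - r\<^sup>2) > 0"
      by (rule order_tendstoD) simp
    moreover have "\<forall>\<^sub>F r in at_left 1. cmod z < r"
      using z by (rule eventually_at_left_real[THEN eventually_mono]) auto
    moreover have "\<forall>\<^sub>F r in at_left (1::real). r < 1"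
      by (simp add: eventually_at_filter)
    ultimately have "\<forall>\<^sub>F r in at_left 1. (cmod (q z))\<^sup>2 * (1 - C * (1 - r\<^sup>2)) \<le> 1"
      by eventually_elim (rule le)
    then have "(cmod (q z))\<^sup>2 * (1 - C * (1 - 1\<^sup>2)) \<le> 1"
      by (intro tendsto_upperbound[OF tendsto_mult[OF tendsto_const lim]]) auto
    then show ?thesis
      by (simp add: power2_le_imp_le[of _ 1])
  qed
  have b: "blaschke_factor w holomorphic_on unit_disc"
    by (rule holomorphic_on_subset[OF blaschke_factor_holomorphic[OF w(1)]]) auto
  have ord: "zorder g v = zorder q v + (if v = w then 1 else 0)" if v: "v \<in> unit_disc" for v
  proof -
    have ev: "\<forall>\<^sub>F z in nhds v. z \<in> unit_disc"
      using v by (intro eventually_nhds_in_open) auto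
    have "zorder g v = zorder (\<lambda>z. blaschke_factor w z * q z) v"
      by (rule zorder_cong) (use ev in \<open>auto elim!: eventually_mono simp: gq eventually_at_filter\<close>)
    also have "\<dots> = zorder (blaschke_factor w) v + zorder q v"
    proof (rule zorder_times_analytic)
      show "blaschke_factor w analytic_on {v}" "q analytic_on {v}"
        using b q v by (meson analytic_at open_ball)+
      show "\<forall>\<^sub>F z in at v. blaschke_factor w z * q z \<noteq> 0"
        using eventually_nonzero_at[OF g nz v] eventually_at_in_open'[OF open_ball v]
        by eventually_elim (use gq in auto)
    qed
    also have "zorder (blaschke_factor w) v = (if v = w then 1 else 0)"
    proof (cases "v = w")
      case True
      have "zorder (blaschke_factor w) w = 1"
        by (rule zorder_eqI[of unit_disc w "blaschke_unit w"])
          (use w blaschke_unit_nonzero[of w w] in \<open>auto simp: blaschke_factor_eq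
            intro: holomorphic_on_subset[OF blaschke_unit_holomorphic[OF w(1)]]\<close>)
      with True show ?thesis
        by simp
    next
      case False
      have "zorder (blaschke_factor w) v = 0"
        by (rule zorder_eqI[of unit_disc v "blaschke_factor w"])
          (use v False blaschke_factor_eq_0_iff[OF w(1), of v] in \<open>auto intro: b\<close>)
      with False show ?thesis
        by simp
    qed
    finally show ?thesis
      by simp
  qed
  show ?thesis
    using q q1 gq ord by (intro exI[of _ q]) auto
qed

text \<open>The clause on orders shows that the quotient has no zero at \<open>v\<close> once all pairs \<open>(v, k)\<close> have been
  used.\<close>

lemma finite_blaschke_division:
  assumes \<theta>: "\<theta> holomorphic_on unit_disc" and \<theta>1: "\<And>z. cmod z < 1 \<Longrightarrow> cmod (\<theta> z) \<le> 1"
    and nz: "\<exists>u\<in>unit_disc. \<theta> u \<noteq> 0"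
    and F: "finite F" "F \<subseteq> disc_zeros \<theta>"
  shows "\<exists>q. q holomorphic_on unit_disc \<and>
    (\<forall>z\<in>unit_disc. cmod (q z) \<le> 1 \<and> \<theta> z = (\<Prod>(w, k)\<in>F. blaschke_factor w z) * q z) \<and>
    (\<forall>v\<in>unit_disc. zorder \<theta> v = zorder q v + int (card {k. (v, k) \<in> F}))"
  using F
proof (induction F rule: finite_induct)
  case empty
  then show ?case
    using \<theta> \<theta>1 by (intro exI[of _ \<theta>]) auto
next
  case (insert x F)
  obtain w k where x: "x = (w, k)"
    by (cases x)
  obtain q where q: "q holomorphic_on unit_disc"
    "\<And>z. z \<in> unit_disc \<Longrightarrow> cmod (q z) \<le> 1 \<and> \<theta> z = (\<Prod>(w, k)\<in>F. blaschke_factor w z) * q z"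
    and ord: "\<And>v. v \<in> unit_disc \<Longrightarrow> zorder \<theta> v = zorder q v + int (card {k. (v, k) \<in> F})"
    using insert.IH insert.prems by auto
  have w: "w \<in> unit_disc" "\<theta> w = 0" and k: "k < nat (zorder \<theta> w)"
    using insert.prems x by (auto simp: disc_zeros_def)
  obtain u where u: "u \<in> unit_disc" "q u \<noteq> 0"
    using nz q(2) by (metis mult_zero_right)
  have fin: "finite {k. (v, k) \<in> F}" for v
    using finite_imageI[OF insert.hyps(1), of snd] by (rule rev_finite_subset) force
  have "{k. (w, k) \<in> F} \<subset> {..<nat (zorder \<theta> w)}"
    using insert.prems insert.hyps(2) k x by (auto simp: disc_zeros_def)
  then have "card {k. (w, k) \<in> F} < nat (zorder \<theta> w)"
    using psubset_card_mono[of "{..<nat (zorder \<theta> w)}"] by simp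
  then have "zorder q w > 0"
    using ord[OF w(1)] by linarith
  then have "q w = 0"
    using zorder_on_disc[OF q(1) _ w(1)] u by (metis less_irrefl)
  have "\<exists>u\<in>unit_disc. q u \<noteq> 0" "\<And>z. cmod z < 1 \<Longrightarrow> cmod (q z) \<le> 1" "cmod w < 1"
    using u q(2) w(1) by auto
  from divide_by_blaschke_factor[OF q(1) this(2,1,3) \<open>q w = 0\<close>] obtain p where p:
    "p holomorphic_on unit_disc" "\<And>z. z \<in> unit_disc \<Longrightarrow> cmod (p z) \<le> 1 \<and> q z = blaschke_factor w z * p z"
    "\<And>v. v \<in> unit_disc \<Longrightarrow> zorder q v = zorder p v + (if v = w then 1 else 0)"
    by blast
  have "card {j. (v, j) \<in> insert (w, k) F} = card {j. (v, j) \<in> F} + (if v = w then 1 else 0)" for v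
  proof (cases "v = w")
    case True
    then have "{j. (v, j) \<in> insert (w, k) F} = insert k {j. (v, j) \<in> F}" by auto
    with True show ?thesis
      using insert.hyps(2) x fin by simp
  qed simp
  then show ?case
    using p q(2) ord insert.hyps x by (intro exI[of _ p]) (auto simp: mult_ac)
qed

subsection \<open>The Blaschke product\<close>

abbreviation "partial_blaschke F z \<equiv> (\<Prod>(w, k)\<in>F. blaschke_factor w z)"

lemma disc_zerosD:
  assumes "(w, k) \<in> disc_zeros \<theta>"
  shows "cmod w < 1" "\<theta> w = 0" "k < nat (zorder \<theta> w)"
  using assms by (auto simp: disc_zeros_def)

lemma partial_blaschke_le_1:
  assumes "F \<subseteq> disc_zeros \<theta>" "cmod z \<le> 1"
  shows "cmod (partial_blaschke F z) \<le> 1"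
  unfolding prod_norm[symmetric]
  by (rule prod_le_1) (use assms in \<open>auto intro!: blaschke_factor_le_1 dest: disc_zerosD\<close>)

lemma partial_blaschke_mono:
  assumes "finite F" "E \<subseteq> F" "F \<subseteq> disc_zeros \<theta>" "cmod z \<le> 1"
  shows "cmod (partial_blaschke F z) \<le> cmod (partial_blaschke E z)"
proof -
  have "partial_blaschke F z = partial_blaschke E z * partial_blaschke (F - E) z"
    using prod.subset_diff[OF assms(2,1), of "\<lambda>(w, k). blaschke_factor w z"] by (simp add: mult.commute)
  moreover have "cmod (partial_blaschke (F - E) z) \<le> 1"
    by (rule partial_blaschke_le_1) (use assms in auto)
  ultimately show ?thesis
    by (metis norm_mult mult_left_le norm_ge_zero)
qed

lemma sum_one_minus_le_neg_ln_prod: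
  fixes b :: "'a \<Rightarrow> real"
  assumes "finite F" "\<And>x. x \<in> F \<Longrightarrow> 0 < b x"
  shows "(\<Sum>x\<in>F. 1 - b x) \<le> - ln (\<Prod>x\<in>F. b x)"
proof -
  have "(\<Sum>x\<in>F. 1 - b x) \<le> (\<Sum>x\<in>F. - ln (b x))"
    by (intro sum_mono) (use ln_le_minus_one[OF assms(2)] in force)
  also have "\<dots> = - ln (\<Prod>x\<in>F. b x)"
    using ln_prod[OF assms(1), of b] assms(2) by (force simp: sum_negf)
  finally show ?thesis .
qed

locale disc_self_map =
  fixes \<theta> :: "complex \<Rightarrow> complex"
  assumes holo: "\<theta> holomorphic_on unit_disc"
    and le_1: "\<And>z. cmod z < 1 \<Longrightarrow> cmod (\<theta> z) \<le> 1"
    and nonzero: "\<exists>u\<in>unit_disc. \<theta> u \<noteq> 0"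
begin

lemma zorder_pos:
  assumes "v \<in> unit_disc"
  shows "if \<theta> v = 0 then zorder \<theta> v > 0 else zorder \<theta> v = 0"
  by (rule zorder_on_disc[OF holo nonzero assms])

lemma norm_le_partial_blaschke:
  assumes "finite F" "F \<subseteq> disc_zeros \<theta>" "cmod z < 1"
  shows "cmod (\<theta> z) \<le> cmod (partial_blaschke F z)"
proof -
  obtain q where "\<And>z. z \<in> unit_disc \<Longrightarrow> cmod (q z) \<le> 1 \<and> \<theta> z = partial_blaschke F z * q z"
    using finite_blaschke_division[OF holo le_1 nonzero assms(1,2)] by blast
  from this[of z] show ?thesis
    using assms(3) by (auto simp: norm_mult mult_left_le)
qed

text \<open>At a point \<open>u\<close> with \<open>\<theta> u \<noteq> 0\<close>, each finite Blaschke product is at least \<open>|\<theta> u|\<close>, and \<open>- ln\<close> of its squared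
  modulus dominates the sum of the differences \<open>1 - |b\<^sub>w(u)|\<^sup>2\<close>, each of which is comparable to
  \<open>1 - |w|\<close>.\<close>

lemma blaschke_condition: "(\<lambda>(w, k). 1 - cmod w) summable_on disc_zeros \<theta>"
proof (rule nonneg_bdd_above_summable_on)
  obtain u where u: "cmod u < 1" "\<theta> u \<noteq> 0"
    using nonzero by auto
  let ?L = "- ln ((cmod (\<theta> u))\<^sup>2)"
  have u2: "1 - (cmod u)\<^sup>2 > 0"
    using u by (simp add: power_less_one_iff)
  have "(\<Sum>(w, k)\<in>F. 1 - cmod w) \<le> 4 * ?L / (1 - (cmod u)\<^sup>2)"
    if F: "finite F" "F \<subseteq> disc_zeros \<theta>" for F
  proof -
    let ?b = "\<lambda>(w, k::nat). (cmod (blaschke_factor w u))\<^sup>2"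
    have pos: "0 < ?b x" if "x \<in> F" for x
    proof -
      obtain w k where x: "x = (w, k)" by (cases x)
      then have "cmod w < 1" "\<theta> w = 0"
        using that F(2) by (auto dest: disc_zerosD)
      then show ?thesis
        using u x by (auto simp: blaschke_factor_eq_0_iff)
    qed
    have each: "(case x of (w, k) \<Rightarrow> 1 - cmod w) * ((1 - (cmod u)\<^sup>2) / 4) \<le> 1 - ?b x" if "x \<in> F" for x
    proof -
      obtain w k where x: "x = (w, k)" by (cases x)
      have w: "cmod w < 1"
        using that F(2) x by (auto dest: disc_zerosD)
      have "cmod (1 - cnj w * u) \<le> 2"
        using norm_triangle_ineq4[of 1 "cnj w * u"] mult_mono[of "cmod w" 1 "cmod u" 1] w u by (simp add: norm_mult)
      then have "(cmod (1 - cnj w * u))\<^sup>2 \<le> 2\<^sup>2"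
        by (rule power_mono) simp
      moreover have "1 - cmod w \<le> 1 - (cmod w)\<^sup>2"
        using w by (simp add: power2_eq_square mult_left_le)
      moreover have "0 < (cmod (1 - cnj w * u))\<^sup>2"
        using disc_denominator_nonzero[of w u] w u by simp
      ultimately have "(1 - cmod w) * (1 - (cmod u)\<^sup>2) / 4 \<le> (1 - (cmod w)\<^sup>2) * (1 - (cmod u)\<^sup>2) / (cmod (1 - cnj w * u))\<^sup>2"
        using u2 w by (intro frac_le mult_right_mono mult_nonneg_nonneg) (auto simp: power_le_one)
      then show ?thesis
        using one_minus_blaschke_factor_norm[of w u] w u x by simp
    qed
    have "(\<Sum>(w, k)\<in>F. 1 - cmod w) * ((1 - (cmod u)\<^sup>2) / 4) \<le> (\<Sum>x\<in>F. 1 - ?b x)"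
      unfolding sum_distrib_right by (rule sum_mono) (rule each)
    also have "\<dots> \<le> - ln (\<Prod>x\<in>F. ?b x)"
      by (rule sum_one_minus_le_neg_ln_prod[OF F(1) pos])
    also have "(\<Prod>x\<in>F. ?b x) = (cmod (partial_blaschke F u))\<^sup>2"
      by (simp add: prod_norm[symmetric] prod_power_distrib case_prod_unfold)
    also have "- ln ((cmod (partial_blaschke F u))\<^sup>2) \<le> ?L"
      using norm_le_partial_blaschke[OF F u(1)] u(2) by (auto intro!: power_mono ln_mono)
    finally show ?thesis
      using u2 by (simp add: field_simps)
  qed
  then show "bdd_above (sum (\<lambda>(w, k). 1 - cmod w) ` {F. F \<subseteq> disc_zeros \<theta> \<and> finite F})"
    by (intro bdd_aboveI) auto
qed (auto dest: disc_zerosD)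

lemma finite_zeros_away_from_circle:
  assumes "c > 0"
  shows "finite {(w, k) \<in> disc_zeros \<theta>. c \<le> 1 - cmod w}" (is "finite ?A")
proof (rule ccontr)
  assume inf: "infinite ?A"
  let ?S = "\<Sum>\<^sub>\<infinity>(w, k)\<in>disc_zeros \<theta>. 1 - cmod w"
  obtain n :: nat where n: "?S < real n * c"
    using reals_Archimedean3[OF assms] by blast
  obtain F where F: "finite F" "card F = n" "F \<subseteq> ?A"
    using infinite_arbitrarily_large[OF inf] by blast
  have "real n * c = (\<Sum>(w, k)\<in>F. c)"
    using F by (simp add: case_prod_unfold)
  also have "\<dots> \<le> (\<Sum>(w, k)\<in>F. 1 - cmod w)"
    using F by (intro sum_mono) auto
  also have "\<dots> \<le> ?S"
    using F by (intro finite_sum_le_infsum blaschke_condition) (auto dest: disc_zerosD)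
  finally show False
    using n by simp
qed

text \<open>On a smaller disc all but finitely many Blaschke factors are within \<open>1 / 2\<close> of \<open>1\<close>. Their principal
  logarithms are holomorphic and have a summable majorant, so the corresponding part of the
  product is an exponential. The finitely many remaining factors account for all zeros of \<open>\<theta>\<close> in the
  smaller disc.\<close>

lemma blaschke_local_factorization:
  assumes r: "0 < r" "r < 1"
  shows "\<exists>s. s holomorphic_on ball 0 r \<and> (\<forall>z\<in>ball 0 r. s z \<noteq> 0 \<and> \<theta> z = blaschke_product \<theta> z * s z \<and>
    ((\<lambda>F. partial_blaschke F z) \<longlongrightarrow> blaschke_product \<theta> z) (finite_subsets_at_top (disc_zeros \<theta>)))"
proof -
  let ?Z = "disc_zeros \<theta>"
  \<comment> \<open>The threshold makes the bound \<open>(1 - |w|) \<cdot> 2 / (1 - r)\<close> of \<open>1 - b\<^sub>w\<close> smaller than \<open>1 / 2\<close> outside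
    \<open>A\<close>. It is below \<open>1 - r\<close>, so \<open>A\<close> contains all zeros in the disc of radius \<open>r\<close>.\<close>
  define A where "A = {(w, k) \<in> ?Z. (1 - r) / 4 \<le> 1 - cmod w}"
  have A: "finite A" "A \<subseteq> ?Z"
    unfolding A_def using finite_zeros_away_from_circle[of "(1 - r) / 4"] r by auto
  let ?l = "\<lambda>x z. Ln (blaschke_factor (fst x) z)"
  define L where "L z = (\<Sum>\<^sub>\<infinity>x\<in>?Z - A. ?l x z)" for z
  have near: "cmod (1 - blaschke_factor (fst x) z) < 1 / 2"
    "cmod (1 - blaschke_factor (fst x) z) \<le> (1 - cmod (fst x)) * (2 / (1 - r))"
    if x: "x \<in> ?Z - A" and z: "cmod z \<le> r" for x z
  proof -
    obtain w k where wk: "x = (w, k)" by (cases x)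
    have w: "cmod w < 1" "1 - cmod w < (1 - r) / 4"
      using x wk by (auto simp: A_def dest: disc_zerosD)
    have "cmod (1 - blaschke_factor w z) \<le> (1 - cmod w) * (2 / (1 - cmod z))"
      using w r z by (intro blaschke_factor_near_1) auto
    also have "\<dots> \<le> (1 - cmod w) * (2 / (1 - r))"
      using w r z by (intro mult_left_mono frac_le) auto
    finally show *: "cmod (1 - blaschke_factor (fst x) z) \<le> (1 - cmod (fst x)) * (2 / (1 - r))"
      using wk by simp
    also have "\<dots> < (1 - r) / 4 * (2 / (1 - r))"
      using w r wk by (intro mult_strict_right_mono) auto
    also have "\<dots> = 1 / 2"
      using r by simp
    finally show "cmod (1 - blaschke_factor (fst x) z) < 1 / 2" .
  qed
  have re: "Re (blaschke_factor (fst x) z) > 0" if "x \<in> ?Z - A" "cmod z \<le> r" for x z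
    using near(1)[OF that] complex_Re_le_cmod[of "1 - blaschke_factor (fst x) z"] by simp
  have lb: "cmod (?l x z) \<le> (1 - cmod (fst x)) * (4 / (1 - r))" if "x \<in> ?Z - A" "cmod z \<le> r" for x z
  proof -
    have "cmod (Ln (1 + (blaschke_factor (fst x) z - 1))) \<le> 2 * cmod (blaschke_factor (fst x) z - 1)"
      using near(1)[OF that] by (intro norm_Ln_le) (simp add: norm_minus_commute)
    also have "\<dots> \<le> 2 * ((1 - cmod (fst x)) * (2 / (1 - r)))"
      using near(2)[OF that] by (simp only: norm_minus_commute)
    finally show ?thesis
      by (simp add: mult.commute)
  qed
  have "(\<lambda>x. (1 - cmod (fst x)) * (4 / (1 - r))) summable_on (?Z - A)"
    using summable_on_subset_banach[OF blaschke_condition, of "?Z - A"]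
    by (intro summable_on_cmult_left) (auto simp: case_prod_unfold)
  then have ulim: "uniform_limit (cball 0 r) (\<lambda>F z. \<Sum>x\<in>F. ?l x z) L (finite_subsets_at_top (?Z - A))"
    unfolding L_def by (intro Weierstrass_m_test_general) (use lb in auto)
  have hol_l: "?l x holomorphic_on cball 0 r" if "x \<in> ?Z - A" for x
  proof (rule holomorphic_on_Ln')
    show "blaschke_factor (fst x) holomorphic_on cball 0 r"
      using that r disc_zerosD(1)[of "fst x" "snd x" \<theta>]
      by (intro holomorphic_on_subset[OF blaschke_factor_holomorphic]) auto
    fix z :: complex assume "z \<in> cball 0 r"
    then show "blaschke_factor (fst x) z \<notin> \<real>\<^sub>\<le>\<^sub>0"
      using re[OF that, of z] by (auto simp: complex_nonpos_Reals_iff)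
  qed
  have L_hol: "L holomorphic_on ball 0 r"
  proof (rule holomorphic_uniform_limit[OF _ ulim])
    show "\<forall>\<^sub>F F in finite_subsets_at_top (?Z - A).
        continuous_on (cball 0 r) (\<lambda>z. \<Sum>x\<in>F. ?l x z) \<and> (\<lambda>z. \<Sum>x\<in>F. ?l x z) holomorphic_on ball 0 r"
    proof (rule eventually_finite_subsets_at_top_weakI)
      fix F assume F: "finite F" "F \<subseteq> ?Z - A"
      then have "(\<lambda>z. \<Sum>x\<in>F. ?l x z) holomorphic_on cball 0 r"
        by (intro holomorphic_on_sum hol_l) auto
      then show "continuous_on (cball 0 r) (\<lambda>z. \<Sum>x\<in>F. ?l x z) \<and> (\<lambda>z. \<Sum>x\<in>F. ?l x z) holomorphic_on ball 0 r"
        by (auto intro: holomorphic_on_imp_continuous_on holomorphic_on_subset)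
    qed
  qed auto
  obtain q where q: "q holomorphic_on unit_disc" "\<And>z. z \<in> unit_disc \<Longrightarrow> \<theta> z = partial_blaschke A z * q z"
    "\<And>v. v \<in> unit_disc \<Longrightarrow> zorder \<theta> v = zorder q v + int (card {k. (v, k) \<in> A})"
    using finite_blaschke_division[OF holo le_1 nonzero A] by auto
  have q_nz: "q v \<noteq> 0" if v: "v \<in> ball 0 r" for v
  proof (cases "\<theta> v = 0")
    case True
    have vd: "v \<in> unit_disc"
      using v r by auto
    have "{k. (v, k) \<in> A} = {..<nat (zorder \<theta> v)}"
      using v r True by (auto simp: A_def disc_zeros_def)
    then have "card {k. (v, k) \<in> A} = nat (zorder \<theta> v)"
      by simp
    moreover have "zorder \<theta> v > 0"
      using zorder_pos[OF vd] True by metis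
    ultimately have "zorder q v = 0"
      using q(3)[OF vd] by linarith
    moreover obtain u where "u \<in> unit_disc" "q u \<noteq> 0"
      using nonzero q(2) by (metis mult_zero_right)
    ultimately show ?thesis
      using zorder_on_disc[OF q(1) _ vd] by (metis less_irrefl)
  qed (use q(2)[of v] v r in auto)
  have lim: "((\<lambda>F. partial_blaschke F z) \<longlongrightarrow> partial_blaschke A z * exp (L z)) (finite_subsets_at_top ?Z)"
    if z: "z \<in> ball 0 r" for z
  proof -
    have "((\<lambda>F. \<Sum>x\<in>F. ?l x z) \<longlongrightarrow> L z) (finite_subsets_at_top (?Z - A))"
      using tendsto_uniform_limitI[OF ulim, of z] z by simp
    moreover have "filterlim (\<lambda>F. F - A) (finite_subsets_at_top (?Z - A)) (finite_subsets_at_top ?Z)"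
      unfolding filterlim_finite_subsets_at_top
    proof (intro allI impI)
      fix X assume X: "finite X \<and> X \<subseteq> ?Z - A"
      then show "\<forall>\<^sub>F F in finite_subsets_at_top ?Z. finite (F - A) \<and> X \<subseteq> F - A \<and> F - A \<subseteq> ?Z - A"
        unfolding eventually_finite_subsets_at_top by (intro exI[of _ X]) auto
    qed
    ultimately have "((\<lambda>F. \<Sum>x\<in>F - A. ?l x z) \<longlongrightarrow> L z) (finite_subsets_at_top ?Z)"
      by (rule filterlim_compose)
    then have "((\<lambda>F. partial_blaschke A z * exp (\<Sum>x\<in>F - A. ?l x z)) \<longlongrightarrow> partial_blaschke A z * exp (L z))
        (finite_subsets_at_top ?Z)"
      by (intro tendsto_intros)
    moreover have "\<forall>\<^sub>F F in finite_subsets_at_top ?Z.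
        partial_blaschke A z * exp (\<Sum>x\<in>F - A. ?l x z) = partial_blaschke F z"
      unfolding eventually_finite_subsets_at_top
    proof (intro exI[of _ A] conjI allI impI A)
      fix F assume F: "finite F \<and> A \<subseteq> F \<and> F \<subseteq> ?Z"
      have "exp (\<Sum>x\<in>F - A. ?l x z) = (\<Prod>x\<in>F - A. exp (?l x z))"
        using F by (intro exp_sum) auto
      also have "\<dots> = partial_blaschke (F - A) z"
      proof (intro prod.cong refl)
        fix x assume "x \<in> F - A"
        then have "blaschke_factor (fst x) z \<noteq> 0"
          using re[of x z] F z by (metis Diff_iff subsetD mem_ball_0 less_imp_le less_irrefl zero_complex.sel(1))
        then show "exp (?l x z) = (case x of (w, k) \<Rightarrow> blaschke_factor w z)"
          by (simp add: case_prod_unfold)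
      qed
      finally show "partial_blaschke A z * exp (\<Sum>x\<in>F - A. ?l x z) = partial_blaschke F z"
        using F prod.subset_diff[of A F "\<lambda>(w, k). blaschke_factor w z"] by (simp add: mult.commute)
    qed
    ultimately show ?thesis
      by (rule Lim_transform_eventually)
  qed
  then have B: "blaschke_product \<theta> z = partial_blaschke A z * exp (L z)" if "z \<in> ball 0 r" for z
    unfolding blaschke_product_def using that by (intro tendsto_Lim) auto
  show ?thesis
  proof (intro exI[of _ "\<lambda>z. q z * exp (- L z)"] conjI ballI)
    show "(\<lambda>z. q z * exp (- L z)) holomorphic_on ball 0 r"
      using r by (intro holomorphic_intros L_hol holomorphic_on_subset[OF q(1)]) auto
    fix z :: complex assume z: "z \<in> ball 0 r"
    then show "q z * exp (- L z) \<noteq> 0"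
      using q_nz by simp
    have "z \<in> unit_disc"
      using z r by auto
    then show "\<theta> z = blaschke_product \<theta> z * (q z * exp (- L z))"
      using q(2) by (simp add: B[OF z] exp_minus field_simps)
    show "((\<lambda>F. partial_blaschke F z) \<longlongrightarrow> blaschke_product \<theta> z) (finite_subsets_at_top ?Z)"
      using lim[OF z] B[OF z] by simp
  qed
qed

lemma blaschke_product_tendsto:
  assumes "cmod z < 1"
  shows "((\<lambda>F. partial_blaschke F z) \<longlongrightarrow> blaschke_product \<theta> z) (finite_subsets_at_top (disc_zeros \<theta>))"
proof -
  have "0 < (1 + cmod z) / 2" "(1 + cmod z) / 2 < 1" "z \<in> ball 0 ((1 + cmod z) / 2)"
    using assms by (auto intro: add_pos_nonneg)
  then show ?thesis
    using blaschke_local_factorization[of "(1 + cmod z) / 2"] by blast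
qed

lemma blaschke_product_le_partial:
  assumes "cmod z < 1" "finite E" "E \<subseteq> disc_zeros \<theta>"
  shows "cmod (blaschke_product \<theta> z) \<le> cmod (partial_blaschke E z)"
proof (rule tendsto_upperbound[OF tendsto_norm[OF blaschke_product_tendsto[OF assms(1)]]])
  show "\<forall>\<^sub>F F in finite_subsets_at_top (disc_zeros \<theta>). cmod (partial_blaschke F z) \<le> cmod (partial_blaschke E z)"
    unfolding eventually_finite_subsets_at_top
    using assms partial_blaschke_mono[of _ E \<theta> z] by (intro exI[of _ E]) auto
qed auto

lemma norm_le_blaschke_product:
  assumes "cmod z < 1"
  shows "cmod (\<theta> z) \<le> cmod (blaschke_product \<theta> z)"
proof (rule tendsto_lowerbound[OF tendsto_norm[OF blaschke_product_tendsto[OF assms(1)]]])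
  show "\<forall>\<^sub>F F in finite_subsets_at_top (disc_zeros \<theta>). cmod (\<theta> z) \<le> cmod (partial_blaschke F z)"
    by (intro eventually_finite_subsets_at_top_weakI norm_le_partial_blaschke assms)
qed auto

text \<open>The quotient is defined at the zeros by continuity. It is bounded by \<open>1\<close> away from the zeros, as
  the limit of the quotients by finite products, and hence everywhere.\<close>

proposition blaschke_factorization:
  shows "\<exists>s. s holomorphic_on unit_disc \<and>
    (\<forall>z\<in>unit_disc. s z \<noteq> 0 \<and> cmod (s z) \<le> 1 \<and> \<theta> z = blaschke_product \<theta> z * s z)"
proof -
  define s where "s v = Lim (at v) (\<lambda>z. \<theta> z / blaschke_product \<theta> z)" for v
  have local: "\<exists>f. f holomorphic_on ball 0 r \<and> (\<forall>z\<in>ball 0 r. f z = s z \<and> s z \<noteq> 0 \<and> cmod (s z) \<le> 1 \<and> \<theta> z = blaschke_product \<theta> z * s z)"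
    if r: "0 < r" "r < 1" for r
  proof -
    obtain f where f: "f holomorphic_on ball 0 r" "\<And>z. z \<in> ball 0 r \<Longrightarrow> f z \<noteq> 0 \<and> \<theta> z = blaschke_product \<theta> z * f z"
      using blaschke_local_factorization[OF r] by auto
    have "s v = f v \<and> cmod (f v) \<le> 1" if v: "v \<in> ball 0 r" for v
    proof -
      have "isCont f v"
        using f(1) v by (meson continuous_on_eq_continuous_at holomorphic_on_imp_continuous_on open_ball)
      then have lim: "(f \<longlongrightarrow> f v) (at v)"
        by (simp add: isCont_def)
      have ev: "\<forall>\<^sub>F z in at v. z \<in> ball 0 r \<and> \<theta> z \<noteq> 0"
        using eventually_at_in_open'[OF open_ball v] eventually_nonzero_at[OF holo nonzero, of v] v r
        by (intro eventually_conj) auto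
      have "((\<lambda>z. \<theta> z / blaschke_product \<theta> z) \<longlongrightarrow> f v) (at v)"
        by (rule Lim_transform_eventually[OF lim]) (use ev in eventually_elim, use f(2) in fastforce)
      then have "s v = f v"
        unfolding s_def by (intro tendsto_Lim) auto
      moreover have "cmod (f v) \<le> 1"
      proof (rule tendsto_upperbound[OF tendsto_norm[OF lim]])
        show "\<forall>\<^sub>F z in at v. cmod (f z) \<le> 1"
          using ev
        proof eventually_elim
          case (elim z)
          have "cmod (\<theta> z) = cmod (blaschke_product \<theta> z) * cmod (f z)" "blaschke_product \<theta> z \<noteq> 0"
            using f(2)[of z] elim by (auto simp: norm_mult)
          then show ?case
            using norm_le_blaschke_product[of z] elim r by (simp add: mult_le_cancel_left1)
        qed
      qed auto
      ultimately show ?thesis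
        by simp
    qed
    then show ?thesis
      using f by (intro exI[of _ f]) auto
  qed
  have "\<exists>r. 0 < r \<and> r < 1 \<and> cmod z < r" if "cmod z < 1" for z :: complex
    using that by (intro exI[of _ "(1 + cmod z) / 2"]) (auto intro: add_pos_nonneg)
  moreover have "s field_differentiable at z" if r: "0 < r" "r < 1" "cmod z < r" for z r
  proof -
    obtain f where "f holomorphic_on ball 0 r" "\<And>z. z \<in> ball 0 r \<Longrightarrow> f z = s z"
      using local[OF r(1,2)] by auto
    then have "s holomorphic_on ball 0 r"
      using holomorphic_transform by blast
    then show ?thesis
      using r by (intro holomorphic_on_imp_differentiable_at[of _ "ball 0 r"]) auto
  qed
  ultimately have "s holomorphic_on unit_disc"
    by (metis holomorphic_onI field_differentiable_at_within mem_ball_0)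
  moreover have "s z \<noteq> 0 \<and> cmod (s z) \<le> 1 \<and> \<theta> z = blaschke_product \<theta> z * s z" if "cmod z < 1" for z
    using local[of "(1 + cmod z) / 2"] that by (auto simp: field_simps add_pos_nonneg)
  ultimately show ?thesis
    by (intro exI[of _ s]) auto
qed

end

subsection \<open>Poisson integrals\<close>

abbreviation poisson_integral :: "complex measure \<Rightarrow> complex \<Rightarrow> real" where
  "poisson_integral \<mu> z \<equiv> LINT \<xi>|\<mu>. (1 - (cmod z)\<^sup>2) / (cmod (\<xi> - z))\<^sup>2"

lemma Re_herglotz_kernel:
  assumes "cmod \<xi> = 1" "cmod z < 1"
  shows "Re ((\<xi> + z) / (\<xi> - z)) = (1 - (cmod z)\<^sup>2) / (cmod (\<xi> - z))\<^sup>2"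
proof -
  have "Re ((\<xi> + z) / (\<xi> - z)) = Re ((\<xi> + z) * cnj (\<xi> - z)) / (cmod (\<xi> - z))\<^sup>2"
    by (metis Re_complex_div_gt_0 Re_divide_of_real complex_div_cnj)
  also have "Re ((\<xi> + z) * cnj (\<xi> - z)) = (cmod \<xi>)\<^sup>2 - (cmod z)\<^sup>2"
    unfolding cmod_power2 by (simp add: power2_eq_square algebra_simps)
  finally show ?thesis
    using assms by simp
qed

lemma continuous_on_herglotz_kernel:
  assumes "cmod z < 1"
  shows "continuous_on unit_circle (\<lambda>\<xi>. (\<xi> + z) / (\<xi> - z))"
  using circle_denominator_nonzero[OF _ assms] by (intro continuous_intros) auto

lemma continuous_on_poisson_kernel:
  assumes "cmod z < 1"
  shows "continuous_on unit_circle (\<lambda>\<xi>. (1 - (cmod z)\<^sup>2) / (cmod (\<xi> - z))\<^sup>2)"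
  using circle_denominator_nonzero[OF _ assms] by (intro continuous_intros) auto

lemma (in circle_measure) Re_herglotz_integral:
  assumes "cmod z < 1"
  shows "Re (LINT \<xi>|\<mu>. (\<xi> + z) / (\<xi> - z)) = poisson_integral \<mu> z"
proof -
  have "Re (LINT \<xi>|\<mu>. (\<xi> + z) / (\<xi> - z)) = (LINT \<xi>|\<mu>. Re ((\<xi> + z) / (\<xi> - z)))"
    by (rule integral_Re[symmetric]) (rule integrable_continuous_on_circle[OF continuous_on_herglotz_kernel[OF assms]])
  also have "\<dots> = poisson_integral \<mu> z"
    by (intro Bochner_Integration.integral_cong refl Re_herglotz_kernel) (use assms in auto)
  finally show ?thesis .
qed

lemma (in circle_measure) herglotz_integral_holomorphic:
  "(\<lambda>z. LINT \<xi>|\<mu>. (\<xi> + z) / (\<xi> - z)) holomorphic_on unit_disc"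
proof (rule holomorphic_transform)
  show "(\<lambda>z. 2 * (LINT \<xi>|\<mu>. 1 / (1 - cnj \<xi> * z)) - of_real (measure \<mu> unit_circle)) holomorphic_on unit_disc"
    by (intro holomorphic_intros cauchy_transform_holomorphic)
qed (simp add: herglotz_integral_eq)

lemma (in circle_measure) poisson_integral_circular_mean:
  assumes r: "0 \<le> r" "r < 1"
  shows "(LINT x|circle_lebesgue. poisson_integral \<mu> (of_real r * x)) =
    measure \<mu> unit_circle"
proof -
  let ?G = "\<lambda>z. LINT \<xi>|\<mu>. (\<xi> + z) / (\<xi> - z)"
  have "(LINT x|circle_lebesgue. poisson_integral \<mu> (of_real r * x)) =
      (LINT x|circle_lebesgue. Re (of_real (Re (?G (of_real r * x))) * cnj x ^ 0))"
    by (intro Bochner_Integration.integral_cong) (use r in \<open>auto simp: Re_herglotz_integral norm_mult\<close>)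
  also have "\<dots> = Re (LINT x|circle_lebesgue. of_real (Re (?G (of_real r * x))) * cnj x ^ 0)"
    by (intro integral_Re lebesgue.integrable_continuous_on_circle continuous_intros
        dilate_holomorphic_continuous_on_circle[OF herglotz_integral_holomorphic r])
  also have "\<dots> = Re (?G 0)"
    unfolding circle_moment_Re[OF herglotz_integral_holomorphic r] by simp
  also have "\<dots> = measure \<mu> unit_circle"
    using herglotz_integral_eq[of 0] by (simp add: scaleR_conv_of_real del: div_self)
  finally show ?thesis .
qed

lemma poisson_integral_lebesgue:
  assumes z: "cmod z < 1"
  shows "poisson_integral circle_lebesgue z = 1"
proof -
  have "(\<lambda>n. z ^ n * (LINT \<xi>|circle_lebesgue. cnj \<xi> ^ n)) sums (LINT \<xi>|circle_lebesgue. 1 / (1 - cnj \<xi> * z))"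
    by (rule lebesgue.cauchy_transform_sums[OF z])
  moreover have "(LINT \<xi>|circle_lebesgue. cnj \<xi> ^ n) = (if n = 0 then 1 else 0)" for n
    using integral_circle_monomials[of 0 n] by auto
  ultimately have "(\<lambda>n. if n = 0 then z ^ n else 0) sums (LINT \<xi>|circle_lebesgue. 1 / (1 - cnj \<xi> * z))"
    by (simp add: if_distrib cong: if_cong)
  then have "(LINT \<xi>|circle_lebesgue. 1 / (1 - cnj \<xi> * z)) = z ^ 0"
    by (rule sums_unique2) (rule sums_single)
  then show ?thesis
    unfolding lebesgue.Re_herglotz_integral[OF z, symmetric] lebesgue.herglotz_integral_eq[OF z] by simp
qed

lemma integral_mono_of_measure_le:
  assumes \<mu>: "circle_measure \<mu>" and \<nu>: "circle_measure \<nu>" and k: "0 \<le> k"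
    and le: "\<And>A. A \<in> sets circle_borel \<Longrightarrow> emeasure \<mu> A \<le> ennreal k * emeasure \<nu> A"
    and f: "continuous_on unit_circle f" "\<And>x. x \<in> unit_circle \<Longrightarrow> 0 \<le> f x"
  shows "(LINT x|\<mu>. f x) \<le> k * (LINT x|\<nu>. f x)"
proof -
  interpret \<mu>: circle_measure \<mu> by fact
  interpret \<nu>: circle_measure \<nu> by fact
  have ae: "AE x in \<mu>. 0 \<le> f x" "AE x in \<nu>. 0 \<le> f x"
    by (rule AE_I2, use f(2) in simp)+
  have le': "\<mu> \<le> scale_measure (ennreal k) \<nu>"
    by (subst le_measure) (auto intro: le)
  have "ennreal (LINT x|\<mu>. f x) = (\<integral>\<^sup>+x. ennreal (f x) \<partial>\<mu>)"
    by (rule nn_integral_eq_integral[symmetric, OF \<mu>.integrable_continuous_on_circle[OF f(1)] ae(1)])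
  also have "\<dots> \<le> (\<integral>\<^sup>+x. ennreal (f x) \<partial>scale_measure (ennreal k) \<nu>)"
    by (rule nn_integral_mono_measure[OF _ le']) simp
  also have "\<dots> = ennreal k * (\<integral>\<^sup>+x. ennreal (f x) \<partial>\<nu>)"
    using \<nu>.measurable_continuous_on_circle[OF f(1)]
    by (intro nn_integral_scale_measure measurable_compose[OF _ measurable_ennreal])
  also have "(\<integral>\<^sup>+x. ennreal (f x) \<partial>\<nu>) = ennreal (LINT x|\<nu>. f x)"
    by (rule nn_integral_eq_integral[OF \<nu>.integrable_continuous_on_circle[OF f(1)] ae(2)])
  also have "ennreal k * \<dots> = ennreal (k * (LINT x|\<nu>. f x))"
    using k ae by (simp add: ennreal_mult integral_nonneg_AE)
  finally show ?thesis
    using k ae by (simp add: integral_nonneg_AE)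
qed

text \<open>The restriction of \<open>\<mu>\<close> to \<open>Y\<close> is below a multiple of Lebesgue measure, so its Poisson integral is
  bounded. The radial limits being zero, dominated convergence sends the circular means to zero;
  but every circular mean is the total mass.\<close>

lemma (in circle_measure) poisson_limit_null_set:
  assumes lim: "AE x in circle_lebesgue.
      ((\<lambda>r. poisson_integral \<mu> (of_real r * x)) \<longlongrightarrow> 0) (at_left (1::real))"
    and Y: "Y \<in> sets circle_borel" and k: "0 \<le> k"
    and le: "\<And>A. A \<in> sets circle_borel \<Longrightarrow> A \<subseteq> Y \<Longrightarrow> emeasure \<mu> A \<le> ennreal k * emeasure circle_lebesgue A"
  shows "emeasure \<mu> Y = 0"
proof -
  define \<mu>' where "\<mu>' = density \<mu> (indicator Y)"
  have Y' [measurable]: "Y \<in> sets \<mu>"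
    using Y by simp
  have em: "emeasure \<mu>' A = emeasure \<mu> (A \<inter> Y)" if "A \<in> sets circle_borel" for A
    using that Y by (simp add: \<mu>'_def emeasure_restricted Int_commute)
  have "circle_measure \<mu>'"
  proof (rule circle_measureI)
    have "emeasure \<mu>' (space \<mu>') = emeasure \<mu> (unit_circle \<inter> Y)"
      using em[of unit_circle] sets.top[of \<mu>] by (simp add: \<mu>'_def)
    then show "finite_measure \<mu>'"
      by (intro finite_measureI) simp
  qed (simp add: \<mu>'_def)
  then interpret \<mu>': circle_measure \<mu>' .
  have nonneg: "0 \<le> (1 - (cmod z)\<^sup>2) / (cmod (\<xi> - z))\<^sup>2" if "cmod z < 1" for z \<xi>
    using that by (intro divide_nonneg_nonneg) (auto simp: power_le_one)
  have P0: "0 \<le> poisson_integral \<mu>' z" if "cmod z < 1" for z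
    using nonneg[OF that] by (intro integral_nonneg_AE AE_I2)
  have P1: "poisson_integral \<mu>' z \<le> poisson_integral \<mu> z" if "cmod z < 1" for z
  proof -
    have "poisson_integral \<mu>' z \<le> 1 * poisson_integral \<mu> z"
    proof (rule integral_mono_of_measure_le)
      show "emeasure \<mu>' A \<le> ennreal 1 * emeasure \<mu> A" if "A \<in> sets circle_borel" for A
        using em[OF that] that by (simp add: emeasure_mono)
    qed (use that nonneg continuous_on_poisson_kernel[OF that] in \<open>auto intro: \<mu>'.circle_measure_axioms circle_measure_axioms\<close>)
    then show ?thesis by simp
  qed
  have Pk: "poisson_integral \<mu>' z \<le> k" if "cmod z < 1" for z
  proof -
    have "poisson_integral \<mu>' z \<le> k * poisson_integral circle_lebesgue z"
    proof (rule integral_mono_of_measure_le)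
      show "emeasure \<mu>' A \<le> ennreal k * emeasure circle_lebesgue A" if "A \<in> sets circle_borel" for A
      proof -
        have "emeasure \<mu>' A \<le> ennreal k * emeasure circle_lebesgue (A \<inter> Y)"
          using em[OF that] le[of "A \<inter> Y"] that Y by auto
        also have "\<dots> \<le> ennreal k * emeasure circle_lebesgue A"
          using that by (intro mult_left_mono emeasure_mono) auto
        finally show ?thesis .
      qed
    qed (use that nonneg k continuous_on_poisson_kernel[OF that] in \<open>auto intro: \<mu>'.circle_measure_axioms lebesgue.circle_measure_axioms\<close>)
    then show ?thesis
      using poisson_integral_lebesgue[OF that] by simp
  qed
  define r where "r n = 1 - inverse (real (Suc n))" for n
  have r: "0 \<le> r n" "r n < 1" for n
    by (auto simp: r_def field_simps)
  have r_lim: "r \<longlonglongrightarrow> 1"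
    unfolding r_def using tendsto_diff[OF tendsto_const LIMSEQ_inverse_real_of_nat] by simp
  moreover have "r n < 1 \<and> r n \<noteq> 1" for n
    using r(2)[of n] by simp
  ultimately have r_left: "filterlim r (at_left 1) sequentially"
    by (simp add: filterlim_at)
  have disc: "cmod (of_real (r n) * x) < 1" if "x \<in> unit_circle" for x n
    using that r[of n] by (simp add: norm_mult)
  have meas: "(\<lambda>x. poisson_integral \<mu>' (of_real (r n) * x)) \<in> borel_measurable circle_lebesgue" for n
  proof (rule lebesgue.measurable_continuous_on_circle)
    have "continuous_on unit_circle (\<lambda>x. Re (LINT \<xi>|\<mu>'. (\<xi> + of_real (r n) * x) / (\<xi> - of_real (r n) * x)))"
      by (intro continuous_intros dilate_holomorphic_continuous_on_circle[OF \<mu>'.herglotz_integral_holomorphic r])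
    then show "continuous_on unit_circle (\<lambda>x. poisson_integral \<mu>' (of_real (r n) * x))"
      by (rule continuous_on_eq) (use disc in \<open>auto simp: \<mu>'.Re_herglotz_integral\<close>)
  qed
  have "(\<lambda>n. LINT x|circle_lebesgue. poisson_integral \<mu>' (of_real (r n) * x)) \<longlonglongrightarrow> (LINT x|circle_lebesgue. 0)"
  proof (rule integral_dominated_convergence[where w = "\<lambda>_. k"])
    show "AE x in circle_lebesgue. (\<lambda>n. poisson_integral \<mu>' (of_real (r n) * x)) \<longlonglongrightarrow> 0"
      using lim AE_space
    proof eventually_elim
      case (elim x)
      then have x: "x \<in> unit_circle" by simp
      have "(\<lambda>n. poisson_integral \<mu> (of_real (r n) * x)) \<longlonglongrightarrow> 0"
        using filterlim_compose[OF elim(1) r_left] .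
      then show ?case
        by (rule tendsto_sandwich[OF _ _ tendsto_const, rotated 2])
          (use P0 P1 disc[OF x] in \<open>auto intro!: always_eventually\<close>)
    qed
    show "AE x in circle_lebesgue. norm (poisson_integral \<mu>' (of_real (r n) * x)) \<le> k" for n
      by (rule AE_I2) (use P0 Pk disc in auto)
  qed (use meas in auto)
  then have "measure \<mu>' unit_circle = 0"
    by (simp add: \<mu>'.poisson_integral_circular_mean[OF r] LIMSEQ_const_iff)
  then have "emeasure \<mu>' unit_circle = 0"
    by (simp add: \<mu>'.emeasure_eq_measure)
  moreover have "unit_circle \<inter> Y = Y"
    using sets.sets_into_space[OF Y'] by auto
  ultimately show ?thesis
    using em[of unit_circle] sets.top[of \<mu>] by simp
qed

text \<open>For each \<open>k\<close>, a Hahn decomposition yields a set on which \<open>\<mu> \<le> k m\<close>, where \<open>m\<close> is Lebesgue measure, and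
  off which \<open>k m \<le> \<mu>\<close>. The former is a null set of \<open>\<mu>\<close>, the complement has a Lebesgue measure of at
  most the total mass of \<open>\<mu>\<close> divided by \<open>k\<close>. The intersection of the complements
  carries \<open>\<mu>\<close> and is a Lebesgue null set.\<close>

lemma (in circle_measure) singular_of_poisson_radial_limit:
  assumes lim: "AE x in circle_lebesgue.
      ((\<lambda>r. poisson_integral \<mu> (of_real r * x)) \<longlongrightarrow> 0) (at_left (1::real))"
  shows "singular_circle_measure \<mu>"
proof -
  have "\<exists>Y. Y \<in> sets circle_borel \<and> emeasure \<mu> Y = 0 \<and>
      measure circle_lebesgue (unit_circle - Y) \<le> measure \<mu> unit_circle / real (Suc k)" for k
  proof -
    let ?M = "scale_measure (ennreal (Suc k)) circle_lebesgue"
    have "\<exists>Y\<in>sets ?M. (\<forall>X\<in>sets ?M. X \<subseteq> Y \<longrightarrow> emeasure \<mu> X \<le> emeasure ?M X) \<and>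
        (\<forall>X\<in>sets ?M. X \<inter> Y = {} \<longrightarrow> emeasure ?M X \<le> emeasure \<mu> X)"
      by (rule finite_unsigned_Hahn_decomposition)
        (auto intro!: finite_measureI finite_measure_axioms simp: space_scale_measure lebesgue.emeasure_eq_measure
          ennreal_mult_eq_top_iff)
    then obtain Y where Y: "Y \<in> sets circle_borel"
      "\<And>X. X \<in> sets circle_borel \<Longrightarrow> X \<subseteq> Y \<Longrightarrow> emeasure \<mu> X \<le> ennreal (Suc k) * emeasure circle_lebesgue X"
      "\<And>X. X \<in> sets circle_borel \<Longrightarrow> X \<inter> Y = {} \<Longrightarrow> ennreal (Suc k) * emeasure circle_lebesgue X \<le> emeasure \<mu> X"
      by auto
    have "emeasure \<mu> Y = 0"
      by (rule poisson_limit_null_set[OF lim Y(1) _ Y(2)]) auto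
    moreover have "measure circle_lebesgue (unit_circle - Y) \<le> measure \<mu> unit_circle / real (Suc k)"
    proof -
      have m: "unit_circle - Y \<in> sets circle_borel"
        using sets.compl_sets[of Y \<mu>] Y(1) by simp
      have "ennreal (Suc k) * emeasure circle_lebesgue (unit_circle - Y) \<le> emeasure \<mu> (unit_circle - Y)"
        using Y(3)[OF m] by auto
      also have "\<dots> \<le> emeasure \<mu> unit_circle"
        using sets.top[of \<mu>] by (intro emeasure_mono) auto
      finally have "real (Suc k) * measure circle_lebesgue (unit_circle - Y) \<le> measure \<mu> unit_circle"
        by (simp add: emeasure_eq_measure lebesgue.emeasure_eq_measure ennreal_mult[symmetric] del: of_nat_Suc)
      then show ?thesis
        by (simp add: field_simps)
    qed
    ultimately show ?thesis
      using Y(1) by blast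
  qed
  then obtain Y where Y: "\<And>k. Y k \<in> sets circle_borel" "\<And>k. emeasure \<mu> (Y k) = 0"
    "\<And>k. measure circle_lebesgue (unit_circle - Y k) \<le> measure \<mu> unit_circle / real (Suc k)"
    by metis
  define N where "N = (\<Inter>k. unit_circle - Y k)"
  have top: "unit_circle \<in> sets circle_borel"
    using sets.top[of \<mu>] by simp
  have N: "N \<in> sets circle_borel"
    unfolding N_def using Y(1) top by (intro sets.countable_INT) auto
  have "measure circle_lebesgue N \<le> measure \<mu> unit_circle * inverse (real (Suc k))" for k
  proof -
    have "measure circle_lebesgue N \<le> measure circle_lebesgue (unit_circle - Y k)"
      using Y(1) top by (intro lebesgue.finite_measure_mono) (auto simp: N_def)
    then show ?thesis
      using order_trans[OF _ Y(3)[of k]] by (simp add: divide_inverse)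
  qed
  moreover have "(\<lambda>k. measure \<mu> unit_circle * inverse (real (Suc k))) \<longlonglongrightarrow> measure \<mu> unit_circle * 0"
    by (intro tendsto_intros LIMSEQ_inverse_real_of_nat)
  ultimately have "measure circle_lebesgue N \<le> measure \<mu> unit_circle * 0"
    by (intro LIMSEQ_le_const) auto
  then have "emeasure circle_lebesgue N = 0"
    by (simp add: lebesgue.emeasure_eq_measure measure_le_0_iff)
  moreover have "emeasure \<mu> (unit_circle - N) = 0"
  proof -
    have "unit_circle - N \<subseteq> (\<Union>k. Y k)"
      by (auto simp: N_def)
    moreover have "emeasure \<mu> (\<Union>k. Y k) = 0"
      using Y(1,2) by (intro emeasure_UN_eq_0) auto
    moreover have "(\<Union>k. Y k) \<in> sets \<mu>"
      using Y(1) by auto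
    ultimately show ?thesis
      by (metis emeasure_eq_0)
  qed
  ultimately show ?thesis
    unfolding singular_circle_measure_def using N finite_measure_axioms by auto
qed


subsection \<open>The canonical factorization of an inner function\<close>

lemma (in circle_measure) norm_singular_inner:
  assumes "cmod z < 1"
  shows "cmod (singular_inner \<mu> z) = exp (- poisson_integral \<mu> z)"
  unfolding singular_inner_def using Re_herglotz_integral[OF assms] by simp

text \<open>The quotient \<open>s\<close> by the Blaschke product has a logarithm with nonpositive real part, whose negative
  is a Herglotz integral. Its measure is singular because \<open>|\<theta>| \<le> |s| \<le> 1\<close> forces \<open>|s|\<close> to have the radial
  limit \<open>1\<close> almost everywhere, so that the Poisson integral \<open>- ln |s|\<close> has the limit \<open>0\<close>.\<close>

proposition inner_function_factorization:
  assumes inner: "inner_function \<theta>" and nz: "\<exists>u\<in>unit_disc. \<theta> u \<noteq> 0"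
  shows "\<exists>\<nu>. circle_measure \<nu> \<and> generates_singular_factor \<nu> \<theta>"
proof -
  interpret disc_self_map \<theta>
    using inner nz by unfold_locales (auto simp: inner_function_def)
  obtain s where s: "s holomorphic_on unit_disc"
    "\<And>z. z \<in> unit_disc \<Longrightarrow> s z \<noteq> 0 \<and> cmod (s z) \<le> 1 \<and> \<theta> z = blaschke_product \<theta> z * s z"
    using blaschke_factorization by auto
  obtain g where g: "g holomorphic_on unit_disc" "\<And>z. z \<in> unit_disc \<Longrightarrow> s z = exp (g z)"
    using contractible_imp_holomorphic_log[OF s(1)] s(2) by (auto simp: convex_imp_contractible)
  have "0 \<le> Re (- g z)" if "cmod z < 1" for z
    using s(2)[of z] g(2)[of z] that by simp
  from herglotz_representation[of "\<lambda>z. - g z", OF holomorphic_on_minus[OF g(1)] this] obtain \<nu> where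
    \<nu>: "circle_measure \<nu>"
    and rep: "\<And>z. cmod z < 1 \<Longrightarrow> - g z = (LINT \<xi>|\<nu>. (\<xi> + z) / (\<xi> - z)) + \<i> * of_real (Im (- g 0))"
    by auto
  interpret \<nu>: circle_measure \<nu> by fact
  define c where "c = exp (\<i> * of_real (Im (g 0)))"
  have c: "cmod c = 1"
    by (simp add: c_def)
  have s_eq: "s z = c * singular_inner \<nu> z" if "cmod z < 1" for z
  proof -
    have "g z = - (LINT \<xi>|\<nu>. (\<xi> + z) / (\<xi> - z)) + \<i> * of_real (Im (g 0))"
      using arg_cong[OF rep[OF that], of uminus] by simp
    then show ?thesis
      using g(2)[of z] that by (simp add: c_def singular_inner_def exp_add[symmetric] add.commute)
  qed
  have P: "poisson_integral \<nu> z = - ln (cmod (s z))" if "cmod z < 1" for z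
    using \<nu>.norm_singular_inner[OF that] c by (simp add: s_eq[OF that] norm_mult)
  have "AE \<xi> in circle_lebesgue. \<exists>l. cmod l = 1 \<and> ((\<lambda>r::real. \<theta> (of_real r * \<xi>)) \<longlongrightarrow> l) (at_left 1)"
    using inner by (simp add: inner_function_def)
  then have "AE x in circle_lebesgue. ((\<lambda>r. poisson_integral \<nu> (of_real r * x)) \<longlongrightarrow> 0) (at_left (1::real))"
    using AE_space
  proof eventually_elim
    case (elim x)
    then obtain l where l: "cmod l = 1" "((\<lambda>r::real. \<theta> (of_real r * x)) \<longlongrightarrow> l) (at_left 1)"
      by auto
    have x: "cmod x = 1"
      using elim by simp
    note ev = eventually_radius_less_1
    have "((\<lambda>r. cmod (s (of_real r * x))) \<longlongrightarrow> 1) (at_left (1::real))"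
    proof (rule tendsto_sandwich)
      show "((\<lambda>r. cmod (\<theta> (of_real r * x))) \<longlongrightarrow> 1) (at_left (1::real))"
        using tendsto_norm[OF l(2)] l(1) by simp
      show "\<forall>\<^sub>F r in at_left (1::real). cmod (s (of_real r * x)) \<le> 1"
        using ev by eventually_elim (use s(2) x in \<open>auto simp: norm_mult\<close>)
      show "\<forall>\<^sub>F r in at_left (1::real). cmod (\<theta> (of_real r * x)) \<le> cmod (s (of_real r * x))"
        using ev
      proof eventually_elim
        case (elim r)
        then have d: "of_real r * x \<in> unit_disc"
          using x by (simp add: norm_mult)
        have "cmod (blaschke_product \<theta> (of_real r * x)) \<le> 1"
          using blaschke_product_le_partial[of _ "{}"] d by simp
        then show ?case
          using s(2)[OF d] by (simp add: norm_mult mult_left_le_one_le)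
      qed
    qed simp
    then have "((\<lambda>r. - ln (cmod (s (of_real r * x)))) \<longlongrightarrow> - ln 1) (at_left (1::real))"
      by (intro tendsto_intros) auto
    then have "((\<lambda>r. - ln (cmod (s (of_real r * x)))) \<longlongrightarrow> 0) (at_left (1::real))"
      by simp
    then show ?case
      by (rule Lim_transform_eventually)
        (use ev in eventually_elim, rule P[symmetric], use x in \<open>simp add: norm_mult\<close>)
  qed
  then have "singular_circle_measure \<nu>"
    by (rule \<nu>.singular_of_poisson_radial_limit)
  then have "generates_singular_factor \<nu> \<theta>"
    unfolding generates_singular_factor_def using c s(2) s_eq
    by (intro conjI exI[of _ c]) (auto simp: mult_ac)
  with \<nu> show ?thesis
    by blast
qed

text \<open>The logarithm of \<open>|\<theta>(z)|\<^sup>2\<close> is the sum of the logarithms of its factors. A Blaschke factor with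
  squared modulus \<open>x\<close> contributes \<open>- ln x \<ge> 1 - x\<close>, the singular factor contributes exactly twice the
  Poisson integral of \<open>\<nu>\<close>.\<close>

lemma (in disc_self_map) zeros_and_singular_mass_le:
  assumes \<nu>: "circle_measure \<nu>" "generates_singular_factor \<nu> \<theta>"
    and z: "cmod z < 1" "\<theta> z \<noteq> 0" and F: "finite F" "F \<subseteq> disc_zeros \<theta>"
  shows "(1 - (cmod z)\<^sup>2) * ((\<Sum>(w, k)\<in>F. (1 - (cmod w)\<^sup>2) / (cmod (1 - cnj w * z))\<^sup>2) +
      2 * (LINT \<xi>|\<nu>. 1 / (cmod (\<xi> - z))\<^sup>2)) \<le> - ln ((cmod (\<theta> z))\<^sup>2)"
proof -
  interpret \<nu>: circle_measure \<nu> by fact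
  obtain c where c: "cmod c = 1" "\<theta> z = c * blaschke_product \<theta> z * singular_inner \<nu> z"
    using \<nu>(2) z(1) unfolding generates_singular_factor_def by auto
  let ?I = "LINT \<xi>|\<nu>. 1 / (cmod (\<xi> - z))\<^sup>2"
  let ?b = "\<lambda>(w, k::nat). (cmod (blaschke_factor w z))\<^sup>2"
  have "poisson_integral \<nu> z = (LINT \<xi>|\<nu>. (1 - (cmod z)\<^sup>2) * (1 / (cmod (\<xi> - z))\<^sup>2))"
    by simp
  also have "\<dots> = (1 - (cmod z)\<^sup>2) * ?I"
    by (rule integral_mult_right_zero)
  finally have si: "cmod (singular_inner \<nu> z) = exp (- ((1 - (cmod z)\<^sup>2) * ?I))"
    using \<nu>.norm_singular_inner[OF z(1)] by simp
  have B: "0 < cmod (blaschke_product \<theta> z)"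
    using c z(2) by auto
  then have PF: "0 < cmod (partial_blaschke F z)"
    using blaschke_product_le_partial[OF z(1) F] by linarith
  have pos: "0 < ?b x" if "x \<in> F" for x
    using PF F that by (auto simp: case_prod_unfold prod_zero_iff)
  have "(\<Sum>(w, k)\<in>F. (1 - (cmod z)\<^sup>2) * ((1 - (cmod w)\<^sup>2) / (cmod (1 - cnj w * z))\<^sup>2)) = (\<Sum>x\<in>F. 1 - ?b x)"
  proof (rule sum.cong[OF refl])
    fix x assume "x \<in> F"
    moreover obtain w k where x: "x = (w, k)" by (cases x)
    ultimately have "cmod w < 1"
      using F(2) by (auto dest: disc_zerosD)
    then show "(case x of (w, k) \<Rightarrow> (1 - (cmod z)\<^sup>2) * ((1 - (cmod w)\<^sup>2) / (cmod (1 - cnj w * z))\<^sup>2)) = 1 - ?b x"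
      using one_minus_blaschke_factor_norm[of w z] z(1) x by simp
  qed
  also have "\<dots> \<le> - ln (\<Prod>x\<in>F. ?b x)"
    by (rule sum_one_minus_le_neg_ln_prod[OF F(1) pos])
  also have "(\<Prod>x\<in>F. ?b x) = (cmod (partial_blaschke F z))\<^sup>2"
    by (simp add: prod_norm[symmetric] prod_power_distrib case_prod_unfold)
  also have "- ln ((cmod (partial_blaschke F z))\<^sup>2) \<le> - ln ((cmod (blaschke_product \<theta> z))\<^sup>2)"
    using B PF blaschke_product_le_partial[OF z(1) F] by (simp add: power_mono)
  finally have "(\<Sum>(w, k)\<in>F. (1 - (cmod z)\<^sup>2) * ((1 - (cmod w)\<^sup>2) / (cmod (1 - cnj w * z))\<^sup>2)) \<le> - 2 * ln (cmod (blaschke_product \<theta> z))"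
    using B by (simp add: ln_realpow)
  moreover have "- ln ((cmod (\<theta> z))\<^sup>2) = - 2 * ln (cmod (blaschke_product \<theta> z)) + 2 * ((1 - (cmod z)\<^sup>2) * ?I)"
    using z(2) B by (simp add: ln_realpow c norm_mult ln_mult si)
  ultimately show ?thesis
    by (simp add: distrib_left sum_distrib_left case_prod_unfold)
qed

section \<open>Exponential decay forces the moment conditions\<close>

subsection \<open>Smallness of the Poisson integral\<close>

lemma exp_partial_sum_le:
  fixes y :: real
  assumes "0 \<le> y"
  shows "(\<Sum>i<n. y ^ i / fact i) \<le> exp y"
proof -
  have s: "(\<lambda>n. y ^ n / fact n) sums exp y"
    using exp_converges[of y] by (simp add: divide_inverse mult.commute)
  have "(\<Sum>i<n. y ^ i / fact i) \<le> (\<Sum>i. y ^ i / fact i)"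
    by (rule sum_le_suminf) (use s assms in \<open>auto simp: sums_iff\<close>)
  then show ?thesis
    using s by (simp add: sums_iff)
qed

lemma power_div_fact_le_exp:
  fixes x :: real
  assumes "0 \<le> x"
  shows "x ^ n / fact n \<le> exp x"
proof -
  have "x ^ n / fact n \<le> (\<Sum>i<Suc n. x ^ i / fact i)"
    using assms by (simp add: sum_nonneg)
  also note exp_partial_sum_le[OF assms]
  finally show ?thesis .
qed

locale exponential_clark =
  fixes \<theta> :: "complex \<Rightarrow> complex" and \<zeta> \<alpha> :: complex and \<sigma> :: "complex measure" and \<epsilon> :: real
  assumes inner: "inner_function \<theta>" and nonconstant: "\<not> \<theta> constant_on unit_disc"
    and zeta: "\<zeta> \<in> unit_circle" and alpha: "\<alpha> \<in> unit_circle" and clark: "clark_measure \<theta> \<alpha> \<sigma>"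
    and eps: "\<epsilon> > 0"
    and exp_finite: "(\<integral>\<^sup>+\<eta>. (if \<eta> = \<zeta> then \<infinity> else ennreal (exp (\<epsilon> / cmod (\<eta> - \<zeta>)))) \<partial>\<sigma>) < \<infinity>"

sublocale exponential_clark \<subseteq> \<sigma>: circle_measure \<sigma>
  using clark by (intro circle_measureI) (auto simp: clark_measure_def singular_circle_measure_def)

sublocale exponential_clark \<subseteq> disc_self_map \<theta>
proof
  show "\<exists>u\<in>unit_disc. \<theta> u \<noteq> 0"
    using nonconstant unfolding constant_on_def by metis
qed (use inner in \<open>auto simp: inner_function_def\<close>)

context exponential_clark
begin

definition E :: "complex \<Rightarrow> real" where
  "E \<eta> = exp (\<epsilon> / cmod (\<eta> - \<zeta>))"

lemma E_measurable [measurable]: "E \<in> borel_measurable \<sigma>"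
  unfolding E_def[abs_def] by (rule \<sigma>.measurable_circle) measurable

lemma singleton_sets: "x \<in> unit_circle \<Longrightarrow> {x} \<in> sets circle_borel"
  unfolding circle_borel_def by (subst sets_restrict_space_iff) auto

lemma no_atom: "emeasure \<sigma> {\<zeta>} = 0"
proof -
  have "\<infinity> * emeasure \<sigma> {\<zeta>} = (\<integral>\<^sup>+\<eta>. \<infinity> * indicator {\<zeta>} \<eta> \<partial>\<sigma>)"
    using singleton_sets[OF zeta] by (subst nn_integral_cmult_indicator) auto
  also have "\<dots> \<le> (\<integral>\<^sup>+\<eta>. (if \<eta> = \<zeta> then \<infinity> else ennreal (exp (\<epsilon> / cmod (\<eta> - \<zeta>)))) \<partial>\<sigma>)"
    by (intro nn_integral_mono) (auto simp: indicator_def)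
  finally show ?thesis
    using exp_finite by (auto simp: ennreal_top_mult split: if_splits)
qed

lemma AE_neq_zeta: "AE \<eta> in \<sigma>. \<eta> \<noteq> \<zeta>"
  using no_atom singleton_sets[OF zeta] by (intro AE_I[of _ _ "{\<zeta>}"]) auto

lemma E_integrable: "integrable \<sigma> E"
proof (rule integrableI_nonneg)
  have "(\<integral>\<^sup>+\<eta>. ennreal (E \<eta>) \<partial>\<sigma>) \<le>
      (\<integral>\<^sup>+\<eta>. (if \<eta> = \<zeta> then \<infinity> else ennreal (exp (\<epsilon> / cmod (\<eta> - \<zeta>)))) \<partial>\<sigma>)"
    by (intro nn_integral_mono) (auto simp: E_def)
  then show "(\<integral>\<^sup>+\<eta>. ennreal (E \<eta>) \<partial>\<sigma>) < \<infinity>"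
    using exp_finite by (rule order.strict_trans1)
qed (auto simp: E_def)

lemma power_le_E:
  assumes "\<eta> \<noteq> \<zeta>"
  shows "(1 / cmod (\<eta> - \<zeta>)) ^ n \<le> fact n / \<epsilon> ^ n * E \<eta>"
proof -
  have "(\<epsilon> / cmod (\<eta> - \<zeta>)) ^ n / fact n \<le> exp (\<epsilon> / cmod (\<eta> - \<zeta>))"
    by (rule power_div_fact_le_exp) (use eps in auto)
  then have "(\<epsilon> / cmod (\<eta> - \<zeta>)) ^ n \<le> fact n * E \<eta>"
    by (simp add: E_def divide_le_eq mult.commute)
  then have "(\<epsilon> / cmod (\<eta> - \<zeta>)) ^ n / \<epsilon> ^ n \<le> fact n * E \<eta> / \<epsilon> ^ n"
    using eps by (intro divide_right_mono) auto
  moreover have "(\<epsilon> / cmod (\<eta> - \<zeta>)) ^ n / \<epsilon> ^ n = (1 / cmod (\<eta> - \<zeta>)) ^ n"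
    using eps by (simp add: power_divide)
  ultimately show ?thesis
    by simp
qed

lemma Re_clark_function:
  assumes z: "cmod z < 1"
  shows "Re ((\<alpha> + \<theta> z) / (\<alpha> - \<theta> z)) = poisson_integral \<sigma> z"
proof -
  have "(LINT \<xi>|\<sigma>. Re ((1 + cnj \<xi> * z) / (1 - cnj \<xi> * z))) = poisson_integral \<sigma> z"
    by (intro Bochner_Integration.integral_cong)
      (use z in \<open>auto simp: herglotz_kernel_eq(2) Re_herglotz_kernel simp del: Re_divide\<close>)
  then show ?thesis
    using clark z by (simp add: clark_measure_def)
qed

lemma poisson_integral_nonneg:
  assumes "cmod z < 1"
  shows "0 \<le> poisson_integral \<sigma> z"
  using assms by (intro integral_nonneg_AE AE_I2 divide_nonneg_nonneg) (auto simp: power_le_one)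

text \<open>The real part of the Cayley transform of \<open>\<theta> z\<close>, multiplied by the squared denominator. It turns
  smallness of the Poisson integral into closeness of \<open>|\<theta> z|\<close> to \<open>1\<close>.\<close>

lemma one_minus_norm_theta:
  assumes z: "cmod z < 1"
  shows "1 - (cmod (\<theta> z))\<^sup>2 = (cmod (\<alpha> - \<theta> z))\<^sup>2 * poisson_integral \<sigma> z"
proof -
  note Re_clark_function[OF z]
  moreover have "Re ((\<alpha> + \<theta> z) / (\<alpha> - \<theta> z)) * (cmod (\<alpha> - \<theta> z))\<^sup>2 = 1 - (cmod (\<theta> z))\<^sup>2"
  proof (cases "\<alpha> = \<theta> z")
    case False
    have "Re ((\<alpha> + \<theta> z) / (\<alpha> - \<theta> z)) = Re ((\<alpha> + \<theta> z) * cnj (\<alpha> - \<theta> z)) / (cmod (\<alpha> - \<theta> z))\<^sup>2"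
      by (metis Re_divide_of_real complex_div_cnj)
    also have "Re ((\<alpha> + \<theta> z) * cnj (\<alpha> - \<theta> z)) = (cmod \<alpha>)\<^sup>2 - (cmod (\<theta> z))\<^sup>2"
      unfolding cmod_power2 by (simp add: power2_eq_square algebra_simps)
    finally show ?thesis
      using False alpha by simp
  qed (use alpha in auto)
  ultimately show ?thesis
    by (simp add: mult.commute)
qed

text \<open>If \<open>\<xi>\<close> is far from \<open>\<zeta>\<close> in comparison with \<open>z\<close>, the kernel is at most \<open>8 h / |\<xi> - \<zeta>|\<^sup>2\<close>, and \<open>E\<close> absorbs
  the square. Otherwise the kernel may be as large as \<open>2 / h\<close>, but then \<open>E \<xi>\<close> is at least
  \<open>exp (\<epsilon> / (2 d))\<close>.\<close>

lemma poisson_kernel_le_E: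
  assumes z: "cmod z < 1" and \<xi>: "\<xi> \<in> unit_circle" "\<xi> \<noteq> \<zeta>"
  defines "h \<equiv> 1 - cmod z" and "d \<equiv> cmod (z - \<zeta>)"
  shows "(1 - (cmod z)\<^sup>2) / (cmod (\<xi> - z))\<^sup>2 \<le> (16 * h / \<epsilon>\<^sup>2 + 2 / h * exp (- \<epsilon> / (2 * d))) * E \<xi>"
proof -
  have h: "0 < h"
    using z by (simp add: h_def)
  have hd: "h \<le> cmod (\<xi> - z)" "h \<le> d"
    using norm_triangle_ineq2[of \<xi> z] norm_triangle_ineq2[of \<zeta> z] \<xi> zeta
    by (simp_all add: h_def d_def norm_minus_commute)
  have num: "1 - (cmod z)\<^sup>2 \<le> 2 * h"
    using sum_power2_ge_zero[of "1 - cmod z" 0] by (simp add: h_def power2_eq_square algebra_simps)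
  have E1: "E \<xi> > 0"
    by (simp add: E_def)
  have dx: "cmod (\<xi> - \<zeta>) > 0"
    using \<xi> by simp
  show ?thesis
  proof (cases "2 * d \<le> cmod (\<xi> - \<zeta>)")
    case True
    have "cmod (\<xi> - \<zeta>) \<le> cmod (\<xi> - z) + d"
      using norm_triangle_ineq[of "\<xi> - z" "z - \<zeta>"] by (simp add: d_def)
    then have "cmod (\<xi> - \<zeta>) / 2 \<le> cmod (\<xi> - z)"
      using True by simp
    then have "(cmod (\<xi> - \<zeta>) / 2)\<^sup>2 \<le> (cmod (\<xi> - z))\<^sup>2"
      by (rule power_mono) simp
    then have "(1 - (cmod z)\<^sup>2) / (cmod (\<xi> - z))\<^sup>2 \<le> 2 * h / (cmod (\<xi> - \<zeta>) / 2)\<^sup>2"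
      using num h dx by (intro frac_le) auto
    also have "\<dots> = 8 * h * (1 / cmod (\<xi> - \<zeta>)) ^ 2"
      by (simp add: power_divide)
    also have "\<dots> \<le> 8 * h * (fact 2 / \<epsilon> ^ 2 * E \<xi>)"
      by (intro mult_left_mono power_le_E) (use \<xi> h in auto)
    also have "\<dots> = 16 * h / \<epsilon>\<^sup>2 * E \<xi>"
      by (simp add: fact_numeral)
    also have "\<dots> \<le> (16 * h / \<epsilon>\<^sup>2 + 2 / h * exp (- \<epsilon> / (2 * d))) * E \<xi>"
      using E1 h by (intro mult_right_mono) auto
    finally show ?thesis .
  next
    case False
    have "(1 - (cmod z)\<^sup>2) / (cmod (\<xi> - z))\<^sup>2 \<le> 2 * h / h\<^sup>2"
      using num h hd by (intro frac_le power_mono) auto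
    also have "\<dots> = 2 / h * 1"
      using h by (simp add: power2_eq_square)
    also have "\<dots> \<le> 2 / h * (exp (- \<epsilon> / (2 * d)) * E \<xi>)"
    proof (intro mult_left_mono)
      have "\<epsilon> / (2 * d) \<le> \<epsilon> / cmod (\<xi> - \<zeta>)"
        using False eps dx h hd by (intro divide_left_mono mult_pos_pos) auto
      then show "1 \<le> exp (- \<epsilon> / (2 * d)) * E \<xi>"
        by (simp add: E_def exp_add[symmetric])
    qed (use h in auto)
    also have "\<dots> = 2 / h * exp (- \<epsilon> / (2 * d)) * E \<xi>"
      by (rule mult.assoc[symmetric])
    also have "\<dots> \<le> (16 * h / \<epsilon>\<^sup>2 + 2 / h * exp (- \<epsilon> / (2 * d))) * E \<xi>"
      using E1 h by (intro mult_right_mono) auto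
    finally show ?thesis .
  qed
qed

text \<open>The number \<open>exp (- \<epsilon> / (2 d))\<close> is smaller than a multiple of any power of \<open>d\<close>. The power \<open>2 N\<close> gives
  \<open>h\<^sup>2\<close> on the region where \<open>(d / 2)\<^sup>N \<le> h\<close>, which compensates the factor \<open>2 / h\<close>.\<close>

lemma poisson_integral_small:
  "\<exists>C>0. \<forall>z. cmod z < 1 \<and> (cmod (z - \<zeta>) / 2) ^ N \<le> 1 - cmod z \<longrightarrow>
    poisson_integral \<sigma> z \<le> C * (1 - cmod z)"
proof -
  define W where "W = (LINT \<xi>|\<sigma>. E \<xi>)"
  define M where "M = fact (2 * N) * (4 / \<epsilon>) ^ (2 * N)"
  have M: "M \<ge> 0"
    using eps by (simp add: M_def)
  have W: "W \<ge> 0"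
    unfolding W_def by (intro integral_nonneg_AE AE_I2) (simp add: E_def)
  show ?thesis
  proof (intro exI[of _ "(16 / \<epsilon>\<^sup>2 + 2 * M) * W + 1"] conjI allI impI)
    show "0 < (16 / \<epsilon>\<^sup>2 + 2 * M) * W + 1"
      using M W by (intro add_nonneg_pos mult_nonneg_nonneg add_nonneg_nonneg) auto
    fix z assume "cmod z < 1 \<and> (cmod (z - \<zeta>) / 2) ^ N \<le> 1 - cmod z"
    then have z: "cmod z < 1" and hN: "(cmod (z - \<zeta>) / 2) ^ N \<le> 1 - cmod z"
      by auto
    define h d where "h = 1 - cmod z" and "d = cmod (z - \<zeta>)"
    have h: "0 < h" "h \<le> d"
      using z norm_triangle_ineq2[of \<zeta> z] zeta by (simp_all add: h_def d_def norm_minus_commute)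
    have "(\<epsilon> / (2 * d)) ^ (2 * N) / fact (2 * N) \<le> exp (\<epsilon> / (2 * d))"
      by (rule power_div_fact_le_exp) (use eps h in auto)
    then have "exp (- (\<epsilon> / (2 * d))) \<le> fact (2 * N) / (\<epsilon> / (2 * d)) ^ (2 * N)"
      using eps h by (simp add: exp_minus field_simps)
    also have "\<dots> = fact (2 * N) * (1 / (\<epsilon> / (2 * d))) ^ (2 * N)"
      unfolding power_one_over times_divide_eq_right mult_1_right ..
    also have "1 / (\<epsilon> / (2 * d)) = (4 / \<epsilon>) * (d / 2)"
      by simp
    also have "fact (2 * N) * ((4 / \<epsilon>) * (d / 2)) ^ (2 * N) = M * ((d / 2) ^ N)\<^sup>2"
      unfolding M_def power_mult_distrib power_even_eq by (simp only: mult.assoc)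
    also have "\<dots> \<le> M * h\<^sup>2"
      using hN h M by (intro mult_left_mono power_mono) (auto simp: h_def d_def)
    finally have ex: "exp (- \<epsilon> / (2 * d)) \<le> M * h\<^sup>2"
      by simp
    have "poisson_integral \<sigma> z \<le>
        (LINT \<xi>|\<sigma>. (16 * h / \<epsilon>\<^sup>2 + 2 / h * exp (- \<epsilon> / (2 * d))) * E \<xi>)"
    proof (rule integral_mono_AE)
      show "AE \<xi> in \<sigma>. (1 - (cmod z)\<^sup>2) / (cmod (\<xi> - z))\<^sup>2 \<le> (16 * h / \<epsilon>\<^sup>2 + 2 / h * exp (- \<epsilon> / (2 * d))) * E \<xi>"
        using AE_neq_zeta AE_space
        by eventually_elim (unfold h_def d_def, rule poisson_kernel_le_E[OF z], auto)
    qed (auto intro!: \<sigma>.integrable_continuous_on_circle continuous_on_poisson_kernel z E_integrable)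
    also have "\<dots> = (16 * h / \<epsilon>\<^sup>2 + 2 / h * exp (- \<epsilon> / (2 * d))) * W"
      by (simp add: W_def)
    also have "\<dots> \<le> (16 * h / \<epsilon>\<^sup>2 + 2 / h * (M * h\<^sup>2)) * W"
      using ex h W by (intro mult_right_mono add_left_mono mult_left_mono) auto
    also have "\<dots> = ((16 / \<epsilon>\<^sup>2 + 2 * M) * W) * h"
      using h by (simp add: power2_eq_square field_simps)
    also have "\<dots> \<le> ((16 / \<epsilon>\<^sup>2 + 2 * M) * W + 1) * h"
      using h by (intro mult_right_mono) auto
    finally show "poisson_integral \<sigma> z \<le> ((16 / \<epsilon>\<^sup>2 + 2 * M) * W + 1) * (1 - cmod z)"
      by (simp add: h_def)
  qed
qed

lemma neg_ln_le:
  fixes x :: real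
  assumes "1 / 2 \<le> x" "x \<le> 1"
  shows "- ln x \<le> 2 * (1 - x)"
proof -
  have "- ln x = ln (1 / x)"
    using assms by (simp add: ln_div)
  also have "\<dots> \<le> 1 / x - 1"
    using assms by (intro ln_le_minus_one) auto
  also have "\<dots> = (1 - x) / x"
    using assms by (simp add: field_simps)
  also have "\<dots> \<le> (1 - x) / (1 / 2)"
    using assms by (intro divide_left_mono) auto
  finally show ?thesis by simp
qed

text \<open>On the region of the preceding estimate, the factor \<open>1 - |z|\<close> in the bound for \<open>- ln |\<theta>(z)|\<^sup>2\<close> cancels
  against the one in front of the mass.\<close>

lemma zeros_and_singular_mass_bounded:
  assumes \<nu>: "circle_measure \<nu>" "generates_singular_factor \<nu> \<theta>"
  shows "\<exists>C>0. \<forall>z. cmod z < 1 \<and> (cmod (z - \<zeta>) / 2) ^ N \<le> 1 - cmod z \<and> 1 - cmod z \<le> 1 / C \<longrightarrow>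
    \<theta> z \<noteq> 0 \<and> (\<forall>F. finite F \<and> F \<subseteq> disc_zeros \<theta> \<longrightarrow>
      (\<Sum>(w, k)\<in>F. (1 - (cmod w)\<^sup>2) / (cmod (1 - cnj w * z))\<^sup>2) + (LINT \<xi>|\<nu>. 1 / (cmod (\<xi> - z))\<^sup>2) \<le> C)"
proof -
  interpret \<nu>: circle_measure \<nu> by fact
  obtain C where C: "C > 0" and Cb: "\<And>z. cmod z < 1 \<Longrightarrow> (cmod (z - \<zeta>) / 2) ^ N \<le> 1 - cmod z \<Longrightarrow>
    poisson_integral \<sigma> z \<le> C * (1 - cmod z)"
    using poisson_integral_small[of N] by auto
  show ?thesis
  \<comment> \<open>The restriction to \<open>1 - |z| \<le> 1 / (8 C)\<close> gives \<open>|\<theta>(z)|\<^sup>2 \<ge> 1 / 2\<close>, where \<open>- ln x \<le> 2 (1 - x)\<close>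
    is available.\<close>
  proof (intro exI[of _ "8 * C"] conjI allI impI)
    show "0 < 8 * C" using C by simp
    fix z assume "cmod z < 1 \<and> (cmod (z - \<zeta>) / 2) ^ N \<le> 1 - cmod z \<and> 1 - cmod z \<le> 1 / (8 * C)"
    then have z: "cmod z < 1" "(cmod (z - \<zeta>) / 2) ^ N \<le> 1 - cmod z" and h: "1 - cmod z \<le> 1 / (8 * C)"
      by auto
    have a2: "(cmod (\<alpha> - \<theta> z))\<^sup>2 \<le> 2\<^sup>2"
      using norm_triangle_ineq4[of \<alpha> "\<theta> z"] alpha le_1[OF z(1)] by (intro power_mono) auto
    note P0 = poisson_integral_nonneg[OF z(1)]
    have d: "1 - (cmod (\<theta> z))\<^sup>2 \<le> 4 * (C * (1 - cmod z))"
      unfolding one_minus_norm_theta[OF z(1)] using a2 Cb[OF z] P0 by (intro mult_mono) auto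
    also have "\<dots> \<le> 1 / 2"
      using h C by (simp add: field_simps)
    finally have half: "1 / 2 \<le> (cmod (\<theta> z))\<^sup>2"
      by simp
    then show nz: "\<theta> z \<noteq> 0"
      by auto
    fix F assume F: "finite F \<and> F \<subseteq> disc_zeros \<theta>"
    let ?S = "\<Sum>(w, k)\<in>F. (1 - (cmod w)\<^sup>2) / (cmod (1 - cnj w * z))\<^sup>2"
    let ?I = "LINT \<xi>|\<nu>. 1 / (cmod (\<xi> - z))\<^sup>2"
    have S: "0 \<le> ?S"
      using F by (intro sum_nonneg) (auto simp: power_le_one dest!: disc_zerosD(1) intro!: divide_nonneg_nonneg)
    have I: "0 \<le> ?I"
      by (intro integral_nonneg_AE AE_I2) auto
    have "1 - cmod z \<le> 1 - (cmod z)\<^sup>2"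
      using z by (simp add: power2_eq_square mult_left_le)
    then have "(1 - cmod z) * (?S + ?I) \<le> (1 - (cmod z)\<^sup>2) * (?S + 2 * ?I)"
      using S I z by (intro mult_mono) (auto simp: power_le_one)
    also have "\<dots> \<le> - ln ((cmod (\<theta> z))\<^sup>2)"
      by (rule zeros_and_singular_mass_le[OF \<nu> z(1) nz]) (use F in auto)
    also have "\<dots> \<le> 2 * (1 - (cmod (\<theta> z))\<^sup>2)"
      using half le_1[OF z(1)] by (intro neg_ln_le) (auto simp: power_le_one)
    also have "\<dots> \<le> 2 * (4 * (C * (1 - cmod z)))"
      using d by simp
    also have "\<dots> = (1 - cmod z) * (8 * C)"
      by simp
    finally show "?S + ?I \<le> 8 * C"
      using z by simp
  qed
qed

end

subsection \<open>Integration along a tangential curve\<close>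

lemma norm_cis_diff_le: "cmod (cis t - cis s) \<le> \<bar>t - s\<bar>"
proof -
  have "cis t - cis s = cis s * (cis (t - s) - 1)"
    by (simp add: cis_mult right_diff_distrib)
  also have "cmod \<dots> = cmod (iexp (t - s) - 1)"
    by (simp add: norm_mult cis_conv_exp)
  also have "\<dots> \<le> \<bar>t - s\<bar>"
    using iexp_approx1[of "t - s" 0] by simp
  finally show ?thesis .
qed

lemma cis_borel_measurable [measurable]: "cis \<in> borel_measurable borel"
  by (intro borel_measurable_continuous_onI continuous_intros)

text \<open>A curve in the disc that touches the circle at \<open>\<zeta>\<close> to the order \<open>N\<close>, parametrized by the angle.\<close>

definition approach_curve :: "complex \<Rightarrow> nat \<Rightarrow> real \<Rightarrow> complex" where
  "approach_curve \<zeta> N t = of_real (1 - cmod (cis t - \<zeta>) ^ N) * cis t"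

lemma approach_curve_measurable [measurable]: "approach_curve \<zeta> N \<in> borel_measurable borel"
  unfolding approach_curve_def[abs_def] by measurable

lemma approach_curve_norm:
  assumes "0 < cmod (cis t - \<zeta>)" "cmod (cis t - \<zeta>) \<le> 1 / 2" "N \<ge> 2"
  shows "cmod (approach_curve \<zeta> N t) = 1 - cmod (cis t - \<zeta>) ^ N" "cmod (approach_curve \<zeta> N t) < 1"
    "(cmod (approach_curve \<zeta> N t - \<zeta>) / 2) ^ N \<le> 1 - cmod (approach_curve \<zeta> N t)"
proof -
  let ?D = "cmod (cis t - \<zeta>)"
  have D: "?D ^ N \<le> ?D"
    using power_decreasing[of 1 N ?D] assms by simp
  show n: "cmod (approach_curve \<zeta> N t) = 1 - ?D ^ N"
    using D assms(2) by (simp add: approach_curve_def norm_mult del: of_real_diff)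
  then show "cmod (approach_curve \<zeta> N t) < 1"
    using assms(1) by simp
  have "cmod (approach_curve \<zeta> N t - cis t) = ?D ^ N"
  proof -
    have "approach_curve \<zeta> N t - cis t = - (of_real (?D ^ N) * cis t)"
      by (simp add: approach_curve_def algebra_simps)
    then show ?thesis
      by (simp add: norm_mult norm_power)
  qed
  then have "cmod (approach_curve \<zeta> N t - \<zeta>) \<le> ?D ^ N + ?D"
    using norm_triangle_ineq[of "approach_curve \<zeta> N t - cis t" "cis t - \<zeta>"] by simp
  then have "(cmod (approach_curve \<zeta> N t - \<zeta>) / 2) ^ N \<le> ?D ^ N"
    using D by (intro power_mono) auto
  then show "(cmod (approach_curve \<zeta> N t - \<zeta>) / 2) ^ N \<le> 1 - cmod (approach_curve \<zeta> N t)"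
    by (simp add: n)
qed

text \<open>A point \<open>x\<close> whose distance from the circle is at most of the order \<open>d\<^sup>N\<close>, for \<open>d = |x - \<zeta>|\<close>, stays
  within that order of an arc of the curve, because the curve too is that close to the circle.
  The arc lasts for a time of the order \<open>d\<^sup>N\<close>.\<close>

lemma arc_close_to_point:
  assumes \<zeta>: "cmod \<zeta> = 1" and x: "cmod x \<le> 1" "x \<noteq> \<zeta>" and d1: "cmod (x - \<zeta>) \<le> 1 / 4" and N: "N \<ge> 2"
    and x_near: "1 - cmod x \<le> (cmod (x - \<zeta>) / 2) ^ N"
  defines "d \<equiv> cmod (x - \<zeta>)"
  shows "\<exists>a. \<forall>t\<in>{a..a + (d / 2) ^ N}. 0 \<le> t \<and> t \<le> 2 * pi \<and> 0 < cmod (cis t - \<zeta>) \<and> cmod (cis t - \<zeta>) \<le> 2 * d \<and>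
    cmod (1 - cnj x * approach_curve \<zeta> N t) \<le> (2 ^ N + 2) * d ^ N"
proof -
  define \<delta> where "\<delta> = (d / 2) ^ N"
  have d: "0 < d" "d \<le> 1 / 4"
    using x d1 by (simp_all add: d_def)
  have \<delta>: "0 < \<delta>" "\<delta> \<le> d / 4"
  proof -
    show "0 < \<delta>" using d by (simp add: \<delta>_def)
    have "\<delta> \<le> (d / 2) ^ 2"
      unfolding \<delta>_def using d N by (intro power_decreasing) auto
    also have "\<dots> \<le> d / 4"
      using d by (simp add: power2_eq_square field_simps)
    finally show "\<delta> \<le> d / 4" .
  qed
  define s where "s = Arg2pi x"
  have s: "0 \<le> s" "s < 2 * pi" "x = of_real (cmod x) * cis s"
    using Arg2pi[of x] by (auto simp: s_def cis_conv_exp is_Arg_def)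
  \<comment> \<open>The arc begins at the argument of \<open>x\<close>, or ends there if it would leave \<open>[0, 2 \<pi>]\<close>.\<close>
  define a where "a = (if s + \<delta> \<le> 2 * pi then s else s - \<delta>)"
  have x0: "cmod (x - cis s) \<le> \<delta>"
  proof -
    have "x - cis s = of_real (cmod x - 1) * cis s"
      using s(3) by (simp add: algebra_simps)
    then have "cmod (x - cis s) = \<bar>cmod x - 1\<bar>"
      by (metis norm_cis norm_mult norm_of_real mult.right_neutral)
    then show ?thesis
      using x x_near by (simp add: \<delta>_def d_def)
  qed
  show ?thesis
    unfolding \<delta>_def[symmetric]
  proof (intro exI[of _ a] ballI)
    fix t assume t: "t \<in> {a..a + \<delta>}"
    have ts: "\<bar>t - s\<bar> \<le> \<delta>"
      using t \<delta> by (auto simp: a_def split: if_splits)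
    have pi: "2 * \<delta> \<le> 2 * pi"
      using \<delta> d pi_gt3 by linarith
    have t2: "0 \<le> t" "t \<le> 2 * pi"
      using t s pi \<delta> by (auto simp: a_def split: if_splits)
    have tx: "cmod (cis t - cis s) \<le> \<delta>"
      using norm_cis_diff_le[of t s] ts by simp
    let ?D = "cmod (cis t - \<zeta>)"
    have "cmod (cis t - x) \<le> 2 * \<delta>"
      using norm_triangle_ineq[of "cis t - cis s" "cis s - x"] tx x0 by (simp add: norm_minus_commute)
    then have D: "?D \<le> d + 2 * \<delta>" "d \<le> ?D + 2 * \<delta>"
      using norm_triangle_ineq[of "cis t - x" "x - \<zeta>"] norm_triangle_ineq[of "x - cis t" "cis t - \<zeta>"]
      by (simp_all add: d_def norm_minus_commute)
    have D2: "0 < ?D" "?D \<le> 2 * d"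
      using D \<delta> d by linarith+
    let ?z = "approach_curve \<zeta> N t"
    have Dn: "?D ^ N \<le> 1"
      using D2 d by (intro power_le_one) auto
    have z1: "cmod ?z \<le> 1"
      using Dn by (simp add: approach_curve_def norm_mult del: of_real_diff)
    have zt: "cmod (cis t - ?z) = ?D ^ N"
    proof -
      have "cis t - ?z = of_real (?D ^ N) * cis t"
        by (simp add: approach_curve_def algebra_simps)
      then show ?thesis
        by (simp add: norm_mult norm_power)
    qed
    have cc: "cis s * cnj (cis s) = 1"
      by (simp add: complex_norm_square[symmetric])
    have "1 - cnj x * ?z = cnj (cis s) * (cis s - ?z) + (cnj (cis s) - cnj x) * ?z"
      using cc by (simp add: algebra_simps)
    then have "cmod (1 - cnj x * ?z) \<le> cmod (cis s - ?z) + cmod (cis s - x) * cmod ?z"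
      by (metis (no_types, lifting) complex_cnj_diff complex_mod_cnj norm_cis norm_mult norm_triangle_ineq mult_1)
    also have "\<dots> \<le> (\<delta> + ?D ^ N) + \<delta> * 1"
    proof (intro add_mono mult_mono)
      show "cmod (cis s - ?z) \<le> \<delta> + ?D ^ N"
        using norm_triangle_ineq[of "cis s - cis t" "cis t - ?z"] tx zt by (simp add: norm_minus_commute)
    qed (use x0 z1 \<delta> in \<open>auto simp: norm_minus_commute\<close>)
    also have "\<dots> \<le> (2 ^ N + 2) * d ^ N"
    proof -
      have "?D ^ N \<le> (2 * d) ^ N"
        using D2 by (intro power_mono) auto
      moreover have "\<delta> \<le> d ^ N"
        unfolding \<delta>_def using d by (intro power_mono) auto
      ultimately show ?thesis
        by (simp add: power_mult_distrib algebra_simps)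
    qed
    finally show "0 \<le> t \<and> t \<le> 2 * pi \<and> 0 < ?D \<and> ?D \<le> 2 * d \<and> cmod (1 - cnj x * ?z) \<le> (2 ^ N + 2) * d ^ N"
      using t2 D2 by simp
  qed
qed

text \<open>The integrand of the integral of the kernel of \<open>x\<close> along the part of the curve near \<open>\<zeta>\<close>. Its values
  are extended nonnegative reals, since it is integrated in \<open>t\<close> and in \<open>x\<close> in either order.\<close>

definition curve_weight :: "complex \<Rightarrow> nat \<Rightarrow> real \<Rightarrow> complex \<Rightarrow> real \<Rightarrow> ennreal" where
  "curve_weight \<zeta> N \<rho> x t =
     (if 0 \<le> t \<and> t \<le> 2 * pi \<and> 0 < cmod (cis t - \<zeta>) \<and> cmod (cis t - \<zeta>) \<le> \<rho>
      then ennreal (1 / (cmod (1 - cnj x * approach_curve \<zeta> N t))\<^sup>2) else 0)"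

lemma curve_weight_measurable [measurable (raw)]:
  assumes [measurable]: "f \<in> borel_measurable M" "g \<in> borel_measurable M"
  shows "(\<lambda>p. curve_weight \<zeta> N \<rho> (f p) (g p)) \<in> borel_measurable M"
proof -
  have [measurable]: "(\<lambda>p. cnj (f p)) \<in> borel_measurable M"
    by (rule measurable_compose[OF assms(1)]) (intro borel_measurable_continuous_onI continuous_intros)
  have [measurable]: "(\<lambda>p. cis (g p)) \<in> borel_measurable M"
    by (rule measurable_compose[OF assms(2) cis_borel_measurable])
  have [measurable]: "(\<lambda>p. approach_curve \<zeta> N (g p)) \<in> borel_measurable M"
    by (rule measurable_compose[OF assms(2) approach_curve_measurable])
  show ?thesis
    unfolding curve_weight_def by measurable
qed

lemma curve_weight_integral_lower:
  assumes \<zeta>: "cmod \<zeta> = 1" and x: "cmod x \<le> 1" "x \<noteq> \<zeta>" and N: "N \<ge> 2"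
    and x_near: "1 - cmod x \<le> (cmod (x - \<zeta>) / 2) ^ N"
    and \<rho>: "\<rho> \<le> 1 / 2" "2 * cmod (x - \<zeta>) \<le> \<rho>"
  shows "ennreal (1 / (2 ^ N * (2 ^ N + 2)\<^sup>2) * (1 / cmod (x - \<zeta>) ^ N)) \<le> (\<integral>\<^sup>+t. curve_weight \<zeta> N \<rho> x t \<partial>lborel)"
proof -
  define d where "d = cmod (x - \<zeta>)"
  have d: "0 < d" "d \<le> 1 / 4"
    using x \<rho> by (simp_all add: d_def)
  obtain a where a: "\<And>t. t \<in> {a..a + (d / 2) ^ N} \<Longrightarrow> 0 \<le> t \<and> t \<le> 2 * pi \<and> 0 < cmod (cis t - \<zeta>) \<and> cmod (cis t - \<zeta>) \<le> 2 * d \<and>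
    cmod (1 - cnj x * approach_curve \<zeta> N t) \<le> (2 ^ N + 2) * d ^ N"
    using arc_close_to_point[OF \<zeta> x _ N x_near] d unfolding d_def by blast
  let ?m = "1 / ((2 ^ N + 2) * d ^ N)\<^sup>2"
  have "ennreal (1 / (2 ^ N * (2 ^ N + 2)\<^sup>2) * (1 / d ^ N)) = ennreal (?m * (d / 2) ^ N)"
  proof -
    have "1 / (a * K\<^sup>2) * (1 / p) = 1 / (K * p)\<^sup>2 * (p / a)" if "K \<noteq> 0" "p \<noteq> 0" "a \<noteq> 0" for a K p :: real
      using that by (simp add: power2_eq_square field_simps)
    from this[of "2 ^ N + 2" "d ^ N" "2 ^ N"] d show ?thesis
      by (simp add: power_divide add_pos_pos less_imp_neq[THEN not_sym])
  qed
  also have "\<dots> = ennreal ?m * ennreal ((d / 2) ^ N)"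
    using d by (intro ennreal_mult) auto
  also have "\<dots> = (\<integral>\<^sup>+t. ennreal ?m * indicator {a..a + (d / 2) ^ N} t \<partial>lborel)"
    using d by (subst nn_integral_cmult_indicator) auto
  also have "\<dots> \<le> (\<integral>\<^sup>+t. curve_weight \<zeta> N \<rho> x t \<partial>lborel)"
  proof (rule nn_integral_mono)
    fix t
    show "ennreal ?m * indicator {a..a + (d / 2) ^ N} t \<le> curve_weight \<zeta> N \<rho> x t"
    proof (cases "t \<in> {a..a + (d / 2) ^ N}")
      case True
      have D: "0 < cmod (cis t - \<zeta>)" "cmod (cis t - \<zeta>) \<le> 1 / 2" "cmod (cis t - \<zeta>) \<le> \<rho>"
        using a[OF True] \<rho> by (auto simp: d_def)
      have "1 - cnj x * approach_curve \<zeta> N t \<noteq> 0"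
        using disc_denominator_nonzero[of "approach_curve \<zeta> N t" x] approach_curve_norm(2)[OF D(1,2) N] x(1)
        by (metis complex_cnj_cnj complex_cnj_diff complex_cnj_mult complex_cnj_one complex_cnj_zero_iff mult.commute)
      then have "?m \<le> 1 / (cmod (1 - cnj x * approach_curve \<zeta> N t))\<^sup>2"
        using a[OF True] d by (intro divide_left_mono power_mono mult_pos_pos) auto
      then show ?thesis
        using True a[OF True] D by (auto simp: curve_weight_def intro!: ennreal_leI)
    qed simp
  qed
  finally show ?thesis
    by (simp add: d_def)
qed

context exponential_clark
begin

text \<open>On the curve the mass of zeros and singular measure is bounded, and exchanging the integrations
  gives the bounds for the curve integrals. The region of the mass bound contains no zeros near \<open>\<zeta>\<close>,
  which makes the nearby zeros tangential. It contains the end of the radius, along which the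
  kernel at \<open>\<zeta>\<close> itself grows like \<open>1 / h\<^sup>2\<close> and excludes an atom.\<close>

lemma curve_weight_bounds:
  assumes \<nu>: "circle_measure \<nu>" "generates_singular_factor \<nu> \<theta>" and N: "N \<ge> 2"
  obtains \<rho> C where "0 < \<rho>" "\<rho> \<le> 1 / 2" "0 < C"
    "\<And>F. finite F \<Longrightarrow> F \<subseteq> disc_zeros \<theta> \<Longrightarrow>
      (\<Sum>(w, k)\<in>F. ennreal (1 - (cmod w)\<^sup>2) * (\<integral>\<^sup>+t. curve_weight \<zeta> N \<rho> w t \<partial>lborel)) \<le> ennreal C"
    "(\<integral>\<^sup>+\<xi>. (\<integral>\<^sup>+t. curve_weight \<zeta> N \<rho> \<xi> t \<partial>lborel) \<partial>\<nu>) \<le> ennreal C"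
    "\<And>w k. (w, k) \<in> disc_zeros \<theta> \<Longrightarrow> cmod (w - \<zeta>) \<le> \<rho> \<Longrightarrow> 1 - cmod w \<le> (cmod (w - \<zeta>) / 2) ^ N"
    "emeasure \<nu> {\<zeta>} = 0"
proof -
  interpret \<nu>: circle_measure \<nu> by fact
  obtain C where C: "C > 0" and Cb: "\<And>z. cmod z < 1 \<Longrightarrow> (cmod (z - \<zeta>) / 2) ^ N \<le> 1 - cmod z \<Longrightarrow> 1 - cmod z \<le> 1 / C \<Longrightarrow>
    \<theta> z \<noteq> 0 \<and> (\<forall>F. finite F \<and> F \<subseteq> disc_zeros \<theta> \<longrightarrow>
      (\<Sum>(w, k)\<in>F. (1 - (cmod w)\<^sup>2) / (cmod (1 - cnj w * z))\<^sup>2) + (LINT \<xi>|\<nu>. 1 / (cmod (\<xi> - z))\<^sup>2) \<le> C)"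
    using zeros_and_singular_mass_bounded[OF \<nu>, of N] by blast
  define \<rho> where "\<rho> = min (1 / 2) (1 / C)"
  have \<rho>: "0 < \<rho>" "\<rho> \<le> 1 / 2" "\<rho> \<le> 1 / C"
    using C by (auto simp: \<rho>_def)
  define T where "T = {t. 0 \<le> t \<and> t \<le> 2 * pi \<and> 0 < cmod (cis t - \<zeta>) \<and> cmod (cis t - \<zeta>) \<le> \<rho>}"
  let ?z = "approach_curve \<zeta> N"
  have on_T: "cmod (?z t) < 1"
    "\<And>F. finite F \<Longrightarrow> F \<subseteq> disc_zeros \<theta> \<Longrightarrow> (\<Sum>(w, k)\<in>F. (1 - (cmod w)\<^sup>2) / (cmod (1 - cnj w * ?z t))\<^sup>2) \<le> C"
    "(LINT \<xi>|\<nu>. 1 / (cmod (\<xi> - ?z t))\<^sup>2) \<le> C" if "t \<in> T" for t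
  proof -
    let ?D = "cmod (cis t - \<zeta>)"
    have D: "0 < ?D" "?D \<le> 1 / 2" "?D \<le> \<rho>"
      using that \<rho> by (auto simp: T_def)
    note cn = approach_curve_norm[OF D(1,2) N]
    show z1: "cmod (?z t) < 1"
      by (rule cn(2))
    have "?D ^ N \<le> ?D"
      using power_decreasing[of 1 N ?D] D N by simp
    then have "1 - cmod (?z t) \<le> 1 / C"
      using cn(1) D \<rho> by simp
    note b = Cb[OF z1 cn(3) this]
    have I: "0 \<le> (LINT \<xi>|\<nu>. 1 / (cmod (\<xi> - ?z t))\<^sup>2)"
      by (intro integral_nonneg_AE AE_I2) auto
    show "(LINT \<xi>|\<nu>. 1 / (cmod (\<xi> - ?z t))\<^sup>2) \<le> C"
      using conjunct2[OF b, rule_format, of "{}"] by simp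
    fix F assume "finite F" "F \<subseteq> disc_zeros \<theta>"
    then show "(\<Sum>(w, k)\<in>F. (1 - (cmod w)\<^sup>2) / (cmod (1 - cnj w * ?z t))\<^sup>2) \<le> C"
      using conjunct2[OF b, rule_format, of F] I by linarith
  qed
  have total: "(\<integral>\<^sup>+t. ennreal C * indicator {0..2 * pi} t \<partial>lborel) = ennreal (C * (2 * pi))"
    using C by (subst nn_integral_cmult_indicator) (auto simp: ennreal_mult)
  have zeros: "(\<Sum>(w, k)\<in>F. ennreal (1 - (cmod w)\<^sup>2) * (\<integral>\<^sup>+t. curve_weight \<zeta> N \<rho> w t \<partial>lborel)) \<le> ennreal (C * (2 * pi))"
    if F: "finite F" "F \<subseteq> disc_zeros \<theta>" for F
  proof -
    have "(\<Sum>(w, k)\<in>F. ennreal (1 - (cmod w)\<^sup>2) * (\<integral>\<^sup>+t. curve_weight \<zeta> N \<rho> w t \<partial>lborel)) =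
        (\<Sum>x\<in>F. (\<integral>\<^sup>+t. ennreal (1 - (cmod (fst x))\<^sup>2) * curve_weight \<zeta> N \<rho> (fst x) t \<partial>lborel))"
      by (intro sum.cong refl) (simp add: case_prod_unfold nn_integral_cmult)
    also have "\<dots> = (\<integral>\<^sup>+t. (\<Sum>x\<in>F. ennreal (1 - (cmod (fst x))\<^sup>2) * curve_weight \<zeta> N \<rho> (fst x) t) \<partial>lborel)"
      by (rule nn_integral_sum[symmetric]) simp
    also have "\<dots> \<le> (\<integral>\<^sup>+t. ennreal C * indicator {0..2 * pi} t \<partial>lborel)"
    proof (rule nn_integral_mono)
      fix t :: real
      show "(\<Sum>x\<in>F. ennreal (1 - (cmod (fst x))\<^sup>2) * curve_weight \<zeta> N \<rho> (fst x) t) \<le> ennreal C * indicator {0..2 * pi} t"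
      proof (cases "t \<in> T")
        case True
        have "(\<Sum>x\<in>F. ennreal (1 - (cmod (fst x))\<^sup>2) * curve_weight \<zeta> N \<rho> (fst x) t) =
            (\<Sum>x\<in>F. ennreal ((1 - (cmod (fst x))\<^sup>2) / (cmod (1 - cnj (fst x) * ?z t))\<^sup>2))"
        proof (intro sum.cong refl)
          fix x assume "x \<in> F"
          then have "cmod (fst x) < 1"
            using F(2) disc_zerosD(1)[of "fst x" "snd x" \<theta>] by auto
          then have "0 \<le> 1 - (cmod (fst x))\<^sup>2"
            by (simp add: power_le_one)
          then show "ennreal (1 - (cmod (fst x))\<^sup>2) * curve_weight \<zeta> N \<rho> (fst x) t =
              ennreal ((1 - (cmod (fst x))\<^sup>2) / (cmod (1 - cnj (fst x) * ?z t))\<^sup>2)"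
            using True by (simp add: curve_weight_def T_def ennreal_mult[symmetric])
        qed
        also have "\<dots> = ennreal (\<Sum>x\<in>F. (1 - (cmod (fst x))\<^sup>2) / (cmod (1 - cnj (fst x) * ?z t))\<^sup>2)"
        proof (rule sum_ennreal)
          fix x assume "x \<in> F"
          then have "cmod (fst x) < 1"
            using F(2) disc_zerosD(1)[of "fst x" "snd x" \<theta>] by auto
          then show "0 \<le> (1 - (cmod (fst x))\<^sup>2) / (cmod (1 - cnj (fst x) * ?z t))\<^sup>2"
            by (simp add: power_le_one)
        qed
        also have "\<dots> \<le> ennreal C"
          using on_T(2)[OF True F] by (intro ennreal_leI) (simp add: case_prod_unfold)
        finally show ?thesis
          using True by (simp add: T_def)
      next
        case False
        then have "curve_weight \<zeta> N \<rho> w t = 0" for w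
          by (auto simp: curve_weight_def T_def)
        then show ?thesis
          by simp
      qed
    qed
    also have "\<dots> = ennreal (C * (2 * pi))"
      by (rule total)
    finally show ?thesis .
  qed
  have singular: "(\<integral>\<^sup>+\<xi>. (\<integral>\<^sup>+t. curve_weight \<zeta> N \<rho> \<xi> t \<partial>lborel) \<partial>\<nu>) \<le> ennreal (C * (2 * pi))"
  proof -
    interpret pair_sigma_finite \<nu> lborel ..
    have [measurable]: "fst \<in> borel_measurable (\<nu> \<Otimes>\<^sub>M lborel)"
      using measurable_compose[OF measurable_fst \<nu>.measurable_circle[OF measurable_ident]] by (simp add: id_def)
    have "(\<integral>\<^sup>+\<xi>. (\<integral>\<^sup>+t. curve_weight \<zeta> N \<rho> \<xi> t \<partial>lborel) \<partial>\<nu>) = (\<integral>\<^sup>+t. (\<integral>\<^sup>+\<xi>. curve_weight \<zeta> N \<rho> \<xi> t \<partial>\<nu>) \<partial>lborel)"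
      by (rule Fubini'[symmetric]) (simp add: case_prod_unfold)
    also have "\<dots> \<le> (\<integral>\<^sup>+t. ennreal C * indicator {0..2 * pi} t \<partial>lborel)"
    proof (rule nn_integral_mono)
      fix t :: real
      show "(\<integral>\<^sup>+\<xi>. curve_weight \<zeta> N \<rho> \<xi> t \<partial>\<nu>) \<le> ennreal C * indicator {0..2 * pi} t"
      proof (cases "t \<in> T")
        case True
        have "(\<integral>\<^sup>+\<xi>. curve_weight \<zeta> N \<rho> \<xi> t \<partial>\<nu>) = (\<integral>\<^sup>+\<xi>. ennreal (1 / (cmod (\<xi> - ?z t))\<^sup>2) \<partial>\<nu>)"
        proof (rule nn_integral_cong)
          fix \<xi> assume "\<xi> \<in> space \<nu>"
          then have \<xi>: "cmod \<xi> = 1" by simp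
          then have "\<xi> - ?z t = \<xi> * (1 - cnj \<xi> * ?z t)"
            using complex_norm_square[of \<xi>] by (simp add: algebra_simps)
          then have "cmod (\<xi> - ?z t) = cmod (1 - cnj \<xi> * ?z t)"
            using \<xi> by (metis norm_mult mult_1)
          then show "curve_weight \<zeta> N \<rho> \<xi> t = ennreal (1 / (cmod (\<xi> - ?z t))\<^sup>2)"
            using True by (simp add: curve_weight_def T_def)
        qed
        also have "\<dots> = ennreal (LINT \<xi>|\<nu>. 1 / (cmod (\<xi> - ?z t))\<^sup>2)"
        proof (rule nn_integral_eq_integral)
          show "integrable \<nu> (\<lambda>\<xi>. 1 / (cmod (\<xi> - ?z t))\<^sup>2)"
            using circle_denominator_nonzero(2)[OF _ on_T(1)[OF True]]
            by (intro \<nu>.integrable_continuous_on_circle continuous_intros) auto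
        qed auto
        also have "\<dots> \<le> ennreal C"
          using on_T(3)[OF True] by (rule ennreal_leI)
        finally show ?thesis
          using True by (simp add: T_def)
      next
        case False
        then have "curve_weight \<zeta> N \<rho> w t = 0" for w
          by (auto simp: curve_weight_def T_def)
        then show ?thesis
          by simp
      qed
    qed
    also have "\<dots> = ennreal (C * (2 * pi))"
      by (rule total)
    finally show ?thesis .
  qed
  have near: "1 - cmod w \<le> (cmod (w - \<zeta>) / 2) ^ N" if "(w, k) \<in> disc_zeros \<theta>" "cmod (w - \<zeta>) \<le> \<rho>" for w k
  proof (rule ccontr)
    assume *: "\<not> ?thesis"
    have "1 - cmod w \<le> cmod (w - \<zeta>)"
      using norm_triangle_ineq2[of \<zeta> w] zeta by (simp add: norm_minus_commute)
    then have "1 - cmod w \<le> 1 / C"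
      using that(2) \<rho>(3) by simp
    then have "\<theta> w \<noteq> 0"
      using Cb[of w] * disc_zerosD(1)[OF that(1)] by auto
    then show False
      using disc_zerosD(2)[OF that(1)] by simp
  qed
  have atom: "emeasure \<nu> {\<zeta>} = 0"
  proof -
    have le: "measure \<nu> {\<zeta>} \<le> C * h\<^sup>2" if h: "0 < h" "h \<le> \<rho>" for h
    proof -
      let ?z = "of_real (1 - h) * \<zeta>"
      have nz: "cmod ?z = 1 - h" "cmod (?z - \<zeta>) = h"
      proof -
        show "cmod ?z = 1 - h"
          using h \<rho> zeta by (simp add: norm_mult del: of_real_diff)
        have "?z - \<zeta> = - (of_real h * \<zeta>)"
          by (simp add: algebra_simps)
        then show "cmod (?z - \<zeta>) = h"
          using h zeta by (simp add: norm_mult)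
      qed
      have "(h / 2) ^ N \<le> h / 2"
        using power_decreasing[of 1 N "h / 2"] N h \<rho> by simp
      then have b: "(LINT \<xi>|\<nu>. 1 / (cmod (\<xi> - ?z))\<^sup>2) \<le> C"
        using Cb[of ?z] nz h \<rho> by (auto dest!: spec[of _ "{}"] conjunct2)
      have "(1 / h\<^sup>2) * measure \<nu> {\<zeta>} = (LINT \<xi>|\<nu>. (1 / h\<^sup>2) * indicator {\<zeta>} \<xi>)"
        using singleton_sets[OF zeta] zeta by simp
      also have "\<dots> \<le> (LINT \<xi>|\<nu>. 1 / (cmod (\<xi> - ?z))\<^sup>2)"
      proof (rule integral_mono)
        show "integrable \<nu> (\<lambda>\<xi>. 1 / h\<^sup>2 * indicator {\<zeta>} \<xi>)"
          using singleton_sets[OF zeta]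
          by (intro integrable_mult_right integrable_real_indicator) (auto simp: \<nu>.emeasure_eq_measure)
        have "cmod ?z < 1"
          using nz h by simp
        then show "integrable \<nu> (\<lambda>\<xi>. 1 / (cmod (\<xi> - ?z))\<^sup>2)"
          using circle_denominator_nonzero(2)[of _ ?z]
          by (intro \<nu>.integrable_continuous_on_circle continuous_intros) auto
        show "1 / h\<^sup>2 * indicator {\<zeta>} \<xi> \<le> 1 / (cmod (\<xi> - ?z))\<^sup>2" for \<xi>
          using nz(2) by (auto simp: indicator_def norm_minus_commute)
      qed
      also note b
      finally show ?thesis
        using h by (simp add: field_simps)
    qed
    have "((\<lambda>h. C * h\<^sup>2) \<longlongrightarrow> C * 0\<^sup>2) (at_right 0)"
      by (intro tendsto_intros)
    then have "measure \<nu> {\<zeta>} \<le> C * 0\<^sup>2"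
    proof (rule tendsto_lowerbound)
      have "\<forall>\<^sub>F h in at_right (0::real). h \<in> {0<..<\<rho>}"
        using \<rho>(1) by (rule eventually_at_right_real)
      then show "\<forall>\<^sub>F h in at_right 0. measure \<nu> {\<zeta>} \<le> C * h\<^sup>2"
        by eventually_elim (use le in auto)
    qed simp
    then show ?thesis
      by (simp add: \<nu>.emeasure_eq_measure measure_le_0_iff)
  qed
  show thesis
    by (rule that[of \<rho> "C * (2 * pi)"]) (use \<rho> C zeros singular near atom in auto)
qed

text \<open>Zeros away from \<open>\<zeta>\<close> are controlled by the Blaschke condition, those near \<open>\<zeta>\<close> by their curve
  integrals.\<close>

lemma zeros_moment:
  assumes \<nu>: "circle_measure \<nu>" "generates_singular_factor \<nu> \<theta>" and N: "N \<ge> 2"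
  shows "(\<Sum>\<^sub>\<infinity>(w, k)\<in>disc_zeros \<theta>. ennreal ((1 - (cmod w)\<^sup>2) / cmod (\<zeta> - w) ^ N)) < \<infinity>"
proof -
  obtain \<rho> C where \<rho>: "0 < \<rho>" "\<rho> \<le> 1 / 2" and C: "0 < C"
    and zeros: "\<And>F. finite F \<Longrightarrow> F \<subseteq> disc_zeros \<theta> \<Longrightarrow>
      (\<Sum>(w, k)\<in>F. ennreal (1 - (cmod w)\<^sup>2) * (\<integral>\<^sup>+t. curve_weight \<zeta> N \<rho> w t \<partial>lborel)) \<le> ennreal C"
    and sing: "(\<integral>\<^sup>+\<xi>. (\<integral>\<^sup>+t. curve_weight \<zeta> N \<rho> \<xi> t \<partial>lborel) \<partial>\<nu>) \<le> ennreal C"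
    and near: "\<And>w k. (w, k) \<in> disc_zeros \<theta> \<Longrightarrow> cmod (w - \<zeta>) \<le> \<rho> \<Longrightarrow> 1 - cmod w \<le> (cmod (w - \<zeta>) / 2) ^ N"
    and atom: "emeasure \<nu> {\<zeta>} = 0"
    by (rule curve_weight_bounds[OF assms]) (rule that)
  define c :: real where "c = 1 / (2 ^ N * (2 ^ N + 2)\<^sup>2)"
  have c: "c > 0"
    unfolding c_def by (intro divide_pos_pos mult_pos_pos zero_less_power add_pos_pos) auto
  let ?S = "\<Sum>\<^sub>\<infinity>(w, k)\<in>disc_zeros \<theta>. 1 - cmod w"
  let ?B = "ennreal (2 / (\<rho> / 2) ^ N * ?S) + ennreal (1 / c) * ennreal C"
  have summand: "ennreal ((1 - (cmod w)\<^sup>2) / cmod (\<zeta> - w) ^ N) \<le>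
      ennreal (2 / (\<rho> / 2) ^ N * (1 - cmod w)) +
      ennreal (1 / c) * (ennreal (1 - (cmod w)\<^sup>2) * (\<integral>\<^sup>+t. curve_weight \<zeta> N \<rho> w t \<partial>lborel))"
    if wk: "(w, k) \<in> disc_zeros \<theta>" for w k
  proof -
    have w: "cmod w < 1"
      using disc_zerosD[OF wk] by simp
    have w2: "0 \<le> 1 - (cmod w)\<^sup>2" "1 - (cmod w)\<^sup>2 \<le> 2 * (1 - cmod w)"
    proof -
      show "0 \<le> 1 - (cmod w)\<^sup>2"
        using w by (simp add: power_le_one)
      show "1 - (cmod w)\<^sup>2 \<le> 2 * (1 - cmod w)"
        using zero_le_power2[of "1 - cmod w"] by (simp add: power2_eq_square algebra_simps)
    qed
    have wz: "w \<noteq> \<zeta>"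
      using w zeta by auto
    show ?thesis
    proof (cases "2 * cmod (w - \<zeta>) \<le> \<rho>")
      case False
      then have "(\<rho> / 2) ^ N \<le> cmod (\<zeta> - w) ^ N"
        using \<rho> by (intro power_mono) (auto simp: norm_minus_commute)
      then have "(1 - (cmod w)\<^sup>2) / cmod (\<zeta> - w) ^ N \<le> 2 * (1 - cmod w) / (\<rho> / 2) ^ N"
        using w2 w \<rho> by (intro frac_le) auto
      then have "ennreal ((1 - (cmod w)\<^sup>2) / cmod (\<zeta> - w) ^ N) \<le> ennreal (2 / (\<rho> / 2) ^ N * (1 - cmod w))"
        by (intro ennreal_leI) simp
      then show ?thesis
        by (rule order_trans) simp
    next
      case True
      have nw: "1 - cmod w \<le> (cmod (w - \<zeta>) / 2) ^ N"
        using near[OF wk] True \<rho>(1) norm_ge_zero[of "w - \<zeta>"] by linarith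
      have "ennreal ((1 - (cmod w)\<^sup>2) / cmod (\<zeta> - w) ^ N) =
          ennreal (1 / c) * (ennreal (1 - (cmod w)\<^sup>2) * ennreal (c * (1 / cmod (w - \<zeta>) ^ N)))"
        using w2 c by (simp add: ennreal_mult[symmetric] norm_minus_commute)
      also have "\<dots> \<le> ennreal (1 / c) * (ennreal (1 - (cmod w)\<^sup>2) * (\<integral>\<^sup>+t. curve_weight \<zeta> N \<rho> w t \<partial>lborel))"
        by (unfold c_def, intro mult_left_mono curve_weight_integral_lower) (use zeta w wz N nw \<rho> True in auto)
      finally show ?thesis
        by (rule order_trans) simp
    qed
  qed
  have fin: "(\<Sum>(w, k)\<in>F. ennreal ((1 - (cmod w)\<^sup>2) / cmod (\<zeta> - w) ^ N)) \<le> ?B"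
    if F: "finite F" "F \<subseteq> disc_zeros \<theta>" for F
  proof -
    have "(\<Sum>(w, k)\<in>F. ennreal ((1 - (cmod w)\<^sup>2) / cmod (\<zeta> - w) ^ N)) \<le>
        (\<Sum>(w, k)\<in>F. ennreal (2 / (\<rho> / 2) ^ N * (1 - cmod w)) +
          ennreal (1 / c) * (ennreal (1 - (cmod w)\<^sup>2) * (\<integral>\<^sup>+t. curve_weight \<zeta> N \<rho> w t \<partial>lborel)))"
      using F(2) summand by (intro sum_mono) auto
    also have "\<dots> = (\<Sum>(w, k)\<in>F. ennreal (2 / (\<rho> / 2) ^ N * (1 - cmod w))) +
        ennreal (1 / c) * (\<Sum>(w, k)\<in>F. ennreal (1 - (cmod w)\<^sup>2) * (\<integral>\<^sup>+t. curve_weight \<zeta> N \<rho> w t \<partial>lborel))"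
      unfolding sum_distrib_left sum.distrib[symmetric] by (intro sum.cong) auto
    also have "(\<Sum>(w, k)\<in>F. ennreal (2 / (\<rho> / 2) ^ N * (1 - cmod w))) = ennreal (\<Sum>(w, k)\<in>F. 2 / (\<rho> / 2) ^ N * (1 - cmod w))"
    proof -
      have "(\<Sum>x\<in>F. ennreal (2 / (\<rho> / 2) ^ N * (1 - cmod (fst x)))) = ennreal (\<Sum>x\<in>F. 2 / (\<rho> / 2) ^ N * (1 - cmod (fst x)))"
      proof (rule sum_ennreal)
        fix x assume "x \<in> F"
        then have "cmod (fst x) < 1"
          using F(2) disc_zerosD(1)[of "fst x" "snd x" \<theta>] by auto
        then show "0 \<le> 2 / (\<rho> / 2) ^ N * (1 - cmod (fst x))"
          using \<rho> by simp
      qed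
      then show ?thesis
        by (simp only: case_prod_unfold)
    qed
    also have "(\<Sum>(w, k)\<in>F. 2 / (\<rho> / 2) ^ N * (1 - cmod w)) = 2 / (\<rho> / 2) ^ N * (\<Sum>(w, k)\<in>F. 1 - cmod w)"
      unfolding sum_distrib_left by (intro sum.cong) auto
    also have "ennreal \<dots> + ennreal (1 / c) * (\<Sum>(w, k)\<in>F. ennreal (1 - (cmod w)\<^sup>2) * (\<integral>\<^sup>+t. curve_weight \<zeta> N \<rho> w t \<partial>lborel)) \<le> ?B"
    proof (intro add_mono mult_left_mono ennreal_leI)
      show "(\<Sum>(w, k)\<in>F. 1 - cmod w) \<le> ?S"
        using F by (intro finite_sum_le_infsum blaschke_condition) (auto dest: disc_zerosD)
    qed (use zeros[OF F] \<rho> in auto)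
    finally show ?thesis .
  qed
  have "(\<Sum>\<^sub>\<infinity>(w, k)\<in>disc_zeros \<theta>. ennreal ((1 - (cmod w)\<^sup>2) / cmod (\<zeta> - w) ^ N)) =
      (SUP F\<in>{F. finite F \<and> F \<subseteq> disc_zeros \<theta>}. \<Sum>(w, k)\<in>F. ennreal ((1 - (cmod w)\<^sup>2) / cmod (\<zeta> - w) ^ N))"
    by (rule nonneg_infsum_complete) auto
  also have "\<dots> \<le> ?B"
    by (intro SUP_least) (use fin in auto)
  also have "\<dots> < \<infinity>"
    by (simp add: ennreal_mult_less_top)
  finally show ?thesis .
qed

lemma singular_moment:
  assumes \<nu>: "circle_measure \<nu>" "generates_singular_factor \<nu> \<theta>" and N: "N \<ge> 2"
  shows "(\<integral>\<^sup>+z. 1 / ennreal (cmod (\<zeta> - z) ^ N) \<partial>\<nu>) < \<infinity>"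
proof -
  interpret \<nu>: circle_measure \<nu> by fact
  obtain \<rho> C where \<rho>: "0 < \<rho>" "\<rho> \<le> 1 / 2" and C: "0 < C"
    and zeros: "\<And>F. finite F \<Longrightarrow> F \<subseteq> disc_zeros \<theta> \<Longrightarrow>
      (\<Sum>(w, k)\<in>F. ennreal (1 - (cmod w)\<^sup>2) * (\<integral>\<^sup>+t. curve_weight \<zeta> N \<rho> w t \<partial>lborel)) \<le> ennreal C"
    and sing: "(\<integral>\<^sup>+\<xi>. (\<integral>\<^sup>+t. curve_weight \<zeta> N \<rho> \<xi> t \<partial>lborel) \<partial>\<nu>) \<le> ennreal C"
    and near: "\<And>w k. (w, k) \<in> disc_zeros \<theta> \<Longrightarrow> cmod (w - \<zeta>) \<le> \<rho> \<Longrightarrow> 1 - cmod w \<le> (cmod (w - \<zeta>) / 2) ^ N"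
    and atom: "emeasure \<nu> {\<zeta>} = 0"
    by (rule curve_weight_bounds[OF assms]) (rule that)
  define c :: real where "c = 1 / (2 ^ N * (2 ^ N + 2)\<^sup>2)"
  have c: "c > 0"
    unfolding c_def by (intro divide_pos_pos mult_pos_pos zero_less_power add_pos_pos) auto
  let ?w = "\<lambda>z. \<integral>\<^sup>+t. curve_weight \<zeta> N \<rho> z t \<partial>lborel"
  have [measurable]: "?w \<in> borel_measurable \<nu>"
    by (rule \<nu>.measurable_circle) measurable
  have ae: "AE z in \<nu>. z \<noteq> \<zeta>"
    using atom singleton_sets[OF zeta] by (intro AE_I[of _ _ "{\<zeta>}"]) auto
  have "(\<integral>\<^sup>+z. 1 / ennreal (cmod (\<zeta> - z) ^ N) \<partial>\<nu>) \<le> (\<integral>\<^sup>+z. ennreal (1 / (\<rho> / 2) ^ N) + ennreal (1 / c) * ?w z \<partial>\<nu>)"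
  proof (rule nn_integral_mono_AE)
    show "AE z in \<nu>. 1 / ennreal (cmod (\<zeta> - z) ^ N) \<le> ennreal (1 / (\<rho> / 2) ^ N) + ennreal (1 / c) * ?w z"
      using ae AE_space
    proof eventually_elim
      case (elim z)
      then have z: "z \<noteq> \<zeta>" "cmod z = 1"
        by auto
      have e: "1 / ennreal (cmod (\<zeta> - z) ^ N) = ennreal (1 / cmod (z - \<zeta>) ^ N)"
        using z divide_ennreal[of 1 "cmod (\<zeta> - z) ^ N"] by (simp add: norm_minus_commute)
      show ?case
      proof (cases "2 * cmod (z - \<zeta>) \<le> \<rho>")
        case False
        then have "(\<rho> / 2) ^ N \<le> cmod (z - \<zeta>) ^ N"
          using \<rho> by (intro power_mono) auto
        then have "ennreal (1 / cmod (z - \<zeta>) ^ N) \<le> ennreal (1 / (\<rho> / 2) ^ N)"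
          using \<rho> by (intro ennreal_leI divide_left_mono) (auto simp: z)
        then show ?thesis
          unfolding e by (rule order_trans) simp
      next
        case True
        have "ennreal (1 / cmod (z - \<zeta>) ^ N) = ennreal (1 / c) * ennreal (c * (1 / cmod (z - \<zeta>) ^ N))"
          using c by (simp add: ennreal_mult[symmetric])
        also have "\<dots> \<le> ennreal (1 / c) * ?w z"
          by (unfold c_def, intro mult_left_mono curve_weight_integral_lower) (use zeta z N \<rho> True in auto)
        finally show ?thesis
          unfolding e by (rule order_trans) simp
      qed
    qed
  qed
  also have "\<dots> = ennreal (1 / (\<rho> / 2) ^ N) * emeasure \<nu> (space \<nu>) + ennreal (1 / c) * (\<integral>\<^sup>+z. ?w z \<partial>\<nu>)"
    by (simp add: nn_integral_add nn_integral_cmult del: \<nu>.space_circle)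
  also have "\<dots> \<le> ennreal (1 / (\<rho> / 2) ^ N) * emeasure \<nu> (space \<nu>) + ennreal (1 / c) * ennreal C"
    by (intro add_left_mono mult_left_mono sing) auto
  also have "\<dots> < \<infinity>"
    by (simp add: ennreal_mult_less_top \<nu>.emeasure_eq_measure)
  finally show ?thesis .
qed

proposition zeta_in_AC: "\<zeta> \<in> AC n \<theta>"
proof -
  obtain \<nu> where \<nu>: "circle_measure \<nu>" "generates_singular_factor \<nu> \<theta>"
    using inner_function_factorization[OF inner nonzero] by blast
  have "(\<Sum>\<^sub>\<infinity>(w, k)\<in>disc_zeros \<theta>. ennreal ((1 - (cmod w)\<^sup>2) / cmod (\<zeta> - w) ^ (2 * n + 2)))
     + (\<integral>\<^sup>+z. 1 / ennreal (cmod (\<zeta> - z) ^ (2 * n + 2)) \<partial>\<nu>) < \<infinity>"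
    using zeros_moment[OF \<nu>, of "2 * n + 2"] singular_moment[OF \<nu>, of "2 * n + 2"]
    by (simp add: ennreal_add_less_top)
  then show ?thesis
    unfolding AC_def using zeta \<nu> by blast
qed

end

section \<open>Closed spans in spaces of square-integrable functions\<close>

lemma square_integrableI_dominated:
  assumes "f \<in> borel_measurable M" "AE x in M. cmod (f x) \<le> w x" "integrable M (\<lambda>x. (w x)\<^sup>2)"
  shows "f \<in> square_integrable M"
proof -
  have "integrable M (\<lambda>x. (cmod (f x))\<^sup>2)"
  proof (rule Bochner_Integration.integrable_bound[OF assms(3)])
    show "AE x in M. norm ((cmod (f x))\<^sup>2) \<le> norm ((w x)\<^sup>2)"
      using assms(2) by eventually_elim (simp add: power_mono)
  qed (use assms(1) in measurable)
  then show ?thesis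
    using assms(1) by (simp add: square_integrable_def)
qed

lemma square_integrableD:
  assumes "f \<in> square_integrable M"
  shows "f \<in> borel_measurable M" "integrable M (\<lambda>x. (cmod (f x))\<^sup>2)"
  using assms by (auto simp: square_integrable_def)

lemma cmod_add_power2_le: "(cmod (a + b))\<^sup>2 \<le> 2 * (cmod a)\<^sup>2 + 2 * (cmod b)\<^sup>2"
proof -
  have "(cmod (a + b))\<^sup>2 \<le> (cmod a + cmod b)\<^sup>2"
    by (intro power_mono norm_triangle_ineq) auto
  also have "\<dots> \<le> 2 * (cmod a)\<^sup>2 + 2 * (cmod b)\<^sup>2"
    using zero_le_power2[of "cmod a - cmod b"] by (simp add: power2_eq_square algebra_simps)
  finally show ?thesis .
qed

lemma square_integrable_add:
  assumes "f \<in> square_integrable M" "g \<in> square_integrable M"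
  shows "(\<lambda>x. f x + g x) \<in> square_integrable M"
proof -
  note [measurable] = square_integrableD(1)[OF assms(1)] square_integrableD(1)[OF assms(2)]
  have "integrable M (\<lambda>x. (cmod (f x + g x))\<^sup>2)"
  proof (rule Bochner_Integration.integrable_bound)
    show "integrable M (\<lambda>x. 2 * (cmod (f x))\<^sup>2 + 2 * (cmod (g x))\<^sup>2)"
      by (intro Bochner_Integration.integrable_add integrable_mult_right square_integrableD assms)
    show "AE x in M. norm ((cmod (f x + g x))\<^sup>2) \<le> norm (2 * (cmod (f x))\<^sup>2 + 2 * (cmod (g x))\<^sup>2)"
      using cmod_add_power2_le by (intro AE_I2) (simp add: order_trans[OF _ abs_ge_self])
  qed measurable
  then show ?thesis
    by (simp add: square_integrable_def)
qed

lemma square_integrable_cmult: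
  assumes "f \<in> square_integrable M"
  shows "(\<lambda>x. c * f x) \<in> square_integrable M"
  using assms by (auto simp: square_integrable_def norm_mult power_mult_distrib)

lemma square_integrable_diff:
  assumes "f \<in> square_integrable M" "g \<in> square_integrable M"
  shows "(\<lambda>x. f x - g x) \<in> square_integrable M"
  using square_integrable_add[OF assms(1) square_integrable_cmult[OF assms(2), of "-1"]] by simp

lemma square_integrable_sum:
  assumes "\<And>i. i \<in> F \<Longrightarrow> f i \<in> square_integrable M"
  shows "(\<lambda>x. \<Sum>i\<in>F. f i x) \<in> square_integrable M"
  using assms by (induction F rule: infinite_finite_induct)
    (auto intro!: square_integrable_add simp: square_integrable_def[of M, THEN eqset_imp_iff, of "\<lambda>_. 0"])

lemma square_integrable_bounded_mult:
  assumes f: "f \<in> square_integrable M" and [measurable]: "\<phi> \<in> borel_measurable M" and B: "AE x in M. cmod (\<phi> x) \<le> B"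
  shows "(\<lambda>x. \<phi> x * f x) \<in> square_integrable M"
proof (rule square_integrableI_dominated[where w = "\<lambda>x. B * cmod (f x)"])
  show "(\<lambda>x. \<phi> x * f x) \<in> borel_measurable M"
    using square_integrableD(1)[OF f] by measurable
  show "AE x in M. cmod (\<phi> x * f x) \<le> B * cmod (f x)"
    using B by eventually_elim (simp add: norm_mult mult_right_mono)
  show "integrable M (\<lambda>x. (B * cmod (f x))\<^sup>2)"
    using square_integrableD(2)[OF f] by (simp add: power_mult_distrib)
qed

lemma integral_power2_triangle:
  assumes "f \<in> square_integrable M" "g \<in> square_integrable M"
  shows "(LINT x|M. (cmod (f x + g x))\<^sup>2) \<le> 2 * (LINT x|M. (cmod (f x))\<^sup>2) + 2 * (LINT x|M. (cmod (g x))\<^sup>2)"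
proof -
  have "(LINT x|M. (cmod (f x + g x))\<^sup>2) \<le> (LINT x|M. 2 * (cmod (f x))\<^sup>2 + 2 * (cmod (g x))\<^sup>2)"
    by (intro integral_mono square_integrableD square_integrable_add assms Bochner_Integration.integrable_add
        integrable_mult_right cmod_add_power2_le)
  also have "\<dots> = 2 * (LINT x|M. (cmod (f x))\<^sup>2) + 2 * (LINT x|M. (cmod (g x))\<^sup>2)"
    by (subst Bochner_Integration.integral_add) (auto intro: square_integrableD assms)
  finally show ?thesis .
qed

lemma dominated_convergence_power2:
  fixes f :: "nat \<Rightarrow> 'a \<Rightarrow> complex"
  assumes f: "\<And>n. f n \<in> borel_measurable M" and g: "g \<in> borel_measurable M"
    and lim: "AE x in M. (\<lambda>n. f n x) \<longlonglongrightarrow> g x"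
    and bd: "\<And>n. AE x in M. cmod (f n x) \<le> w x" and w: "integrable M (\<lambda>x. (w x)\<^sup>2)"
  shows "g \<in> square_integrable M" "(\<lambda>n. LINT x|M. (cmod (g x - f n x))\<^sup>2) \<longlonglongrightarrow> 0"
proof -
  note [measurable] = f g
  have bd': "AE x in M. \<forall>n. cmod (f n x) \<le> w x"
    using bd by (simp add: AE_all_countable)
  have gw: "AE x in M. cmod (g x) \<le> w x"
    using lim bd'
    by eventually_elim (rule LIMSEQ_le_const2[OF tendsto_norm], auto)
  then show "g \<in> square_integrable M"
    using w by (intro square_integrableI_dominated[where w = w]) auto
  have "(\<lambda>n. LINT x|M. (cmod (g x - f n x))\<^sup>2) \<longlonglongrightarrow> (LINT x|M. 0)"
  proof (rule integral_dominated_convergence[where w = "\<lambda>x. 4 * (w x)\<^sup>2"])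
    show "AE x in M. (\<lambda>n. (cmod (g x - f n x))\<^sup>2) \<longlonglongrightarrow> 0"
      using lim
    proof eventually_elim
      case (elim x)
      have "(\<lambda>n. (cmod (g x - f n x))\<^sup>2) \<longlonglongrightarrow> (cmod (g x - g x))\<^sup>2"
        by (intro tendsto_intros elim)
      then show ?case by simp
    qed
    show "AE x in M. norm ((cmod (g x - f n x))\<^sup>2) \<le> 4 * (w x)\<^sup>2" for n
      using gw bd[of n]
    proof eventually_elim
      case (elim x)
      have "(cmod (g x - f n x))\<^sup>2 \<le> (2 * w x)\<^sup>2"
        using elim norm_triangle_ineq4[of "g x" "f n x"] by (intro power_mono) auto
      then show ?case by simp
    qed
  qed (use w in auto)
  then show "(\<lambda>n. LINT x|M. (cmod (g x - f n x))\<^sup>2) \<longlonglongrightarrow> 0"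
    by simp
qed

definition closed_span :: "'a measure \<Rightarrow> 'i set \<Rightarrow> ('i \<Rightarrow> 'a \<Rightarrow> complex) \<Rightarrow> ('a \<Rightarrow> complex) set" where
  "closed_span M I e = {g \<in> square_integrable M. \<forall>\<epsilon>>0. \<exists>F c. finite F \<and> F \<subseteq> I \<and>
        (LINT x|M. (cmod (g x - (\<Sum>i\<in>F. c i * e i x)))\<^sup>2) < \<epsilon>}"

locale l2_system =
  fixes M :: "'a measure" and I :: "'i set" and e :: "'i \<Rightarrow> 'a \<Rightarrow> complex"
  assumes system: "\<And>i. i \<in> I \<Longrightarrow> e i \<in> square_integrable M"
begin

abbreviation "CS \<equiv> closed_span M I e"

lemma span_square_integrable: "F \<subseteq> I \<Longrightarrow> (\<lambda>x. \<Sum>i\<in>F. c i * e i x) \<in> square_integrable M"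
  by (intro square_integrable_sum square_integrable_cmult system) auto

lemma closed_span_square_integrable: "g \<in> CS \<Longrightarrow> g \<in> square_integrable M"
  by (simp add: closed_span_def)

lemma closed_span_limit:
  assumes g: "g \<in> square_integrable M"
    and approx: "\<And>\<epsilon>. \<epsilon> > 0 \<Longrightarrow> \<exists>h\<in>CS. (LINT x|M. (cmod (g x - h x))\<^sup>2) < \<epsilon>"
  shows "g \<in> CS"
  unfolding closed_span_def
proof (intro CollectI conjI allI impI g)
  fix \<epsilon> :: real assume e: "\<epsilon> > 0"
  obtain h where h: "h \<in> CS" "(LINT x|M. (cmod (g x - h x))\<^sup>2) < \<epsilon> / 4"
    using approx[of "\<epsilon> / 4"] e by auto
  obtain F c where F: "finite F" "F \<subseteq> I" "(LINT x|M. (cmod (h x - (\<Sum>i\<in>F. c i * e i x)))\<^sup>2) < \<epsilon> / 4"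
    using h(1) e unfolding closed_span_def by (auto dest!: spec[of _ "\<epsilon> / 4"])
  have "(LINT x|M. (cmod ((g x - h x) + (h x - (\<Sum>i\<in>F. c i * e i x))))\<^sup>2) \<le>
      2 * (LINT x|M. (cmod (g x - h x))\<^sup>2) + 2 * (LINT x|M. (cmod (h x - (\<Sum>i\<in>F. c i * e i x)))\<^sup>2)"
    by (intro integral_power2_triangle square_integrable_diff g closed_span_square_integrable h span_square_integrable F)
  also have "\<dots> < \<epsilon>"
    using h F by linarith
  finally show "\<exists>F c. finite F \<and> F \<subseteq> I \<and> (LINT x|M. (cmod (g x - (\<Sum>i\<in>F. c i * e i x)))\<^sup>2) < \<epsilon>"
    using F by (intro exI[of _ F] exI[of _ c]) (simp add: algebra_simps)
qed

lemma closed_span_dominated: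
  assumes f: "\<And>n. f n \<in> CS" and g: "g \<in> borel_measurable M"
    and lim: "AE x in M. (\<lambda>n. f n x) \<longlonglongrightarrow> g x"
    and bd: "\<And>n. AE x in M. cmod (f n x) \<le> w x" and w: "integrable M (\<lambda>x. (w x)\<^sup>2)"
  shows "g \<in> CS"
proof -
  note dc = dominated_convergence_power2[OF square_integrableD(1)[OF closed_span_square_integrable[OF f]] g lim bd w]
  show ?thesis
  proof (rule closed_span_limit[OF dc(1)])
    fix \<epsilon> :: real assume "\<epsilon> > 0"
    then have "\<forall>\<^sub>F n in sequentially. (LINT x|M. (cmod (g x - f n x))\<^sup>2) < \<epsilon>"
      using dc(2) by (simp add: order_tendstoD(2))
    then obtain n where "(LINT x|M. (cmod (g x - f n x))\<^sup>2) < \<epsilon>"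
      using eventually_happens'[OF sequentially_bot] by blast
    then show "\<exists>h\<in>CS. (LINT x|M. (cmod (g x - h x))\<^sup>2) < \<epsilon>"
      by (intro bexI[of _ "f n"] f)
  qed
qed

lemma closed_span_AE:
  assumes "f \<in> CS" "g \<in> borel_measurable M" "AE x in M. f x = g x"
  shows "g \<in> CS"
proof (rule closed_span_dominated[where f = "\<lambda>_. f" and w = "\<lambda>x. cmod (f x)"])
  show "AE x in M. (\<lambda>n. f x) \<longlonglongrightarrow> g x"
    using assms(3) by eventually_elim simp
  show "integrable M (\<lambda>x. (cmod (f x))\<^sup>2)"
    by (rule square_integrableD(2)[OF closed_span_square_integrable[OF assms(1)]])
qed (use assms in auto)

lemma span_in_closed_span:
  assumes "finite F" "F \<subseteq> I"
  shows "(\<lambda>x. \<Sum>i\<in>F. c i * e i x) \<in> CS"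
  unfolding closed_span_def
proof (intro CollectI conjI allI impI span_square_integrable assms)
  fix \<epsilon> :: real assume "\<epsilon> > 0"
  then show "\<exists>F' c'. finite F' \<and> F' \<subseteq> I \<and>
      (LINT x|M. (cmod ((\<Sum>i\<in>F. c i * e i x) - (\<Sum>i\<in>F'. c' i * e i x)))\<^sup>2) < \<epsilon>"
    using assms by (intro exI[of _ F] exI[of _ c]) simp
qed

lemma closed_span_basis:
  assumes "i \<in> I"
  shows "e i \<in> CS"
  using span_in_closed_span[of "{i}" "\<lambda>_. 1"] assms by simp

lemma closed_span_cmult:
  assumes "g \<in> CS"
  shows "(\<lambda>x. c * g x) \<in> CS"
  unfolding closed_span_def
proof (intro CollectI conjI allI impI square_integrable_cmult closed_span_square_integrable assms)
  fix \<epsilon> :: real assume e: "\<epsilon> > 0"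
  let ?\<delta> = "\<epsilon> / ((cmod c)\<^sup>2 + 1)"
  have p: "0 < (cmod c)\<^sup>2 + 1"
    by (simp add: add_nonneg_pos)
  then have "?\<delta> > 0"
    using e by simp
  then obtain F d where F: "finite F" "F \<subseteq> I" "(LINT x|M. (cmod (g x - (\<Sum>i\<in>F. d i * e i x)))\<^sup>2) < ?\<delta>"
    using assms unfolding closed_span_def by blast
  have "(LINT x|M. (cmod (c * g x - (\<Sum>i\<in>F. (c * d i) * e i x)))\<^sup>2) =
      (LINT x|M. (cmod c)\<^sup>2 * (cmod (g x - (\<Sum>i\<in>F. d i * e i x)))\<^sup>2)"
    by (intro Bochner_Integration.integral_cong refl)
      (simp add: mult.assoc sum_distrib_left[symmetric] right_diff_distrib[symmetric] norm_mult power_mult_distrib)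
  also have "\<dots> = (cmod c)\<^sup>2 * (LINT x|M. (cmod (g x - (\<Sum>i\<in>F. d i * e i x)))\<^sup>2)"
    by simp
  also have "\<dots> \<le> (cmod c)\<^sup>2 * ?\<delta>"
    using F by (intro mult_left_mono) auto
  also have "\<dots> < \<epsilon>"
    using p e by (simp add: field_simps)
  finally show "\<exists>F d. finite F \<and> F \<subseteq> I \<and> (LINT x|M. (cmod (c * g x - (\<Sum>i\<in>F. d i * e i x)))\<^sup>2) < \<epsilon>"
    using F by (intro exI[of _ F] exI[of _ "\<lambda>i. c * d i"]) auto
qed

lemma closed_span_add:
  assumes f: "f \<in> CS" and g: "g \<in> CS"
  shows "(\<lambda>x. f x + g x) \<in> CS"
proof (rule closed_span_limit)
  show "(\<lambda>x. f x + g x) \<in> square_integrable M"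
    by (intro square_integrable_add closed_span_square_integrable f g)
  fix \<epsilon> :: real assume e: "\<epsilon> > 0"
  obtain F c where F: "finite F" "F \<subseteq> I" "(LINT x|M. (cmod (f x - (\<Sum>i\<in>F. c i * e i x)))\<^sup>2) < \<epsilon> / 4"
    using f e unfolding closed_span_def by (auto dest!: spec[of _ "\<epsilon> / 4"])
  obtain G d where G: "finite G" "G \<subseteq> I" "(LINT x|M. (cmod (g x - (\<Sum>i\<in>G. d i * e i x)))\<^sup>2) < \<epsilon> / 4"
    using g e unfolding closed_span_def by (auto dest!: spec[of _ "\<epsilon> / 4"])
  let ?h = "\<lambda>x. \<Sum>i\<in>F \<union> G. ((if i \<in> F then c i else 0) + (if i \<in> G then d i else 0)) * e i x"
  have h: "?h x = (\<Sum>i\<in>F. c i * e i x) + (\<Sum>i\<in>G. d i * e i x)" for x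
  proof -
    have "?h x = (\<Sum>i\<in>F \<union> G. if i \<in> F then c i * e i x else 0) + (\<Sum>i\<in>F \<union> G. if i \<in> G then d i * e i x else 0)"
      unfolding sum.distrib[symmetric] by (intro sum.cong) (auto simp: distrib_right)
    also have "(\<Sum>i\<in>F \<union> G. if i \<in> F then c i * e i x else 0) = (\<Sum>i\<in>F. c i * e i x)"
      using F G by (intro sum.mono_neutral_cong_right) auto
    also have "(\<Sum>i\<in>F \<union> G. if i \<in> G then d i * e i x else 0) = (\<Sum>i\<in>G. d i * e i x)"
      using F G by (intro sum.mono_neutral_cong_right) auto
    finally show ?thesis .
  qed
  have "(LINT x|M. (cmod ((f x - (\<Sum>i\<in>F. c i * e i x)) + (g x - (\<Sum>i\<in>G. d i * e i x))))\<^sup>2) \<le>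
      2 * (LINT x|M. (cmod (f x - (\<Sum>i\<in>F. c i * e i x)))\<^sup>2) + 2 * (LINT x|M. (cmod (g x - (\<Sum>i\<in>G. d i * e i x)))\<^sup>2)"
    by (intro integral_power2_triangle square_integrable_diff closed_span_square_integrable f g span_square_integrable F G)
  also have "\<dots> < \<epsilon>"
    using F G by linarith
  finally have "(LINT x|M. (cmod (f x + g x - ?h x))\<^sup>2) < \<epsilon>"
    unfolding h by (simp add: algebra_simps)
  moreover have "?h \<in> CS"
    using F G by (intro span_in_closed_span) auto
  ultimately show "\<exists>h\<in>CS. (LINT x|M. (cmod (f x + g x - h x))\<^sup>2) < \<epsilon>"
    by (rule bexI)
qed

lemma closed_span_sum:
  assumes "finite F" "\<And>i. i \<in> F \<Longrightarrow> f i \<in> CS"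
  shows "(\<lambda>x. \<Sum>i\<in>F. f i x) \<in> CS"
  using assms
proof (induction F rule: finite_induct)
  case empty
  then show ?case
    using span_in_closed_span[of "{}"] by simp
next
  case (insert i F)
  then show ?case
    using closed_span_add[of "f i"] by simp
qed

lemma closed_span_multiplier:
  assumes [measurable]: "\<phi> \<in> borel_measurable M" and B: "AE x in M. cmod (\<phi> x) \<le> B"
    and basis: "\<And>i. i \<in> I \<Longrightarrow> (\<lambda>x. \<phi> x * e i x) \<in> CS" and g: "g \<in> CS"
  shows "(\<lambda>x. \<phi> x * g x) \<in> CS"
proof (rule closed_span_limit)
  note g2 = closed_span_square_integrable[OF g]
  show "(\<lambda>x. \<phi> x * g x) \<in> square_integrable M"
    by (rule square_integrable_bounded_mult[OF g2 _ B]) simp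
  fix \<epsilon> :: real assume e: "\<epsilon> > 0"
  let ?\<delta> = "\<epsilon> / (B\<^sup>2 + 1)"
  have p: "0 < B\<^sup>2 + 1"
    by (simp add: add_nonneg_pos)
  then have "?\<delta> > 0"
    using e by simp
  then obtain F c where F: "finite F" "F \<subseteq> I" "(LINT x|M. (cmod (g x - (\<Sum>i\<in>F. c i * e i x)))\<^sup>2) < ?\<delta>"
    using g unfolding closed_span_def by blast
  let ?h = "\<lambda>x. g x - (\<Sum>i\<in>F. c i * e i x)"
  have h: "?h \<in> square_integrable M"
    by (intro square_integrable_diff g2 span_square_integrable F)
  have "(LINT x|M. (cmod (\<phi> x * ?h x))\<^sup>2) \<le> (LINT x|M. B\<^sup>2 * (cmod (?h x))\<^sup>2)"
  proof (rule integral_mono_AE)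
    show "AE x in M. (cmod (\<phi> x * ?h x))\<^sup>2 \<le> B\<^sup>2 * (cmod (?h x))\<^sup>2"
      using B by eventually_elim (simp add: norm_mult power_mult_distrib mult_right_mono power_mono)
    show "integrable M (\<lambda>x. (cmod (\<phi> x * ?h x))\<^sup>2)"
      using square_integrable_bounded_mult[OF h _ B] by (simp add: square_integrable_def)
  qed (use h in \<open>simp add: square_integrable_def\<close>)
  also have "\<dots> = B\<^sup>2 * (LINT x|M. (cmod (?h x))\<^sup>2)"
    by simp
  also have "\<dots> \<le> B\<^sup>2 * ?\<delta>"
    using F by (intro mult_left_mono) auto
  also have "\<dots> < \<epsilon>"
    using p e by (simp add: field_simps)
  finally have "(LINT x|M. (cmod (\<phi> x * g x - (\<Sum>i\<in>F. c i * (\<phi> x * e i x))))\<^sup>2) < \<epsilon>"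
    by (simp add: right_diff_distrib sum_distrib_left mult.left_commute)
  moreover have "(\<lambda>x. \<Sum>i\<in>F. c i * (\<phi> x * e i x)) \<in> CS"
    using F by (intro closed_span_sum closed_span_cmult basis) auto
  ultimately show "\<exists>h\<in>CS. (LINT x|M. (cmod (\<phi> x * g x - h x))\<^sup>2) < \<epsilon>"
    by (rule bexI)
qed

lemma complete_systemI:
  assumes "\<And>g. g \<in> square_integrable M \<Longrightarrow> g \<in> CS"
  shows "complete_system M I e"
  using assms system unfolding complete_system_def closed_span_def by blast

end

text \<open>Approximating continuous functions suffices for completeness: indicators of closed sets are
  bounded limits of continuous functions, the sets whose indicators are in the closed span form a
  Dynkin system, and simple functions are dense.\<close>

locale l2_circle_system = circle_measure \<mu> + l2_system \<mu> I e for \<mu> I e +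
  assumes continuous_in_span: "\<And>f. continuous_on UNIV f \<Longrightarrow> (\<lambda>x. of_real (f x)) \<in> closed_span \<mu> I e"
begin

lemma indicator_in_span:
  assumes "A \<in> sets borel"
  shows "indicator A \<in> CS"
proof -
  have meas: "(indicator A :: complex \<Rightarrow> complex) \<in> borel_measurable \<mu>" if "A \<in> sets borel" for A :: "complex set"
    by (rule measurable_circle) (use that in measurable)
  have one: "(\<lambda>x. 1) \<in> CS"
    using continuous_in_span[of "\<lambda>_. 1"] by simp
  have A: "A \<in> sigma_sets UNIV (Collect closed)"
    using assms by (simp add: borel_eq_closed)
  have bor: "B \<in> sets borel" if "B \<in> sigma_sets UNIV (Collect closed)" for B :: "complex set"
    using that by (simp add: borel_eq_closed)
  have "Int_stable (Collect (closed :: complex set \<Rightarrow> bool))" "Collect closed \<subseteq> Pow (UNIV :: complex set)"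
    by (auto simp: Int_stable_def)
  from this A show ?thesis
  proof (induction rule: sigma_sets_induct_disjoint)
    case (basic C)
    then have C: "closed C" by simp
    show ?case
    proof (cases "C = {}")
      case True
      then show ?thesis
        using closed_span_cmult[OF one, of 0] by (simp add: indicator_def[abs_def])
    next
      case False
      \<comment> \<open>Tent functions that are \<open>1\<close> on \<open>C\<close> and decrease with slope \<open>n\<close>.\<close>
      show ?thesis
      proof (rule closed_span_dominated[where f = "\<lambda>n x. of_real (max 0 (1 - real n * infdist x C))" and w = "\<lambda>_. 1"])
        show "(\<lambda>x. of_real (max 0 (1 - real n * infdist x C))) \<in> CS" for n
          by (intro continuous_in_span continuous_intros)
        show "AE x in \<mu>. (\<lambda>n. complex_of_real (max 0 (1 - real n * infdist x C))) \<longlonglongrightarrow> indicator C x"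
        proof (rule AE_I2)
          fix x
          show "(\<lambda>n. complex_of_real (max 0 (1 - real n * infdist x C))) \<longlonglongrightarrow> indicator C x"
          proof (cases "x \<in> C")
            case True
            then show ?thesis by simp
          next
            case nx: False
            then have pos: "infdist x C > 0"
              using in_closed_iff_infdist_zero[OF C False, of x] infdist_nonneg[of x C] by linarith
            obtain n0 :: nat where "1 < real n0 * infdist x C"
              using reals_Archimedean3[OF pos] by blast
            have "max 0 (1 - real n * infdist x C) = 0" if "n \<ge> n0" for n
            proof -
              have "real n0 * infdist x C \<le> real n * infdist x C"
                using that pos by (intro mult_right_mono) auto
              then show ?thesis
                using \<open>1 < real n0 * infdist x C\<close> by simp
            qed
            then have "\<forall>\<^sub>F n in sequentially. complex_of_real (max 0 (1 - real n * infdist x C)) = indicator C x"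
              using nx by (auto simp: eventually_sequentially intro!: exI[of _ n0])
            then show ?thesis
              by (rule tendsto_eventually)
          qed
        qed
        show "AE x in \<mu>. cmod (complex_of_real (max 0 (1 - real n * infdist x C))) \<le> 1" for n
          by (rule AE_I2) (auto simp: infdist_nonneg)
      qed (use C meas in auto)
    qed
  next
    case empty
    then show ?case
      using closed_span_cmult[OF one, of 0] by (simp add: indicator_def[abs_def])
  next
    case (compl B)
    have "(\<lambda>x. 1 + (-1) * indicator B x) \<in> CS"
      by (intro closed_span_add closed_span_cmult one compl)
    moreover have "(\<lambda>x. 1 + (-1) * indicator B x) = (indicator (UNIV - B) :: complex \<Rightarrow> complex)"
      by (auto simp: indicator_def)
    ultimately show ?case
      by simp
  next
    case (union B)
    show ?case
    proof (rule closed_span_dominated[where f = "\<lambda>n x. \<Sum>i<n. indicator (B i) x" and w = "\<lambda>_. 1"])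
      show "(\<lambda>x. \<Sum>i<n. indicator (B i) x) \<in> CS" for n
        by (intro closed_span_sum union) auto
      have sum_eq: "(\<Sum>i<n. indicator (B i) x) = (indicator (\<Union>i<n. B i) x :: complex)" for n x
        using union(1) by (intro indicator_UN_disjoint[symmetric]) (auto intro: disjoint_family_on_mono)
      show "AE x in \<mu>. (\<lambda>n. \<Sum>i<n. indicator (B i) x) \<longlonglongrightarrow> (indicator (\<Union>i. B i) x :: complex)"
        unfolding sum_eq by (intro AE_I2 LIMSEQ_indicator_UN)
      show "AE x in \<mu>. cmod (\<Sum>i<n. indicator (B i) x) \<le> 1" for n
        unfolding sum_eq by (rule AE_I2) (simp add: indicator_def)
      have "B i \<in> sets borel" for i
        using union(2) bor by auto
      then show "(indicator (\<Union>i. B i) :: complex \<Rightarrow> complex) \<in> borel_measurable \<mu>"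
        by (intro meas) auto
    qed simp
  qed
qed

lemma complete: "complete_system \<mu> I e"
proof (rule complete_systemI)
  fix g assume g: "g \<in> square_integrable \<mu>"
  note gm = square_integrableD[OF g]
  obtain S where S: "\<And>i. simple_function \<mu> (S i)" "\<And>x. x \<in> space \<mu> \<Longrightarrow> (\<lambda>i. S i x) \<longlonglongrightarrow> g x"
    "\<And>i x. x \<in> space \<mu> \<Longrightarrow> dist (S i x) 0 \<le> 2 * dist (g x) 0"
    using borel_measurable_implies_sequence_metric[OF gm(1), of 0] by blast
  show "g \<in> CS"
  proof (rule closed_span_dominated[where f = S and w = "\<lambda>x. 2 * cmod (g x)"])
    show "S n \<in> CS" for n
    proof (rule closed_span_AE)
      let ?T = "\<lambda>x. \<Sum>y\<in>S n ` space \<mu>. y * indicator (S n -` {y} \<inter> space \<mu>) x"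
      have fin: "finite (S n ` space \<mu>)"
        using S(1) by (rule simple_functionD)
      have bor: "S n -` {y} \<inter> space \<mu> \<in> sets borel" for y
      proof -
        have "S n -` {y} \<inter> space \<mu> \<in> sets circle_borel"
          using simple_functionD(2)[OF S(1), of n "{y}"] by simp
        then show ?thesis
          unfolding circle_borel_def by (subst (asm) sets_restrict_space_iff) auto
      qed
      show "?T \<in> CS"
        by (intro closed_span_sum closed_span_cmult indicator_in_span fin bor)
      show "S n \<in> borel_measurable \<mu>"
        using S(1) by (rule borel_measurable_simple_function)
      show "AE x in \<mu>. ?T x = S n x"
      proof (rule AE_I2)
        fix x assume x: "x \<in> space \<mu>"
        have "?T x = (\<Sum>y\<in>S n ` space \<mu>. if y = S n x then y else 0)"
          using x by (intro sum.cong refl) (auto simp: indicator_def)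
        also have "\<dots> = S n x"
          using fin x by (subst sum.delta) auto
        finally show "?T x = S n x" .
      qed
    qed
    show "AE x in \<mu>. (\<lambda>i. S i x) \<longlonglongrightarrow> g x"
      using S(2) by (rule AE_I2)
    show "AE x in \<mu>. cmod (S n x) \<le> 2 * cmod (g x)" for n
      using S(3) by (intro AE_I2) (simp add: dist_norm)
    show "integrable \<mu> (\<lambda>x. (2 * cmod (g x))\<^sup>2)"
      using gm(2) by (simp add: power_mult_distrib)
  qed (rule gm)
qed

end

section \<open>Completeness of the negative powers\<close>

lemma one_minus_exp_lower:
  fixes y :: real
  assumes "0 \<le> y" "y \<le> 1"
  shows "y / 2 \<le> 1 - exp (- y)"
proof -
  have "exp (- y) \<le> 1 / (1 + y)"
    using exp_ge_add_one_self[of y] assms by (simp add: exp_minus field_simps)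
  moreover have "1 / (1 + y) \<le> 1 - y / 2"
    using assms mult_left_mono[of y 1 y] by (simp add: field_simps)
  ultimately show ?thesis
    by linarith
qed

context exponential_clark
begin

definition pole :: "nat \<Rightarrow> complex \<Rightarrow> complex" where
  "pole k z = inverse ((z - \<zeta>) ^ k)"

definition u :: "complex \<Rightarrow> complex" where
  "u x = 1 / (1 - cnj \<zeta> * x)"

text \<open>On the circle, \<open>u\<close> has real part \<open>1 / 2\<close>, so \<open>v\<close> is imaginary there.\<close>

definition v :: "complex \<Rightarrow> complex" where
  "v x = u x - 1 / 2"

lemma zeta_cnj: "\<zeta> * cnj \<zeta> = 1" "cnj \<zeta> * \<zeta> = 1"
  using zeta complex_norm_square[of \<zeta>] by (simp_all add: mult.commute)

lemma pole_eq: "pole k x = (- cnj \<zeta>) ^ k * u x ^ k"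
proof -
  have "x - \<zeta> = - \<zeta> * (1 - cnj \<zeta> * x)"
    using zeta_cnj by (simp add: algebra_simps flip: mult.assoc)
  moreover have "inverse (- \<zeta>) = - cnj \<zeta>"
    using zeta_cnj by (intro inverse_unique) simp
  ultimately have "inverse (x - \<zeta>) = - cnj \<zeta> * u x"
    by (simp add: u_def inverse_mult_distrib divide_inverse)
  then show ?thesis
    unfolding pole_def power_inverse[symmetric] by (simp only: power_mult_distrib)
qed

lemma u_power_eq: "u x ^ k = (- \<zeta>) ^ k * pole k x"
  unfolding pole_eq using zeta_cnj by (simp add: mult.assoc[symmetric] power_mult_distrib[symmetric])

lemma u_v_on_circle:
  assumes "x \<in> unit_circle" "x \<noteq> \<zeta>"
  shows "1 - cnj \<zeta> * x \<noteq> 0" "cmod (u x) = 1 / cmod (x - \<zeta>)" "Re (v x) = 0" "cmod (v x) \<le> 1 / cmod (x - \<zeta>)"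
proof -
  let ?a = "cnj \<zeta> * x"
  have eq: "x - \<zeta> = - \<zeta> * (1 - ?a)"
    using zeta_cnj by (simp add: algebra_simps flip: mult.assoc)
  then show nz: "1 - ?a \<noteq> 0"
    using assms(2) by auto
  have "cmod (x - \<zeta>) = cmod (1 - ?a)"
    unfolding eq using zeta by (simp add: norm_mult)
  then show un: "cmod (u x) = 1 / cmod (x - \<zeta>)"
    by (simp add: u_def norm_divide)
  have a: "cmod ?a = 1"
    using assms zeta by (simp add: norm_mult)
  have "1 / (1 - a) - 1 / 2 = (1 + a) / (2 * (1 - a))" if "1 - a \<noteq> 0" for a :: complex
    using that by (simp add: field_simps)
  from this[OF nz] have "v x = (1 + ?a) / (2 * (1 - ?a))"
    by (simp only: v_def u_def)
  also have "\<dots> = ((1 + ?a) * cnj (1 - ?a)) / (2 * ((1 - ?a) * cnj (1 - ?a)))"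
  proof -
    have "cnj (1 - ?a) \<noteq> 0"
      using nz by (simp only: complex_cnj_zero_iff not_False_eq_True)
    then show ?thesis
      unfolding mult.assoc[symmetric] by (rule mult_divide_mult_cancel_right[symmetric])
  qed
  also have "(1 - ?a) * cnj (1 - ?a) = of_real ((cmod (1 - ?a))\<^sup>2)"
    by (simp only: complex_norm_square)
  finally have "v x = ((1 + ?a) * cnj (1 - ?a)) / of_real (2 * (cmod (1 - ?a))\<^sup>2)"
    by simp
  moreover have "Re ((1 + ?a) * cnj (1 - ?a)) = 1 - (cmod ?a)\<^sup>2"
    unfolding cmod_power2 by (simp add: power2_eq_square algebra_simps)
  ultimately show re: "Re (v x) = 0"
    using a by (simp only: Re_divide_of_real) simp
  have "cmod (v x) = \<bar>Im (u x)\<bar>"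
    using re by (simp add: cmod_eq_Im v_def)
  also have "\<dots> \<le> cmod (u x)"
    by (rule abs_Im_le_cmod)
  finally show "cmod (v x) \<le> 1 / cmod (x - \<zeta>)"
    by (simp add: un)
qed

lemma u_measurable [measurable]: "u \<in> borel_measurable \<sigma>"
  unfolding u_def[abs_def] by (rule \<sigma>.measurable_circle) measurable

lemma v_measurable [measurable]: "v \<in> borel_measurable \<sigma>"
  unfolding v_def[abs_def] u_def by (rule \<sigma>.measurable_circle) measurable

lemma pole_measurable [measurable]: "pole k \<in> borel_measurable \<sigma>"
  unfolding pole_def[abs_def] by (rule \<sigma>.measurable_circle) measurable

lemma ident_measurable [measurable]: "(\<lambda>x. x) \<in> borel_measurable \<sigma>"
  by (rule \<sigma>.measurable_circle) measurable

lemma pole_norm: "cmod (pole k x) = (1 / cmod (x - \<zeta>)) ^ k"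
  by (simp add: pole_def norm_inverse norm_power norm_divide power_one_over inverse_eq_divide)

lemma AE_circle: "AE x in \<sigma>. x \<in> unit_circle \<and> x \<noteq> \<zeta>"
  using AE_neq_zeta AE_space by eventually_elim simp

text \<open>Squaring doubles the exponent to \<open>\<epsilon> / 2\<close>. The other half of the exponential in \<open>E\<close> dominates the
  powers.\<close>

lemma dominating_integrable:
  "integrable \<sigma> (\<lambda>x. ((1 / cmod (x - \<zeta>)) ^ m * exp (\<epsilon> / 4 / cmod (x - \<zeta>)))\<^sup>2)"
proof (rule Bochner_Integration.integrable_bound)
  let ?c = "fact (2 * m) / (\<epsilon> / 2) ^ (2 * m)"
  show "integrable \<sigma> (\<lambda>x. ?c * E x)"
    by (intro integrable_mult_right E_integrable)
  show "(\<lambda>x. ((1 / cmod (x - \<zeta>)) ^ m * exp (\<epsilon> / 4 / cmod (x - \<zeta>)))\<^sup>2) \<in> borel_measurable \<sigma>"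
    by (rule \<sigma>.measurable_circle) measurable
  show "AE x in \<sigma>. norm (((1 / cmod (x - \<zeta>)) ^ m * exp (\<epsilon> / 4 / cmod (x - \<zeta>)))\<^sup>2) \<le> norm (?c * E x)"
    using AE_neq_zeta
  proof eventually_elim
    case (elim x)
    define y where "y = 1 / cmod (x - \<zeta>)"
    have y: "y > 0"
      using elim by (simp add: y_def)
    have "(\<epsilon> / 2 * y) ^ (2 * m) / fact (2 * m) \<le> exp (\<epsilon> / 2 * y)"
      by (rule power_div_fact_le_exp) (use eps y in auto)
    then have "(\<epsilon> / 2) ^ (2 * m) * y ^ (2 * m) \<le> exp (\<epsilon> / 2 * y) * fact (2 * m)"
      by (simp only: power_mult_distrib pos_divide_le_eq[OF fact_gt_zero])
    then have b: "y ^ (2 * m) \<le> ?c * exp (\<epsilon> / 2 * y)"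
      using eps by (simp add: pos_le_divide_eq mult_ac)
    have "(y ^ m * exp (\<epsilon> / 4 * y))\<^sup>2 = y ^ (2 * m) * exp (\<epsilon> / 2 * y)"
      by (simp add: power_mult_distrib power_even_eq exp_double[symmetric] power2_eq_square[of "exp _"] exp_add[symmetric])
    also have "\<dots> \<le> ?c * exp (\<epsilon> / 2 * y) * exp (\<epsilon> / 2 * y)"
      using b by (intro mult_right_mono) auto
    also have "\<dots> = ?c * exp (\<epsilon> * y)"
      by (simp add: mult.assoc exp_add[symmetric])
    finally have "(y ^ m * exp (\<epsilon> / 4 * y))\<^sup>2 \<le> ?c * exp (\<epsilon> * y)" .
    moreover have "?c * exp (\<epsilon> * y) \<ge> 0"
      using eps by simp
    ultimately show ?case
      by (simp add: y_def E_def)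
  qed
qed

lemma power_integrable: "integrable \<sigma> (\<lambda>x. ((1 / cmod (x - \<zeta>)) ^ m)\<^sup>2)"
proof (rule Bochner_Integration.integrable_bound[OF dominating_integrable[of m]])
  show "(\<lambda>x. ((1 / cmod (x - \<zeta>)) ^ m)\<^sup>2) \<in> borel_measurable \<sigma>"
    by (rule \<sigma>.measurable_circle) measurable
  show "AE x in \<sigma>. norm (((1 / cmod (x - \<zeta>)) ^ m)\<^sup>2) \<le> norm (((1 / cmod (x - \<zeta>)) ^ m * exp (\<epsilon> / 4 / cmod (x - \<zeta>)))\<^sup>2)"
  proof (rule AE_I2)
    fix x
    have "(1 / cmod (x - \<zeta>)) ^ m * 1 \<le> (1 / cmod (x - \<zeta>)) ^ m * exp (\<epsilon> / 4 / cmod (x - \<zeta>))"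
      using eps by (intro mult_left_mono) auto
    then have "((1 / cmod (x - \<zeta>)) ^ m)\<^sup>2 \<le> ((1 / cmod (x - \<zeta>)) ^ m * exp (\<epsilon> / 4 / cmod (x - \<zeta>)))\<^sup>2"
      by (intro power_mono) auto
    then show "norm (((1 / cmod (x - \<zeta>)) ^ m)\<^sup>2) \<le> norm (((1 / cmod (x - \<zeta>)) ^ m * exp (\<epsilon> / 4 / cmod (x - \<zeta>)))\<^sup>2)"
      by simp
  qed
qed

sublocale pole: l2_system \<sigma> "{1..}" pole
proof
  fix k :: nat
  show "pole k \<in> square_integrable \<sigma>"
    by (rule square_integrableI_dominated[OF pole_measurable _ power_integrable[of k]]) (simp add: pole_norm)
qed

definition pole_span :: "(complex \<Rightarrow> complex) set" where
  "pole_span = closed_span \<sigma> {1..} pole"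

lemmas pole_span_sum = pole.closed_span_sum[folded pole_span_def]
  and pole_span_cmult = pole.closed_span_cmult[folded pole_span_def]
  and pole_span_add = pole.closed_span_add[folded pole_span_def]
  and pole_span_dominated = pole.closed_span_dominated[folded pole_span_def]
  and pole_span_AE = pole.closed_span_AE[folded pole_span_def]

lemma pole_span_basis: "0 < k \<Longrightarrow> pole k \<in> pole_span"
  unfolding pole_span_def by (rule pole.closed_span_basis) simp

lemma pole_span_multiplier:
  assumes "\<phi> \<in> borel_measurable \<sigma>" "AE x in \<sigma>. cmod (\<phi> x) \<le> B"
    and "\<And>k. 0 < k \<Longrightarrow> (\<lambda>x. \<phi> x * pole k x) \<in> pole_span" "g \<in> pole_span"
  shows "(\<lambda>x. \<phi> x * g x) \<in> pole_span"
  unfolding pole_span_def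
proof (rule pole.closed_span_multiplier[OF assms(1,2) _ assms(4)[unfolded pole_span_def]])
  show "(\<lambda>x. \<phi> x * pole i x) \<in> pole.CS" if "i \<in> {1..}" for i
    using assms(3)[of i] that by (simp add: pole_span_def)
qed

text \<open>Multiplication by \<open>v = u - 1 / 2\<close> raises the exponent of \<open>u\<close> by one or keeps it, so it remains
  positive.\<close>

lemma power_in_span: "0 < j \<Longrightarrow> (\<lambda>x. v x ^ k * u x ^ j) \<in> pole_span"
proof (induction k arbitrary: j)
  case 0
  have "(\<lambda>x. (- \<zeta>) ^ j * pole j x) \<in> pole_span"
    using 0 by (intro pole_span_cmult pole_span_basis) auto
  then show ?case
    by (simp add: u_power_eq)
next
  case (Suc k)
  have "(\<lambda>x. v x ^ k * u x ^ Suc j + (- 1 / 2) * (v x ^ k * u x ^ j)) \<in> pole_span"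
    by (intro pole_span_add pole_span_cmult Suc.IH) (use Suc.prems in auto)
  moreover have "(\<lambda>x. v x ^ k * u x ^ Suc j + (- 1 / 2) * (v x ^ k * u x ^ j)) = (\<lambda>x. v x ^ Suc k * u x ^ j)"
    by (rule ext) (simp add: v_def[of "_"] algebra_simps)
  ultimately show ?case
    by simp
qed

lemma exp_v_norm: "x \<in> unit_circle \<Longrightarrow> x \<noteq> \<zeta> \<Longrightarrow> cmod (exp (of_real t * v x)) = 1"
  using u_v_on_circle(3)[of x] by simp

text \<open>The exponential series in \<open>\<tau> v\<close> is summed under the integral. The bound on \<open>\<tau>\<close> is what makes its partial
  sums square-integrable uniformly; the factor \<open>exp (t v)\<close> that is already present has modulus one.\<close>

lemma exp_step:
  assumes IH: "\<And>k j. 0 < j \<Longrightarrow> (\<lambda>x. v x ^ k * exp (of_real t * v x) * u x ^ j) \<in> pole_span"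
    and \<tau>: "\<bar>\<tau>\<bar> \<le> \<epsilon> / 4" and j: "0 < j"
  shows "(\<lambda>x. v x ^ k * exp (of_real (t + \<tau>) * v x) * u x ^ j) \<in> pole_span"
proof (rule pole_span_dominated[where w = "\<lambda>x. (1 / cmod (x - \<zeta>)) ^ (k + j) * exp (\<epsilon> / 4 / cmod (x - \<zeta>))"
      and f = "\<lambda>n x. \<Sum>i<n. (of_real \<tau> ^ i / fact i) * (v x ^ (k + i) * exp (of_real t * v x) * u x ^ j)"])
  show "(\<lambda>x. \<Sum>i<n. (of_real \<tau> ^ i / fact i) * (v x ^ (k + i) * exp (of_real t * v x) * u x ^ j)) \<in> pole_span" for n
    by (intro pole_span_sum pole_span_cmult IH j) auto
  have eq: "(of_real \<tau> ^ i / fact i) * (v x ^ (k + i) * exp (of_real t * v x) * u x ^ j) =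
      (v x ^ k * exp (of_real t * v x) * u x ^ j) * ((of_real \<tau> * v x) ^ i / fact i)" for i x
    by (simp add: power_add power_mult_distrib)
  show "AE x in \<sigma>. (\<lambda>n. \<Sum>i<n. (of_real \<tau> ^ i / fact i) * (v x ^ (k + i) * exp (of_real t * v x) * u x ^ j)) \<longlonglongrightarrow>
      v x ^ k * exp (of_real (t + \<tau>) * v x) * u x ^ j"
  proof (rule AE_I2)
    fix x
    have "(\<lambda>i. (of_real \<tau> * v x) ^ i / fact i) sums exp (of_real \<tau> * v x)"
      using exp_converges[of "of_real \<tau> * v x"] by (simp add: scaleR_conv_of_real divide_inverse mult.commute)
    from sums_mult[OF this, of "v x ^ k * exp (of_real t * v x) * u x ^ j"]
    have "(\<lambda>n. \<Sum>i<n. (of_real \<tau> ^ i / fact i) * (v x ^ (k + i) * exp (of_real t * v x) * u x ^ j)) \<longlonglongrightarrow>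
        v x ^ k * exp (of_real t * v x) * u x ^ j * exp (of_real \<tau> * v x)"
      unfolding eq sums_def .
    moreover have "exp (of_real (t + \<tau>) * v x) = exp (of_real t * v x) * exp (of_real \<tau> * v x)"
      by (simp add: distrib_right exp_add)
    ultimately show "(\<lambda>n. \<Sum>i<n. (of_real \<tau> ^ i / fact i) * (v x ^ (k + i) * exp (of_real t * v x) * u x ^ j)) \<longlonglongrightarrow>
        v x ^ k * exp (of_real (t + \<tau>) * v x) * u x ^ j"
      by (simp only: mult_ac)
  qed
  show "AE x in \<sigma>. cmod (\<Sum>i<n. (of_real \<tau> ^ i / fact i) * (v x ^ (k + i) * exp (of_real t * v x) * u x ^ j)) \<le>
      (1 / cmod (x - \<zeta>)) ^ (k + j) * exp (\<epsilon> / 4 / cmod (x - \<zeta>))" for n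
    using AE_circle
  proof eventually_elim
    case (elim x)
    then have x: "x \<in> unit_circle" "x \<noteq> \<zeta>" by auto
    note uf = u_v_on_circle[OF x]
    let ?y = "1 / cmod (x - \<zeta>)"
    have "cmod (\<Sum>i<n. (v x ^ k * exp (of_real t * v x) * u x ^ j) * ((of_real \<tau> * v x) ^ i / fact i)) =
        (cmod (v x) ^ k * ?y ^ j) * cmod (\<Sum>i<n. (of_real \<tau> * v x) ^ i / fact i)"
      unfolding sum_distrib_left[symmetric] using exp_v_norm[OF x, of t] uf(2)
      by (simp add: norm_mult norm_power del: norm_exp_eq_Re)
    also have "\<dots> \<le> (?y ^ k * ?y ^ j) * exp (\<epsilon> / 4 * ?y)"
    proof (intro mult_mono power_mono uf(4))
      have "cmod (\<Sum>i<n. (of_real \<tau> * v x) ^ i / fact i) \<le> (\<Sum>i<n. (\<bar>\<tau>\<bar> * cmod (v x)) ^ i / fact i)"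
        by (rule sum_norm_le) (simp add: norm_mult norm_power norm_divide)
      also have "\<dots> \<le> exp (\<bar>\<tau>\<bar> * cmod (v x))"
        by (rule exp_partial_sum_le) simp
      also have "\<dots> \<le> exp (\<epsilon> / 4 * ?y)"
        using \<tau> uf(4) eps by (simp only: exp_le_cancel_iff) (intro mult_mono, auto)
      finally show "cmod (\<Sum>i<n. (of_real \<tau> * v x) ^ i / fact i) \<le> exp (\<epsilon> / 4 * ?y)" .
    qed auto
    finally show ?case
      unfolding eq by (simp add: power_add)
  qed
  show "(\<lambda>x. v x ^ k * exp (of_real (t + \<tau>) * v x) * u x ^ j) \<in> borel_measurable \<sigma>"
    by measurable
qed (rule dominating_integrable)

text \<open>The steps have the same length for every \<open>t\<close>, so finitely many of them cover any distance.\<close>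

lemma exp_in_span:
  assumes "0 < j"
  shows "(\<lambda>x. v x ^ k * exp (of_real t * v x) * u x ^ j) \<in> pole_span"
proof -
  obtain n :: nat where n: "\<bar>t\<bar> < real n * (\<epsilon> / 4)"
    using reals_Archimedean3[of "\<epsilon> / 4"] eps by auto
  have n0: "real n > 0"
    using n by (cases "n = 0") auto
  define \<tau> where "\<tau> = t / real n"
  have \<tau>: "\<bar>\<tau>\<bar> \<le> \<epsilon> / 4"
    using n n0 by (simp add: \<tau>_def field_simps)
  have "(\<lambda>x. v x ^ k * exp (of_real (real m * \<tau>) * v x) * u x ^ j) \<in> pole_span" if "0 < j" for m k j
    using that
  proof (induction m arbitrary: k j)
    case 0
    then show ?case
      using power_in_span[of j k] by simp
  next
    case (Suc m)
    have "(\<lambda>x. v x ^ k * exp (of_real (real m * \<tau> + \<tau>) * v x) * u x ^ j) \<in> pole_span"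
      by (rule exp_step[OF Suc.IH \<tau> Suc.prems])
    moreover have "real m * \<tau> + \<tau> = real (Suc m) * \<tau>"
      by (simp add: algebra_simps)
    ultimately show ?case
      by (simp only:)
  qed
  from this[OF assms, of k n] show ?thesis
    using n0 by (simp add: \<tau>_def)
qed

text \<open>Bounded functions that map the closed span into itself. By boundedness it suffices to look at the
  basis.\<close>

definition multiplier :: "(complex \<Rightarrow> complex) \<Rightarrow> bool" where
  "multiplier \<phi> \<longleftrightarrow> \<phi> \<in> borel_measurable \<sigma> \<and> (\<exists>B. AE x in \<sigma>. cmod (\<phi> x) \<le> B) \<and>
     (\<forall>k>0. (\<lambda>x. \<phi> x * pole k x) \<in> pole_span)"

lemma multiplier_closed_span:
  assumes "multiplier \<phi>" "g \<in> pole_span"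
  shows "(\<lambda>x. \<phi> x * g x) \<in> pole_span"
  using assms pole_span_multiplier[of \<phi> _ g] unfolding multiplier_def by blast

lemma multiplier_const: "multiplier (\<lambda>_. c)"
  unfolding multiplier_def by (auto intro!: pole_span_cmult pole_span_basis exI[of _ "cmod c"])

lemma multiplier_add:
  assumes "multiplier \<phi>" "multiplier \<psi>"
  shows "multiplier (\<lambda>x. \<phi> x + \<psi> x)"
proof -
  obtain B C where B: "AE x in \<sigma>. cmod (\<phi> x) \<le> B" "AE x in \<sigma>. cmod (\<psi> x) \<le> C"
    using assms by (auto simp: multiplier_def)
  have "AE x in \<sigma>. cmod (\<phi> x + \<psi> x) \<le> B + C"
    using B by eventually_elim (rule order_trans[OF norm_triangle_ineq], simp)
  then show ?thesis
    using assms unfolding multiplier_def by (auto simp: distrib_right intro!: pole_span_add)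
qed

lemma multiplier_mult:
  assumes "multiplier \<phi>" "multiplier \<psi>"
  shows "multiplier (\<lambda>x. \<phi> x * \<psi> x)"
proof -
  obtain B C where B: "AE x in \<sigma>. cmod (\<phi> x) \<le> B" "AE x in \<sigma>. cmod (\<psi> x) \<le> C"
    using assms by (auto simp: multiplier_def)
  have "AE x in \<sigma>. cmod (\<phi> x * \<psi> x) \<le> B * C"
    using B
  proof eventually_elim
    case (elim x)
    then have "0 \<le> B"
      using norm_ge_zero order_trans by blast
    with elim show ?case
      by (simp add: norm_mult mult_mono)
  qed
  moreover have "(\<lambda>x. \<phi> x * (\<psi> x * pole k x)) \<in> pole_span" if "0 < k" for k
    using assms(2) that by (intro multiplier_closed_span[OF assms(1)]) (simp add: multiplier_def)
  ultimately show ?thesis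
    using assms unfolding multiplier_def by (auto simp: mult.assoc)
qed

lemma multiplier_limit:
  assumes \<phi>: "\<And>n. multiplier (\<phi> n)" and [measurable]: "\<psi> \<in> borel_measurable \<sigma>"
    and lim: "AE x in \<sigma>. (\<lambda>n. \<phi> n x) \<longlonglongrightarrow> \<psi> x" and bd: "\<And>n. AE x in \<sigma>. cmod (\<phi> n x) \<le> B"
  shows "multiplier \<psi>"
  unfolding multiplier_def
proof (intro conjI allI impI exI[of _ B])
  have "AE x in \<sigma>. \<forall>n. cmod (\<phi> n x) \<le> B"
    using bd by (simp add: AE_all_countable)
  then show "AE x in \<sigma>. cmod (\<psi> x) \<le> B"
    using lim by eventually_elim (rule LIMSEQ_le_const2[OF tendsto_norm], auto)
  fix k :: nat assume k: "0 < k"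
  show "(\<lambda>x. \<psi> x * pole k x) \<in> pole_span"
  proof (rule pole_span_dominated[where f = "\<lambda>n x. \<phi> n x * pole k x" and w = "\<lambda>x. B * cmod (pole k x)"])
    show "(\<lambda>x. \<phi> n x * pole k x) \<in> pole_span" for n
      using \<phi>[of n] k by (simp add: multiplier_def)
    show "AE x in \<sigma>. (\<lambda>n. \<phi> n x * pole k x) \<longlonglongrightarrow> \<psi> x * pole k x"
      using lim by eventually_elim (intro tendsto_intros)
    show "AE x in \<sigma>. cmod (\<phi> n x * pole k x) \<le> B * cmod (pole k x)" for n
      using bd[of n] by eventually_elim (simp add: norm_mult mult_right_mono)
    show "integrable \<sigma> (\<lambda>x. (B * cmod (pole k x))\<^sup>2)"
      using square_integrableD(2)[OF pole.system[of k]] k by (simp add: power_mult_distrib)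
  qed measurable
qed simp

lemma multiplier_AE:
  assumes "multiplier \<phi>" "\<psi> \<in> borel_measurable \<sigma>" "AE x in \<sigma>. \<phi> x = \<psi> x"
  shows "multiplier \<psi>"
proof -
  obtain B where "AE x in \<sigma>. cmod (\<phi> x) \<le> B"
    using assms(1) by (auto simp: multiplier_def)
  moreover have "AE x in \<sigma>. (\<lambda>n::nat. \<phi> x) \<longlonglongrightarrow> \<psi> x"
    using assms(3) by eventually_elim simp
  ultimately show ?thesis
    using multiplier_limit[OF assms(1,2)] by blast
qed

lemma multiplier_sum:
  assumes "finite F" "\<And>i. i \<in> F \<Longrightarrow> multiplier (f i)"
  shows "multiplier (\<lambda>x. \<Sum>i\<in>F. f i x)"
  using assms
proof (induction F rule: finite_induct)
  case empty
  show ?case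
    using multiplier_const[of 0] by simp
next
  case (insert i F)
  then show ?case
    using multiplier_add[of "f i"] by simp
qed

lemma multiplier_exp: "multiplier (\<lambda>x. exp (of_real t * v x))"
  unfolding multiplier_def
proof (intro conjI allI impI exI[of _ 1])
  show "AE x in \<sigma>. cmod (exp (of_real t * v x)) \<le> 1"
    using AE_circle by eventually_elim (metis exp_v_norm order_refl)
  fix k :: nat assume "0 < k"
  then have "(\<lambda>x. (- cnj \<zeta>) ^ k * (v x ^ 0 * exp (of_real t * v x) * u x ^ k)) \<in> pole_span"
    by (intro pole_span_cmult exp_in_span)
  then show "(\<lambda>x. exp (of_real t * v x) * pole k x) \<in> pole_span"
    by (simp add: pole_eq mult_ac)
qed measurable

lemma multiplier_geometric:
  assumes q: "0 \<le> q" "q < 1"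
  shows "multiplier (\<lambda>x. 1 / (1 - of_real q * exp (of_real t * v x)))"
proof (rule multiplier_limit[where \<phi> = "\<lambda>n x. \<Sum>i<n. of_real (q ^ i) * exp (of_real (real i * t) * v x)" and B = "1 / (1 - q)"])
  show "multiplier (\<lambda>x. \<Sum>i<n. of_real (q ^ i) * exp (of_real (real i * t) * v x))" for n
    by (intro multiplier_sum multiplier_mult multiplier_const multiplier_exp) auto
  show "AE x in \<sigma>. (\<lambda>n. \<Sum>i<n. of_real (q ^ i) * exp (of_real (real i * t) * v x)) \<longlonglongrightarrow> 1 / (1 - of_real q * exp (of_real t * v x))"
    using AE_circle
  proof eventually_elim
    case (elim x)
    then have "cmod (of_real q * exp (of_real t * v x)) < 1"
      using exp_v_norm[of x t] q by (simp add: norm_mult del: norm_exp_eq_Re)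
    from geometric_sums[OF this] show ?case
      by (simp add: sums_def power_mult_distrib exp_of_nat_mult[symmetric] mult.assoc)
  qed
  show "AE x in \<sigma>. cmod (\<Sum>i<n. of_real (q ^ i) * exp (of_real (real i * t) * v x)) \<le> 1 / (1 - q)" for n
    using AE_circle
  proof eventually_elim
    case (elim x)
    have "cmod (\<Sum>i<n. of_real (q ^ i) * exp (of_real (real i * t) * v x)) \<le> (\<Sum>i<n. q ^ i)"
    proof (rule sum_norm_le)
      fix i
      have "cmod (exp (of_real (real i * t) * v x)) = 1"
        using elim by (intro exp_v_norm) auto
      then show "cmod (of_real (q ^ i) * exp (of_real (real i * t) * v x)) \<le> q ^ i"
        using q by (simp only: norm_mult norm_of_real) simp
    qed
    also have "\<dots> \<le> (\<Sum>i. q ^ i)"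
      using q by (intro sum_le_suminf) (auto simp: summable_geometric)
    also have "\<dots> = 1 / (1 - q)"
      using q by (simp add: suminf_geometric)
    finally show ?case .
  qed
qed measurable

text \<open>With \<open>w = 1 / 2 - s v\<close>, the quotient \<open>h / (1 - exp (- h w))\<close> tends to \<open>1 / w\<close> as \<open>h \<rightarrow> 0\<close>, and for \<open>h > 0\<close> it is
  the sum of a geometric series in the multiplier \<open>exp (h s v)\<close> with the ratio \<open>exp (- h / 2)\<close>. Since
  \<open>Re w = 1 / 2\<close>, the denominator is at least \<open>1 - exp (- h / 2) \<ge> h / 4\<close>, so the quotients are
  bounded.\<close>

lemma multiplier_resolvent:
  assumes s: "s = 1 \<or> s = (- 1 :: real)"
  shows "multiplier (\<lambda>x. 1 / (1 / 2 - of_real s * v x))"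
proof -
  define h where "h n = inverse (real (Suc n))" for n
  have h: "0 < h n" "h n \<le> 1" for n
    by (auto simp: h_def field_simps)
  have h_lim: "h \<longlonglongrightarrow> 0"
    unfolding h_def by (rule LIMSEQ_inverse_real_of_nat)
  let ?\<phi> = "\<lambda>n x. of_real (h n) * (1 / (1 - of_real (exp (- (h n / 2))) * exp (of_real (h n * s) * v x)))"
  show ?thesis
  proof (rule multiplier_limit[where \<phi> = ?\<phi> and B = 4])
    show "multiplier (?\<phi> n)" for n
      using h[of n] by (intro multiplier_mult multiplier_const multiplier_geometric) auto
    show "AE x in \<sigma>. (\<lambda>n. ?\<phi> n x) \<longlonglongrightarrow> 1 / (1 / 2 - of_real s * v x)"
      using AE_circle
    proof eventually_elim
      case (elim x)
      define w where "w = 1 / 2 - of_real s * v x"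
      have "Re w = 1 / 2"
        using u_v_on_circle(3)[of x] elim by (simp add: w_def)
      then have w: "w \<noteq> 0"
        by auto
      have "((\<lambda>z. (exp (0 + z) - exp 0) / z) \<longlongrightarrow> exp (0::complex)) (at 0)"
        by (rule DERIV_D) (rule DERIV_exp)
      then have d: "((\<lambda>z::complex. (exp z - 1) / z) \<longlongrightarrow> 1) (at 0)"
        by simp
      have "(\<lambda>n. - of_real (h n) * w) \<longlonglongrightarrow> - of_real 0 * w"
        by (intro tendsto_intros h_lim)
      then have z: "filterlim (\<lambda>n. - of_real (h n) * w) (at 0) sequentially"
        using h(1) w by (auto simp: filterlim_at less_imp_neq[THEN not_sym])
      have "(\<lambda>n. w * ((exp (- of_real (h n) * w) - 1) / (- of_real (h n) * w))) \<longlonglongrightarrow> w * 1"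
        by (intro tendsto_mult tendsto_const filterlim_compose[OF d z])
      then have "(\<lambda>n. 1 / (w * ((exp (- of_real (h n) * w) - 1) / (- of_real (h n) * w)))) \<longlonglongrightarrow> 1 / (w * 1)"
        using w by (intro tendsto_divide tendsto_const) auto
      moreover have "1 / (w * ((exp (- of_real (h n) * w) - 1) / (- of_real (h n) * w))) = ?\<phi> n x" for n
      proof -
        have e: "exp (- of_real (h n) * w) = of_real (exp (- (h n / 2))) * exp (of_real (h n * s) * v x)"
          by (simp add: w_def exp_of_real[symmetric] exp_add[symmetric] algebra_simps)
        have "w * ((exp (- of_real (h n) * w) - 1) / (- of_real (h n) * w)) = (1 - exp (- of_real (h n) * w)) / of_real (h n)"
          using w h(1)[of n] by (simp add: field_simps)
        then show ?thesis
          unfolding e by simp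
      qed
      ultimately show ?case
        by (simp add: w_def)
    qed
    show "AE x in \<sigma>. cmod (?\<phi> n x) \<le> 4" for n
      using AE_circle
    proof eventually_elim
      case (elim x)
      let ?q = "exp (- (h n / 2))"
      have "h n / 2 / 2 \<le> 1 - ?q"
        using h[of n] by (intro one_minus_exp_lower) auto
      also have "1 - ?q \<le> cmod (1 - of_real ?q * exp (of_real (h n * s) * v x))"
        using norm_triangle_ineq2[of 1 "of_real ?q * exp (of_real (h n * s) * v x)"] exp_v_norm[of x "h n * s"] elim
        by (simp add: norm_mult del: norm_exp_eq_Re)
      finally have "h n / cmod (1 - of_real ?q * exp (of_real (h n * s) * v x)) \<le> h n / (h n / 2 / 2)"
        using h[of n] by (intro divide_left_mono mult_pos_pos) auto
      also have "\<dots> = 4"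
        using h(1)[of n] by simp
      finally show ?case
        using h(1)[of n] by (simp add: norm_mult norm_divide)
    qed
  qed measurable
qed

text \<open>The resolvent \<open>1 / (1 / 2 + v)\<close> is \<open>1 / u = 1 - cnj \<zeta> x\<close>.\<close>

lemma multiplier_ident: "multiplier (\<lambda>x. x)"
proof -
  have "multiplier (\<lambda>x. \<zeta> + (- \<zeta>) * (1 / (1 / 2 - of_real (- 1) * v x)))"
    by (intro multiplier_add multiplier_mult multiplier_const multiplier_resolvent) auto
  then show ?thesis
  proof (rule multiplier_AE)
    show "AE x in \<sigma>. \<zeta> + (- \<zeta>) * (1 / (1 / 2 - of_real (- 1) * v x)) = x"
      using AE_circle
    proof eventually_elim
      case (elim x)
      have "1 / 2 - of_real (- 1) * v x = u x"
        by (simp add: v_def)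
      then have "1 / (1 / 2 - of_real (- 1) * v x) = 1 - cnj \<zeta> * x"
        by (simp add: u_def)
      then show ?case
        using zeta_cnj by (simp add: right_diff_distrib mult.assoc[symmetric])
    qed
  qed measurable
qed

text \<open>On the circle \<open>1 / 2 - v\<close> is the conjugate of \<open>u\<close>.\<close>

lemma multiplier_cnj: "multiplier cnj"
proof -
  have "multiplier (\<lambda>x. cnj \<zeta> + (- cnj \<zeta>) * (1 / (1 / 2 - of_real 1 * v x)))"
    by (intro multiplier_add multiplier_mult multiplier_const multiplier_resolvent) auto
  then show ?thesis
  proof (rule multiplier_AE)
    show "cnj \<in> borel_measurable \<sigma>"
      by (intro \<sigma>.measurable_continuous_on_circle continuous_intros)
    show "AE x in \<sigma>. cnj \<zeta> + (- cnj \<zeta>) * (1 / (1 / 2 - of_real 1 * v x)) = cnj x"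
      using AE_circle
    proof eventually_elim
      case (elim x)
      then have x: "x * cnj x = 1"
        using complex_norm_square[of x] by simp
      have nz: "1 - cnj \<zeta> * x \<noteq> 0" "cnj \<zeta> * x \<noteq> 0"
        using u_v_on_circle(1)[of x] elim zeta by auto
      have alg: "1 / (1 - 1 / (1 - a)) = 1 - 1 / a" if "1 - a \<noteq> 0" "a \<noteq> 0" for a :: complex
        using that by (simp add: field_simps)
      have "1 / 2 - of_real 1 * v x = 1 - 1 / (1 - cnj \<zeta> * x)"
        by (simp add: v_def u_def)
      then have "1 / (1 / 2 - of_real 1 * v x) = 1 - 1 / (cnj \<zeta> * x)"
        using alg[OF nz] by (simp only:)
      also have "1 / (cnj \<zeta> * x) = \<zeta> * cnj x"
      proof -
        have "(\<zeta> * cnj x) * (cnj \<zeta> * x) = (\<zeta> * cnj \<zeta>) * (x * cnj x)"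
          by (simp only: mult_ac)
        then have "1 = (\<zeta> * cnj x) * (cnj \<zeta> * x)"
          using x zeta_cnj by simp
        then show ?thesis
          unfolding nonzero_divide_eq_eq[OF nz(2)] .
      qed
      finally have "1 / (1 / 2 - of_real 1 * v x) = 1 - \<zeta> * cnj x" .
      then show ?case
        using zeta_cnj by (simp add: right_diff_distrib mult.assoc[symmetric])
    qed
  qed
qed

lemma multiplier_real_polynomial:
  assumes "real_polynomial_function p"
  shows "multiplier (\<lambda>x. of_real (p x))"
  using assms
proof (induction rule: real_polynomial_function.induct)
  case (linear f)
  interpret f: bounded_linear f by fact
  have "of_real (f x) = (of_real (f 1) / 2) * (x + cnj x) + (of_real (f \<i>) / (2 * \<i>)) * (x + (-1) * cnj x)" for x
  proof -
    have "Re x *\<^sub>R 1 + Im x *\<^sub>R \<i> = x"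
      by (simp add: complex_eq_iff)
    then have "f x = f (Re x *\<^sub>R 1 + Im x *\<^sub>R \<i>)"
      by (simp only:)
    also have "\<dots> = Re x * f 1 + Im x * f \<i>"
      by (simp add: f.add f.scaleR)
    finally show ?thesis
      by (simp add: complex_eq_iff)
  qed
  then have "(\<lambda>x. complex_of_real (f x)) =
      (\<lambda>x. (of_real (f 1) / 2) * (x + cnj x) + (of_real (f \<i>) / (2 * \<i>)) * (x + (-1) * cnj x))"
    by (rule ext)
  moreover have "multiplier (\<lambda>x. (of_real (f 1) / 2) * (x + cnj x) + (of_real (f \<i>) / (2 * \<i>)) * (x + (-1) * cnj x))"
    by (intro multiplier_add multiplier_mult multiplier_const multiplier_ident multiplier_cnj)
  ultimately show ?case
    by (rule ssubst[where P = multiplier])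
next
  case (const c)
  show ?case
    by (rule multiplier_const)
next
  case (add f g)
  show ?case
    using multiplier_add[OF add.IH] by simp
next
  case (mult f g)
  show ?case
    using multiplier_mult[OF mult.IH] by simp
qed

lemma multiplier_continuous:
  assumes f: "continuous_on unit_circle f"
  shows "multiplier (\<lambda>x. of_real (f x))"
proof -
  have "\<exists>p. real_polynomial_function p \<and> (\<forall>x\<in>unit_circle. \<bar>f x - p x\<bar> < inverse (real (Suc n)))" for n
    by (rule Stone_Weierstrass_real_polynomial_function[OF compact_sphere f, of "inverse (real (Suc n))"]) auto
  then obtain p where p: "\<And>n. real_polynomial_function (p n)"
    "\<And>n x. x \<in> unit_circle \<Longrightarrow> \<bar>f x - p n x\<bar> < inverse (real (Suc n))"
    by metis
  obtain B where B: "\<And>x. x \<in> unit_circle \<Longrightarrow> norm (f x) \<le> B"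
    using compact_imp_bounded[OF compact_continuous_image[OF f compact_sphere]]
    unfolding bounded_iff by blast
  show ?thesis
  proof (rule multiplier_limit[where \<phi> = "\<lambda>n x. of_real (p n x)" and B = "B + 1"])
    show "multiplier (\<lambda>x. of_real (p n x))" for n
      by (rule multiplier_real_polynomial[OF p(1)])
    show "(\<lambda>x. complex_of_real (f x)) \<in> borel_measurable \<sigma>"
      by (intro \<sigma>.measurable_continuous_on_circle continuous_intros f)
    show "AE x in \<sigma>. (\<lambda>n. complex_of_real (p n x)) \<longlonglongrightarrow> of_real (f x)"
    proof (rule AE_I2)
      fix x assume "x \<in> space \<sigma>"
      then have x: "x \<in> unit_circle" by simp
      have "(\<lambda>n. p n x - f x) \<longlonglongrightarrow> 0"
        by (rule Lim_null_comparison[OF _ LIMSEQ_inverse_real_of_nat])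
          (use p(2)[OF x] in \<open>auto simp: abs_minus_commute less_imp_le intro!: always_eventually\<close>)
      then show "(\<lambda>n. complex_of_real (p n x)) \<longlonglongrightarrow> of_real (f x)"
        by (intro tendsto_of_real) (simp add: LIM_zero_iff)
    qed
    show "AE x in \<sigma>. cmod (complex_of_real (p n x)) \<le> B + 1" for n
    proof (rule AE_I2)
      fix x assume "x \<in> space \<sigma>"
      then have x: "x \<in> unit_circle" by simp
      have "inverse (real (Suc n)) \<le> 1"
        by (simp add: field_simps)
      then show "cmod (complex_of_real (p n x)) \<le> B + 1"
        using B[OF x] p(2)[OF x, of n] by simp
    qed
  qed
qed

sublocale l2_circle_system \<sigma> "{1..}" pole
proof
  fix f :: "complex \<Rightarrow> real" assume "continuous_on UNIV f"
  then have f: "continuous_on unit_circle f"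
    by (rule continuous_on_subset) simp
  \<comment> \<open>A continuous function \<open>f\<close> is the product of the multiplier \<open>f (x - \<zeta>)\<close> and the first pole.\<close>
  have "multiplier (\<lambda>x. of_real (f x) * (x + (- \<zeta>)))"
    by (intro multiplier_mult multiplier_add multiplier_const multiplier_ident multiplier_continuous f)
  then have "(\<lambda>x. of_real (f x) * (x + (- \<zeta>)) * pole 1 x) \<in> pole_span"
    by (rule multiplier_closed_span) (rule pole_span_basis, simp)
  then show "(\<lambda>x. of_real (f x)) \<in> closed_span \<sigma> {1..} pole"
    unfolding pole_span_def[symmetric]
  proof (rule pole_span_AE)
    show "(\<lambda>x. complex_of_real (f x)) \<in> borel_measurable \<sigma>"
      by (intro \<sigma>.measurable_continuous_on_circle continuous_intros f)
    show "AE x in \<sigma>. of_real (f x) * (x + (- \<zeta>)) * pole 1 x = of_real (f x)"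
      using AE_neq_zeta by eventually_elim (simp add: pole_def)
  qed
qed

proposition strong_localization: "strong_localization_point \<theta> \<zeta>"
  unfolding strong_localization_point_def
  using zeta_in_AC alpha clark no_atom complete unfolding pole_def[abs_def] by blast

end

section \<open>Hardy space and model space\<close>

lemma square_integrable_integrable_mult:
  assumes "f \<in> square_integrable M" "g \<in> square_integrable M"
  shows "integrable M (\<lambda>x. f x * cnj (g x))"
proof (rule Bochner_Integration.integrable_bound)
  show "integrable M (\<lambda>x. (cmod (f x))\<^sup>2 + (cmod (g x))\<^sup>2)"
    by (intro Bochner_Integration.integrable_add square_integrableD assms)
  have "cnj \<in> borel_measurable borel"
    by (intro borel_measurable_continuous_onI continuous_intros)
  then show "(\<lambda>x. f x * cnj (g x)) \<in> borel_measurable M"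
    using square_integrableD(1)[OF assms(1)] measurable_compose[OF square_integrableD(1)[OF assms(2)]]
    by (intro borel_measurable_times) auto
  show "AE x in M. norm (f x * cnj (g x)) \<le> norm ((cmod (f x))\<^sup>2 + (cmod (g x))\<^sup>2)"
  proof (rule AE_I2)
    fix x
    have "2 * (cmod (f x) * cmod (g x)) \<le> (cmod (f x))\<^sup>2 + (cmod (g x))\<^sup>2"
      using zero_le_power2[of "cmod (f x) - cmod (g x)"] by (simp add: power2_eq_square algebra_simps)
    moreover have "0 \<le> cmod (f x) * cmod (g x)"
      by simp
    ultimately have "cmod (f x) * cmod (g x) \<le> (cmod (f x))\<^sup>2 + (cmod (g x))\<^sup>2"
      by linarith
    then show "norm (f x * cnj (g x)) \<le> norm ((cmod (f x))\<^sup>2 + (cmod (g x))\<^sup>2)"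
      by (simp add: norm_mult)
  qed
qed

lemma l2_cauchy_schwarz:
  assumes f: "f \<in> square_integrable M" and g: "g \<in> square_integrable M"
  shows "(cmod (LINT x|M. f x * cnj (g x)))\<^sup>2 \<le> (LINT x|M. (cmod (f x))\<^sup>2) * (LINT x|M. (cmod (g x))\<^sup>2)"
proof -
  let ?Z = "LINT x|M. f x * cnj (g x)" and ?A = "LINT x|M. (cmod (f x))\<^sup>2" and ?B = "LINT x|M. (cmod (g x))\<^sup>2"
  \<comment> \<open>The squared norm of \<open>f - t Z g\<close>.\<close>
  have quad: "0 \<le> ?A - 2 * t * (cmod ?Z)\<^sup>2 + t\<^sup>2 * (cmod ?Z)\<^sup>2 * ?B" for t :: real
  proof -
    let ?l = "of_real t * ?Z"
    have pt: "(cmod (f x - ?l * g x))\<^sup>2 = (cmod (f x))\<^sup>2 - 2 * Re (cnj ?l * (f x * cnj (g x))) + (cmod ?l)\<^sup>2 * (cmod (g x))\<^sup>2" for x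
      unfolding cmod_diff_power2 by (simp add: norm_mult power_mult_distrib mult_ac)
    have int: "integrable M (\<lambda>x. cnj ?l * (f x * cnj (g x)))"
      by (intro integrable_mult_right square_integrable_integrable_mult f g)
    have "0 \<le> (LINT x|M. (cmod (f x - ?l * g x))\<^sup>2)"
      by (intro integral_nonneg_AE AE_I2) simp
    also have "\<dots> = (LINT x|M. (cmod (f x))\<^sup>2 - 2 * Re (cnj ?l * (f x * cnj (g x)))) + (LINT x|M. (cmod ?l)\<^sup>2 * (cmod (g x))\<^sup>2)"
      unfolding pt
      by (intro Bochner_Integration.integral_add Bochner_Integration.integrable_diff integrable_mult_right
          square_integrableD f g integrable_Re int)
    also have "(LINT x|M. (cmod (f x))\<^sup>2 - 2 * Re (cnj ?l * (f x * cnj (g x)))) = ?A - (LINT x|M. 2 * Re (cnj ?l * (f x * cnj (g x))))"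
      by (intro Bochner_Integration.integral_diff integrable_mult_right square_integrableD f g integrable_Re int)
    also have "(LINT x|M. 2 * Re (cnj ?l * (f x * cnj (g x)))) = 2 * (LINT x|M. Re (cnj ?l * (f x * cnj (g x))))"
      by (rule integral_mult_right_zero)
    also have "(LINT x|M. Re (cnj ?l * (f x * cnj (g x)))) = Re (LINT x|M. cnj ?l * (f x * cnj (g x)))"
      by (rule integral_Re[OF int])
    also have "(LINT x|M. cnj ?l * (f x * cnj (g x))) = cnj ?l * ?Z"
      by (rule integral_mult_right_zero)
    also have "(LINT x|M. (cmod ?l)\<^sup>2 * (cmod (g x))\<^sup>2) = (cmod ?l)\<^sup>2 * ?B"
      by (rule integral_mult_right_zero)
    also have "Re (cnj ?l * ?Z) = t * (cmod ?Z)\<^sup>2"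
      unfolding cmod_power2 by (simp add: power2_eq_square algebra_simps)
    also have "(cmod ?l)\<^sup>2 = t\<^sup>2 * (cmod ?Z)\<^sup>2"
      by (simp add: norm_mult power_mult_distrib)
    finally show ?thesis
      by simp
  qed
  have A: "0 \<le> ?A" and B: "0 \<le> ?B"
    by (intro integral_nonneg_AE AE_I2; simp)+
  show ?thesis
  proof (cases "?B = 0")
    case True
    show ?thesis
    proof (rule ccontr)
      assume "\<not> ?thesis"
      then have z: "(cmod ?Z)\<^sup>2 > 0"
        using True by simp
      have "2 * ((?A + 1) / (cmod ?Z)\<^sup>2) * (cmod ?Z)\<^sup>2 \<le> ?A"
        using quad[of "(?A + 1) / (cmod ?Z)\<^sup>2"] True by simp
      moreover have "2 * ((?A + 1) / (cmod ?Z)\<^sup>2) * (cmod ?Z)\<^sup>2 = 2 * (?A + 1)"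
        using z by simp
      ultimately have "2 * (?A + 1) \<le> ?A"
        by (simp only:)
      then show False
        using A by (simp add: not_le[symmetric])
    qed
  next
    case False
    then have Bp: "?B > 0"
      using B by linarith
    have "0 \<le> ?A - 2 * (1 / ?B) * (cmod ?Z)\<^sup>2 + (1 / ?B)\<^sup>2 * (cmod ?Z)\<^sup>2 * ?B"
      by (rule quad)
    also have "(1 / ?B)\<^sup>2 * (cmod ?Z)\<^sup>2 * ?B = (1 / ?B) * (cmod ?Z)\<^sup>2"
      using Bp by (simp add: power2_eq_square)
    finally have "(1 / ?B) * (cmod ?Z)\<^sup>2 \<le> ?A"
      by (simp add: algebra_simps)
    then show ?thesis
      using Bp by (simp add: field_simps)
  qed
qed

lemma (in circle_measure) square_integrable_continuous:
  assumes "continuous_on unit_circle f"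
  shows "f \<in> square_integrable \<mu>"
  unfolding square_integrable_def
  by (intro CollectI conjI measurable_continuous_on_circle integrable_continuous_on_circle continuous_intros assms)

lemma circle_parseval_norm:
  assumes f: "f holomorphic_on unit_disc" and r: "0 \<le> r" "r < 1"
  shows "(\<lambda>n. (cmod (taylor_coeff f n))\<^sup>2 * r ^ (2 * n)) sums (LINT \<xi>|circle_lebesgue. (cmod (f (of_real r * \<xi>)))\<^sup>2)"
proof -
  have "(LINT \<xi>|circle_lebesgue. f (of_real r * \<xi>) * cnj (f (of_real r * \<xi>))) =
      of_real (LINT \<xi>|circle_lebesgue. (cmod (f (of_real r * \<xi>)))\<^sup>2)"
    by (simp only: complex_norm_square[symmetric] integral_complex_of_real)
  then have "(\<lambda>n. complex_of_real ((cmod (taylor_coeff f n))\<^sup>2 * r ^ (2 * n))) sums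
      of_real (LINT \<xi>|circle_lebesgue. (cmod (f (of_real r * \<xi>)))\<^sup>2)"
    using circle_parseval[OF f f r] by (simp only: complex_norm_square[symmetric] of_real_mult of_real_power)
  then show ?thesis
    by (simp only: sums_of_real_iff)
qed

lemma hardy2D:
  assumes "f \<in> hardy2"
  shows "f holomorphic_on unit_disc"
    "\<exists>K\<ge>0. \<forall>r. 0 \<le> r \<longrightarrow> r < 1 \<longrightarrow> (LINT \<xi>|circle_lebesgue. (cmod (f (of_real r * \<xi>)))\<^sup>2) \<le> K"
proof -
  show "f holomorphic_on unit_disc"
    using assms by (simp add: hardy2_def)
  obtain K where K: "\<And>r. r \<in> {0..<1} \<Longrightarrow> (LINT \<xi>|circle_lebesgue. (cmod (f (of_real r * \<xi>)))\<^sup>2) \<le> K"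
    using assms unfolding hardy2_def bdd_above_def by blast
  then show "\<exists>K\<ge>0. \<forall>r. 0 \<le> r \<longrightarrow> r < 1 \<longrightarrow> (LINT \<xi>|circle_lebesgue. (cmod (f (of_real r * \<xi>)))\<^sup>2) \<le> K"
    by (intro exI[of _ "max K 0"]) (auto simp: le_max_iff_disj)
qed

lemma hardy2_bounded:
  assumes g: "g holomorphic_on unit_disc" and B: "\<And>z. cmod z < 1 \<Longrightarrow> cmod (g z) \<le> B"
  shows "g \<in> hardy2"
proof -
  have "(LINT \<xi>|circle_lebesgue. (cmod (g (of_real r * \<xi>)))\<^sup>2) \<le> B\<^sup>2" if r: "r \<in> {0..<1}" for r
  proof -
    have "(LINT \<xi>|circle_lebesgue. (cmod (g (of_real r * \<xi>)))\<^sup>2) \<le> (LINT \<xi>|circle_lebesgue. B\<^sup>2)"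
    proof (rule integral_mono)
      show "integrable circle_lebesgue (\<lambda>\<xi>. (cmod (g (of_real r * \<xi>)))\<^sup>2)"
        using r by (intro lebesgue.integrable_continuous_on_circle continuous_intros dilate_holomorphic_continuous_on_circle[OF g]) auto
      fix \<xi> assume "\<xi> \<in> space circle_lebesgue"
      then show "(cmod (g (of_real r * \<xi>)))\<^sup>2 \<le> B\<^sup>2"
        using r by (intro power_mono B) (auto simp: norm_mult)
    qed simp
    then show ?thesis
      by simp
  qed
  then have "bdd_above ((\<lambda>r. LINT \<xi>|circle_lebesgue. (cmod (g (of_real r * \<xi>)))\<^sup>2) ` {0..<1})"
    by (rule bdd_aboveI2)
  then show ?thesis
    using g unfolding hardy2_def by blast
qed

lemma hardy2_summable:
  assumes "f \<in> hardy2"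
  shows "summable (\<lambda>n. (cmod (taylor_coeff f n))\<^sup>2)"
proof -
  obtain K where K: "\<And>r. 0 \<le> r \<Longrightarrow> r < 1 \<Longrightarrow> (LINT \<xi>|circle_lebesgue. (cmod (f (of_real r * \<xi>)))\<^sup>2) \<le> K"
    using hardy2D(2)[OF assms] by auto
  have part: "(\<Sum>n<N. (cmod (taylor_coeff f n))\<^sup>2) \<le> K" for N
  proof -
    have "(\<Sum>n<N. (cmod (taylor_coeff f n))\<^sup>2 * r ^ (2 * n)) \<le> K" if r: "0 < r" "r < 1" for r
    proof -
      note s = circle_parseval_norm[OF hardy2D(1)[OF assms], of r]
      have "(\<Sum>n<N. (cmod (taylor_coeff f n))\<^sup>2 * r ^ (2 * n)) \<le> (\<Sum>n. (cmod (taylor_coeff f n))\<^sup>2 * r ^ (2 * n))"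
        using s r by (intro sum_le_suminf) (auto simp: sums_iff)
      also have "\<dots> \<le> K"
        using s r K[of r] by (simp add: sums_iff)
      finally show ?thesis .
    qed
    moreover note eventually_radius_less_1
    ultimately have "\<forall>\<^sub>F r in at_left (1::real). (\<Sum>n<N. (cmod (taylor_coeff f n))\<^sup>2 * r ^ (2 * n)) \<le> K"
      by (auto elim!: eventually_mono)
    moreover have "((\<lambda>r. \<Sum>n<N. (cmod (taylor_coeff f n))\<^sup>2 * r ^ (2 * n)) \<longlongrightarrow> (\<Sum>n<N. (cmod (taylor_coeff f n))\<^sup>2 * 1 ^ (2 * n))) (at_left (1::real))"
      by (intro tendsto_intros)
    ultimately have "(\<Sum>n<N. (cmod (taylor_coeff f n))\<^sup>2 * 1 ^ (2 * n)) \<le> K"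
      by (intro tendsto_upperbound) auto
    then show ?thesis
      by simp
  qed
  show ?thesis
    by (rule summableI_nonneg_bounded[OF _ part]) simp
qed

text \<open>By Parseval's identity the means are power series in \<open>r\<^sup>2\<close> whose coefficients are absolutely
  summable, so they are continuous up to \<open>r = 1\<close>.\<close>

lemma hardy_inner_tendsto:
  assumes f: "f \<in> hardy2" and g: "g \<in> hardy2"
  shows "((\<lambda>r. LINT \<xi>|circle_lebesgue. f (of_real r * \<xi>) * cnj (g (of_real r * \<xi>))) \<longlongrightarrow> hardy_inner f g) (at_left (1::real))"
proof -
  define c where "c n = taylor_coeff f n * cnj (taylor_coeff g n)" for n
  have c: "summable (\<lambda>n. cmod (c n))"
  proof (rule summable_comparison_test')
    show "summable (\<lambda>n. (cmod (taylor_coeff f n))\<^sup>2 + (cmod (taylor_coeff g n))\<^sup>2)"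
      by (intro summable_add hardy2_summable f g)
    fix n :: nat
    have "2 * (cmod (taylor_coeff f n) * cmod (taylor_coeff g n)) \<le> (cmod (taylor_coeff f n))\<^sup>2 + (cmod (taylor_coeff g n))\<^sup>2"
      using zero_le_power2[of "cmod (taylor_coeff f n) - cmod (taylor_coeff g n)"] by (simp add: power2_eq_square algebra_simps)
    moreover have "0 \<le> cmod (taylor_coeff f n) * cmod (taylor_coeff g n)"
      by simp
    moreover have "norm (cmod (c n)) = cmod (taylor_coeff f n) * cmod (taylor_coeff g n)"
      by (simp add: c_def norm_mult)
    ultimately show "norm (cmod (c n)) \<le> (cmod (taylor_coeff f n))\<^sup>2 + (cmod (taylor_coeff g n))\<^sup>2"
      by linarith
  qed
  have "uniform_limit {0..1} (\<lambda>N r. \<Sum>n<N. c n * of_real r ^ (2 * n)) (\<lambda>r. \<Sum>n. c n * of_real r ^ (2 * n)) sequentially"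
  proof (rule Weierstrass_m_test[OF _ c])
    show "norm (c n * of_real r ^ (2 * n)) \<le> cmod (c n)" if "r \<in> {0..1}" for n and r :: real
      using that by (auto simp: norm_mult norm_power power_le_one intro!: mult_left_le)
  qed
  then have "continuous_on {0..1} (\<lambda>r::real. \<Sum>n. c n * of_real r ^ (2 * n))"
    by (rule uniform_limit_theorem[rotated]) (auto intro!: always_eventually continuous_intros)
  then have "((\<lambda>r::real. \<Sum>n. c n * of_real r ^ (2 * n)) \<longlongrightarrow> (\<Sum>n. c n * of_real 1 ^ (2 * n))) (at_left 1)"
    by (rule continuous_on_Icc_at_leftD) simp
  moreover from eventually_radius_less_1 have "\<forall>\<^sub>F r in at_left (1::real). (\<Sum>n. c n * of_real r ^ (2 * n)) =
      (LINT \<xi>|circle_lebesgue. f (of_real r * \<xi>) * cnj (g (of_real r * \<xi>)))"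
  proof eventually_elim
    case (elim r)
    show ?case
      unfolding c_def
      by (rule sums_unique[OF circle_parseval[OF hardy2D(1)[OF f] hardy2D(1)[OF g]], symmetric]) (use elim in simp_all)
  qed
  ultimately have "((\<lambda>r. LINT \<xi>|circle_lebesgue. f (of_real r * \<xi>) * cnj (g (of_real r * \<xi>))) \<longlongrightarrow>
      (\<Sum>n. c n * of_real 1 ^ (2 * n))) (at_left (1::real))"
    by (rule Lim_transform_eventually)
  moreover from this have "hardy_inner f g = (\<Sum>n. c n * of_real 1 ^ (2 * n))"
    unfolding hardy_inner_def by (rule tendsto_Lim[OF trivial_limit_at_left_real])
  ultimately show ?thesis
    by (simp only:)
qed

lemma circle_integral_cauchy_kernel:
  assumes f: "f holomorphic_on unit_disc" and r: "0 \<le> r" "r < 1" and w: "cmod w < 1"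
  shows "(LINT \<xi>|circle_lebesgue. f (of_real r * \<xi>) * cnj (1 / (1 - cnj w * (of_real r * \<xi>)))) = f (of_real r ^ 2 * w)"
proof -
  note cont = dilate_holomorphic_continuous_on_circle[OF f r]
  obtain B where B: "\<And>x. x \<in> unit_circle \<Longrightarrow> norm (f (of_real r * x)) \<le> B"
    using compact_imp_bounded[OF compact_continuous_image[OF cont compact_sphere]]
    unfolding bounded_iff by blast
  have rw: "cmod (of_real r * w) < 1"
    using mult_mono[of r 1 "cmod w" "cmod w"] r w by (simp add: norm_mult)
  have "(\<lambda>n. (of_real r * w) ^ n * (LINT \<xi>|circle_lebesgue. f (of_real r * \<xi>) * cnj \<xi> ^ n)) sums
      (LINT \<xi>|circle_lebesgue. f (of_real r * \<xi>) * cnj (1 / (1 - cnj w * (of_real r * \<xi>))))"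
  proof (rule lebesgue.integral_absolutely_convergent_series)
    show "summable (\<lambda>n. cmod ((of_real r * w) ^ n))"
      using rw by (simp add: norm_power summable_geometric)
    show "continuous_on unit_circle (\<lambda>\<xi>. f (of_real r * \<xi>) * cnj \<xi> ^ n)" for n
      by (intro continuous_intros cont)
    show "cmod (f (of_real r * x) * cnj x ^ n) \<le> B" if "x \<in> unit_circle" for n x
      using B[OF that] that by (simp add: norm_mult norm_power)
    show "(\<lambda>n. (of_real r * w) ^ n * (f (of_real r * x) * cnj x ^ n)) sums
        (f (of_real r * x) * cnj (1 / (1 - cnj w * (of_real r * x))))" if "x \<in> unit_circle" for x
    proof -
      have "cmod (of_real r * w * cnj x) < 1"
        using rw that by (simp add: norm_mult)
      from sums_mult[OF geometric_sums[OF this], of "f (of_real r * x)"] show ?thesis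
        by (simp add: power_mult_distrib mult_ac)
    qed
  qed
  then have "(\<lambda>n. taylor_coeff f n * (of_real r ^ 2 * w) ^ n) sums
      (LINT \<xi>|circle_lebesgue. f (of_real r * \<xi>) * cnj (1 / (1 - cnj w * (of_real r * \<xi>))))"
    unfolding circle_moment_cnj_power[OF f r] by (simp add: power_mult_distrib power2_eq_square mult_ac)
  moreover have "cmod (of_real r ^ 2 * w) < 1"
    using mult_mono[of "r\<^sup>2" 1 "cmod w" "cmod w"] r w by (simp add: norm_mult norm_power power_le_one)
  then have "(\<lambda>n. taylor_coeff f n * (of_real r ^ 2 * w) ^ n) sums f (of_real r ^ 2 * w)"
    by (rule taylor_sums[OF f])
  ultimately show ?thesis
    by (rule sums_unique2)
qed

text \<open>The coefficients are conjugated, which makes the pairing of a function \<open>p\<close> with the sum equal to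
  \<open>\<Sum>w\<in>F. c w * p w\<close>.\<close>

definition kernel_sum :: "complex set \<Rightarrow> (complex \<Rightarrow> complex) \<Rightarrow> complex \<Rightarrow> complex" where
  "kernel_sum F c z = (\<Sum>w\<in>F. cnj (c w) * (1 / (1 - cnj w * z)))"

lemma kernel_sum_bounded:
  assumes F: "finite F" "F \<subseteq> unit_disc"
  shows "kernel_sum F c holomorphic_on unit_disc" "\<exists>B. \<forall>z. cmod z < 1 \<longrightarrow> cmod (kernel_sum F c z) \<le> B"
proof -
  show "kernel_sum F c holomorphic_on unit_disc"
    unfolding kernel_sum_def[abs_def] using F(2) disc_denominator_nonzero
    by (intro holomorphic_intros) (auto simp: subset_iff)
  show "\<exists>B. \<forall>z. cmod z < 1 \<longrightarrow> cmod (kernel_sum F c z) \<le> B"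
  proof (intro exI allI impI)
    fix z :: complex assume z: "cmod z < 1"
    show "cmod (kernel_sum F c z) \<le> (\<Sum>w\<in>F. cmod (c w) * (1 / (1 - cmod w)))"
      unfolding kernel_sum_def
    proof (rule sum_norm_le)
      fix w assume "w \<in> F"
      then have w: "cmod w < 1" using F by auto
      have "1 - cmod w \<le> cmod (1 - cnj w * z)"
        using norm_triangle_ineq2[of 1 "cnj w * z"] mult_left_le[of "cmod z" "cmod w"] z by (simp add: norm_mult)
      moreover from this have "0 < cmod (1 - cnj w * z)"
        using w by linarith
      ultimately have "1 / cmod (1 - cnj w * z) \<le> 1 / (1 - cmod w)"
        using w by (intro divide_left_mono mult_pos_pos) simp_all
      from mult_left_mono[OF this norm_ge_zero[of "c w"]]
      show "cmod (cnj (c w) * (1 / (1 - cnj w * z))) \<le> cmod (c w) * (1 / (1 - cmod w))"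
        by (simp only: norm_mult norm_divide norm_one complex_mod_cnj)
    qed
  qed
qed

lemma kernel_sum_pairing_tendsto:
  assumes p: "p holomorphic_on unit_disc" and F: "finite F" "F \<subseteq> unit_disc"
  shows "((\<lambda>r. LINT \<xi>|circle_lebesgue. p (of_real r * \<xi>) * cnj (kernel_sum F c (of_real r * \<xi>))) \<longlongrightarrow>
    (\<Sum>w\<in>F. c w * p w)) (at_left (1::real))"
proof (rule Lim_transform_eventually)
  show "((\<lambda>r. \<Sum>w\<in>F. c w * p (of_real r ^ 2 * w)) \<longlongrightarrow> (\<Sum>w\<in>F. c w * p w)) (at_left (1::real))"
  proof (intro tendsto_sum tendsto_mult tendsto_const)
    fix w assume "w \<in> F"
    then have w: "w \<in> unit_disc" using F by auto
    have "((\<lambda>r. of_real r ^ 2 * w) \<longlongrightarrow> of_real 1 ^ 2 * w) (at_left (1::real))"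
      by (intro tendsto_intros)
    then have "((\<lambda>r. of_real r ^ 2 * w) \<longlongrightarrow> w) (at_left (1::real))"
      by simp
    moreover have "isCont p w"
      using p w by (meson continuous_on_eq_continuous_at holomorphic_on_imp_continuous_on open_ball)
    ultimately show "((\<lambda>r. p (of_real r ^ 2 * w)) \<longlongrightarrow> p w) (at_left (1::real))"
      by (rule isCont_tendsto_compose[rotated])
  qed
  from eventually_radius_less_1 show "\<forall>\<^sub>F r in at_left (1::real). (\<Sum>w\<in>F. c w * p (of_real r ^ 2 * w)) =
      (LINT \<xi>|circle_lebesgue. p (of_real r * \<xi>) * cnj (kernel_sum F c (of_real r * \<xi>)))"
  proof eventually_elim
    case (elim r)
    have k: "(\<lambda>z. 1 / (1 - cnj w * z)) holomorphic_on unit_disc" if "w \<in> F" for w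
      using F(2) that disc_denominator_nonzero[of w] by (intro holomorphic_intros) auto
    have "(LINT \<xi>|circle_lebesgue. p (of_real r * \<xi>) * cnj (kernel_sum F c (of_real r * \<xi>))) =
        (LINT \<xi>|circle_lebesgue. (\<Sum>w\<in>F. c w * (p (of_real r * \<xi>) * cnj (1 / (1 - cnj w * (of_real r * \<xi>))))))"
      unfolding kernel_sum_def cnj_sum sum_distrib_left complex_cnj_mult complex_cnj_cnj
      by (intro Bochner_Integration.integral_cong sum.cong refl) (simp only: mult_ac)
    also have "\<dots> = (\<Sum>w\<in>F. (LINT \<xi>|circle_lebesgue. c w * (p (of_real r * \<xi>) * cnj (1 / (1 - cnj w * (of_real r * \<xi>))))))"
      using elim by (intro Bochner_Integration.integral_sum lebesgue.integrable_continuous_on_circle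
          continuous_on_mult continuous_on_const continuous_on_cnj dilate_holomorphic_continuous_on_circle[OF p]
          dilate_holomorphic_continuous_on_circle[OF k]) auto
    also have "\<dots> = (\<Sum>w\<in>F. c w * p (of_real r ^ 2 * w))"
      using elim F by (intro sum.cong refl) (subst integral_mult_right_zero, subst circle_integral_cauchy_kernel[OF p], auto)
    finally show ?case ..
  qed
qed

text \<open>Write \<open>\<langle>\<cdot>, \<cdot>\<rangle>\<close> for the inner product of the Hardy space. With \<open>s\<close> and \<open>t\<close> the sums of Cauchy
  kernels for the coefficients \<open>d\<close> and \<open>d \<theta>\<close>, the function \<open>s - \<theta> t\<close> is the corresponding
  sum of reproducing kernels of the model space. As \<open>f\<close> is orthogonal to \<open>\<theta> t\<close>, the sum \<open>\<Sum> d f\<close> is \<open>\<langle>f, s - \<theta> t\<rangle>\<close>. The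
  Cauchy-Schwarz inequality is applied on circles of radius \<open>r < 1\<close>, and \<open>|\<theta> t| \<le> |t|\<close> bounds the squared
  norm of \<open>s - \<theta> t\<close> by \<open>\<langle>s, s\<rangle> - 2 Re \<langle>\<theta> t, s\<rangle> + \<langle>t, t\<rangle>\<close>, whose limit is the
  quadratic form of the reproducing kernel.\<close>

proposition (in disc_self_map) model_space_evaluation_bound:
  assumes f: "f \<in> model_space \<theta>"
  shows "\<exists>K\<ge>0. \<forall>F d. finite F \<longrightarrow> F \<subseteq> unit_disc \<longrightarrow>
    (cmod (\<Sum>w\<in>F. d w * f w))\<^sup>2 \<le>
      K * Re (\<Sum>w\<in>F. \<Sum>v\<in>F. d w * cnj (d v) * ((1 - \<theta> w * cnj (\<theta> v)) / (1 - cnj v * w)))"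
proof -
  have fh: "f \<in> hardy2" and orth: "\<And>g. g \<in> hardy2 \<Longrightarrow> hardy_inner f (\<lambda>z. \<theta> z * g z) = 0"
    using f by (auto simp: model_space_def)
  note fhol = hardy2D(1)[OF fh]
  obtain K where K: "K \<ge> 0" "\<And>r. 0 \<le> r \<Longrightarrow> r < 1 \<Longrightarrow> (LINT \<xi>|circle_lebesgue. (cmod (f (of_real r * \<xi>)))\<^sup>2) \<le> K"
    using hardy2D(2)[OF fh] by auto
  show ?thesis
  proof (intro exI[of _ K] conjI allI impI K(1))
    fix F d assume F: "finite F" "F \<subseteq> unit_disc"
    define s where "s = kernel_sum F d"
    define e where "e w = d w * \<theta> w" for w
    define t where "t = kernel_sum F e"
    define q where "q z = \<theta> z * t z" for z
    have s: "s holomorphic_on unit_disc" and t: "t holomorphic_on unit_disc"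
      using kernel_sum_bounded(1)[OF F] by (simp_all add: s_def t_def)
    obtain B where B: "\<And>z. cmod z < 1 \<Longrightarrow> cmod (t z) \<le> B"
      using kernel_sum_bounded(2)[OF F, of e] by (auto simp: t_def)
    have q: "q holomorphic_on unit_disc"
      unfolding q_def by (intro holomorphic_intros holo t)
    have qt: "cmod (q z) \<le> cmod (t z)" if "cmod z < 1" for z
      using le_1[OF that] by (simp add: q_def norm_mult mult_left_le_one_le)
    have th: "t \<in> hardy2" and qh: "q \<in> hardy2"
      using hardy2_bounded[OF t B] hardy2_bounded[OF q order_trans[OF qt B]] by auto
    let ?L = "\<lambda>a b r. LINT \<xi>|circle_lebesgue. a (of_real r * \<xi>) * cnj (b (of_real r * \<xi>))"
    have lim_s: "((\<lambda>r. ?L p s r) \<longlongrightarrow> (\<Sum>w\<in>F. d w * p w)) (at_left (1::real))" if "p holomorphic_on unit_disc" for p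
      unfolding s_def by (rule kernel_sum_pairing_tendsto[OF that F])
    have lim_t: "((\<lambda>r. ?L t t r) \<longlongrightarrow> (\<Sum>w\<in>F. e w * t w)) (at_left (1::real))"
      using kernel_sum_pairing_tendsto[OF t F, of e] by (simp add: t_def)
    have lim_q: "((\<lambda>r. ?L f q r) \<longlongrightarrow> 0) (at_left (1::real))"
      using hardy_inner_tendsto[OF fh qh] orth[OF th] by (simp add: q_def[abs_def])
    let ?N = "\<lambda>r. Re (?L s s r) - 2 * Re (?L q s r) + Re (?L t t r)"
    have ineq: "(cmod (?L f s r - ?L f q r))\<^sup>2 \<le> K * ?N r" if r: "0 \<le> r" "r < 1" for r
    proof -
      note cont = dilate_holomorphic_continuous_on_circle[OF _ r]
      note I = lebesgue.integrable_continuous_on_circle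
      have "?L f s r - ?L f q r = (LINT \<xi>|circle_lebesgue.
          f (of_real r * \<xi>) * cnj (s (of_real r * \<xi>)) - f (of_real r * \<xi>) * cnj (q (of_real r * \<xi>)))"
        by (intro Bochner_Integration.integral_diff[symmetric] I continuous_on_mult continuous_on_cnj cont fhol s q)
      also have "\<dots> = (LINT \<xi>|circle_lebesgue. f (of_real r * \<xi>) * cnj (s (of_real r * \<xi>) - q (of_real r * \<xi>)))"
        by (simp only: right_diff_distrib complex_cnj_diff)
      finally have "?L f s r - ?L f q r = (LINT \<xi>|circle_lebesgue. f (of_real r * \<xi>) * cnj (s (of_real r * \<xi>) - q (of_real r * \<xi>)))" .
      then have "(cmod (?L f s r - ?L f q r))\<^sup>2 =
          (cmod (LINT \<xi>|circle_lebesgue. f (of_real r * \<xi>) * cnj (s (of_real r * \<xi>) - q (of_real r * \<xi>))))\<^sup>2"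
        by (simp only:)
      also have "\<dots> \<le> (LINT \<xi>|circle_lebesgue. (cmod (f (of_real r * \<xi>)))\<^sup>2) *
          (LINT \<xi>|circle_lebesgue. (cmod (s (of_real r * \<xi>) - q (of_real r * \<xi>)))\<^sup>2)"
        by (intro l2_cauchy_schwarz lebesgue.square_integrable_continuous continuous_on_diff cont fhol s q)
      also have "\<dots> \<le> K * ?N r"
      proof (intro mult_mono K r)
        have re: "Re (?L a b r) = (LINT \<xi>|circle_lebesgue. Re (a (of_real r * \<xi>) * cnj (b (of_real r * \<xi>))))"
          if "a holomorphic_on unit_disc" "b holomorphic_on unit_disc" for a b
          by (intro integral_Re[symmetric] I continuous_on_mult continuous_on_cnj cont that)
        have "(LINT \<xi>|circle_lebesgue. (cmod (s (of_real r * \<xi>) - q (of_real r * \<xi>)))\<^sup>2) \<le>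
            (LINT \<xi>|circle_lebesgue. Re (s (of_real r * \<xi>) * cnj (s (of_real r * \<xi>)))
              - 2 * Re (q (of_real r * \<xi>) * cnj (s (of_real r * \<xi>))) + Re (t (of_real r * \<xi>) * cnj (t (of_real r * \<xi>))))"
        proof (rule integral_mono)
          fix \<xi> assume "\<xi> \<in> space circle_lebesgue"
          then have z: "cmod (of_real r * \<xi>) < 1"
            using r by (simp add: norm_mult)
          let ?z = "of_real r * \<xi>"
          have sq: "Re (a * cnj a) = (cmod a)\<^sup>2" for a
            by (simp only: complex_norm_square[symmetric] Re_complex_of_real)
          have "(cmod (q ?z))\<^sup>2 \<le> (cmod (t ?z))\<^sup>2"
            using qt[OF z] by (intro power_mono) auto
          moreover have "Re (s ?z * cnj (q ?z)) = Re (q ?z * cnj (s ?z))"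
            by (simp add: mult.commute)
          ultimately show "(cmod (s ?z - q ?z))\<^sup>2 \<le> Re (s ?z * cnj (s ?z)) - 2 * Re (q ?z * cnj (s ?z)) + Re (t ?z * cnj (t ?z))"
            unfolding cmod_diff_power2 sq by linarith
        qed (intro I continuous_intros cont s q t)+
        also have "\<dots> = ?N r"
          unfolding re[OF s s] re[OF q s] re[OF t t] integral_mult_right_zero[symmetric]
          by (subst Bochner_Integration.integral_diff[symmetric], (intro I continuous_intros cont s q t)+,
              subst Bochner_Integration.integral_add[symmetric], (intro I continuous_intros cont s q t)+, rule refl)
        finally show "(LINT \<xi>|circle_lebesgue. (cmod (s (of_real r * \<xi>) - q (of_real r * \<xi>)))\<^sup>2) \<le> ?N r" .
      qed (auto intro!: integral_nonneg_AE)
      finally show ?thesis .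
    qed
    from eventually_radius_less_1 have ev: "\<forall>\<^sub>F r in at_left (1::real). (cmod (?L f s r - ?L f q r))\<^sup>2 \<le> K * ?N r"
      by eventually_elim (rule ineq, auto)
    have "((\<lambda>r. (cmod (?L f s r - ?L f q r))\<^sup>2) \<longlongrightarrow> (cmod ((\<Sum>w\<in>F. d w * f w) - 0))\<^sup>2) (at_left (1::real))"
      by (intro tendsto_intros lim_s[OF fhol] lim_q)
    moreover have "((\<lambda>r. K * ?N r) \<longlongrightarrow>
        K * (Re (\<Sum>w\<in>F. d w * s w) - 2 * Re (\<Sum>w\<in>F. d w * q w) + Re (\<Sum>w\<in>F. e w * t w))) (at_left (1::real))"
      by (intro tendsto_intros lim_s[OF s] lim_s[OF q] lim_t)
    ultimately have "(cmod ((\<Sum>w\<in>F. d w * f w) - 0))\<^sup>2 \<le>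
        K * (Re (\<Sum>w\<in>F. d w * s w) - 2 * Re (\<Sum>w\<in>F. d w * q w) + Re (\<Sum>w\<in>F. e w * t w))"
      using ev by (intro tendsto_le[OF trivial_limit_at_left_real])
    also have "(\<Sum>w\<in>F. e w * t w) = (\<Sum>w\<in>F. d w * q w)"
      by (simp add: e_def q_def mult.assoc)
    also have "Re (\<Sum>w\<in>F. d w * s w) - 2 * Re (\<Sum>w\<in>F. d w * q w) + Re (\<Sum>w\<in>F. d w * q w) =
        Re (\<Sum>w\<in>F. d w * s w - d w * q w)"
      by (simp only: sum_subtractf minus_complex.sel)
    also have "(\<Sum>w\<in>F. d w * s w - d w * q w) =
        (\<Sum>w\<in>F. \<Sum>v\<in>F. d w * cnj (d v) * ((1 - \<theta> w * cnj (\<theta> v)) / (1 - cnj v * w)))"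
    proof (rule sum.cong[OF refl])
      fix w
      have "d w * s w - d w * q w = (\<Sum>v\<in>F. d w * (cnj (d v) * (1 / (1 - cnj v * w))) -
          d w * (\<theta> w * (cnj (d v * \<theta> v) * (1 / (1 - cnj v * w)))))"
        by (simp only: s_def t_def q_def e_def kernel_sum_def sum_distrib_left sum_subtractf)
      also have "\<dots> = (\<Sum>v\<in>F. d w * cnj (d v) * ((1 - \<theta> w * cnj (\<theta> v)) / (1 - cnj v * w)))"
        by (intro sum.cong refl) (simp add: diff_divide_distrib algebra_simps)
      finally show "d w * s w - d w * q w = (\<Sum>v\<in>F. d w * cnj (d v) * ((1 - \<theta> w * cnj (\<theta> v)) / (1 - cnj v * w)))" .
    qed
    finally show "(cmod (\<Sum>w\<in>F. d w * f w))\<^sup>2 \<le>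
        K * Re (\<Sum>w\<in>F. \<Sum>v\<in>F. d w * cnj (d v) * ((1 - \<theta> w * cnj (\<theta> v)) / (1 - cnj v * w)))"
      by (simp only: diff_zero)
  qed
qed

section \<open>Functions dominated by the Clark measure\<close>

text \<open>The \<open>n\<close>-th derivative of the Cauchy kernel \<open>1 / (1 - cnj \<xi> w)\<close> in \<open>w\<close>.\<close>

definition cauchy_deriv :: "nat \<Rightarrow> complex \<Rightarrow> complex \<Rightarrow> complex" where
  "cauchy_deriv n w \<xi> = fact n * cnj \<xi> ^ n / (1 - cnj \<xi> * w) ^ Suc n"

lemma cauchy_deriv_0: "cauchy_deriv 0 w \<xi> = 1 / (1 - cnj \<xi> * w)"
  by (simp add: cauchy_deriv_def)

lemma cauchy_deriv_derivative:
  assumes "1 - cnj \<xi> * w \<noteq> 0"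
  shows "((\<lambda>w. cauchy_deriv n w \<xi>) has_field_derivative cauchy_deriv (Suc n) w \<xi>) (at w within S)"
proof -
  let ?q = "1 - cnj \<xi> * w"
  have "((\<lambda>w. inverse (1 - cnj \<xi> * w)) has_field_derivative cnj \<xi> * inverse ?q * inverse ?q) (at w within S)"
    using assms by (auto intro!: derivative_eq_intros)
  from DERIV_cmult[OF DERIV_power_Suc[OF this, of n], of "fact n * cnj \<xi> ^ n"]
  have "((\<lambda>w. (fact n * cnj \<xi> ^ n) * inverse (1 - cnj \<xi> * w) ^ Suc n) has_field_derivative
      (fact n * cnj \<xi> ^ n) * ((1 + of_nat n) * ((cnj \<xi> * inverse ?q * inverse ?q) * inverse ?q ^ n))) (at w within S)" .
  moreover have "(fact n * cnj \<xi> ^ n) * ((1 + of_nat n) * ((cnj \<xi> * inverse ?q * inverse ?q) * inverse ?q ^ n)) =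
      cauchy_deriv (Suc n) w \<xi>"
  proof -
    have "(fact n * c ^ n) * ((1 + of_nat n) * ((c * inverse q * inverse q) * inverse q ^ n)) =
        fact (Suc n) * c ^ Suc n / q ^ Suc (Suc n)" for c q :: complex
      by (simp add: divide_inverse power_inverse mult_ac)
    then show ?thesis
      unfolding cauchy_deriv_def .
  qed
  moreover have "(\<lambda>w. (fact n * cnj \<xi> ^ n) * inverse (1 - cnj \<xi> * w) ^ Suc n) = (\<lambda>w. cauchy_deriv n w \<xi>)"
    by (simp add: cauchy_deriv_def fun_eq_iff divide_inverse power_inverse)
  ultimately show ?thesis
    by (simp only:)
qed

lemma cauchy_deriv_norm_le:
  assumes "cmod \<xi> = 1" "cmod w \<le> \<rho>" "\<rho> < 1"
  shows "cmod (cauchy_deriv n w \<xi>) \<le> fact n / (1 - \<rho>) ^ Suc n"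
proof -
  have "1 - \<rho> \<le> cmod (1 - cnj \<xi> * w)"
    using disc_denominator_lower[of \<xi> w] assms by simp
  then have "fact n / cmod (1 - cnj \<xi> * w) ^ Suc n \<le> fact n / (1 - \<rho>) ^ Suc n"
    using assms(3) by (intro frac_le power_mono zero_less_power) auto
  then show ?thesis
    using assms(1) by (simp add: cauchy_deriv_def norm_mult norm_divide norm_power del: power_Suc)
qed

lemma cauchy_deriv_continuous:
  assumes "cmod w < 1"
  shows "continuous_on unit_circle (cauchy_deriv n w)"
  unfolding cauchy_deriv_def[abs_def] using circle_denominator_nonzero(1)[OF _ assms]
  by (intro continuous_intros) auto

text \<open>Moving \<open>w\<close> from \<open>\<zeta>\<close> inwards along the radius reduces the denominator of the Cauchy kernel by a factor
  of at most \<open>2\<close>. This gives the kernels along the radius a common majorant.\<close>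

lemma radial_denominator_lower:
  assumes a: "cmod a = 1" and r: "0 \<le> r" "r \<le> 1"
  shows "cmod (1 - a) \<le> 2 * cmod (1 - of_real r * a)"
proof -
  have "1 - r \<le> cmod (1 - of_real r * a)"
    using norm_triangle_ineq2[of 1 "of_real r * a"] a r by (simp add: norm_mult)
  moreover have "cmod (1 - a) \<le> cmod (1 - of_real r * a) + (1 - r)"
  proof -
    have "1 - a = (1 - of_real r * a) - of_real (1 - r) * a"
      by (simp add: algebra_simps)
    then have "cmod (1 - a) \<le> cmod (1 - of_real r * a) + cmod (of_real (1 - r) * a)"
      by (metis norm_triangle_ineq4)
    then show ?thesis
      using a r by (simp add: norm_mult del: of_real_diff)
  qed
  ultimately show ?thesis
    by linarith
qed

text \<open>The assumption says that the kernel at \<open>w\<close> is sent to \<open>h w\<close> by a bounded linear functional on the span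
  of the Cauchy kernels in \<open>L\<^sup>2(\<sigma>)\<close>.\<close>

locale dominated = exponential_clark +
  fixes h :: "complex \<Rightarrow> complex" and K :: real
  assumes h_holo: "h holomorphic_on unit_disc" and K: "0 \<le> K"
    and dominates: "\<And>F c. finite F \<Longrightarrow> F \<subseteq> unit_disc \<Longrightarrow>
      (cmod (\<Sum>w\<in>F. c w * h w))\<^sup>2 \<le> K * (LINT \<xi>|\<sigma>. (cmod (\<Sum>w\<in>F. c w * cauchy_deriv 0 w \<xi>))\<^sup>2)"
begin

text \<open>The closure of the graph of this functional; \<open>graph_closure \<phi> a\<close> says that the extension of the
  functional to the closed span has the value \<open>a\<close> at \<open>\<phi>\<close>.\<close>

definition graph_closure :: "(complex \<Rightarrow> complex) \<Rightarrow> complex \<Rightarrow> bool" where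
  "graph_closure \<phi> a \<longleftrightarrow> \<phi> \<in> square_integrable \<sigma> \<and> (\<forall>\<delta>>0. \<exists>F c. finite F \<and> F \<subseteq> unit_disc \<and>
     (LINT \<xi>|\<sigma>. (cmod (\<phi> \<xi> - (\<Sum>w\<in>F. c w * cauchy_deriv 0 w \<xi>)))\<^sup>2) < \<delta> \<and> (cmod (a - (\<Sum>w\<in>F. c w * h w)))\<^sup>2 < \<delta>)"

lemma kernel_square_integrable: "cmod w < 1 \<Longrightarrow> cauchy_deriv n w \<in> square_integrable \<sigma>"
  by (intro \<sigma>.square_integrable_continuous cauchy_deriv_continuous)

lemma combination_square_integrable:
  "F \<subseteq> unit_disc \<Longrightarrow> (\<lambda>\<xi>. \<Sum>w\<in>F. c w * cauchy_deriv 0 w \<xi>) \<in> square_integrable \<sigma>"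
  by (intro square_integrable_sum square_integrable_cmult kernel_square_integrable) auto

lemma graph_closure_approx:
  assumes "graph_closure \<phi> a" "\<delta> > 0"
  obtains F c where "finite F" "F \<subseteq> unit_disc"
    "(LINT \<xi>|\<sigma>. (cmod (\<phi> \<xi> - (\<Sum>w\<in>F. c w * cauchy_deriv 0 w \<xi>)))\<^sup>2) < \<delta>" "(cmod (a - (\<Sum>w\<in>F. c w * h w)))\<^sup>2 < \<delta>"
  using assms unfolding graph_closure_def by blast

lemma graph_closure_square_integrable: "graph_closure \<phi> a \<Longrightarrow> \<phi> \<in> square_integrable \<sigma>"
  by (simp add: graph_closure_def)

lemma graph_closure_kernel:
  assumes "cmod w < 1"
  shows "graph_closure (cauchy_deriv 0 w) (h w)"
  unfolding graph_closure_def
proof (intro conjI allI impI kernel_square_integrable assms)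
  fix \<delta> :: real assume "\<delta> > 0"
  then show "\<exists>F c. finite F \<and> F \<subseteq> unit_disc \<and>
     (LINT \<xi>|\<sigma>. (cmod (cauchy_deriv 0 w \<xi> - (\<Sum>w\<in>F. c w * cauchy_deriv 0 w \<xi>)))\<^sup>2) < \<delta> \<and> (cmod (h w - (\<Sum>w\<in>F. c w * h w)))\<^sup>2 < \<delta>"
    using assms by (intro exI[of _ "{w}"] exI[of _ "\<lambda>_. 1"]) simp
qed

lemma graph_closure_limit:
  assumes \<phi>: "\<phi> \<in> square_integrable \<sigma>"
    and approx: "\<And>\<delta>. \<delta> > 0 \<Longrightarrow> \<exists>\<psi> b. graph_closure \<psi> b \<and> (LINT \<xi>|\<sigma>. (cmod (\<phi> \<xi> - \<psi> \<xi>))\<^sup>2) < \<delta> \<and> (cmod (a - b))\<^sup>2 < \<delta>"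
  shows "graph_closure \<phi> a"
  unfolding graph_closure_def
proof (intro conjI allI impI \<phi>)
  fix \<delta> :: real assume d: "\<delta> > 0"
  obtain \<psi> b where \<psi>: "graph_closure \<psi> b" "(LINT \<xi>|\<sigma>. (cmod (\<phi> \<xi> - \<psi> \<xi>))\<^sup>2) < \<delta> / 4" "(cmod (a - b))\<^sup>2 < \<delta> / 4"
    using approx[of "\<delta> / 4"] d by auto
  obtain F c where F: "finite F" "F \<subseteq> unit_disc"
    "(LINT \<xi>|\<sigma>. (cmod (\<psi> \<xi> - (\<Sum>w\<in>F. c w * cauchy_deriv 0 w \<xi>)))\<^sup>2) < \<delta> / 4" "(cmod (b - (\<Sum>w\<in>F. c w * h w)))\<^sup>2 < \<delta> / 4"
    using graph_closure_approx[OF \<psi>(1), of "\<delta> / 4"] d by auto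
  have "(LINT \<xi>|\<sigma>. (cmod ((\<phi> \<xi> - \<psi> \<xi>) + (\<psi> \<xi> - (\<Sum>w\<in>F. c w * cauchy_deriv 0 w \<xi>))))\<^sup>2) \<le>
      2 * (LINT \<xi>|\<sigma>. (cmod (\<phi> \<xi> - \<psi> \<xi>))\<^sup>2) + 2 * (LINT \<xi>|\<sigma>. (cmod (\<psi> \<xi> - (\<Sum>w\<in>F. c w * cauchy_deriv 0 w \<xi>)))\<^sup>2)"
    by (intro integral_power2_triangle square_integrable_diff \<phi> graph_closure_square_integrable[OF \<psi>(1)]
        combination_square_integrable F)
  also have "\<dots> < \<delta>"
    using \<psi> F by linarith
  finally have 1: "(LINT \<xi>|\<sigma>. (cmod (\<phi> \<xi> - (\<Sum>w\<in>F. c w * cauchy_deriv 0 w \<xi>)))\<^sup>2) < \<delta>"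
    by simp
  have "(cmod ((a - b) + (b - (\<Sum>w\<in>F. c w * h w))))\<^sup>2 \<le> 2 * (cmod (a - b))\<^sup>2 + 2 * (cmod (b - (\<Sum>w\<in>F. c w * h w)))\<^sup>2"
    by (rule cmod_add_power2_le)
  also have "\<dots> < \<delta>"
    using \<psi> F by linarith
  finally have "(cmod (a - (\<Sum>w\<in>F. c w * h w)))\<^sup>2 < \<delta>"
    by simp
  with 1 F show "\<exists>F c. finite F \<and> F \<subseteq> unit_disc \<and>
     (LINT \<xi>|\<sigma>. (cmod (\<phi> \<xi> - (\<Sum>w\<in>F. c w * cauchy_deriv 0 w \<xi>)))\<^sup>2) < \<delta> \<and> (cmod (a - (\<Sum>w\<in>F. c w * h w)))\<^sup>2 < \<delta>"
    by blast
qed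

lemma graph_closure_linear:
  assumes \<phi>: "graph_closure \<phi> a" and \<psi>: "graph_closure \<psi> b"
  shows "graph_closure (\<lambda>\<xi>. \<phi> \<xi> + s * \<psi> \<xi>) (a + s * b)"
  unfolding graph_closure_def
proof (intro conjI allI impI)
  note \<phi>2 = graph_closure_square_integrable[OF \<phi>] and \<psi>2 = graph_closure_square_integrable[OF \<psi>]
  show "(\<lambda>\<xi>. \<phi> \<xi> + s * \<psi> \<xi>) \<in> square_integrable \<sigma>"
    by (intro square_integrable_add square_integrable_cmult \<phi>2 \<psi>2)
  fix \<delta> :: real assume d: "\<delta> > 0"
  define \<eta> where "\<eta> = \<delta> / (4 * ((cmod s)\<^sup>2 + 1))"
  have s1: "0 < (cmod s)\<^sup>2 + 1"
    by (simp add: add_nonneg_pos)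
  have \<eta>: "\<eta> > 0" "2 * \<eta> + 2 * ((cmod s)\<^sup>2 * \<eta>) < \<delta>"
  proof -
    show "\<eta> > 0" using d s1 by (simp add: \<eta>_def)
    have "2 * \<eta> + 2 * ((cmod s)\<^sup>2 * \<eta>) = 2 * (((cmod s)\<^sup>2 + 1) * \<eta>)"
      by (simp add: algebra_simps)
    also have "((cmod s)\<^sup>2 + 1) * \<eta> = \<delta> / 4"
    proof -
      have "p * (\<delta> / (4 * p)) = \<delta> / 4" if "p > 0" for p :: real
        using that by simp
      from this[OF s1] show ?thesis
        unfolding \<eta>_def .
    qed
    finally show "2 * \<eta> + 2 * ((cmod s)\<^sup>2 * \<eta>) < \<delta>"
      using d by simp
  qed
  obtain F c where F: "finite F" "F \<subseteq> unit_disc"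
    "(LINT \<xi>|\<sigma>. (cmod (\<phi> \<xi> - (\<Sum>w\<in>F. c w * cauchy_deriv 0 w \<xi>)))\<^sup>2) < \<eta>" "(cmod (a - (\<Sum>w\<in>F. c w * h w)))\<^sup>2 < \<eta>"
    using graph_closure_approx[OF \<phi> \<eta>(1)] by blast
  obtain G e where G: "finite G" "G \<subseteq> unit_disc"
    "(LINT \<xi>|\<sigma>. (cmod (\<psi> \<xi> - (\<Sum>w\<in>G. e w * cauchy_deriv 0 w \<xi>)))\<^sup>2) < \<eta>" "(cmod (b - (\<Sum>w\<in>G. e w * h w)))\<^sup>2 < \<eta>"
    using graph_closure_approx[OF \<psi> \<eta>(1)] by blast
  let ?c = "\<lambda>w. (if w \<in> F then c w else 0) + s * (if w \<in> G then e w else 0)"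
  have comb: "(\<Sum>w\<in>F \<union> G. ?c w * g w) = (\<Sum>w\<in>F. c w * g w) + s * (\<Sum>w\<in>G. e w * g w)" for g :: "complex \<Rightarrow> complex"
  proof -
    have "(\<Sum>w\<in>F \<union> G. ?c w * g w) = (\<Sum>w\<in>F \<union> G. if w \<in> F then c w * g w else 0) + (\<Sum>w\<in>F \<union> G. if w \<in> G then s * (e w * g w) else 0)"
      unfolding sum.distrib[symmetric] by (intro sum.cong) (auto simp: distrib_right mult.assoc)
    also have "(\<Sum>w\<in>F \<union> G. if w \<in> F then c w * g w else 0) = (\<Sum>w\<in>F. c w * g w)"
      using F G by (intro sum.mono_neutral_cong_right) auto
    also have "(\<Sum>w\<in>F \<union> G. if w \<in> G then s * (e w * g w) else 0) = (\<Sum>w\<in>G. s * (e w * g w))"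
      using F G by (intro sum.mono_neutral_cong_right) auto
    finally show ?thesis
      by (simp only: sum_distrib_left)
  qed
  have "(LINT \<xi>|\<sigma>. (cmod ((\<phi> \<xi> - (\<Sum>w\<in>F. c w * cauchy_deriv 0 w \<xi>)) + s * (\<psi> \<xi> - (\<Sum>w\<in>G. e w * cauchy_deriv 0 w \<xi>))))\<^sup>2) \<le>
      2 * (LINT \<xi>|\<sigma>. (cmod (\<phi> \<xi> - (\<Sum>w\<in>F. c w * cauchy_deriv 0 w \<xi>)))\<^sup>2) +
      2 * (LINT \<xi>|\<sigma>. (cmod (s * (\<psi> \<xi> - (\<Sum>w\<in>G. e w * cauchy_deriv 0 w \<xi>))))\<^sup>2)"
    by (intro integral_power2_triangle square_integrable_diff square_integrable_cmult \<phi>2 \<psi>2 combination_square_integrable F G)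
  also have "(LINT \<xi>|\<sigma>. (cmod (s * (\<psi> \<xi> - (\<Sum>w\<in>G. e w * cauchy_deriv 0 w \<xi>))))\<^sup>2) =
      (cmod s)\<^sup>2 * (LINT \<xi>|\<sigma>. (cmod (\<psi> \<xi> - (\<Sum>w\<in>G. e w * cauchy_deriv 0 w \<xi>)))\<^sup>2)"
    unfolding norm_mult power_mult_distrib by (rule integral_mult_right_zero)
  also have "2 * (LINT \<xi>|\<sigma>. (cmod (\<phi> \<xi> - (\<Sum>w\<in>F. c w * cauchy_deriv 0 w \<xi>)))\<^sup>2) + 2 * \<dots> \<le> 2 * \<eta> + 2 * ((cmod s)\<^sup>2 * \<eta>)"
    using F(3) G(3) by (intro add_mono mult_left_mono) auto
  finally have 1: "(LINT \<xi>|\<sigma>. (cmod (\<phi> \<xi> + s * \<psi> \<xi> - (\<Sum>w\<in>F \<union> G. ?c w * cauchy_deriv 0 w \<xi>)))\<^sup>2) < \<delta>"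
    using \<eta>(2) unfolding comb by (simp add: algebra_simps)
  have "(cmod ((a - (\<Sum>w\<in>F. c w * h w)) + s * (b - (\<Sum>w\<in>G. e w * h w))))\<^sup>2 \<le>
      2 * (cmod (a - (\<Sum>w\<in>F. c w * h w)))\<^sup>2 + 2 * (cmod (s * (b - (\<Sum>w\<in>G. e w * h w))))\<^sup>2"
    by (rule cmod_add_power2_le)
  also have "\<dots> \<le> 2 * \<eta> + 2 * ((cmod s)\<^sup>2 * \<eta>)"
    unfolding norm_mult power_mult_distrib using F(4) G(4) by (intro add_mono mult_left_mono) auto
  finally have "(cmod (a + s * b - (\<Sum>w\<in>F \<union> G. ?c w * h w)))\<^sup>2 < \<delta>"
    using \<eta>(2) unfolding comb by (simp add: algebra_simps)
  with 1 F G show "\<exists>F c. finite F \<and> F \<subseteq> unit_disc \<and>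
     (LINT \<xi>|\<sigma>. (cmod (\<phi> \<xi> + s * \<psi> \<xi> - (\<Sum>w\<in>F. c w * cauchy_deriv 0 w \<xi>)))\<^sup>2) < \<delta> \<and> (cmod (a + s * b - (\<Sum>w\<in>F. c w * h w)))\<^sup>2 < \<delta>"
    by (intro exI[of _ "F \<union> G"] exI[of _ ?c]) auto
qed

text \<open>Passing to the closure costs a factor \<open>2\<close> in the domain and another one in the range, because squared
  norms are used throughout.\<close>

lemma graph_closure_bound:
  assumes "graph_closure \<phi> a"
  shows "(cmod a)\<^sup>2 \<le> 4 * K * (LINT \<xi>|\<sigma>. (cmod (\<phi> \<xi>))\<^sup>2)"
proof (rule field_le_epsilon)
  fix \<delta> :: real assume d: "\<delta> > 0"
  define \<eta> where "\<eta> = \<delta> / (2 + 4 * K)"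
  have k1: "2 + 4 * K > 0"
    using K by simp
  then have \<eta>: "\<eta> > 0"
    using d by (simp add: \<eta>_def)
  note \<phi>2 = graph_closure_square_integrable[OF assms]
  obtain F c where F: "finite F" "F \<subseteq> unit_disc"
    "(LINT \<xi>|\<sigma>. (cmod (\<phi> \<xi> - (\<Sum>w\<in>F. c w * cauchy_deriv 0 w \<xi>)))\<^sup>2) < \<eta>" "(cmod (a - (\<Sum>w\<in>F. c w * h w)))\<^sup>2 < \<eta>"
    using graph_closure_approx[OF assms \<eta>] by blast
  let ?S = "\<lambda>\<xi>. \<Sum>w\<in>F. c w * cauchy_deriv 0 w \<xi>"
  have "(LINT \<xi>|\<sigma>. (cmod (\<phi> \<xi> + (- 1) * (\<phi> \<xi> - ?S \<xi>)))\<^sup>2) \<le>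
      2 * (LINT \<xi>|\<sigma>. (cmod (\<phi> \<xi>))\<^sup>2) + 2 * (LINT \<xi>|\<sigma>. (cmod ((- 1) * (\<phi> \<xi> - ?S \<xi>)))\<^sup>2)"
    by (intro integral_power2_triangle square_integrable_cmult square_integrable_diff \<phi>2 combination_square_integrable F)
  then have S: "(LINT \<xi>|\<sigma>. (cmod (?S \<xi>))\<^sup>2) \<le> 2 * (LINT \<xi>|\<sigma>. (cmod (\<phi> \<xi>))\<^sup>2) + 2 * (LINT \<xi>|\<sigma>. (cmod (\<phi> \<xi> - ?S \<xi>))\<^sup>2)"
    by (simp add: norm_minus_commute)
  have "(cmod ((a - (\<Sum>w\<in>F. c w * h w)) + (\<Sum>w\<in>F. c w * h w)))\<^sup>2 \<le>
      2 * (cmod (a - (\<Sum>w\<in>F. c w * h w)))\<^sup>2 + 2 * (cmod (\<Sum>w\<in>F. c w * h w))\<^sup>2"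
    by (rule cmod_add_power2_le)
  also have "\<dots> \<le> 2 * \<eta> + 2 * (K * (2 * (LINT \<xi>|\<sigma>. (cmod (\<phi> \<xi>))\<^sup>2) + 2 * \<eta>))"
  proof (intro add_mono mult_left_mono)
    have "(cmod (\<Sum>w\<in>F. c w * h w))\<^sup>2 \<le> K * (LINT \<xi>|\<sigma>. (cmod (?S \<xi>))\<^sup>2)"
      by (rule dominates[OF F(1,2)])
    also have "\<dots> \<le> K * (2 * (LINT \<xi>|\<sigma>. (cmod (\<phi> \<xi>))\<^sup>2) + 2 * \<eta>)"
      using S F(3) K by (intro mult_left_mono) auto
    finally show "(cmod (\<Sum>w\<in>F. c w * h w))\<^sup>2 \<le> K * (2 * (LINT \<xi>|\<sigma>. (cmod (\<phi> \<xi>))\<^sup>2) + 2 * \<eta>)" .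
  qed (use F(4) in auto)
  also have "\<dots> = 4 * K * (LINT \<xi>|\<sigma>. (cmod (\<phi> \<xi>))\<^sup>2) + (2 + 4 * K) * \<eta>"
    by (simp add: algebra_simps)
  also have "(2 + 4 * K) * \<eta> = \<delta>"
    using k1 by (simp add: \<eta>_def)
  finally show "(cmod a)\<^sup>2 \<le> 4 * K * (LINT \<xi>|\<sigma>. (cmod (\<phi> \<xi>))\<^sup>2) + \<delta>"
    by simp
qed

lemma graph_closure_sequence:
  assumes g: "\<And>m. graph_closure (\<phi> m) (a m)" and \<psi>: "\<psi> \<in> square_integrable \<sigma>"
    and lim: "(\<lambda>m. LINT \<xi>|\<sigma>. (cmod (\<psi> \<xi> - \<phi> m \<xi>))\<^sup>2) \<longlonglongrightarrow> 0" "a \<longlonglongrightarrow> b"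
  shows "graph_closure \<psi> b"
proof (rule graph_closure_limit[OF \<psi>])
  fix \<delta> :: real assume d: "\<delta> > 0"
  have "(\<lambda>m. (cmod (b - a m))\<^sup>2) \<longlonglongrightarrow> (cmod (b - b))\<^sup>2"
    by (intro tendsto_intros lim)
  then have "\<forall>\<^sub>F m in sequentially. (cmod (b - a m))\<^sup>2 < \<delta>"
    by (rule order_tendstoD(2)) (use d in simp)
  moreover have "\<forall>\<^sub>F m in sequentially. (LINT \<xi>|\<sigma>. (cmod (\<psi> \<xi> - \<phi> m \<xi>))\<^sup>2) < \<delta>"
    using lim(1) d by (rule order_tendstoD(2))
  ultimately have "\<forall>\<^sub>F m in sequentially. (LINT \<xi>|\<sigma>. (cmod (\<psi> \<xi> - \<phi> m \<xi>))\<^sup>2) < \<delta> \<and> (cmod (b - a m))\<^sup>2 < \<delta>"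
    by eventually_elim simp
  then obtain m where "(LINT \<xi>|\<sigma>. (cmod (\<psi> \<xi> - \<phi> m \<xi>))\<^sup>2) < \<delta> \<and> (cmod (b - a m))\<^sup>2 < \<delta>"
    using eventually_happens'[OF sequentially_bot] by blast
  then show "\<exists>\<psi>' b'. graph_closure \<psi>' b' \<and> (LINT \<xi>|\<sigma>. (cmod (\<psi> \<xi> - \<psi>' \<xi>))\<^sup>2) < \<delta> \<and> (cmod (b - b'))\<^sup>2 < \<delta>"
    using g[of m] by (intro exI[of _ "\<phi> m"] exI[of _ "a m"]) auto
qed

text \<open>The difference quotients of the kernel converge boundedly on the circle, those of \<open>h\<close> converge to
  the derivative.\<close>

lemma graph_closure_derivative:
  assumes "cmod w < 1"
  shows "graph_closure (cauchy_deriv n w) ((deriv ^^ n) h w)"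
  using assms
proof (induction n arbitrary: w)
  case 0
  then show ?case
    by (simp add: graph_closure_kernel)
next
  case (Suc n)
  \<comment> \<open>Difference quotients with steps along the positive reals stay in the disc of radius \<open>\<rho>\<close>, where
    the derivatives of the kernel are bounded.\<close>
  define \<rho> where "\<rho> = (1 + cmod w) / 2"
  have \<rho>: "cmod w < \<rho>" "\<rho> < 1"
    using Suc.prems by (auto simp: \<rho>_def)
  define d where "d m = (\<rho> - cmod w) * inverse (real (Suc m))" for m
  have d: "0 < d m" "d m \<le> \<rho> - cmod w" for m
    using \<rho> mult_left_le[of "inverse (real (Suc m))" "\<rho> - cmod w"] by (auto simp: d_def field_simps)
  have "d \<longlonglongrightarrow> (\<rho> - cmod w) * 0"
    unfolding d_def by (intro tendsto_intros LIMSEQ_inverse_real_of_nat)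
  then have d_lim: "(\<lambda>m. complex_of_real (d m)) \<longlonglongrightarrow> 0"
    using tendsto_of_real[of d 0] by simp
  then have d_at: "filterlim (\<lambda>m. complex_of_real (d m)) (at 0) sequentially"
    using d(1) by (auto simp: filterlim_at less_imp_neq[THEN not_sym])
  have wd: "cmod (w + of_real (d m)) \<le> \<rho>" for m
    using norm_triangle_ineq[of w "of_real (d m)"] d[of m] by simp
  then have wd1: "cmod (w + of_real (d m)) < 1" for m
    using \<rho>(2) le_less_trans by blast
  let ?\<phi> = "\<lambda>m \<xi>. (cauchy_deriv n (w + of_real (d m)) \<xi> - cauchy_deriv n w \<xi>) / of_real (d m)"
  let ?a = "\<lambda>m. ((deriv ^^ n) h (w + of_real (d m)) - (deriv ^^ n) h w) / of_real (d m)"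
  let ?B = "fact (Suc n) / (1 - \<rho>) ^ Suc (Suc n)"
  have lim: "(\<lambda>m. ?\<phi> m \<xi>) \<longlonglongrightarrow> cauchy_deriv (Suc n) w \<xi>" if "\<xi> \<in> unit_circle" for \<xi>
  proof -
    have "((\<lambda>w. cauchy_deriv n w \<xi>) has_field_derivative cauchy_deriv (Suc n) w \<xi>) (at w)"
      using that Suc.prems circle_denominator_nonzero(1)[of \<xi> w] by (intro cauchy_deriv_derivative) auto
    then have "((\<lambda>t. (cauchy_deriv n (w + t) \<xi> - cauchy_deriv n w \<xi>) / t) \<longlongrightarrow> cauchy_deriv (Suc n) w \<xi>) (at 0)"
      by (rule DERIV_D)
    from filterlim_compose[OF this d_at] show ?thesis .
  qed
  have bd: "cmod (?\<phi> m \<xi>) \<le> ?B" if \<xi>: "\<xi> \<in> unit_circle" for m \<xi>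
  proof -
    have "cmod (cauchy_deriv n (w + of_real (d m)) \<xi> - cauchy_deriv n w \<xi>) \<le> ?B * cmod ((w + of_real (d m)) - w)"
    proof (rule field_differentiable_bound[of "cball 0 \<rho>" "\<lambda>w. cauchy_deriv n w \<xi>" "\<lambda>w. cauchy_deriv (Suc n) w \<xi>"])
      fix z assume z: "z \<in> cball (0::complex) \<rho>"
      then have z1: "cmod z < 1"
        using \<rho> by auto
      show "((\<lambda>w. cauchy_deriv n w \<xi>) has_field_derivative cauchy_deriv (Suc n) z \<xi>) (at z within cball 0 \<rho>)"
        using \<xi> circle_denominator_nonzero(1)[of \<xi> z] z1 by (intro cauchy_deriv_derivative) auto
      show "cmod (cauchy_deriv (Suc n) z \<xi>) \<le> ?B"
        using z \<xi> \<rho> by (intro cauchy_deriv_norm_le) auto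
    qed (use wd \<rho> in auto)
    then have "cmod (cauchy_deriv n (w + of_real (d m)) \<xi> - cauchy_deriv n w \<xi>) \<le> ?B * d m"
      using d(1)[of m] by simp
    then show ?thesis
      using d(1)[of m] by (simp add: norm_divide divide_le_eq del: fact_Suc power_Suc)
  qed
  note l2 = dominated_convergence_power2[of ?\<phi> \<sigma> "cauchy_deriv (Suc n) w" "\<lambda>_. ?B"]
  have meas: "?\<phi> m \<in> borel_measurable \<sigma>" "cauchy_deriv (Suc n) w \<in> borel_measurable \<sigma>" for m
    using cauchy_deriv_continuous[OF wd1] cauchy_deriv_continuous[OF Suc.prems] d(1)[of m]
    by (auto intro!: \<sigma>.measurable_continuous_on_circle continuous_on_divide continuous_on_diff continuous_on_const
        simp: less_imp_neq[THEN not_sym])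
  show ?case
  proof (rule graph_closure_sequence[where \<phi> = ?\<phi> and a = ?a])
    show "graph_closure (?\<phi> m) (?a m)" for m
    proof -
      have 1: "graph_closure (\<lambda>\<xi>. cauchy_deriv n (w + of_real (d m)) \<xi> + (- 1) * cauchy_deriv n w \<xi>)
          ((deriv ^^ n) h (w + of_real (d m)) + (- 1) * (deriv ^^ n) h w)"
        by (intro graph_closure_linear Suc.IH wd1 Suc.prems)
      let ?\<psi> = "\<lambda>\<xi>. cauchy_deriv n (w + of_real (d m)) \<xi> + (- 1) * cauchy_deriv n w \<xi>"
      have "graph_closure (\<lambda>\<xi>. ?\<psi> \<xi> + (1 / of_real (d m) - 1) * ?\<psi> \<xi>)
          (((deriv ^^ n) h (w + of_real (d m)) + (- 1) * (deriv ^^ n) h w) +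
            (1 / of_real (d m) - 1) * ((deriv ^^ n) h (w + of_real (d m)) + (- 1) * (deriv ^^ n) h w))"
        by (rule graph_closure_linear[OF 1 1])
      \<comment> \<open>A multiple \<open>s \<phi>\<close> is the combination \<open>\<phi> + (s - 1) \<phi>\<close>.\<close>
      moreover have "y + (1 / of_real (d m) - 1) * y = y / of_real (d m)" for y :: complex
        by (simp add: algebra_simps)
      ultimately show ?thesis
        by simp
    qed
    show "cauchy_deriv (Suc n) w \<in> square_integrable \<sigma>"
      by (rule kernel_square_integrable[OF Suc.prems])
    show "(\<lambda>m. LINT \<xi>|\<sigma>. (cmod (cauchy_deriv (Suc n) w \<xi> - ?\<phi> m \<xi>))\<^sup>2) \<longlonglongrightarrow> 0"
      by (rule l2(2)[OF meas(1) meas(2)]) (use lim bd in \<open>auto intro!: AE_I2 simp del: fact_Suc power_Suc\<close>)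
    have "((deriv ^^ n) h has_field_derivative (deriv ^^ Suc n) h w) (at w)"
      using holomorphic_derivI[OF holomorphic_higher_deriv[OF h_holo open_ball, of n] open_ball, of w] Suc.prems by simp
    then have "((\<lambda>t. ((deriv ^^ n) h (w + t) - (deriv ^^ n) h w) / t) \<longlongrightarrow> (deriv ^^ Suc n) h w) (at 0)"
      by (rule DERIV_D)
    from filterlim_compose[OF this d_at] show "?a \<longlonglongrightarrow> (deriv ^^ Suc n) h w" .
  qed
qed

lemma radial_kernel_limit:
  assumes r: "\<And>m. 0 \<le> r m" "\<And>m. r m < 1" "r \<longlonglongrightarrow> (1::real)"
  shows "cauchy_deriv n \<zeta> \<in> square_integrable \<sigma>"
    "(\<lambda>m. LINT \<xi>|\<sigma>. (cmod (cauchy_deriv n \<zeta> \<xi> - cauchy_deriv n (of_real (r m) * \<zeta>) \<xi>))\<^sup>2) \<longlonglongrightarrow> 0"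
proof -
  let ?w = "\<lambda>\<xi>. fact n * (2 ^ Suc n * (1 / cmod (\<xi> - \<zeta>)) ^ Suc n)"
  have rd: "cmod (of_real (r m) * \<zeta>) < 1" for m
    using r(1,2)[of m] zeta by (simp add: norm_mult)
  have dist: "cmod (1 - cnj \<xi> * \<zeta>) = cmod (\<xi> - \<zeta>)" if "\<xi> \<in> unit_circle" for \<xi>
  proof -
    have "\<xi> - \<zeta> = \<xi> * (1 - cnj \<xi> * \<zeta>)"
      using that complex_norm_square[of \<xi>] by (simp add: algebra_simps)
    then show ?thesis
      using that by (metis mem_sphere_0 mult_1 norm_mult)
  qed
  have meas: "cauchy_deriv n (of_real (r m) * \<zeta>) \<in> borel_measurable \<sigma>" for m
    by (intro \<sigma>.measurable_continuous_on_circle cauchy_deriv_continuous rd)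
  have meas': "cauchy_deriv n \<zeta> \<in> borel_measurable \<sigma>"
  proof (rule \<sigma>.measurable_circle)
    have "cnj \<in> borel_measurable borel"
      by (intro borel_measurable_continuous_onI continuous_intros)
    then show "cauchy_deriv n \<zeta> \<in> borel_measurable borel"
      unfolding cauchy_deriv_def[abs_def] by measurable
  qed
  have lim: "AE \<xi> in \<sigma>. (\<lambda>m. cauchy_deriv n (of_real (r m) * \<zeta>) \<xi>) \<longlonglongrightarrow> cauchy_deriv n \<zeta> \<xi>"
    using AE_circle
  proof eventually_elim
    case (elim \<xi>)
    then have nz: "1 - cnj \<xi> * \<zeta> \<noteq> 0"
      using dist[of \<xi>] by auto
    have "(\<lambda>m. cauchy_deriv n (of_real (r m) * \<zeta>) \<xi>) \<longlonglongrightarrow> fact n * cnj \<xi> ^ n / (1 - cnj \<xi> * (of_real 1 * \<zeta>)) ^ Suc n"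
      unfolding cauchy_deriv_def using nz by (intro tendsto_intros r(3)) auto
    then show ?case
      by (simp add: cauchy_deriv_def)
  qed
  have bd: "AE \<xi> in \<sigma>. cmod (cauchy_deriv n (of_real (r m) * \<zeta>) \<xi>) \<le> ?w \<xi>" for m
    using AE_circle
  proof eventually_elim
    case (elim \<xi>)
    have "cmod (cnj \<xi> * \<zeta>) = 1"
      using elim zeta by (simp add: norm_mult)
    from radial_denominator_lower[OF this, of "r m"] r(1,2)[of m] dist[of \<xi>] elim
    have le: "cmod (\<xi> - \<zeta>) \<le> 2 * cmod (1 - cnj \<xi> * (of_real (r m) * \<zeta>))"
      by (simp add: mult_ac)
    have x: "cmod (\<xi> - \<zeta>) > 0"
      using elim by simp
    have "1 / y \<le> 2 * (1 / x)" if "0 < x" "x \<le> 2 * y" for x y :: real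
    proof -
      have "0 < y"
        using that by linarith
      then show ?thesis
        using that by (simp add: field_simps)
    qed
    from this[OF x le] have "1 / cmod (1 - cnj \<xi> * (of_real (r m) * \<zeta>)) \<le> 2 * (1 / cmod (\<xi> - \<zeta>))" .
    then have "(1 / cmod (1 - cnj \<xi> * (of_real (r m) * \<zeta>))) ^ Suc n \<le> (2 * (1 / cmod (\<xi> - \<zeta>))) ^ Suc n"
      by (intro power_mono) auto
    then have "fact n * (1 / cmod (1 - cnj \<xi> * (of_real (r m) * \<zeta>))) ^ Suc n \<le> ?w \<xi>"
      unfolding power_mult_distrib by (intro mult_left_mono) auto
    then show ?case
      using elim by (simp add: cauchy_deriv_def norm_mult norm_divide norm_power power_one_over del: power_Suc)
  qed
  have w2: "integrable \<sigma> (\<lambda>\<xi>. (?w \<xi>)\<^sup>2)"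
    unfolding power_mult_distrib[of "fact n"] power_mult_distrib[of "2 ^ Suc n"]
    by (intro integrable_mult_right power_integrable)
  show "cauchy_deriv n \<zeta> \<in> square_integrable \<sigma>"
    by (rule dominated_convergence_power2(1)[OF meas meas' lim bd w2])
  show "(\<lambda>m. LINT \<xi>|\<sigma>. (cmod (cauchy_deriv n \<zeta> \<xi> - cauchy_deriv n (of_real (r m) * \<zeta>) \<xi>))\<^sup>2) \<longlonglongrightarrow> 0"
    by (rule dominated_convergence_power2(2)[OF meas meas' lim bd w2])
qed

text \<open>The kernels converge in \<open>L\<^sup>2(\<sigma>)\<close> along one sequence of radii, which makes the derivatives a Cauchy
  sequence with some limit \<open>a\<close>. The value of the functional at the limit kernel is then \<open>a\<close>, and its
  boundedness gives convergence along every other sequence.\<close>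

lemma radial_derivative_limit:
  "\<exists>a. graph_closure (cauchy_deriv n \<zeta>) a \<and> ((\<lambda>r. (deriv ^^ n) h (of_real r * \<zeta>)) \<longlongrightarrow> a) (at_left (1::real))"
proof -
  let ?D = "\<lambda>r::real. (deriv ^^ n) h (of_real r * \<zeta>)"
  let ?E = "\<lambda>r. LINT \<xi>|\<sigma>. (cmod (cauchy_deriv n \<zeta> \<xi> - cauchy_deriv n (of_real r * \<zeta>) \<xi>))\<^sup>2"
  have g: "graph_closure (cauchy_deriv n (of_real r * \<zeta>)) (?D r)" if "0 \<le> r" "r < 1" for r
    using that zeta by (intro graph_closure_derivative) (simp add: norm_mult)
  define r where "r m = 1 - inverse (real (Suc m))" for m
  have r: "0 \<le> r m" "r m < 1" for m
    by (auto simp: r_def field_simps)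
  have r_lim: "r \<longlonglongrightarrow> 1"
    unfolding r_def using tendsto_diff[OF tendsto_const LIMSEQ_inverse_real_of_nat] by simp
  note l2 = radial_kernel_limit[OF r r_lim, of n]
  have k2: "cauchy_deriv n (of_real (r m) * \<zeta>) \<in> square_integrable \<sigma>" for m
    by (rule graph_closure_square_integrable[OF g[OF r]])
  have diff: "(cmod (?D (r m) - ?D (r k)))\<^sup>2 \<le> 4 * K * (2 * ?E (r m) + 2 * ?E (r k))" for m k
  proof -
    let ?\<phi> = "\<lambda>\<xi>. cauchy_deriv n (of_real (r m) * \<zeta>) \<xi> + (- 1) * cauchy_deriv n (of_real (r k) * \<zeta>) \<xi>"
    have "graph_closure ?\<phi> (?D (r m) + (- 1) * ?D (r k))"
      by (intro graph_closure_linear g r)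
    then have "(cmod (?D (r m) + (- 1) * ?D (r k)))\<^sup>2 \<le> 4 * K * (LINT \<xi>|\<sigma>. (cmod (?\<phi> \<xi>))\<^sup>2)"
      by (rule graph_closure_bound)
    also have "(LINT \<xi>|\<sigma>. (cmod (?\<phi> \<xi>))\<^sup>2) =
        (LINT \<xi>|\<sigma>. (cmod ((cauchy_deriv n \<zeta> \<xi> - cauchy_deriv n (of_real (r k) * \<zeta>) \<xi>) +
          (- 1) * (cauchy_deriv n \<zeta> \<xi> - cauchy_deriv n (of_real (r m) * \<zeta>) \<xi>)))\<^sup>2)"
      by (intro Bochner_Integration.integral_cong refl) (simp add: algebra_simps)
    also have "4 * K * \<dots> \<le> 4 * K * (2 * ?E (r k) + 2 * (LINT \<xi>|\<sigma>. (cmod ((- 1) * (cauchy_deriv n \<zeta> \<xi> - cauchy_deriv n (of_real (r m) * \<zeta>) \<xi>)))\<^sup>2))"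
      using K by (intro mult_left_mono integral_power2_triangle square_integrable_diff square_integrable_cmult l2(1) k2) auto
    also have "(LINT \<xi>|\<sigma>. (cmod ((- 1) * (cauchy_deriv n \<zeta> \<xi> - cauchy_deriv n (of_real (r m) * \<zeta>) \<xi>)))\<^sup>2) = ?E (r m)"
      by (simp only: norm_mult norm_minus_cancel norm_one mult_1)
    finally show ?thesis
      by (simp add: add.commute)
  qed
  have "Cauchy (\<lambda>m. ?D (r m))"
  proof (rule metric_CauchyI)
    fix e :: real assume e: "e > 0"
    have p: "16 * K + 1 > 0"
      using K by simp
    then have "e\<^sup>2 / (16 * K + 1) > 0"
      using e by simp
    then obtain N where N: "\<And>m. m \<ge> N \<Longrightarrow> ?E (r m) < e\<^sup>2 / (16 * K + 1)"
      using order_tendstoD(2)[OF l2(2)] unfolding eventually_sequentially by blast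
    have "dist (?D (r m)) (?D (r k)) < e" if "m \<ge> N" "k \<ge> N" for m k
    proof -
      have "(cmod (?D (r m) - ?D (r k)))\<^sup>2 \<le> 4 * K * (2 * ?E (r m) + 2 * ?E (r k))"
        by (rule diff)
      also have "\<dots> \<le> 4 * K * (2 * (e\<^sup>2 / (16 * K + 1)) + 2 * (e\<^sup>2 / (16 * K + 1)))"
        using K N[OF that(1)] N[OF that(2)] by (intro mult_left_mono add_mono) auto
      also have "\<dots> = 16 * K * (e\<^sup>2 / (16 * K + 1))"
        by simp
      also have "\<dots> < (16 * K + 1) * (e\<^sup>2 / (16 * K + 1))"
        using p e by (intro mult_strict_right_mono) auto
      also have "\<dots> = e\<^sup>2"
        using p by simp
      finally show ?thesis
        using e by (simp add: dist_norm power2_less_imp_less)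
    qed
    then show "\<exists>N. \<forall>m\<ge>N. \<forall>k\<ge>N. dist (?D (r m)) (?D (r k)) < e"
      by blast
  qed
  then obtain a where a: "(\<lambda>m. ?D (r m)) \<longlonglongrightarrow> a"
    using Cauchy_convergent convergent_def by blast
  have ga: "graph_closure (cauchy_deriv n \<zeta>) a"
    by (rule graph_closure_sequence[OF g[OF r] l2 a])
  have "(?D \<longlongrightarrow> a) (at_left 1)"
  proof (rule tendsto_at_left_sequentially[of 0])
    fix S :: "nat \<Rightarrow> real" assume S: "\<And>m. S m < 1" "\<And>m. 0 < S m" "S \<longlonglongrightarrow> 1"
    have bound: "(cmod (a - ?D (S m)))\<^sup>2 \<le> 4 * K * ?E (S m)" for m
    proof -
      have "graph_closure (\<lambda>\<xi>. cauchy_deriv n \<zeta> \<xi> + (- 1) * cauchy_deriv n (of_real (S m) * \<zeta>) \<xi>) (a + (- 1) * ?D (S m))"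
        using S(1,2)[of m] by (intro graph_closure_linear ga g) auto
      from graph_closure_bound[OF this] show ?thesis
        by simp
    qed
    have "(\<lambda>m. 4 * K * ?E (S m)) \<longlonglongrightarrow> 4 * K * 0"
      using S by (intro tendsto_intros radial_kernel_limit(2)) (auto intro: less_imp_le)
    then have E0: "(\<lambda>m. 4 * K * ?E (S m)) \<longlonglongrightarrow> 0"
      by (simp only: mult_zero_right)
    have "(\<lambda>m. (cmod (a - ?D (S m)))\<^sup>2) \<longlonglongrightarrow> 0"
    proof (rule Lim_null_comparison[OF _ E0])
      have "norm ((cmod (a - ?D (S m)))\<^sup>2) \<le> 4 * K * ?E (S m)" for m
        using bound[of m] by (simp only: real_norm_def abs_power2)
      then show "\<forall>\<^sub>F m in sequentially. norm ((cmod (a - ?D (S m)))\<^sup>2) \<le> 4 * K * ?E (S m)"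
        by (intro always_eventually allI)
    qed
    then have "(\<lambda>m. sqrt ((cmod (a - ?D (S m)))\<^sup>2)) \<longlonglongrightarrow> sqrt 0"
      by (rule tendsto_real_sqrt)
    then have "(\<lambda>m. cmod (?D (S m) - a)) \<longlonglongrightarrow> 0"
      by (simp add: norm_minus_commute)
    then show "(\<lambda>m. ?D (S m)) \<longlonglongrightarrow> a"
      by (simp add: tendsto_norm_zero_iff LIM_zero_iff)
  qed simp
  with ga show ?thesis
    by blast
qed

text \<open>The functional vanishes at all derivatives of the kernel at \<open>\<zeta>\<close>. On the circle these are multiples
  of \<open>\<xi> (\<xi> - \<zeta>)\<^sup>-\<^sup>i\<close> with \<open>i \<ge> 1\<close>, while the Cauchy kernel at \<open>w\<close> is \<open>\<xi> / (\<xi> - w)\<close>. The factor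
  \<open>\<xi>\<close> has modulus one, so an approximation of \<open>1 / (\<xi> - w)\<close> by negative powers shows that the
  value at the kernel is zero.\<close>

lemma vanishes_if_flat:
  assumes flat: "\<And>n. ((\<lambda>r. (deriv ^^ n) h (of_real r * \<zeta>)) \<longlongrightarrow> 0) (at_left (1::real))" and w: "cmod w < 1"
  shows "h w = 0"
proof -
  have g0: "graph_closure (cauchy_deriv n \<zeta>) 0" for n
  proof -
    obtain a where a: "graph_closure (cauchy_deriv n \<zeta>) a" "((\<lambda>r. (deriv ^^ n) h (of_real r * \<zeta>)) \<longlongrightarrow> a) (at_left (1::real))"
      using radial_derivative_limit by blast
    then have "a = 0"
      using tendsto_unique[OF trivial_limit_at_left_real _ flat] by blast
    with a show ?thesis by simp
  qed
  have "(cmod (h w))\<^sup>2 \<le> 0"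
  proof (rule field_le_epsilon)
    fix \<delta> :: real assume d: "\<delta> > 0"
    have k: "4 * K + 1 > 0"
      using K by simp
    have "(\<lambda>\<xi>. 1 / (\<xi> - w)) \<in> square_integrable \<sigma>"
      using circle_denominator_nonzero(2)[OF _ w] by (intro \<sigma>.square_integrable_continuous continuous_intros) auto
    then obtain F c where F: "finite F" "F \<subseteq> {1..}"
      and small: "(LINT \<xi>|\<sigma>. (cmod (1 / (\<xi> - w) - (\<Sum>i\<in>F. c i * pole i \<xi>)))\<^sup>2) < \<delta> / (4 * K + 1)"
      using complete d k unfolding complete_system_def by (meson divide_pos_pos)
    let ?k = "\<lambda>i. c i / fact (i - 1)"
    have sum: "graph_closure (\<lambda>\<xi>. cauchy_deriv 0 w \<xi> + (\<Sum>i\<in>H. (- ?k i) * cauchy_deriv (i - 1) \<zeta> \<xi>)) (h w)" if "finite H" for H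
      using that
    proof (induction H rule: finite_induct)
      case empty
      then show ?case
        using graph_closure_kernel[OF w] by simp
    next
      case (insert i H)
      have "graph_closure (\<lambda>\<xi>. (cauchy_deriv 0 w \<xi> + (\<Sum>i\<in>H. (- ?k i) * cauchy_deriv (i - 1) \<zeta> \<xi>)) + (- ?k i) * cauchy_deriv (i - 1) \<zeta> \<xi>)
          (h w + (- ?k i) * 0)"
        by (rule graph_closure_linear[OF insert.IH g0])
      moreover have "(\<lambda>\<xi>. (cauchy_deriv 0 w \<xi> + (\<Sum>i\<in>H. (- ?k i) * cauchy_deriv (i - 1) \<zeta> \<xi>)) + (- ?k i) * cauchy_deriv (i - 1) \<zeta> \<xi>) =
          (\<lambda>\<xi>. cauchy_deriv 0 w \<xi> + (\<Sum>i\<in>insert i H. (- ?k i) * cauchy_deriv (i - 1) \<zeta> \<xi>))"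
        unfolding sum.insert[OF insert.hyps] by (simp only: add_ac)
      ultimately show ?case
        by (simp only: mult_zero_right add_0_right)
    qed
    have ae: "AE \<xi> in \<sigma>. cmod (cauchy_deriv 0 w \<xi> + (\<Sum>i\<in>F. (- ?k i) * cauchy_deriv (i - 1) \<zeta> \<xi>)) =
        cmod (1 / (\<xi> - w) - (\<Sum>i\<in>F. c i * pole i \<xi>))"
      using AE_circle
    proof eventually_elim
      case (elim \<xi>)
      then have \<xi>: "\<xi> * cnj \<xi> = 1" "cmod \<xi> = 1" "\<xi> \<noteq> 0"
        using complex_norm_square[of \<xi>] by auto
      have e: "cnj \<xi> * (\<xi> - y) = 1 - cnj \<xi> * y" for y
        using \<xi>(1) by (simp add: algebra_simps)
      have c0: "cnj \<xi> \<noteq> 0"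
        using \<xi> by simp
      have "cauchy_deriv 0 w \<xi> = \<xi> * (1 / (\<xi> - w))"
        unfolding cauchy_deriv_0 e[symmetric] using \<xi> circle_denominator_nonzero(2)[OF \<xi>(2) w] c0
        by (simp add: nonzero_divide_eq_eq mult.assoc[symmetric])
      moreover have "(- ?k i) * cauchy_deriv (i - 1) \<zeta> \<xi> = - (\<xi> * (c i * pole i \<xi>))" if "i \<in> F" for i
      proof -
        have i: "Suc (i - 1) = i"
          using that F by auto
        have "cauchy_deriv (i - 1) \<zeta> \<xi> = fact (i - 1) * (cnj \<xi> ^ (i - 1) / (cnj \<xi> ^ i * (\<xi> - \<zeta>) ^ i))"
          unfolding cauchy_deriv_def i e[symmetric] power_mult_distrib by simp
        also have "cnj \<xi> ^ (i - 1) / (cnj \<xi> ^ i * (\<xi> - \<zeta>) ^ i) = \<xi> * pole i \<xi>"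
        proof -
          have "cnj \<xi> ^ i = cnj \<xi> * cnj \<xi> ^ (i - 1)"
            using power_Suc[of "cnj \<xi>" "i - 1"] i by simp
          then have "cnj \<xi> ^ (i - 1) / (cnj \<xi> ^ i * (\<xi> - \<zeta>) ^ i) = (1 / cnj \<xi>) * (1 / (\<xi> - \<zeta>) ^ i)"
            using c0 by simp
          also have "1 / cnj \<xi> = \<xi>"
            using \<xi> c0 by (simp add: nonzero_divide_eq_eq)
          finally show ?thesis
            by (simp add: pole_def inverse_eq_divide)
        qed
        finally show ?thesis
          by simp
      qed
      ultimately have "cauchy_deriv 0 w \<xi> + (\<Sum>i\<in>F. (- ?k i) * cauchy_deriv (i - 1) \<zeta> \<xi>) =
          \<xi> * (1 / (\<xi> - w) - (\<Sum>i\<in>F. c i * pole i \<xi>))"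
        by (simp add: sum_negf sum_distrib_left right_diff_distrib cong: sum.cong)
      then show ?case
        using \<xi>(2) by (simp only: norm_mult mult_1)
    qed
    have "(cmod (h w))\<^sup>2 \<le> 4 * K * (LINT \<xi>|\<sigma>. (cmod (cauchy_deriv 0 w \<xi> + (\<Sum>i\<in>F. (- ?k i) * cauchy_deriv (i - 1) \<zeta> \<xi>)))\<^sup>2)"
      by (rule graph_closure_bound[OF sum[OF F(1)]])
    also have "(LINT \<xi>|\<sigma>. (cmod (cauchy_deriv 0 w \<xi> + (\<Sum>i\<in>F. (- ?k i) * cauchy_deriv (i - 1) \<zeta> \<xi>)))\<^sup>2) =
        (LINT \<xi>|\<sigma>. (cmod (1 / (\<xi> - w) - (\<Sum>i\<in>F. c i * pole i \<xi>)))\<^sup>2)"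
    proof (rule integral_cong_AE)
      show "AE \<xi> in \<sigma>. (cmod (cauchy_deriv 0 w \<xi> + (\<Sum>i\<in>F. (- ?k i) * cauchy_deriv (i - 1) \<zeta> \<xi>)))\<^sup>2 =
          (cmod (1 / (\<xi> - w) - (\<Sum>i\<in>F. c i * pole i \<xi>)))\<^sup>2"
        using ae by eventually_elim (simp only:)
      show "(\<lambda>\<xi>. (cmod (cauchy_deriv 0 w \<xi> + (\<Sum>i\<in>F. (- ?k i) * cauchy_deriv (i - 1) \<zeta> \<xi>)))\<^sup>2) \<in> borel_measurable \<sigma>"
        using square_integrableD(2)[OF graph_closure_square_integrable[OF sum[OF F(1)]]]
        by (rule borel_measurable_integrable)
      show "(\<lambda>\<xi>. (cmod (1 / (\<xi> - w) - (\<Sum>i\<in>F. c i * pole i \<xi>)))\<^sup>2) \<in> borel_measurable \<sigma>"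
        by measurable
    qed
    also have "4 * K * \<dots> \<le> 4 * K * (\<delta> / (4 * K + 1))"
      using small K by (intro mult_left_mono) auto
    also have "\<dots> \<le> (4 * K + 1) * (\<delta> / (4 * K + 1))"
      using d k by (intro mult_right_mono) auto
    also have "\<dots> = 0 + \<delta>"
      using k by simp
    finally show "(cmod (h w))\<^sup>2 \<le> 0 + \<delta>" .
  qed
  then show ?thesis
    by simp
qed

end

section \<open>Quasi-analyticity\<close>

context exponential_clark
begin

lemma theta_ne_alpha:
  assumes z: "cmod z < 1"
  shows "\<alpha> - \<theta> z \<noteq> 0"
proof
  assume "\<alpha> - \<theta> z = 0"
  then have "cmod (\<theta> z) = 1"
    using alpha by simp
  then have "\<theta> constant_on unit_disc"
    using le_1 z by (intro maximum_modulus_principle[OF holo, of unit_disc z]) auto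
  then show False
    using nonconstant by simp
qed

text \<open>Up to an additive constant, the Cauchy transform of \<open>\<sigma>\<close>.\<close>

definition p :: "complex \<Rightarrow> complex" where
  "p z = \<alpha> / (\<alpha> - \<theta> z)"

definition cauchy_transform :: "complex \<Rightarrow> complex" where
  "cauchy_transform z = (LINT \<xi>|\<sigma>. 1 / (1 - cnj \<xi> * z))"

lemma alpha_cnj: "\<alpha> * cnj \<alpha> = 1"
  using alpha complex_norm_square[of \<alpha>] by simp

lemma p_holomorphic: "p holomorphic_on unit_disc"
  unfolding p_def[abs_def] using theta_ne_alpha by (intro holomorphic_intros holo) auto

text \<open>The functions \<open>(\<alpha> + \<theta>) / (\<alpha> - \<theta>)\<close> and the Herglotz integral of \<open>\<sigma>\<close> have the same real part, so they differ
  by an imaginary constant. The value of \<open>Re \<kappa>\<close> is needed for the kernel identity.\<close>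

lemma p_eq_cauchy_transform:
  "\<exists>\<kappa>. 2 * Re \<kappa> = 1 - measure \<sigma> unit_circle \<and> (\<forall>z\<in>unit_disc. p z = cauchy_transform z + \<kappa>)"
proof -
  let ?F = "\<lambda>z. (\<alpha> + \<theta> z) / (\<alpha> - \<theta> z)"
  let ?G = "\<lambda>z. LINT \<xi>|\<sigma>. (\<xi> + z) / (\<xi> - z)"
  define H where "H z = ?F z - ?G z" for z
  have H: "H holomorphic_on unit_disc"
    unfolding H_def using theta_ne_alpha by (intro holomorphic_intros holo \<sigma>.herglotz_integral_holomorphic) auto
  have re: "Re (H z) = 0" if z: "cmod z < 1" for z
  proof -
    have "Re (?F z) = poisson_integral \<sigma> z"
      by (rule Re_clark_function[OF z])
    also have "\<dots> = Re (?G z)"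
      by (rule \<sigma>.Re_herglotz_integral[OF z, symmetric])
    finally show ?thesis
      by (simp add: H_def)
  qed
  have "taylor_coeff H k = 0" if "k > 0" for k
  proof -
    have "(LINT \<xi>|circle_lebesgue. of_real (Re (H (of_real (1 / 2) * \<xi>))) * cnj \<xi> ^ k) = (LINT \<xi>|circle_lebesgue. 0)"
    proof (rule Bochner_Integration.integral_cong[OF refl])
      fix \<xi> assume "\<xi> \<in> space circle_lebesgue"
      then have "cmod (of_real (1 / 2) * \<xi>) < 1"
        by (simp add: norm_mult)
      then show "of_real (Re (H (of_real (1 / 2) * \<xi>))) * cnj \<xi> ^ k = (0::complex)"
        by (simp only: re of_real_0 mult_zero_left)
    qed
    then show ?thesis
      using circle_moment_Re[OF H, of "1 / 2" k] that by simp
  qed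
  then have tc: "(\<lambda>n. taylor_coeff H n * z ^ n) = (\<lambda>n. if n = 0 then H 0 else 0)" for z
    by (auto simp: taylor_coeff_def)
  have const: "H z = H 0" if "cmod z < 1" for z
    using taylor_sums[OF H that] sums_single[of 0 "\<lambda>_. H 0"] unfolding tc by (rule sums_unique2)
  define \<kappa> where "\<kappa> = (1 - of_real (measure \<sigma> unit_circle) + H 0) / 2"
  have "2 * Re \<kappa> = 1 - measure \<sigma> unit_circle"
    using re[of 0] by (simp add: \<kappa>_def)
  moreover have "p z = cauchy_transform z + \<kappa>" if z: "z \<in> unit_disc" for z
  proof -
    have z1: "cmod z < 1"
      using z by simp
    have "?F z = 2 * cauchy_transform z - of_real (measure \<sigma> unit_circle) + H 0"
    proof -
      have "?F z - ?G z = H 0"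
        using const[OF z1] unfolding H_def .
      moreover have "?G z = 2 * cauchy_transform z - of_real (measure \<sigma> unit_circle)"
        using \<sigma>.herglotz_integral_eq[OF z1] unfolding cauchy_transform_def by simp
      ultimately show ?thesis
        by (simp only: diff_eq_eq) (simp only: algebra_simps)
    qed
    moreover have "p z = (1 + ?F z) / 2"
      using theta_ne_alpha[OF z1] by (simp add: p_def field_simps)
    ultimately show ?thesis
      by (simp add: \<kappa>_def field_simps)
  qed
  ultimately show ?thesis
    by blast
qed

lemma Re_p: "cmod z < 1 \<Longrightarrow> 1 / 2 \<le> Re (p z)"
proof -
  assume z: "cmod z < 1"
  have "0 \<le> Re ((\<alpha> + \<theta> z) / (\<alpha> - \<theta> z))"
    unfolding Re_clark_function[OF z] by (rule poisson_integral_nonneg[OF z])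
  moreover have "p z = of_real (1 / 2) * (1 + (\<alpha> + \<theta> z) / (\<alpha> - \<theta> z))"
    using theta_ne_alpha[OF z] by (simp add: p_def field_simps)
  then have "Re (p z) = 1 / 2 * (1 + Re ((\<alpha> + \<theta> z) / (\<alpha> - \<theta> z))) - 0 * Im (1 + (\<alpha> + \<theta> z) / (\<alpha> - \<theta> z))"
    by (simp only: times_complex.sel plus_complex.sel one_complex.sel Re_complex_of_real Im_complex_of_real)
  ultimately show ?thesis
    by (simp del: Re_divide)
qed

text \<open>The product of two Cauchy kernels, multiplied by \<open>1 - cnj y w\<close>, is the sum of one kernel and the
  conjugate of the other minus \<open>1\<close>. Its integral is \<open>p w + cnj (p y) - 1\<close>, which is also what is left
  of the left side.\<close>

lemma clark_kernel_identity:
  assumes w: "cmod w < 1" and y: "cmod y < 1"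
  shows "p w * cnj (p y) * ((1 - \<theta> w * cnj (\<theta> y)) / (1 - cnj y * w)) =
    (LINT \<xi>|\<sigma>. cauchy_deriv 0 w \<xi> * cnj (cauchy_deriv 0 y \<xi>))"
proof -
  obtain \<kappa> where \<kappa>: "2 * Re \<kappa> = 1 - measure \<sigma> unit_circle" "\<And>z. z \<in> unit_disc \<Longrightarrow> p z = cauchy_transform z + \<kappa>"
    using p_eq_cauchy_transform by blast
  have nz: "1 - cnj y * w \<noteq> 0"
    using disc_denominator_nonzero[OF y, of w] w by simp
  have int: "integrable \<sigma> (cauchy_deriv 0 z)" if "cmod z < 1" for z
    by (rule \<sigma>.integrable_continuous_on_circle[OF cauchy_deriv_continuous[OF that]])
  have alg: "(1 - a * b) * ((1 / (1 - a)) * (1 / (1 - b))) = 1 / (1 - a) + 1 / (1 - b) - 1"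
    if "1 - a \<noteq> 0" "1 - b \<noteq> 0" for a b :: complex
  proof -
    define s t where "s = 1 / (1 - a)" and "t = 1 / (1 - b)"
    have st: "(1 - a) * s = 1" "(1 - b) * t = 1"
      using that by (simp_all add: s_def t_def)
    then have "a * s = s - 1" "b * t = t - 1"
      by (simp_all add: algebra_simps)
    then have "(a * s) * (b * t) = (s - 1) * (t - 1)"
      by simp
    then have "(1 - a * b) * (s * t) = s + t - 1"
      by (simp add: algebra_simps)
    then show ?thesis
      by (simp add: s_def t_def)
  qed
  have "(1 - cnj y * w) * (LINT \<xi>|\<sigma>. cauchy_deriv 0 w \<xi> * cnj (cauchy_deriv 0 y \<xi>)) =
      (LINT \<xi>|\<sigma>. (1 - cnj y * w) * (cauchy_deriv 0 w \<xi> * cnj (cauchy_deriv 0 y \<xi>)))"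
    by (rule integral_mult_right_zero[symmetric])
  also have "\<dots> = (LINT \<xi>|\<sigma>. cauchy_deriv 0 w \<xi> + cnj (cauchy_deriv 0 y \<xi>) - 1)"
  proof (rule Bochner_Integration.integral_cong[OF refl])
    fix \<xi> assume "\<xi> \<in> space \<sigma>"
    then have \<xi>: "cmod \<xi> = 1" by simp
    then have cc: "cnj \<xi> * \<xi> = 1"
      using complex_norm_square[of \<xi>] by (simp add: mult.commute)
    have n1: "1 - cnj \<xi> * w \<noteq> 0" "1 - \<xi> * cnj y \<noteq> 0"
    proof -
      show "1 - cnj \<xi> * w \<noteq> 0"
        by (rule circle_denominator_nonzero[OF \<xi> w])
      have "cnj (1 - cnj \<xi> * y) \<noteq> 0"
        using circle_denominator_nonzero(1)[OF \<xi> y] by (simp only: complex_cnj_zero_iff not_False_eq_True)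
      then show "1 - \<xi> * cnj y \<noteq> 0"
        by simp
    qed
    have "(cnj \<xi> * w) * (\<xi> * cnj y) = (cnj \<xi> * \<xi>) * (cnj y * w)"
      by (simp only: mult_ac)
    then have "(cnj \<xi> * w) * (\<xi> * cnj y) = cnj y * w"
      using cc by simp
    with alg[OF n1] show "(1 - cnj y * w) * (cauchy_deriv 0 w \<xi> * cnj (cauchy_deriv 0 y \<xi>)) =
        cauchy_deriv 0 w \<xi> + cnj (cauchy_deriv 0 y \<xi>) - 1"
      by (simp add: cauchy_deriv_0)
  qed
  also have "\<dots> = (LINT \<xi>|\<sigma>. cauchy_deriv 0 w \<xi>) + (LINT \<xi>|\<sigma>. cnj (cauchy_deriv 0 y \<xi>)) - (LINT \<xi>|\<sigma>. 1)"
    by (subst Bochner_Integration.integral_diff, (intro Bochner_Integration.integrable_add integrable_cnj int w y \<sigma>.integrable_const)+,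
        subst Bochner_Integration.integral_add, (intro integrable_cnj int w y)+, rule refl)
  also have "(LINT \<xi>|\<sigma>. cnj (cauchy_deriv 0 y \<xi>)) = cnj (LINT \<xi>|\<sigma>. cauchy_deriv 0 y \<xi>)"
    by (rule Bochner_Integration.integral_cnj)
  also have "(LINT \<xi>|\<sigma>. cauchy_deriv 0 w \<xi>) + cnj (LINT \<xi>|\<sigma>. cauchy_deriv 0 y \<xi>) - (LINT \<xi>|\<sigma>. 1) = p w + cnj (p y) - 1"
  proof -
    have "\<kappa> + cnj \<kappa> = of_real (1 - measure \<sigma> unit_circle)"
      unfolding complex_add_cnj \<kappa>(1) ..
    moreover have "(LINT \<xi>|\<sigma>. (1::complex)) = of_real (measure \<sigma> unit_circle)"
      by (simp add: scaleR_conv_of_real)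
    ultimately show ?thesis
      using \<kappa>(2)[of w] \<kappa>(2)[of y] w y
      by (simp add: cauchy_transform_def cauchy_deriv_0[abs_def] algebra_simps)
  qed
  also have "p w + cnj (p y) - 1 = p w * cnj (p y) * (1 - \<theta> w * cnj (\<theta> y))"
  proof -
    have n: "\<alpha> - \<theta> w \<noteq> 0" "cnj \<alpha> - cnj (\<theta> y) \<noteq> 0"
      using theta_ne_alpha[OF w] theta_ne_alpha[OF y] by (simp_all flip: complex_cnj_diff)
    have "a / (a - s) + b / (b - t) - 1 = a / (a - s) * (b / (b - t)) * (1 - s * t)"
      if "a - s \<noteq> 0" "b - t \<noteq> 0" "a * b = 1" for a b s t :: complex
    proof -
      define x z where "x = a / (a - s)" and "z = b / (b - t)"
      have "(a - s) * x = a" "(b - t) * z = b"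
        using that by (simp_all add: x_def z_def)
      then have "s * x = a * (x - 1)" "t * z = b * (z - 1)"
        by (simp_all add: algebra_simps)
      then have "(s * x) * (t * z) = (a * b) * ((x - 1) * (z - 1))"
        by (simp only: mult_ac)
      then have "x + z - 1 = x * z * (1 - s * t)"
        using that(3) by (simp add: algebra_simps)
      then show ?thesis
        by (simp add: x_def z_def)
    qed
    from this[OF n alpha_cnj] show ?thesis
      by (simp add: p_def)
  qed
  finally have "(1 - cnj y * w) * (LINT \<xi>|\<sigma>. cauchy_deriv 0 w \<xi> * cnj (cauchy_deriv 0 y \<xi>)) =
      p w * cnj (p y) * (1 - \<theta> w * cnj (\<theta> y))" .
  then show ?thesis
    using nz by (simp add: field_simps)
qed

lemma quadratic_form_eq:
  assumes F: "finite F" "F \<subseteq> unit_disc"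
  shows "Re (\<Sum>w\<in>F. \<Sum>y\<in>F. (c w * p w) * cnj (c y * p y) * ((1 - \<theta> w * cnj (\<theta> y)) / (1 - cnj y * w))) =
    (LINT \<xi>|\<sigma>. (cmod (\<Sum>w\<in>F. c w * cauchy_deriv 0 w \<xi>))\<^sup>2)"
proof -
  let ?e = "\<lambda>w y \<xi>. cauchy_deriv 0 w \<xi> * cnj (cauchy_deriv 0 y \<xi>)"
  have cont: "continuous_on unit_circle (?e w y)" if "w \<in> F" "y \<in> F" for w y
    using that F(2) by (intro continuous_on_mult continuous_on_cnj cauchy_deriv_continuous) auto
  have "(\<Sum>w\<in>F. \<Sum>y\<in>F. (c w * p w) * cnj (c y * p y) * ((1 - \<theta> w * cnj (\<theta> y)) / (1 - cnj y * w))) =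
      (\<Sum>w\<in>F. \<Sum>y\<in>F. c w * cnj (c y) * (LINT \<xi>|\<sigma>. ?e w y \<xi>))"
  proof (intro sum.cong refl)
    fix w y assume "w \<in> F" "y \<in> F"
    then have "cmod w < 1" "cmod y < 1"
      using F(2) by auto
    from clark_kernel_identity[OF this] 
    show "(c w * p w) * cnj (c y * p y) * ((1 - \<theta> w * cnj (\<theta> y)) / (1 - cnj y * w)) =
        c w * cnj (c y) * (LINT \<xi>|\<sigma>. ?e w y \<xi>)"
      by (simp only: complex_cnj_mult mult_ac)
  qed
  also have "\<dots> = (\<Sum>w\<in>F. \<Sum>y\<in>F. (LINT \<xi>|\<sigma>. c w * cnj (c y) * ?e w y \<xi>))"
    by (simp only: integral_mult_right_zero)
  also have "\<dots> = (\<Sum>w\<in>F. (LINT \<xi>|\<sigma>. (\<Sum>y\<in>F. c w * cnj (c y) * ?e w y \<xi>)))"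
    by (intro sum.cong refl Bochner_Integration.integral_sum[symmetric] integrable_mult_right
        \<sigma>.integrable_continuous_on_circle cont)
  also have "\<dots> = (LINT \<xi>|\<sigma>. (\<Sum>w\<in>F. \<Sum>y\<in>F. c w * cnj (c y) * ?e w y \<xi>))"
    by (intro Bochner_Integration.integral_sum[symmetric] Bochner_Integration.integrable_sum integrable_mult_right
        \<sigma>.integrable_continuous_on_circle cont)
  also have "\<dots> = (LINT \<xi>|\<sigma>. complex_of_real ((cmod (\<Sum>w\<in>F. c w * cauchy_deriv 0 w \<xi>))\<^sup>2))"
  proof (rule Bochner_Integration.integral_cong[OF refl])
    fix \<xi>
    have "(\<Sum>w\<in>F. \<Sum>y\<in>F. c w * cnj (c y) * ?e w y \<xi>) =
        (\<Sum>w\<in>F. \<Sum>y\<in>F. (c w * cauchy_deriv 0 w \<xi>) * cnj (c y * cauchy_deriv 0 y \<xi>))"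
      by (intro sum.cong refl) (simp only: complex_cnj_mult mult_ac)
    also have "\<dots> = (\<Sum>w\<in>F. c w * cauchy_deriv 0 w \<xi>) * cnj (\<Sum>y\<in>F. c y * cauchy_deriv 0 y \<xi>)"
      unfolding cnj_sum sum_product ..
    finally show "(\<Sum>w\<in>F. \<Sum>y\<in>F. c w * cnj (c y) * ?e w y \<xi>) = complex_of_real ((cmod (\<Sum>w\<in>F. c w * cauchy_deriv 0 w \<xi>))\<^sup>2)"
      unfolding complex_norm_square[symmetric] .
  qed
  also have "\<dots> = of_real (LINT \<xi>|\<sigma>. (cmod (\<Sum>w\<in>F. c w * cauchy_deriv 0 w \<xi>))\<^sup>2)"
    by (rule integral_complex_of_real)
  finally show ?thesis
    by (simp only: Re_complex_of_real)
qed

lemma model_space_dominated: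
  assumes f: "f \<in> model_space \<theta>"
  shows "\<exists>K. dominated \<theta> \<zeta> \<alpha> \<sigma> \<epsilon> (\<lambda>z. f z * p z) K"
proof -
  have fhol: "f holomorphic_on unit_disc"
    using f by (auto simp: model_space_def hardy2_def)
  obtain K where K: "K \<ge> 0" and bound: "\<And>F d. finite F \<Longrightarrow> F \<subseteq> unit_disc \<Longrightarrow>
    (cmod (\<Sum>w\<in>F. d w * f w))\<^sup>2 \<le>
      K * Re (\<Sum>w\<in>F. \<Sum>y\<in>F. d w * cnj (d y) * ((1 - \<theta> w * cnj (\<theta> y)) / (1 - cnj y * w)))"
    using model_space_evaluation_bound[OF f] by blast
  have "dominated \<theta> \<zeta> \<alpha> \<sigma> \<epsilon> (\<lambda>z. f z * p z) K"
  proof (unfold_locales)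
    show "(\<lambda>z. f z * p z) holomorphic_on unit_disc"
      by (intro holomorphic_intros fhol p_holomorphic)
    fix F :: "complex set" and c :: "complex \<Rightarrow> complex" assume F: "finite F" "F \<subseteq> unit_disc"
    have "(cmod (\<Sum>w\<in>F. (c w * p w) * f w))\<^sup>2 \<le> K * (LINT \<xi>|\<sigma>. (cmod (\<Sum>w\<in>F. c w * cauchy_deriv 0 w \<xi>))\<^sup>2)"
      using bound[OF F, of "\<lambda>w. c w * p w"] unfolding quadratic_form_eq[OF F] .
    then show "(cmod (\<Sum>w\<in>F. c w * (f w * p w)))\<^sup>2 \<le> K * (LINT \<xi>|\<sigma>. (cmod (\<Sum>w\<in>F. c w * cauchy_deriv 0 w \<xi>))\<^sup>2)"
      by (simp only: mult_ac)
  qed (rule K)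
  then show ?thesis
    by blast
qed

lemma cauchy_transform_dominated: "dominated \<theta> \<zeta> \<alpha> \<sigma> \<epsilon> cauchy_transform (measure \<sigma> unit_circle)"
proof (unfold_locales)
  show "cauchy_transform holomorphic_on unit_disc"
    unfolding cauchy_transform_def[abs_def] by (rule \<sigma>.cauchy_transform_holomorphic)
  fix F :: "complex set" and c :: "complex \<Rightarrow> complex" assume F: "finite F" "F \<subseteq> unit_disc"
  let ?S = "\<lambda>\<xi>. \<Sum>w\<in>F. c w * cauchy_deriv 0 w \<xi>"
  have cont: "continuous_on unit_circle (cauchy_deriv 0 w)" if "w \<in> F" for w
    using that F(2) by (intro cauchy_deriv_continuous) auto
  have "(\<Sum>w\<in>F. c w * cauchy_transform w) = (\<Sum>w\<in>F. (LINT \<xi>|\<sigma>. c w * cauchy_deriv 0 w \<xi>))"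
    by (simp only: cauchy_transform_def cauchy_deriv_0 integral_mult_right_zero)
  also have "\<dots> = (LINT \<xi>|\<sigma>. ?S \<xi> * cnj 1)"
    unfolding complex_cnj_one mult_1_right
    by (intro Bochner_Integration.integral_sum[symmetric] integrable_mult_right \<sigma>.integrable_continuous_on_circle cont)
  finally have "(cmod (\<Sum>w\<in>F. c w * cauchy_transform w))\<^sup>2 = (cmod (LINT \<xi>|\<sigma>. ?S \<xi> * cnj 1))\<^sup>2"
    by (simp only:)
  also have "\<dots> \<le> (LINT \<xi>|\<sigma>. (cmod (?S \<xi>))\<^sup>2) * (LINT \<xi>|\<sigma>. (cmod 1)\<^sup>2)"
    by (intro l2_cauchy_schwarz \<sigma>.square_integrable_continuous continuous_on_sum continuous_on_mult continuous_on_const cont)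
  also have "(LINT \<xi>|\<sigma>. (cmod 1)\<^sup>2) = measure \<sigma> unit_circle"
    by simp
  finally show "(cmod (\<Sum>w\<in>F. c w * cauchy_transform w))\<^sup>2 \<le> measure \<sigma> unit_circle * (LINT \<xi>|\<sigma>. (cmod (?S \<xi>))\<^sup>2)"
    by (simp only: mult.commute)
qed simp

definition radial_jet :: "(complex \<Rightarrow> complex) \<Rightarrow> (nat \<Rightarrow> complex) \<Rightarrow> bool" where
  "radial_jet f a \<longleftrightarrow> f holomorphic_on unit_disc \<and>
     (\<forall>n. ((\<lambda>r::real. (deriv ^^ n) f (of_real r * \<zeta>)) \<longlongrightarrow> a n) (at_left 1))"

lemma eventually_radius: "\<forall>\<^sub>F r in at_left (1::real). of_real r * \<zeta> \<in> unit_disc"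
proof -
  from eventually_radius_less_1 show ?thesis
    by eventually_elim (use zeta in \<open>simp add: norm_mult\<close>)
qed

lemma radial_jet_cong:
  assumes "radial_jet f a" and eq: "\<And>z. z \<in> unit_disc \<Longrightarrow> f z = g z" and g: "g holomorphic_on unit_disc"
  shows "radial_jet g a"
  unfolding radial_jet_def
proof (intro conjI allI g)
  fix n
  have f: "f holomorphic_on unit_disc" and lim: "((\<lambda>r::real. (deriv ^^ n) f (of_real r * \<zeta>)) \<longlongrightarrow> a n) (at_left 1)"
    using assms(1) by (auto simp: radial_jet_def)
  have "\<forall>\<^sub>F r in at_left (1::real). (deriv ^^ n) f (of_real r * \<zeta>) = (deriv ^^ n) g (of_real r * \<zeta>)"
    using eventually_radius
    by eventually_elim (rule higher_deriv_transform_within_open[OF f g open_ball _ eq])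
  with lim show "((\<lambda>r::real. (deriv ^^ n) g (of_real r * \<zeta>)) \<longlongrightarrow> a n) (at_left 1)"
    by (rule Lim_transform_eventually)
qed

lemma radial_jet_add_const:
  assumes "radial_jet f a"
  shows "radial_jet (\<lambda>z. f z + c) (\<lambda>n. a n + (if n = 0 then c else 0))"
  unfolding radial_jet_def
proof (intro conjI allI)
  have f: "f holomorphic_on unit_disc" and lim: "\<And>n. ((\<lambda>r::real. (deriv ^^ n) f (of_real r * \<zeta>)) \<longlongrightarrow> a n) (at_left 1)"
    using assms by (auto simp: radial_jet_def)
  show "(\<lambda>z. f z + c) holomorphic_on unit_disc"
    by (intro holomorphic_intros f)
  fix n
  have "((\<lambda>r::real. (deriv ^^ n) f (of_real r * \<zeta>) + (if n = 0 then c else 0)) \<longlongrightarrow> a n + (if n = 0 then c else 0)) (at_left 1)"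
    by (intro tendsto_intros lim)
  moreover have "\<forall>\<^sub>F r in at_left (1::real). (deriv ^^ n) f (of_real r * \<zeta>) + (if n = 0 then c else 0) =
      (deriv ^^ n) (\<lambda>z. f z + c) (of_real r * \<zeta>)"
    using eventually_radius
    by eventually_elim (subst higher_deriv_add[OF f holomorphic_on_const open_ball], auto)
  ultimately show "((\<lambda>r::real. (deriv ^^ n) (\<lambda>z. f z + c) (of_real r * \<zeta>)) \<longlongrightarrow> a n + (if n = 0 then c else 0)) (at_left 1)"
    by (rule Lim_transform_eventually)
qed

lemma radial_jet_mult:
  assumes "radial_jet f a" "radial_jet g b"
  shows "radial_jet (\<lambda>z. f z * g z) (\<lambda>n. \<Sum>i=0..n. of_nat (n choose i) * a i * b (n - i))"
  unfolding radial_jet_def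
proof (intro conjI allI)
  have f: "f holomorphic_on unit_disc" "\<And>n. ((\<lambda>r::real. (deriv ^^ n) f (of_real r * \<zeta>)) \<longlongrightarrow> a n) (at_left 1)"
    and g: "g holomorphic_on unit_disc" "\<And>n. ((\<lambda>r::real. (deriv ^^ n) g (of_real r * \<zeta>)) \<longlongrightarrow> b n) (at_left 1)"
    using assms by (auto simp: radial_jet_def)
  show "(\<lambda>z. f z * g z) holomorphic_on unit_disc"
    by (intro holomorphic_intros f g)
  fix n
  have "((\<lambda>r::real. \<Sum>i=0..n. of_nat (n choose i) * (deriv ^^ i) f (of_real r * \<zeta>) * (deriv ^^ (n - i)) g (of_real r * \<zeta>)) \<longlongrightarrow>
      (\<Sum>i=0..n. of_nat (n choose i) * a i * b (n - i))) (at_left 1)"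
    by (intro tendsto_intros f g)
  moreover have "\<forall>\<^sub>F r in at_left (1::real).
      (\<Sum>i=0..n. of_nat (n choose i) * (deriv ^^ i) f (of_real r * \<zeta>) * (deriv ^^ (n - i)) g (of_real r * \<zeta>)) =
      (deriv ^^ n) (\<lambda>z. f z * g z) (of_real r * \<zeta>)"
    using eventually_radius
    by eventually_elim (rule higher_deriv_mult[OF f(1) g(1) open_ball, symmetric])
  ultimately show "((\<lambda>r::real. (deriv ^^ n) (\<lambda>z. f z * g z) (of_real r * \<zeta>)) \<longlongrightarrow>
      (\<Sum>i=0..n. of_nat (n choose i) * a i * b (n - i))) (at_left 1)"
    by (rule Lim_transform_eventually)
qed

text \<open>The Leibniz rule for \<open>f g = 1\<close> expresses the top derivative of \<open>g\<close> by lower ones and by derivatives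
  of \<open>f\<close>; the coefficient to be divided by is \<open>f\<close> itself, whose limit is not zero.\<close>

lemma radial_jet_inverse:
  assumes "radial_jet f a" and a0: "a 0 \<noteq> 0" and g: "g holomorphic_on unit_disc"
    and inv: "\<And>z. z \<in> unit_disc \<Longrightarrow> f z * g z = 1"
  shows "\<exists>b. radial_jet g b"
proof -
  have f: "f holomorphic_on unit_disc" "\<And>n. ((\<lambda>r::real. (deriv ^^ n) f (of_real r * \<zeta>)) \<longlongrightarrow> a n) (at_left 1)"
    using assms(1) by (auto simp: radial_jet_def)
  have "\<exists>l. ((\<lambda>r::real. (deriv ^^ n) g (of_real r * \<zeta>)) \<longlongrightarrow> l) (at_left 1)" for n
  proof (induction n rule: less_induct)
    case (less n)
    define b where "b m = (SOME l. ((\<lambda>r::real. (deriv ^^ m) g (of_real r * \<zeta>)) \<longlongrightarrow> l) (at_left 1))" for m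
    have b: "((\<lambda>r::real. (deriv ^^ m) g (of_real r * \<zeta>)) \<longlongrightarrow> b m) (at_left 1)" if "m < n" for m
      unfolding b_def using less.IH[OF that] by (rule someI_ex)
    let ?\<delta> = "if n = 0 then 1 else 0 :: complex"
    let ?R = "\<lambda>r::real. \<Sum>i=1..n. of_nat (n choose i) * (deriv ^^ i) f (of_real r * \<zeta>) * (deriv ^^ (n - i)) g (of_real r * \<zeta>)"
    have "((\<lambda>r. (?\<delta> - ?R r) / (deriv ^^ 0) f (of_real r * \<zeta>)) \<longlongrightarrow>
        (?\<delta> - (\<Sum>i=1..n. of_nat (n choose i) * a i * b (n - i))) / a 0) (at_left 1)"
      by (intro tendsto_intros f(2) b a0) auto
    moreover have "\<forall>\<^sub>F r in at_left (1::real). (?\<delta> - ?R r) / (deriv ^^ 0) f (of_real r * \<zeta>) = (deriv ^^ n) g (of_real r * \<zeta>)"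
      using eventually_radius
    proof eventually_elim
      case (elim r)
      let ?z = "of_real r * \<zeta>"
      have "(deriv ^^ n) (\<lambda>z. f z * g z) ?z = (deriv ^^ n) (\<lambda>_. 1) ?z"
        by (rule higher_deriv_transform_within_open[OF _ _ open_ball elim inv]) (intro holomorphic_intros f g)+
      then have "(\<Sum>i=0..n. of_nat (n choose i) * (deriv ^^ i) f ?z * (deriv ^^ (n - i)) g ?z) = ?\<delta>"
        unfolding higher_deriv_mult[OF f(1) g open_ball elim] by simp
      moreover have "(\<Sum>i=0..n. of_nat (n choose i) * (deriv ^^ i) f ?z * (deriv ^^ (n - i)) g ?z) =
          f ?z * (deriv ^^ n) g ?z + ?R r"
        by (simp add: sum.atLeast_Suc_atMost)
      ultimately have "?\<delta> - ?R r = f ?z * (deriv ^^ n) g ?z"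
        by (simp add: algebra_simps)
      moreover have "f ?z \<noteq> 0"
        using inv[OF elim] by auto
      ultimately show ?case
        by simp
    qed
    ultimately have "((\<lambda>r::real. (deriv ^^ n) g (of_real r * \<zeta>)) \<longlongrightarrow>
        (?\<delta> - (\<Sum>i=1..n. of_nat (n choose i) * a i * b (n - i))) / a 0) (at_left 1)"
      by (rule Lim_transform_eventually)
    then show ?case
      by blast
  qed
  then obtain b where "\<And>n. ((\<lambda>r::real. (deriv ^^ n) g (of_real r * \<zeta>)) \<longlongrightarrow> b n) (at_left 1)"
    by metis
  then show ?thesis
    using g unfolding radial_jet_def by blast
qed

lemma dominated_radial_jet:
  assumes "dominated \<theta> \<zeta> \<alpha> \<sigma> \<epsilon> h K"
  shows "\<exists>a. radial_jet h a"
proof -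
  interpret d: dominated \<theta> \<zeta> \<alpha> \<sigma> \<epsilon> h K by fact
  have "\<exists>a. \<forall>n. ((\<lambda>r. (deriv ^^ n) h (of_real r * \<zeta>)) \<longlongrightarrow> a n) (at_left (1::real))"
    using d.radial_derivative_limit by metis
  then show ?thesis
    using d.h_holo unfolding radial_jet_def by blast
qed

text \<open>Both \<open>f p\<close> and \<open>p\<close> have radial limits of all derivatives, and \<open>f = (f p) (1 / p)\<close>. Conversely, if all
  limits for \<open>f\<close> are zero, then so are those for \<open>f p\<close>, by the Leibniz rule.\<close>

proposition quasianalytic: "radial_quasianalytic \<theta> \<zeta>"
proof -
  obtain \<kappa> where \<kappa>: "\<And>z. z \<in> unit_disc \<Longrightarrow> p z = cauchy_transform z + \<kappa>"
    using p_eq_cauchy_transform by blast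
  obtain c where "radial_jet cauchy_transform c"
    using dominated_radial_jet[OF cauchy_transform_dominated] by blast
  from radial_jet_cong[OF radial_jet_add_const[OF this, of \<kappa>] _ p_holomorphic] \<kappa>
  obtain b where b: "radial_jet p b"
    by metis
  define q where "q z = (\<alpha> - \<theta> z) / \<alpha>" for z
  have q: "q holomorphic_on unit_disc"
    unfolding q_def using alpha by (intro holomorphic_intros holo) auto
  have pq: "p z * q z = 1" if "z \<in> unit_disc" for z
    using theta_ne_alpha[of z] that alpha by (auto simp: p_def q_def)
  have "((\<lambda>r. Re ((deriv ^^ 0) p (of_real r * \<zeta>))) \<longlongrightarrow> Re (b 0)) (at_left (1::real))"
    using b unfolding radial_jet_def by (intro tendsto_Re) blast
  moreover have "\<forall>\<^sub>F r in at_left (1::real). 1 / 2 \<le> Re ((deriv ^^ 0) p (of_real r * \<zeta>))"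
    using eventually_radius by eventually_elim (use Re_p in auto)
  ultimately have "1 / 2 \<le> Re (b 0)"
    by (intro tendsto_lowerbound) auto
  then have "b 0 \<noteq> 0"
    by auto
  then obtain e where e: "radial_jet q e"
    using radial_jet_inverse[OF b _ q pq] by blast
  show ?thesis
    unfolding radial_quasianalytic_def
  proof (intro conjI ballI allI impI)
    fix f n assume f: "f \<in> model_space \<theta>"
    then have fhol: "f holomorphic_on unit_disc"
      by (auto simp: model_space_def hardy2_def)
    obtain K where "dominated \<theta> \<zeta> \<alpha> \<sigma> \<epsilon> (\<lambda>z. f z * p z) K"
      using model_space_dominated[OF f] by blast
    then obtain a where a: "radial_jet (\<lambda>z. f z * p z) a"
      using dominated_radial_jet by blast
    have "\<exists>a. radial_jet f a"
      using radial_jet_cong[OF radial_jet_mult[OF a e] _ fhol] pq by (auto simp: mult.assoc)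
    then show "\<exists>l. ((\<lambda>r::real. (deriv ^^ n) f (of_real r * \<zeta>)) \<longlongrightarrow> l) (at_left 1)"
      unfolding radial_jet_def by blast
  next
    fix f z assume f: "f \<in> model_space \<theta>" and z: "z \<in> unit_disc"
      and flat: "\<forall>n. ((\<lambda>r::real. (deriv ^^ n) f (of_real r * \<zeta>)) \<longlongrightarrow> 0) (at_left 1)"
    then have "radial_jet f (\<lambda>_. 0)"
      by (auto simp: radial_jet_def model_space_def hardy2_def)
    from radial_jet_mult[OF this b]
    have flat': "((\<lambda>r. (deriv ^^ n) (\<lambda>z. f z * p z) (of_real r * \<zeta>)) \<longlongrightarrow> 0) (at_left (1::real))" for n
      by (simp add: radial_jet_def)
    obtain K where "dominated \<theta> \<zeta> \<alpha> \<sigma> \<epsilon> (\<lambda>z. f z * p z) K"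
      using model_space_dominated[OF f] by blast
    then interpret d: dominated \<theta> \<zeta> \<alpha> \<sigma> \<epsilon> "\<lambda>z. f z * p z" K .
    have "f z * p z = 0"
      by (rule d.vanishes_if_flat[OF flat']) (use z in simp)
    then show "f z = 0"
      using pq[OF z] by auto
  qed
qed

end

theorem theorem1p6:
  fixes \<theta> :: "complex \<Rightarrow> complex" and \<zeta> \<alpha> :: complex and \<sigma> :: "complex measure" and \<epsilon> :: real
  assumes "inner_function \<theta>" and "\<not> \<theta> constant_on unit_disc"
    and "\<zeta> \<in> unit_circle"
    and "\<alpha> \<in> unit_circle" and "clark_measure \<theta> \<alpha> \<sigma>"
    and "\<epsilon> > 0"
    and "(\<integral>\<^sup>+\<eta>. (if \<eta> = \<zeta> then \<infinity> else ennreal (exp (\<epsilon> / cmod (\<eta> - \<zeta>)))) \<partial>\<sigma>) < \<infinity>"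
  shows "strong_localization_point \<theta> \<zeta> \<and> radial_quasianalytic \<theta> \<zeta>"
proof -
  interpret exponential_clark \<theta> \<zeta> \<alpha> \<sigma> \<epsilon>
    by (rule exponential_clark.intro[OF assms])
  show ?thesis
    using strong_localization quasianalytic by blast
qed


end
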